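(* (a) Let $\mathbf E$ be an exact DG-category with exact coproducts. Then for any objects $J\in\mathsf H^0(\mathbf E_{\mathbf{inj}})$ and $X\in\mathsf{Ac}^{\mathsf{co}}(\mathbf E)$ one has $\operatorname{Hom}_{\mathsf H^0(\mathbf E)}(X,J)=0$. Consequently, the composition of the triangulated inclusion functor $\mathsf H^0(\mathbf E_{\mathbf{inj}})\to\mathsf H^0(\mathbf E)$ and the Verdier quotient functor $\mathsf H^0(\mathbf E)\to\mathsf D^{\mathsf{co}}(\mathbf E)$ is a fully faithful triangulated functor $\mathsf H^0(\mathbf E_{\mathbf{inj}})\to\mathsf D^{\mathsf{co}}(\mathbf E)$. (b) Let $\mathbf E$ be an exact DG-category with exact products. Then for any objects $P\in\mathsf H^0(\mathbf E_{\mathbf{proj}})$ and $Y\in\mathsf{Ac}^{\mathsf{ctr}}(\mathbf E)$ one has $\operatorname{Hom}_{\mathsf H^0(\mathbf E)}(P,Y)=0$. Consequently, the composition of the triangulated inclusion functor $\mathsf H^0(\mathbf E_{\mathbf{proj}})\to\mathsf H^0(\mathbf E)$ and the Verdier quotient functor $\mathsf H^0(\mathbf E)\to\mathsf D^{\mathsf{ctr}}(\mathbf E)$ is a fully faithful triangulated functor $\mathsf H^0(\mathbf E_{\mathbf{proj}})\to\mathsf D^{\mathsf{ctr}}(\mathbf E)$.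
   Context: Gradings: fix an abelian group $\Gamma$, a symmetric bilinear form $\sigma\colon\Gamma\times\Gamma\to\mathbb Z/2$ and an element $\mathbf 1\in\Gamma$ with $\sigma(\mathbf 1,\mathbf 1)=1$; complexes are $\Gamma$-graded with differentials of degree $\mathbf 1$ (an integer $n$ denotes $n\cdot\mathbf 1$; $(-1)^i$ means $(-1)^{\sigma(\mathbf 1,i)}$), with the Koszul sign rule (standard case: $\Gamma=\mathbb Z$). A DG-category $\mathbf A$ is a category enriched in complexes of abelian groups; $\mathsf Z^0(\mathbf A)$ and $\mathsf H^0(\mathbf A)$ have the same objects and the degree-$0$ cocycles (closed morphisms), resp. the degree-$0$ cohomology, of $\operatorname{Hom}^\bullet_{\mathbf A}(X,Y)$ as morphisms; $\mathbf A$ is additive if $\mathsf Z^0(\mathbf A)$ is. Shifts $X[i]$: objects with mutually inverse closed morphisms in $\operatorname{Hom}^{-i}(X,X[i])$ and $\operatorname{Hom}^{i}(X[i],X)$. The cone of a closed degree-$0$ morphism $X\to Y$ represents, functorially in $Z$, the cone of $\operatorname{Hom}^\bullet(Z,X)\to\operatorname{Hom}^\bullet(Z,Y)$. (Co)products in $\mathbf A$: objects with $\operatorname{Hom}^\bullet(\coprod X_\alpha,Z)\simeq\prod\operatorname{Hom}^\bullet(X_\alpha,Z)$, resp. $\operatorname{Hom}^\bullet(Z,\prod Y_\alpha)\simeq\prod\operatorname{Hom}^\bullet(Z,Y_\alpha)$, functorially in $Z$. For additive $\mathbf A$ with shifts and cones, $\mathsf H^0(\mathbf A)$ is triangulated,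 and every finite complex in $\mathsf Z^0(\mathbf A)$ has a totalization (an iterated cone) in $\mathbf A$. The DG-category $\mathbf E^\natural$: objects $(X,\sigma_X)$ with $X\in\mathbf E$, $\sigma_X\in\operatorname{Hom}^{-1}_{\mathbf E}(X,X)$, $d(\sigma_X)=\mathrm{id}_X$, $\sigma_X^2=0$; $\operatorname{Hom}^i_{\mathbf E^\natural}((X,\sigma_X),(Y,\sigma_Y))$ is the group of closed morphisms $X\to Y$ of degree $-i$ in $\mathbf E$, with differential $f\mapsto\sigma_Yf-(-1)^if\sigma_X$. $\Phi_{\mathbf E}\colon\mathsf Z^0(\mathbf E)\to\mathsf Z^0(\mathbf E^\natural)$ takes $A$ to $\operatorname{cone}(\mathrm{id}_A[-1])$ with its natural contracting homotopy ($\iota'\pi'$, where $\pi'\colon\operatorname{cone}(\mathrm{id}_A[-1])\to A$ of degree $-1$ and $\iota'\colon A\to\operatorname{cone}(\mathrm{id}_A[-1])$ of degree $0$ are the canonical nonclosed projection and injection); $\Psi^+_{\mathbf E}(X,\sigma_X)=X$. An exact DG-category is an additive DG-category $\mathbf E$ with shifts and cones endowed with (Quillen) exact category structures on both $\mathsf Z^0(\mathbf E)$ and $\mathsf Z^0(\mathbf E^\natural)$ which are preserved by the shifts $[1],[-1]$ and such that both $\Phi_{\mathbf E}$ and $\Psi^+_{\mathbf E}$ preserve and reflect admissible short exact sequences. $\mathbf E$ has exact coproducts (products) if all infinite coproducts (products) exist in the DG-category $\mathbf E$ and (co)products of short exact sequences in $\mathsf Z^0(\mathbf E)$ (equivalently,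 in $\mathsf Z^0(\mathbf E^\natural)$) are short exact sequences. If $\mathbf E$ has exact coproducts, $\mathsf{Ac}^{\mathsf{co}}(\mathbf E)\subset\mathsf H^0(\mathbf E)$ is the minimal triangulated subcategory containing the totalizations of all short exact sequences in $\mathsf Z^0(\mathbf E)$ (viewed as three-term complexes) and closed under coproducts, and $\mathsf D^{\mathsf{co}}(\mathbf E)=\mathsf H^0(\mathbf E)/\mathsf{Ac}^{\mathsf{co}}(\mathbf E)$. Dually, with exact products, $\mathsf{Ac}^{\mathsf{ctr}}(\mathbf E)$ is the minimal triangulated subcategory containing these totalizations and closed under products, and $\mathsf D^{\mathsf{ctr}}(\mathbf E)=\mathsf H^0(\mathbf E)/\mathsf{Ac}^{\mathsf{ctr}}(\mathbf E)$. $\mathbf E_{\mathbf{inj}}\subset\mathbf E$ (resp. $\mathbf E_{\mathbf{proj}}\subset\mathbf E$) is the full DG-subcategory of graded-injective (resp. graded-projective) objects, i.e. objects $J$ (resp. $P$) such that $\Phi_{\mathbf E}(J)$ is injective (resp. $\Phi_{\mathbf E}(P)$ is projective) in the exact category $\mathsf Z^0(\mathbf E^\natural)$; both are closed under shifts and cones. *)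

theory Defs
  imports Main "HOL-Library.Z2"
begin

section \<open>Categories, functors, additive and exact categories\<close>

text \<open>
  Morphisms do not carry their source and target: all operations on morphisms take the
  relevant objects as arguments, and values outside the Hom sets are irrelevant.
  \<open>Comp C X Y Z g f\<close> is the composition \<open>X \<rightarrow> Y \<rightarrow> Z\<close> of \<open>f\<close> followed by \<open>g\<close>.
\<close>

record ('o, 'm) cat =
  Obj :: "'o set"
  Hom :: "'o \<Rightarrow> 'o \<Rightarrow> 'm set"
  Comp :: "'o \<Rightarrow> 'o \<Rightarrow> 'o \<Rightarrow> 'm \<Rightarrow> 'm \<Rightarrow> 'm"
  Id :: "'o \<Rightarrow> 'm"

definition category :: "('o, 'm, 'z) cat_scheme \<Rightarrow> bool" where
  "category C \<longleftrightarrow>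
     (\<forall>X\<in>Obj C. Id C X \<in> Hom C X X) \<and>
     (\<forall>X\<in>Obj C. \<forall>Y\<in>Obj C. \<forall>Z\<in>Obj C. \<forall>f\<in>Hom C X Y. \<forall>g\<in>Hom C Y Z.
        Comp C X Y Z g f \<in> Hom C X Z) \<and>
     (\<forall>X\<in>Obj C. \<forall>Y\<in>Obj C. \<forall>f\<in>Hom C X Y.
        Comp C X X Y f (Id C X) = f \<and> Comp C X Y Y (Id C Y) f = f) \<and>
     (\<forall>W\<in>Obj C. \<forall>X\<in>Obj C. \<forall>Y\<in>Obj C. \<forall>Z\<in>Obj C.
        \<forall>f\<in>Hom C W X. \<forall>g\<in>Hom C X Y. \<forall>h\<in>Hom C Y Z.
        Comp C W Y Z h (Comp C W X Y g f) = Comp C W X Z (Comp C X Y Z h g) f)"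

definition cat_iso :: "('o, 'm, 'z) cat_scheme \<Rightarrow> 'o \<Rightarrow> 'o \<Rightarrow> 'm \<Rightarrow> bool" where
  "cat_iso C X Y f \<longleftrightarrow> X \<in> Obj C \<and> Y \<in> Obj C \<and> f \<in> Hom C X Y \<and>
     (\<exists>g\<in>Hom C Y X. Comp C X Y X g f = Id C X \<and> Comp C Y X Y f g = Id C Y)"

definition is_coproduct ::
  "('o, 'm, 'z) cat_scheme \<Rightarrow> 'i set \<Rightarrow> ('i \<Rightarrow> 'o) \<Rightarrow> 'o \<Rightarrow> ('i \<Rightarrow> 'm) \<Rightarrow> bool" where
  "is_coproduct C I X W j \<longleftrightarrow>
     W \<in> Obj C \<and> (\<forall>\<alpha>\<in>I. X \<alpha> \<in> Obj C \<and> j \<alpha> \<in> Hom C (X \<alpha>) W) \<and>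
     (\<forall>Z\<in>Obj C. \<forall>\<phi>. (\<forall>\<alpha>\<in>I. \<phi> \<alpha> \<in> Hom C (X \<alpha>) Z) \<longrightarrow>
        (\<exists>!h. h \<in> Hom C W Z \<and> (\<forall>\<alpha>\<in>I. Comp C (X \<alpha>) W Z h (j \<alpha>) = \<phi> \<alpha>)))"

definition is_product ::
  "('o, 'm, 'z) cat_scheme \<Rightarrow> 'i set \<Rightarrow> ('i \<Rightarrow> 'o) \<Rightarrow> 'o \<Rightarrow> ('i \<Rightarrow> 'm) \<Rightarrow> bool" where
  "is_product C I X W p \<longleftrightarrow>
     W \<in> Obj C \<and> (\<forall>\<alpha>\<in>I. X \<alpha> \<in> Obj C \<and> p \<alpha> \<in> Hom C W (X \<alpha>)) \<and>
     (\<forall>Z\<in>Obj C. \<forall>\<phi>. (\<forall>\<alpha>\<in>I. \<phi> \<alpha> \<in> Hom C Z (X \<alpha>)) \<longrightarrow>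
        (\<exists>!h. h \<in> Hom C Z W \<and> (\<forall>\<alpha>\<in>I. Comp C Z W (X \<alpha>) (p \<alpha>) h = \<phi> \<alpha>)))"

record ('a, 'm, 'b, 'n) functor_data =
  FO :: "'a \<Rightarrow> 'b"
  FM :: "'a \<Rightarrow> 'a \<Rightarrow> 'm \<Rightarrow> 'n"

definition is_functor ::
  "('a, 'm, 'y) cat_scheme \<Rightarrow> ('b, 'n, 'z) cat_scheme \<Rightarrow> ('a, 'm, 'b, 'n) functor_data \<Rightarrow> bool" where
  "is_functor C D F \<longleftrightarrow> category C \<and> category D \<and>
     (\<forall>X\<in>Obj C. FO F X \<in> Obj D \<and> FM F X X (Id C X) = Id D (FO F X)) \<and>
     (\<forall>X\<in>Obj C. \<forall>Y\<in>Obj C. \<forall>f\<in>Hom C X Y. FM F X Y f \<in> Hom D (FO F X) (FO F Y)) \<and>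
     (\<forall>X\<in>Obj C. \<forall>Y\<in>Obj C. \<forall>Z\<in>Obj C. \<forall>f\<in>Hom C X Y. \<forall>g\<in>Hom C Y Z.
        FM F X Z (Comp C X Y Z g f) =
        Comp D (FO F X) (FO F Y) (FO F Z) (FM F Y Z g) (FM F X Y f))"

definition functor_comp ::
  "('b, 'n, 'c, 'k) functor_data \<Rightarrow> ('a, 'm, 'b, 'n) functor_data \<Rightarrow> ('a, 'm, 'c, 'k) functor_data" where
  "functor_comp G F =
     \<lparr> FO = (\<lambda>X. FO G (FO F X)),
       FM = (\<lambda>X Y f. FM G (FO F X) (FO F Y) (FM F X Y f)) \<rparr>"

definition inclusion_functor :: "('o, 'm, 'o, 'm) functor_data" where
  "inclusion_functor = \<lparr> FO = (\<lambda>X. X), FM = (\<lambda>X Y f. f) \<rparr>"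

definition fully_faithful ::
  "('a, 'm, 'y) cat_scheme \<Rightarrow> ('b, 'n, 'z) cat_scheme \<Rightarrow> ('a, 'm, 'b, 'n) functor_data \<Rightarrow> bool" where
  "fully_faithful C D F \<longleftrightarrow>
     (\<forall>X\<in>Obj C. \<forall>Y\<in>Obj C. bij_betw (FM F X Y) (Hom C X Y) (Hom D (FO F X) (FO F Y)))"

definition subgroup_set :: "'m::ab_group_add set \<Rightarrow> bool" where
  "subgroup_set H \<longleftrightarrow> 0 \<in> H \<and> (\<forall>x\<in>H. \<forall>y\<in>H. x - y \<in> H)"

text \<open>Here the Hom sets are subgroups of the ambient group \<open>'m\<close>.\<close>

definition additive_category :: "('o, 'm::ab_group_add, 'z) cat_scheme \<Rightarrow> bool" where
  "additive_category C \<longleftrightarrow> category C \<and>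
     (\<forall>X\<in>Obj C. \<forall>Y\<in>Obj C. subgroup_set (Hom C X Y)) \<and>
     (\<forall>X\<in>Obj C. \<forall>Y\<in>Obj C. \<forall>Z\<in>Obj C.
        \<forall>f\<in>Hom C X Y. \<forall>f'\<in>Hom C X Y. \<forall>g\<in>Hom C Y Z. \<forall>g'\<in>Hom C Y Z.
        Comp C X Y Z g (f + f') = Comp C X Y Z g f + Comp C X Y Z g f' \<and>
        Comp C X Y Z (g + g') f = Comp C X Y Z g f + Comp C X Y Z g' f) \<and>
     (\<exists>N\<in>Obj C. \<forall>X\<in>Obj C. Hom C N X = {0} \<and> Hom C X N = {0}) \<and>
     (\<forall>X\<in>Obj C. \<forall>Y\<in>Obj C. \<exists>W\<in>Obj C.
        \<exists>i\<in>Hom C X W. \<exists>j\<in>Hom C Y W. \<exists>p\<in>Hom C W X. \<exists>q\<in>Hom C W Y.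
          Comp C X W X p i = Id C X \<and> Comp C Y W Y q j = Id C Y \<and>
          Comp C X W Y q i = 0 \<and> Comp C Y W X p j = 0 \<and>
          Comp C W X W i p + Comp C W Y W j q = Id C W)"

definition is_kernel :: "('o, 'm::ab_group_add, 'z) cat_scheme \<Rightarrow> 'o \<Rightarrow> 'm \<Rightarrow> 'o \<Rightarrow> 'm \<Rightarrow> 'o \<Rightarrow> bool" where
  "is_kernel C A i B p D \<longleftrightarrow> Comp C A B D p i = 0 \<and>
     (\<forall>X\<in>Obj C. \<forall>f\<in>Hom C X B. Comp C X B D p f = 0 \<longrightarrow>
        (\<exists>!g. g \<in> Hom C X A \<and> Comp C X A B i g = f))"

definition is_cokernel :: "('o, 'm::ab_group_add, 'z) cat_scheme \<Rightarrow> 'o \<Rightarrow> 'm \<Rightarrow> 'o \<Rightarrow> 'm \<Rightarrow> 'o \<Rightarrow> bool" where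
  "is_cokernel C A i B p D \<longleftrightarrow> Comp C A B D p i = 0 \<and>
     (\<forall>X\<in>Obj C. \<forall>f\<in>Hom C B X. Comp C A B X f i = 0 \<longrightarrow>
        (\<exists>!g. g \<in> Hom C D X \<and> Comp C B D X g p = f))"

text \<open>Pushout square of \<open>i : A \<rightarrow> B\<close> and \<open>f : A \<rightarrow> A'\<close>, with \<open>i' : A' \<rightarrow> B'\<close> and \<open>f' : B \<rightarrow> B'\<close>.\<close>

definition is_pushout ::
  "('o, 'm, 'z) cat_scheme \<Rightarrow> 'o \<Rightarrow> 'o \<Rightarrow> 'o \<Rightarrow> 'o \<Rightarrow> 'm \<Rightarrow> 'm \<Rightarrow> 'm \<Rightarrow> 'm \<Rightarrow> bool" where
  "is_pushout C A B A' B' i f i' f' \<longleftrightarrow> B' \<in> Obj C \<and> i' \<in> Hom C A' B' \<and> f' \<in> Hom C B B' \<and>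
     Comp C A A' B' i' f = Comp C A B B' f' i \<and>
     (\<forall>X\<in>Obj C. \<forall>u\<in>Hom C A' X. \<forall>v\<in>Hom C B X. Comp C A A' X u f = Comp C A B X v i \<longrightarrow>
        (\<exists>!w. w \<in> Hom C B' X \<and> Comp C A' B' X w i' = u \<and> Comp C B B' X w f' = v))"

text \<open>Pullback square of \<open>p : B \<rightarrow> D\<close> and \<open>f : D' \<rightarrow> D\<close>, with \<open>p' : B' \<rightarrow> D'\<close> and \<open>f' : B' \<rightarrow> B\<close>.\<close>

definition is_pullback ::
  "('o, 'm, 'z) cat_scheme \<Rightarrow> 'o \<Rightarrow> 'o \<Rightarrow> 'o \<Rightarrow> 'o \<Rightarrow> 'm \<Rightarrow> 'm \<Rightarrow> 'm \<Rightarrow> 'm \<Rightarrow> bool" where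
  "is_pullback C B D B' D' p f p' f' \<longleftrightarrow> B' \<in> Obj C \<and> p' \<in> Hom C B' D' \<and> f' \<in> Hom C B' B \<and>
     Comp C B' D' D f p' = Comp C B' B D p f' \<and>
     (\<forall>X\<in>Obj C. \<forall>u\<in>Hom C X D'. \<forall>v\<in>Hom C X B. Comp C X D' D f u = Comp C X B D p v \<longrightarrow>
        (\<exists>!w. w \<in> Hom C X B' \<and> Comp C X B' D' p' w = u \<and> Comp C X B' B f' w = v))"

text \<open>
  A tuple \<open>(A, i, B, p, D)\<close> stands for the sequence \<open>0 \<rightarrow> A \<rightarrow> B \<rightarrow> D \<rightarrow> 0\<close> with maps \<open>i\<close> and \<open>p\<close>.
\<close>

type_synonym ('o, 'm) ses = "'o \<times> 'm \<times> 'o \<times> 'm \<times> 'o"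

definition inflation :: "('o, 'm) ses set \<Rightarrow> 'o \<Rightarrow> 'm \<Rightarrow> 'o \<Rightarrow> bool" where
  "inflation S A i B \<longleftrightarrow> (\<exists>p D. (A, i, B, p, D) \<in> S)"

definition deflation :: "('o, 'm) ses set \<Rightarrow> 'o \<Rightarrow> 'm \<Rightarrow> 'o \<Rightarrow> bool" where
  "deflation S B p D \<longleftrightarrow> (\<exists>i A. (A, i, B, p, D) \<in> S)"

text \<open>Quillen exact structures, in the axiomatization due to Keller.\<close>

definition exact_structure :: "('o, 'm::ab_group_add, 'z) cat_scheme \<Rightarrow> ('o, 'm) ses set \<Rightarrow> bool" where
  "exact_structure C S \<longleftrightarrow> additive_category C \<and>
     (\<forall>A i B p D. (A, i, B, p, D) \<in> S \<longrightarrow>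
        A \<in> Obj C \<and> B \<in> Obj C \<and> D \<in> Obj C \<and> i \<in> Hom C A B \<and> p \<in> Hom C B D \<and>
        is_kernel C A i B p D \<and> is_cokernel C A i B p D) \<and>
     (\<forall>A i B p D A' i' B' p' D' a b d.
        (A, i, B, p, D) \<in> S \<and> i' \<in> Hom C A' B' \<and> p' \<in> Hom C B' D' \<and>
        cat_iso C A A' a \<and> cat_iso C B B' b \<and> cat_iso C D D' d \<and>
        Comp C A B B' b i = Comp C A A' B' i' a \<and> Comp C B D D' d p = Comp C B B' D' p' b \<longrightarrow>
        (A', i', B', p', D') \<in> S) \<and>
     (\<forall>A\<in>Obj C. inflation S A (Id C A) A \<and> deflation S A (Id C A) A) \<and>
     (\<forall>A i B j D. inflation S A i B \<and> inflation S B j D \<longrightarrow> inflation S A (Comp C A B D j i) D) \<and>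
     (\<forall>A p B q D. deflation S A p B \<and> deflation S B q D \<longrightarrow> deflation S A (Comp C A B D q p) D) \<and>
     (\<forall>A i B A' f. inflation S A i B \<and> A' \<in> Obj C \<and> f \<in> Hom C A A' \<longrightarrow>
        (\<exists>B' i' f'. is_pushout C A B A' B' i f i' f' \<and> inflation S A' i' B')) \<and>
     (\<forall>B p D D' f. deflation S B p D \<and> D' \<in> Obj C \<and> f \<in> Hom C D' D \<longrightarrow>
        (\<exists>B' p' f'. is_pullback C B D B' D' p f p' f' \<and> deflation S B' p' D'))"

definition injective_object :: "('o, 'm, 'z) cat_scheme \<Rightarrow> ('o, 'm) ses set \<Rightarrow> 'o \<Rightarrow> bool" where
  "injective_object C S J \<longleftrightarrow> J \<in> Obj C \<and>
     (\<forall>A i B. inflation S A i B \<longrightarrow>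
        (\<forall>f\<in>Hom C A J. \<exists>g\<in>Hom C B J. Comp C A B J g i = f))"

definition projective_object :: "('o, 'm, 'z) cat_scheme \<Rightarrow> ('o, 'm) ses set \<Rightarrow> 'o \<Rightarrow> bool" where
  "projective_object C S P \<longleftrightarrow> P \<in> Obj C \<and>
     (\<forall>B p D. deflation S B p D \<longrightarrow>
        (\<forall>f\<in>Hom C P D. \<exists>g\<in>Hom C P B. Comp C P B D p g = f))"

section \<open>Triangulated data and Verdier quotients\<close>

text \<open>
  A category with addition of morphisms, the shift functor \<open>[1]\<close> and a class of distinguished
  triangles; \<open>(X, Y, Z, f, g, h)\<close> stands for \<open>X \<rightarrow> Y \<rightarrow> Z \<rightarrow> X[1]\<close>.
\<close>

type_synonym ('o, 'm) triangle = "'o \<times> 'o \<times> 'o \<times> 'm \<times> 'm \<times> 'm"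

record ('o, 'm) tricat = "('o, 'm) cat" +
  Add :: "'o \<Rightarrow> 'o \<Rightarrow> 'm \<Rightarrow> 'm \<Rightarrow> 'm"
  Sh :: "'o \<Rightarrow> 'o"
  ShM :: "'o \<Rightarrow> 'o \<Rightarrow> 'm \<Rightarrow> 'm"
  Tri :: "('o, 'm) triangle set"

fun is_triangle :: "('o, 'm, 'z) tricat_scheme \<Rightarrow> ('o, 'm) triangle \<Rightarrow> bool" where
  "is_triangle T (X, Y, Z, f, g, h) \<longleftrightarrow> X \<in> Obj T \<and> Y \<in> Obj T \<and> Z \<in> Obj T \<and>
     f \<in> Hom T X Y \<and> g \<in> Hom T Y Z \<and> h \<in> Hom T Z (Sh T X)"

fun triangle_iso :: "('o, 'm, 'z) tricat_scheme \<Rightarrow> ('o, 'm) triangle \<Rightarrow> ('o, 'm) triangle \<Rightarrow> bool" where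
  "triangle_iso T (X, Y, Z, f, g, h) (X', Y', Z', f', g', h') \<longleftrightarrow>
     (\<exists>a b c. cat_iso T X X' a \<and> cat_iso T Y Y' b \<and> cat_iso T Z Z' c \<and>
        Comp T X Y Y' b f = Comp T X X' Y' f' a \<and>
        Comp T Y Z Z' c g = Comp T Y Y' Z' g' b \<and>
        Comp T Z (Sh T X) (Sh T X') (ShM T X X' a) h = Comp T Z Z' (Sh T X') h' c)"

definition with_triangles ::
  "('o, 'm) tricat \<Rightarrow> ('o, 'm) triangle set \<Rightarrow> ('o, 'm) tricat" where
  "with_triangles T Std = T\<lparr> Tri := {t. is_triangle T t \<and> (\<exists>t'\<in>Std. triangle_iso T t t')} \<rparr>"

definition triangulated_functor ::
  "('a, 'm, 'y) tricat_scheme \<Rightarrow> ('b, 'n, 'z) tricat_scheme \<Rightarrow> ('a, 'm, 'b, 'n) functor_data \<Rightarrow> bool" where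
  "triangulated_functor T U F \<longleftrightarrow> is_functor T U F \<and>
     (\<forall>X\<in>Obj T. \<forall>Y\<in>Obj T. \<forall>f\<in>Hom T X Y. \<forall>g\<in>Hom T X Y.
        FM F X Y (Add T X Y f g) = Add U (FO F X) (FO F Y) (FM F X Y f) (FM F X Y g)) \<and>
     (\<exists>\<eta>.
       (\<forall>X\<in>Obj T. cat_iso U (FO F (Sh T X)) (Sh U (FO F X)) (\<eta> X)) \<and>
       (\<forall>X\<in>Obj T. \<forall>Y\<in>Obj T. \<forall>f\<in>Hom T X Y.
          Comp U (FO F (Sh T X)) (FO F (Sh T Y)) (Sh U (FO F Y))
            (\<eta> Y) (FM F (Sh T X) (Sh T Y) (ShM T X Y f)) =
          Comp U (FO F (Sh T X)) (Sh U (FO F X)) (Sh U (FO F Y))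
            (ShM U (FO F X) (FO F Y) (FM F X Y f)) (\<eta> X)) \<and>
       (\<forall>X Y Z f g h. (X, Y, Z, f, g, h) \<in> Tri T \<longrightarrow>
          (FO F X, FO F Y, FO F Z, FM F X Y f, FM F Y Z g,
           Comp U (FO F Z) (FO F (Sh T X)) (Sh U (FO F X)) (\<eta> X) (FM F Z (Sh T X) h)) \<in> Tri U))"

text \<open>Strictly full triangulated subcategories, given by their sets of objects.\<close>

definition triangulated_subcategory :: "('o, 'm, 'z) tricat_scheme \<Rightarrow> 'o set \<Rightarrow> bool" where
  "triangulated_subcategory T A \<longleftrightarrow> A \<subseteq> Obj T \<and> A \<noteq> {} \<and>
     (\<forall>X Y f. cat_iso T X Y f \<and> X \<in> A \<longrightarrow> Y \<in> A) \<and>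
     (\<forall>X\<in>Obj T. X \<in> A \<longleftrightarrow> Sh T X \<in> A) \<and>
     (\<forall>X Y Z f g h. (X, Y, Z, f, g, h) \<in> Tri T \<longrightarrow>
        (X \<in> A \<and> Y \<in> A \<longrightarrow> Z \<in> A) \<and> (Y \<in> A \<and> Z \<in> A \<longrightarrow> X \<in> A) \<and> (X \<in> A \<and> Z \<in> A \<longrightarrow> Y \<in> A))"

text \<open>
  Localization of a category at a class \<open>S\<close> of arrows \<open>(X, s, Y)\<close>: morphisms are zigzags,
  written in order of traversal, modulo the congruence which makes \<open>Fwd\<close> functorial and
  \<open>Bwd X s Y\<close>, a formal morphism from \<open>Y\<close> to \<open>X\<close>, inverse to \<open>Fwd X s Y\<close>.
\<close>

datatype ('o, 'm) step = Fwd 'o 'm 'o | Bwd 'o 'm 'o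

inductive zigzag ::
  "('o, 'm, 'z) cat_scheme \<Rightarrow> ('o \<times> 'm \<times> 'o) set \<Rightarrow> 'o \<Rightarrow> ('o, 'm) step list \<Rightarrow> 'o \<Rightarrow> bool"
  for C S where
  zz_nil: "X \<in> Obj C \<Longrightarrow> zigzag C S X [] X"
| zz_fwd: "X \<in> Obj C \<Longrightarrow> Y \<in> Obj C \<Longrightarrow> f \<in> Hom C X Y \<Longrightarrow> zigzag C S Y p Z
    \<Longrightarrow> zigzag C S X (Fwd X f Y # p) Z"
| zz_bwd: "X \<in> Obj C \<Longrightarrow> Y \<in> Obj C \<Longrightarrow> s \<in> Hom C X Y \<Longrightarrow> (X, s, Y) \<in> S \<Longrightarrow> zigzag C S X p Z
    \<Longrightarrow> zigzag C S Y (Bwd X s Y # p) Z"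

inductive zz_eq ::
  "('o, 'm, 'z) cat_scheme \<Rightarrow> ('o \<times> 'm \<times> 'o) set \<Rightarrow> 'o \<Rightarrow> 'o \<Rightarrow>
     ('o, 'm) step list \<Rightarrow> ('o, 'm) step list \<Rightarrow> bool"
  for C S where
  zze_refl: "zigzag C S X p Y \<Longrightarrow> zz_eq C S X Y p p"
| zze_sym: "zz_eq C S X Y p q \<Longrightarrow> zz_eq C S X Y q p"
| zze_trans: "zz_eq C S X Y p q \<Longrightarrow> zz_eq C S X Y q r \<Longrightarrow> zz_eq C S X Y p r"
| zze_context: "zigzag C S W a X \<Longrightarrow> zz_eq C S X Y p q \<Longrightarrow> zigzag C S Y b Z
    \<Longrightarrow> zz_eq C S W Z (a @ p @ b) (a @ q @ b)"
| zze_id: "X \<in> Obj C \<Longrightarrow> zz_eq C S X X [Fwd X (Id C X) X] []"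
| zze_comp: "X \<in> Obj C \<Longrightarrow> Y \<in> Obj C \<Longrightarrow> Z \<in> Obj C \<Longrightarrow> f \<in> Hom C X Y \<Longrightarrow> g \<in> Hom C Y Z
    \<Longrightarrow> zz_eq C S X Z [Fwd X f Y, Fwd Y g Z] [Fwd X (Comp C X Y Z g f) Z]"
| zze_inv1: "X \<in> Obj C \<Longrightarrow> Y \<in> Obj C \<Longrightarrow> s \<in> Hom C X Y \<Longrightarrow> (X, s, Y) \<in> S
    \<Longrightarrow> zz_eq C S X X [Fwd X s Y, Bwd X s Y] []"
| zze_inv2: "X \<in> Obj C \<Longrightarrow> Y \<in> Obj C \<Longrightarrow> s \<in> Hom C X Y \<Longrightarrow> (X, s, Y) \<in> S
    \<Longrightarrow> zz_eq C S Y Y [Bwd X s Y, Fwd X s Y] []"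

definition zz_class ::
  "('o, 'm, 'z) cat_scheme \<Rightarrow> ('o \<times> 'm \<times> 'o) set \<Rightarrow> 'o \<Rightarrow> 'o \<Rightarrow>
     ('o, 'm) step list \<Rightarrow> ('o, 'm) step list set" where
  "zz_class C S X Y p = {q. zz_eq C S X Y p q}"

definition cone_in :: "('o, 'm, 'z) tricat_scheme \<Rightarrow> 'o set \<Rightarrow> ('o \<times> 'm \<times> 'o) set" where
  "cone_in T A = {(X, s, Y). \<exists>Z g h. (X, Y, Z, s, g, h) \<in> Tri T \<and> Z \<in> A}"

fun shift_step :: "('o, 'm, 'z) tricat_scheme \<Rightarrow> ('o, 'm) step \<Rightarrow> ('o, 'm) step" where
  "shift_step T (Fwd X f Y) = Fwd (Sh T X) (ShM T X Y f) (Sh T Y)"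
| "shift_step T (Bwd X f Y) = Bwd (Sh T X) (ShM T X Y f) (Sh T Y)"

definition quotient_functor ::
  "('o, 'm, 'z) tricat_scheme \<Rightarrow> 'o set \<Rightarrow> ('o, 'm, 'o, ('o, 'm) step list set) functor_data" where
  "quotient_functor T A =
     \<lparr> FO = (\<lambda>X. X), FM = (\<lambda>X Y f. zz_class T (cone_in T A) X Y [Fwd X f Y]) \<rparr>"

text \<open>
  Addition in \<open>T/A\<close> is by common denominators, \<open>f s\<inverse> + g s\<inverse> = (f + g) s\<inverse>\<close>; the distinguished
  triangles are those isomorphic in \<open>T/A\<close> to images of distinguished triangles of \<open>T\<close>.
\<close>

definition verdier_quotient ::
  "('o, 'm, 'z) tricat_scheme \<Rightarrow> 'o set \<Rightarrow> ('o, ('o, 'm) step list set) tricat" where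
  "verdier_quotient T A = (let S = cone_in T A; cl = zz_class T S; Q = quotient_functor T A in
     with_triangles
     \<lparr> Obj = Obj T,
       Hom = (\<lambda>X Y. {cl X Y p |p. zigzag T S X p Y}),
       Comp = (\<lambda>X Y Z \<psi> \<phi>. {r. \<exists>p\<in>\<phi>. \<exists>q\<in>\<psi>. zz_eq T S X Z (p @ q) r}),
       Id = (\<lambda>X. cl X X []),
       Add = (\<lambda>X Y \<phi> \<psi>. THE \<theta>. \<exists>W s f g. W \<in> Obj T \<and> s \<in> Hom T W X \<and> (W, s, X) \<in> S \<and>
          f \<in> Hom T W Y \<and> g \<in> Hom T W Y \<and>
          \<phi> = cl X Y [Bwd W s X, Fwd W f Y] \<and> \<psi> = cl X Y [Bwd W s X, Fwd W g Y] \<and>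
          \<theta> = cl X Y [Bwd W s X, Fwd W (Add T W Y f g) Y]),
       Sh = Sh T,
       ShM = (\<lambda>X Y \<phi>. {r. \<exists>p\<in>\<phi>. zz_eq T S (Sh T X) (Sh T Y) (map (shift_step T) p) r}),
       Tri = {} \<rparr>
     {(X, Y, Z, FM Q X Y f, FM Q Y Z g, FM Q Z (Sh T X) h) |X Y Z f g h. (X, Y, Z, f, g, h) \<in> Tri T})"

section \<open>DG-categories\<close>

text \<open>
  The grading data (the form \<open>gsig\<close> and the element \<open>gone\<close>) are part of the record. All groups
  \<open>dhom E X Y n\<close> are subgroups of one ambient abelian group \<open>'m\<close>, with one composition
  operation on \<open>'m\<close>; this is no loss of generality, as one can take for \<open>'m\<close> the
  direct sum of all the groups \<open>Hom\<^sup>n(X, Y)\<close>. No condition is imposed on the intersections of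
  the subgroups. The differential on \<open>dhom E X Y n\<close> is \<open>dd E X Y n\<close>.
\<close>

record ('o, 'g, 'm) dg =
  gsig :: "'g \<Rightarrow> 'g \<Rightarrow> bit"
  gone :: 'g
  dobj :: "'o set"
  dhom :: "'o \<Rightarrow> 'o \<Rightarrow> 'g \<Rightarrow> 'm set"
  dcomp :: "'m \<Rightarrow> 'm \<Rightarrow> 'm"
  did :: "'o \<Rightarrow> 'm"
  dd :: "'o \<Rightarrow> 'o \<Rightarrow> 'g \<Rightarrow> 'm \<Rightarrow> 'm"

text \<open>Multiplication by \<open>(-1)\<^sup>n\<close>, i.e. by \<open>-1\<close> to the power \<open>gsig 1 n\<close>.\<close>

definition dsign :: "('o, 'g, 'm::ab_group_add) dg \<Rightarrow> 'g \<Rightarrow> 'm \<Rightarrow> 'm" where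
  "dsign E n f = (if gsig E (gone E) n = 0 then f else - f)"

definition grading_data :: "('g::ab_group_add \<Rightarrow> 'g \<Rightarrow> bit) \<Rightarrow> 'g \<Rightarrow> bool" where
  "grading_data \<sigma> e \<longleftrightarrow> (\<forall>i j. \<sigma> i j = \<sigma> j i) \<and> (\<forall>i j k. \<sigma> (i + j) k = \<sigma> i k + \<sigma> j k) \<and> \<sigma> e e = 1"

definition dg_category :: "('o, 'g::ab_group_add, 'm::ab_group_add) dg \<Rightarrow> bool" where
  "dg_category E \<longleftrightarrow> grading_data (gsig E) (gone E) \<and>
     (\<forall>X\<in>dobj E. \<forall>Y\<in>dobj E. \<forall>n. subgroup_set (dhom E X Y n)) \<and>
     (\<forall>X\<in>dobj E. did E X \<in> dhom E X X 0) \<and>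
     (\<forall>X\<in>dobj E. \<forall>Y\<in>dobj E. \<forall>n. \<forall>f\<in>dhom E X Y n.
        dcomp E f (did E X) = f \<and> dcomp E (did E Y) f = f) \<and>
     (\<forall>X\<in>dobj E. \<forall>Y\<in>dobj E. \<forall>Z\<in>dobj E. \<forall>m n. \<forall>f\<in>dhom E X Y n. \<forall>g\<in>dhom E Y Z m.
        dcomp E g f \<in> dhom E X Z (m + n) \<and>
        (\<forall>f'\<in>dhom E X Y n. dcomp E g (f + f') = dcomp E g f + dcomp E g f') \<and>
        (\<forall>g'\<in>dhom E Y Z m. dcomp E (g + g') f = dcomp E g f + dcomp E g' f)) \<and>
     (\<forall>W\<in>dobj E. \<forall>X\<in>dobj E. \<forall>Y\<in>dobj E. \<forall>Z\<in>dobj E. \<forall>l m n.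
        \<forall>f\<in>dhom E W X n. \<forall>g\<in>dhom E X Y m. \<forall>h\<in>dhom E Y Z l.
        dcomp E h (dcomp E g f) = dcomp E (dcomp E h g) f) \<and>
     (\<forall>X\<in>dobj E. \<forall>Y\<in>dobj E. \<forall>n. \<forall>f\<in>dhom E X Y n.
        dd E X Y n f \<in> dhom E X Y (n + gone E) \<and>
        (\<forall>f'\<in>dhom E X Y n. dd E X Y n (f + f') = dd E X Y n f + dd E X Y n f') \<and>
        dd E X Y (n + gone E) (dd E X Y n f) = 0) \<and>
     (\<forall>X\<in>dobj E. \<forall>Y\<in>dobj E. \<forall>Z\<in>dobj E. \<forall>m n. \<forall>f\<in>dhom E X Y n. \<forall>g\<in>dhom E Y Z m.
        dd E X Z (m + n) (dcomp E g f) =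
        dcomp E (dd E Y Z m g) f + dsign E m (dcomp E g (dd E X Y n f)))"

definition dclosed :: "('o, 'g, 'm::ab_group_add) dg \<Rightarrow> 'o \<Rightarrow> 'o \<Rightarrow> 'g \<Rightarrow> 'm set" where
  "dclosed E X Y n = {f \<in> dhom E X Y n. dd E X Y n f = 0}"

definition Z0 :: "('o, 'g::ab_group_add, 'm::ab_group_add) dg \<Rightarrow> ('o, 'm) cat" where
  "Z0 E = \<lparr> Obj = dobj E, Hom = (\<lambda>X Y. dclosed E X Y 0),
            Comp = (\<lambda>X Y Z g f. dcomp E g f), Id = did E \<rparr>"

definition full_dg_subcategory :: "('o, 'g, 'm) dg \<Rightarrow> 'o set \<Rightarrow> ('o, 'g, 'm) dg" where
  "full_dg_subcategory E A = E\<lparr> dobj := dobj E \<inter> A \<rparr>"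

definition is_shift ::
  "('o, 'g::ab_group_add, 'm::ab_group_add) dg \<Rightarrow> 'g \<Rightarrow> 'o \<Rightarrow> 'o \<times> 'm \<times> 'm \<Rightarrow> bool" where
  "is_shift E i X = (\<lambda>(Y, u, v). Y \<in> dobj E \<and> u \<in> dclosed E X Y (- i) \<and> v \<in> dclosed E Y X i \<and>
     dcomp E v u = did E X \<and> dcomp E u v = did E Y)"

text \<open>
  The shifts \<open>X[n]\<close> by integers \<open>n\<close> are obtained by iterating \<open>[1]\<close> and \<open>[-1]\<close>.
\<close>

definition has_shifts :: "('o, 'g::ab_group_add, 'm::ab_group_add) dg \<Rightarrow> bool" where
  "has_shifts E \<longleftrightarrow> (\<forall>X\<in>dobj E. \<forall>i\<in>{gone E, - gone E}. \<exists>t. is_shift E i X t)"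

text \<open>A shift of \<open>X\<close>, unique up to a unique closed isomorphism, with its two structure morphisms.\<close>

definition shift_obj :: "('o, 'g::ab_group_add, 'm::ab_group_add) dg \<Rightarrow> 'g \<Rightarrow> 'o \<Rightarrow> 'o" where
  "shift_obj E i X = fst (SOME t. is_shift E i X t)"

definition to_shift :: "('o, 'g::ab_group_add, 'm::ab_group_add) dg \<Rightarrow> 'g \<Rightarrow> 'o \<Rightarrow> 'm" where
  "to_shift E i X = fst (snd (SOME t. is_shift E i X t))"

definition from_shift :: "('o, 'g::ab_group_add, 'm::ab_group_add) dg \<Rightarrow> 'g \<Rightarrow> 'o \<Rightarrow> 'm" where
  "from_shift E i X = snd (snd (SOME t. is_shift E i X t))"

text \<open>The shift of a morphism \<open>f : X \<rightarrow> Y\<close> of degree zero.\<close>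

definition shift_mor :: "('o, 'g::ab_group_add, 'm::ab_group_add) dg \<Rightarrow> 'g \<Rightarrow> 'o \<Rightarrow> 'o \<Rightarrow> 'm \<Rightarrow> 'm" where
  "shift_mor E i X Y f = dcomp E (to_shift E i Y) (dcomp E f (from_shift E i X))"

text \<open>
  The cone of a closed \<open>f : X \<rightarrow> Y\<close> of degree zero represents the functor taking \<open>Z\<close> to the cone of
  \<open>Hom(Z, X) \<rightarrow> Hom(Z, Y)\<close>, whose elements of degree \<open>n\<close> are pairs \<open>(y, x)\<close> of degrees \<open>n\<close> and
  \<open>n + 1\<close>, with \<open>d(y, x) = (dy + f x, - dx)\<close>. By the Yoneda lemma a representation is given by a
  universal pair \<open>(p, q)\<close> of (nonclosed and closed) projections of \<open>C\<close> to \<open>Y\<close> and \<open>X\<close>, as follows;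
  the two conditions on differentials say that \<open>c \<mapsto> (p c, q c)\<close> is a morphism of complexes.
\<close>

definition is_cone ::
  "('o, 'g::ab_group_add, 'm::ab_group_add) dg \<Rightarrow> 'o \<Rightarrow> 'o \<Rightarrow> 'm \<Rightarrow> 'o \<times> 'm \<times> 'm \<Rightarrow> bool" where
  "is_cone E X Y f = (\<lambda>(C, p, q).
     C \<in> dobj E \<and> p \<in> dhom E C Y 0 \<and> q \<in> dhom E C X (gone E) \<and>
     dd E C Y 0 p = - dcomp E f q \<and> dd E C X (gone E) q = 0 \<and>
     (\<forall>Z\<in>dobj E. \<forall>n. \<forall>y\<in>dhom E Z Y n. \<forall>x\<in>dhom E Z X (n + gone E).
        \<exists>!c. c \<in> dhom E Z C n \<and> dcomp E p c = y \<and> dcomp E q c = x))"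

definition has_cones :: "('o, 'g::ab_group_add, 'm::ab_group_add) dg \<Rightarrow> bool" where
  "has_cones E \<longleftrightarrow> (\<forall>X\<in>dobj E. \<forall>Y\<in>dobj E. \<forall>f\<in>dclosed E X Y 0. \<exists>t. is_cone E X Y f t)"

text \<open>The injections of \<open>Y\<close> (closed, degree \<open>0\<close>) and \<open>X\<close> (nonclosed, degree \<open>-1\<close>) into the cone.\<close>

definition cone_in_cod ::
  "('o, 'g::ab_group_add, 'm::ab_group_add) dg \<Rightarrow> 'o \<Rightarrow> 'o \<times> 'm \<times> 'm \<Rightarrow> 'm" where
  "cone_in_cod E Y = (\<lambda>(C, p, q).
     THE c. c \<in> dhom E Y C 0 \<and> dcomp E p c = did E Y \<and> dcomp E q c = 0)"

definition cone_in_dom ::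
  "('o, 'g::ab_group_add, 'm::ab_group_add) dg \<Rightarrow> 'o \<Rightarrow> 'o \<times> 'm \<times> 'm \<Rightarrow> 'm" where
  "cone_in_dom E X = (\<lambda>(C, p, q).
     THE c. c \<in> dhom E X C (- gone E) \<and> dcomp E p c = 0 \<and> dcomp E q c = did E X)"

text \<open>
  The totalization of a three-term complex \<open>K \<rightarrow> L \<rightarrow> M\<close> with maps \<open>f\<close>, \<open>g\<close>: the cone of the
  closed morphism \<open>cone(f) \<rightarrow> M\<close> which is \<open>g\<close> on \<open>L\<close> and \<open>0\<close> on \<open>K\<close>, that is \<open>g p\<close>. (The
  position of the complex only affects the result by a shift.)
\<close>

definition is_totalization ::
  "('o, 'g::ab_group_add, 'm::ab_group_add) dg \<Rightarrow> ('o, 'm) ses \<Rightarrow> 'o \<Rightarrow> bool" where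
  "is_totalization E = (\<lambda>(K, f, L, g, M) T.
     \<exists>C p q. is_cone E K L f (C, p, q) \<and> (\<exists>p' q'. is_cone E C M (dcomp E g p) (T, p', q')))"

definition is_dg_coproduct ::
  "('o, 'g::ab_group_add, 'm::ab_group_add) dg \<Rightarrow> 'i set \<Rightarrow> ('i \<Rightarrow> 'o) \<Rightarrow> 'o \<Rightarrow> ('i \<Rightarrow> 'm) \<Rightarrow> bool" where
  "is_dg_coproduct E I X W j \<longleftrightarrow>
     W \<in> dobj E \<and> (\<forall>\<alpha>\<in>I. X \<alpha> \<in> dobj E \<and> j \<alpha> \<in> dclosed E (X \<alpha>) W 0) \<and>
     (\<forall>Z\<in>dobj E. \<forall>n \<phi>. (\<forall>\<alpha>\<in>I. \<phi> \<alpha> \<in> dhom E (X \<alpha>) Z n) \<longrightarrow>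
        (\<exists>!h. h \<in> dhom E W Z n \<and> (\<forall>\<alpha>\<in>I. dcomp E h (j \<alpha>) = \<phi> \<alpha>)))"

definition is_dg_product ::
  "('o, 'g::ab_group_add, 'm::ab_group_add) dg \<Rightarrow> 'i set \<Rightarrow> ('i \<Rightarrow> 'o) \<Rightarrow> 'o \<Rightarrow> ('i \<Rightarrow> 'm) \<Rightarrow> bool" where
  "is_dg_product E I X W p \<longleftrightarrow>
     W \<in> dobj E \<and> (\<forall>\<alpha>\<in>I. X \<alpha> \<in> dobj E \<and> p \<alpha> \<in> dclosed E W (X \<alpha>) 0) \<and>
     (\<forall>Z\<in>dobj E. \<forall>n \<phi>. (\<forall>\<alpha>\<in>I. \<phi> \<alpha> \<in> dhom E Z (X \<alpha>) n) \<longrightarrow>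
        (\<exists>!h. h \<in> dhom E Z W n \<and> (\<forall>\<alpha>\<in>I. dcomp E (p \<alpha>) h = \<phi> \<alpha>)))"

section \<open>The homotopy category\<close>

definition hclass :: "('o, 'g::ab_group_add, 'm::ab_group_add) dg \<Rightarrow> 'o \<Rightarrow> 'o \<Rightarrow> 'm \<Rightarrow> 'm set" where
  "hclass E X Y f = {f + dd E X Y (- gone E) h |h. h \<in> dhom E X Y (- gone E)}"

text \<open>
  The standard triangles are \<open>X \<rightarrow> Y \<rightarrow> cone(f) \<rightarrow> X[1]\<close>, the last map being the closed projection
  \<open>q : cone(f) \<rightarrow> X\<close> of degree \<open>1\<close> followed by \<open>X \<rightarrow> X[1]\<close>.
\<close>

definition H0 :: "('o, 'g::ab_group_add, 'm::ab_group_add) dg \<Rightarrow> ('o, 'm set) tricat" where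
  "H0 E = with_triangles
     \<lparr> Obj = dobj E,
       Hom = (\<lambda>X Y. hclass E X Y ` dclosed E X Y 0),
       Comp = (\<lambda>X Y Z G F. \<Union>g\<in>G. \<Union>f\<in>F. hclass E X Z (dcomp E g f)),
       Id = (\<lambda>X. hclass E X X (did E X)),
       Add = (\<lambda>X Y F G. {f + g |f g. f \<in> F \<and> g \<in> G}),
       Sh = shift_obj E (gone E),
       ShM = (\<lambda>X Y F. \<Union>f\<in>F. hclass E (shift_obj E (gone E) X) (shift_obj E (gone E) Y)
                                 (shift_mor E (gone E) X Y f)),
       Tri = {} \<rparr>
     {(X, Y, C, hclass E X Y f, hclass E Y C (cone_in_cod E Y (C, p, q)),
       hclass E C (shift_obj E (gone E) X) (dcomp E (to_shift E (gone E) X) q)) |X Y C f p q.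
        X \<in> dobj E \<and> Y \<in> dobj E \<and> f \<in> dclosed E X Y 0 \<and> is_cone E X Y f (C, p, q)}"

section \<open>The DG-category \<open>E\<^sup>\<natural>\<close>\<close>

definition natural_dg ::
  "('o, 'g::ab_group_add, 'm::ab_group_add) dg \<Rightarrow> ('o \<times> 'm, 'g, 'm) dg" where
  "natural_dg E =
     \<lparr> gsig = gsig E, gone = gone E,
       dobj = {(X, s). X \<in> dobj E \<and> s \<in> dhom E X X (- gone E) \<and>
                       dd E X X (- gone E) s = did E X \<and> dcomp E s s = 0},
       dhom = (\<lambda>(X, s) (Y, t) i. dclosed E X Y (- i)),
       dcomp = dcomp E,
       did = (\<lambda>(X, s). did E X),
       dd = (\<lambda>(X, s) (Y, t) i f. dcomp E t f - dsign E i (dcomp E f s)) \<rparr>"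

text \<open>\<open>cone(id\<^bsub>A[-1]\<^esub>)\<close> with its two projections \<open>p\<close>, \<open>q\<close> to \<open>A[-1]\<close>, of degrees \<open>0\<close> and \<open>1\<close>.\<close>

definition phi_cone ::
  "('o, 'g::ab_group_add, 'm::ab_group_add) dg \<Rightarrow> 'o \<Rightarrow> 'o \<times> 'm \<times> 'm" where
  "phi_cone E A = (let B = shift_obj E (- gone E) A in SOME t. is_cone E B B (did E B) t)"

definition phi_obj :: "('o, 'g::ab_group_add, 'm::ab_group_add) dg \<Rightarrow> 'o \<Rightarrow> 'o \<times> 'm" where
  "phi_obj E A =
     (let B = shift_obj E (- gone E) A; (C, p, q) = phi_cone E A;
          \<pi>' = dcomp E (from_shift E (- gone E) A) p;
          \<iota>' = dcomp E (cone_in_dom E B (C, p, q)) (to_shift E (- gone E) A)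
      in (C, dcomp E \<iota>' \<pi>'))"

text \<open>The morphism \<open>cone(id\<^bsub>A[-1]\<^esub>) \<rightarrow> cone(id\<^bsub>A'[-1]\<^esub>)\<close> given by \<open>f[-1]\<close> on both components.\<close>

definition phi_mor :: "('o, 'g::ab_group_add, 'm::ab_group_add) dg \<Rightarrow> 'o \<Rightarrow> 'o \<Rightarrow> 'm \<Rightarrow> 'm" where
  "phi_mor E A A' f =
     (let B' = shift_obj E (- gone E) A'; (C, p, q) = phi_cone E A; t = phi_cone E A';
          f1 = shift_mor E (- gone E) A A' f
      in dcomp E (cone_in_cod E B' t) (dcomp E f1 p) + dcomp E (cone_in_dom E B' t) (dcomp E f1 q))"

section \<open>Exact DG-categories\<close>

definition shift_preserves_ses ::
  "('o, 'g::ab_group_add, 'm::ab_group_add) dg \<Rightarrow> 'g \<Rightarrow> ('o, 'm) ses set \<Rightarrow> bool" where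
  "shift_preserves_ses E i S \<longleftrightarrow> (\<forall>X f Y g Z. (X, f, Y, g, Z) \<in> S \<longrightarrow>
     (shift_obj E i X, shift_mor E i X Y f, shift_obj E i Y, shift_mor E i Y Z g, shift_obj E i Z) \<in> S)"

definition exact_dg_category ::
  "('o, 'g::ab_group_add, 'm::ab_group_add) dg \<Rightarrow> ('o, 'm) ses set \<Rightarrow> ('o \<times> 'm, 'm) ses set \<Rightarrow> bool" where
  "exact_dg_category E S SN \<longleftrightarrow>
     dg_category E \<and> additive_category (Z0 E) \<and> has_shifts E \<and> has_cones E \<and>
     exact_structure (Z0 E) S \<and> exact_structure (Z0 (natural_dg E)) SN \<and>
     (\<forall>i\<in>{gone E, - gone E}.
        shift_preserves_ses E i S \<and> shift_preserves_ses (natural_dg E) i SN) \<and>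
     (\<forall>X\<in>dobj E. \<forall>Y\<in>dobj E. \<forall>Z\<in>dobj E. \<forall>f\<in>dclosed E X Y 0. \<forall>g\<in>dclosed E Y Z 0.
        (X, f, Y, g, Z) \<in> S \<longleftrightarrow>
        (phi_obj E X, phi_mor E X Y f, phi_obj E Y, phi_mor E Y Z g, phi_obj E Z) \<in> SN) \<and>
     (\<forall>M\<in>dobj (natural_dg E). \<forall>N\<in>dobj (natural_dg E). \<forall>P\<in>dobj (natural_dg E).
        \<forall>f\<in>dclosed (natural_dg E) M N 0. \<forall>g\<in>dclosed (natural_dg E) N P 0.
        (M, f, N, g, P) \<in> SN \<longleftrightarrow> (fst M, f, fst N, g, fst P) \<in> S)"

text \<open>
  \<open>U\<close> is the collection of index sets of the infinite (co)products under consideration (the small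
  sets). The intended \<open>U\<close> consists of all small sets, but no property of \<open>U\<close> is needed.
\<close>

definition has_exact_coproducts ::
  "'i set set \<Rightarrow> ('o, 'g::ab_group_add, 'm::ab_group_add) dg \<Rightarrow> ('o, 'm) ses set \<Rightarrow> bool" where
  "has_exact_coproducts U E S \<longleftrightarrow>
     (\<forall>I\<in>U. \<forall>X. (\<forall>\<alpha>\<in>I. X \<alpha> \<in> dobj E) \<longrightarrow> (\<exists>W j. is_dg_coproduct E I X W j)) \<and>
     (\<forall>I\<in>U. \<forall>X f Y g Z X' j Y' k Z' l f' g'.
        (\<forall>\<alpha>\<in>I. (X \<alpha>, f \<alpha>, Y \<alpha>, g \<alpha>, Z \<alpha>) \<in> S) \<and>
        is_dg_coproduct E I X X' j \<and> is_dg_coproduct E I Y Y' k \<and> is_dg_coproduct E I Z Z' l \<and>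
        f' \<in> dclosed E X' Y' 0 \<and> (\<forall>\<alpha>\<in>I. dcomp E f' (j \<alpha>) = dcomp E (k \<alpha>) (f \<alpha>)) \<and>
        g' \<in> dclosed E Y' Z' 0 \<and> (\<forall>\<alpha>\<in>I. dcomp E g' (k \<alpha>) = dcomp E (l \<alpha>) (g \<alpha>)) \<longrightarrow>
        (X', f', Y', g', Z') \<in> S)"

definition has_exact_products ::
  "'i set set \<Rightarrow> ('o, 'g::ab_group_add, 'm::ab_group_add) dg \<Rightarrow> ('o, 'm) ses set \<Rightarrow> bool" where
  "has_exact_products U E S \<longleftrightarrow>
     (\<forall>I\<in>U. \<forall>X. (\<forall>\<alpha>\<in>I. X \<alpha> \<in> dobj E) \<longrightarrow> (\<exists>W p. is_dg_product E I X W p)) \<and>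
     (\<forall>I\<in>U. \<forall>X f Y g Z X' j Y' k Z' l f' g'.
        (\<forall>\<alpha>\<in>I. (X \<alpha>, f \<alpha>, Y \<alpha>, g \<alpha>, Z \<alpha>) \<in> S) \<and>
        is_dg_product E I X X' j \<and> is_dg_product E I Y Y' k \<and> is_dg_product E I Z Z' l \<and>
        f' \<in> dclosed E X' Y' 0 \<and> (\<forall>\<alpha>\<in>I. dcomp E (k \<alpha>) f' = dcomp E (f \<alpha>) (j \<alpha>)) \<and>
        g' \<in> dclosed E Y' Z' 0 \<and> (\<forall>\<alpha>\<in>I. dcomp E (l \<alpha>) g' = dcomp E (g \<alpha>) (k \<alpha>)) \<longrightarrow>
        (X', f', Y', g', Z') \<in> S)"

section \<open>Coderived and contraderived categories\<close>

definition Ac_co ::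
  "'i set set \<Rightarrow> ('o, 'g::ab_group_add, 'm::ab_group_add) dg \<Rightarrow> ('o, 'm) ses set \<Rightarrow> 'o set" where
  "Ac_co U E S = \<Inter>{A. triangulated_subcategory (H0 E) A \<and>
     (\<forall>s\<in>S. \<forall>T. is_totalization E s T \<longrightarrow> T \<in> A) \<and>
     (\<forall>I\<in>U. \<forall>X W j. (\<forall>\<alpha>\<in>I. X \<alpha> \<in> A) \<and> is_coproduct (H0 E) I X W j \<longrightarrow> W \<in> A)}"

definition Ac_ctr ::
  "'i set set \<Rightarrow> ('o, 'g::ab_group_add, 'm::ab_group_add) dg \<Rightarrow> ('o, 'm) ses set \<Rightarrow> 'o set" where
  "Ac_ctr U E S = \<Inter>{A. triangulated_subcategory (H0 E) A \<and>
     (\<forall>s\<in>S. \<forall>T. is_totalization E s T \<longrightarrow> T \<in> A) \<and>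
     (\<forall>I\<in>U. \<forall>X W p. (\<forall>\<alpha>\<in>I. X \<alpha> \<in> A) \<and> is_product (H0 E) I X W p \<longrightarrow> W \<in> A)}"

definition D_co ::
  "'i set set \<Rightarrow> ('o, 'g::ab_group_add, 'm::ab_group_add) dg \<Rightarrow> ('o, 'm) ses set \<Rightarrow>
     ('o, ('o, 'm set) step list set) tricat" where
  "D_co U E S = verdier_quotient (H0 E) (Ac_co U E S)"

definition D_ctr ::
  "'i set set \<Rightarrow> ('o, 'g::ab_group_add, 'm::ab_group_add) dg \<Rightarrow> ('o, 'm) ses set \<Rightarrow>
     ('o, ('o, 'm set) step list set) tricat" where
  "D_ctr U E S = verdier_quotient (H0 E) (Ac_ctr U E S)"

definition E_inj ::
  "('o, 'g::ab_group_add, 'm::ab_group_add) dg \<Rightarrow> ('o \<times> 'm, 'm) ses set \<Rightarrow> ('o, 'g, 'm) dg" where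
  "E_inj E SN = full_dg_subcategory E {J. injective_object (Z0 (natural_dg E)) SN (phi_obj E J)}"

definition E_proj ::
  "('o, 'g::ab_group_add, 'm::ab_group_add) dg \<Rightarrow> ('o \<times> 'm, 'm) ses set \<Rightarrow> ('o, 'g, 'm) dg" where
  "E_proj E SN = full_dg_subcategory E {P. projective_object (Z0 (natural_dg E)) SN (phi_obj E P)}"

end

theory Submission
  imports Defs
begin

text \<open>
  An object \<open>J\<close> is graded-injective iff graded (not necessarily closed) morphisms into \<open>J\<close> of any integer
  degree extend along inflations: a graded morphism \<open>A \<rightarrow> J\<close> is the same as a closed morphism
  \<open>cone(id\<^bsub>A[-1]\<^esub>) \<rightarrow> J\<close>, and the latter are morphisms \<open>\<Phi>(A) \<rightarrow> \<Phi>(J)\<close> by adjunction. Hence \<open>Hom(-, J)\<close> turns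
  a short exact sequence into a short exact sequence of complexes, and its totalization into an acyclic
  complex. The objects \<open>X\<close> with \<open>Hom(X, J)\<close> acyclic for all such \<open>J\<close> form a triangulated subcategory closed
  under coproducts, so that it contains all coacyclic objects.

  Consequently \<open>Hom(-, J)\<close> inverts the morphisms with coacyclic cones, hence is defined on zigzags. Evaluation
  at \<open>id\<^bsub>J\<^esub>\<close> inverts the map \<open>Hom(X, J) \<rightarrow> Hom(X, J)\<close> from the homotopy category to its quotient, without any
  calculus of fractions. Part (b) is dual.
\<close>

section \<open>Categories\<close>

text \<open>Exactness in \<open>S\<close> and \<open>SN\<close> speaks of closed morphisms of degree
  0, whereas the chase through a totalization needs kernels and cokernels for graded morphisms. The
  bridge: \<open>phi_obj\<close> carries a sequence of \<open>S\<close> to \<open>SN\<close>, and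
  forgetting the homotopies brings it back, so the cones of \<open>id\<close> on
  \<open>A[-1]\<close> form a sequence in \<open>S\<close> again; closed morphisms to and from these
  cones encode graded morphisms to and from the original terms.

  Coproducts in the homotopy category see degree 0 only. The other degrees are reached by shifting
  the graded-injective object, which is why acyclicity is tested against all such objects at once.

  The shift is a chosen object, chosen separately in \<open>E\<close> and in its full subcategory.
  Hence the inclusion is triangulated through a comparison of shifts, and cones of the subcategory
  must be recognized as cones of \<open>E\<close>.

  Addition in the quotient is a definite description over common denominators; its uniqueness is
  derived from the target being local or the source being colocal.\<close>

lemma category_Id: "category C \<Longrightarrow> X \<in> Obj C \<Longrightarrow> Id C X \<in> Hom C X X"
  by (simp add: category_def)

lemma category_Comp:
  "category C \<Longrightarrow> X \<in> Obj C \<Longrightarrow> Y \<in> Obj C \<Longrightarrow> Z \<in> Obj C \<Longrightarrow> f \<in> Hom C X Y \<Longrightarrow> g \<in> Hom C Y Z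
    \<Longrightarrow> Comp C X Y Z g f \<in> Hom C X Z"
  by (simp add: category_def)

lemma category_Id_right:
  "category C \<Longrightarrow> X \<in> Obj C \<Longrightarrow> Y \<in> Obj C \<Longrightarrow> f \<in> Hom C X Y \<Longrightarrow> Comp C X X Y f (Id C X) = f"
  by (simp add: category_def)

lemma category_Id_left:
  "category C \<Longrightarrow> X \<in> Obj C \<Longrightarrow> Y \<in> Obj C \<Longrightarrow> f \<in> Hom C X Y \<Longrightarrow> Comp C X Y Y (Id C Y) f = f"
  by (simp add: category_def)

lemma category_assoc:
  "category C \<Longrightarrow> W \<in> Obj C \<Longrightarrow> X \<in> Obj C \<Longrightarrow> Y \<in> Obj C \<Longrightarrow> Z \<in> Obj C \<Longrightarrow>
    f \<in> Hom C W X \<Longrightarrow> g \<in> Hom C X Y \<Longrightarrow> h \<in> Hom C Y Z \<Longrightarrow>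
    Comp C W Y Z h (Comp C W X Y g f) = Comp C W X Z (Comp C X Y Z h g) f"
  by (simp add: category_def)

section \<open>Localization by zigzags\<close>

lemma zigzag_objs: "zigzag C S X p Y \<Longrightarrow> X \<in> Obj C \<and> Y \<in> Obj C"
  by (induction rule: zigzag.induct) auto

lemma zigzag_append: "zigzag C S X p Y \<Longrightarrow> zigzag C S Y q Z \<Longrightarrow> zigzag C S X (p @ q) Z"
  by (induction rule: zigzag.induct) (auto intro: zigzag.intros)

lemma zigzag_Fwd: "X \<in> Obj C \<Longrightarrow> Y \<in> Obj C \<Longrightarrow> f \<in> Hom C X Y \<Longrightarrow> zigzag C S X [Fwd X f Y] Y"
  by (auto intro: zigzag.intros)

lemma zigzag_Bwd:
  "X \<in> Obj C \<Longrightarrow> Y \<in> Obj C \<Longrightarrow> s \<in> Hom C X Y \<Longrightarrow> (X, s, Y) \<in> S \<Longrightarrow> zigzag C S Y [Bwd X s Y] X"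
  by (auto intro: zigzag.intros)

lemma zz_eq_zigzag:
  assumes "category C" "zz_eq C S X Y p q"
  shows "zigzag C S X p Y \<and> zigzag C S X q Y"
  using assms(2)
proof (induction rule: zz_eq.induct)
  case (zze_context W a X Y p q b Z)
  then show ?case by (auto intro: zigzag_append)
qed (use assms(1) in \<open>auto intro!: zigzag.intros intro: category_Id category_Comp\<close>)

lemma zz_eq_append:
  assumes "category C" "zz_eq C S X Y p p'" "zz_eq C S Y Z q q'"
  shows "zz_eq C S X Z (p @ q) (p' @ q')"
proof -
  note zz = zz_eq_zigzag[OF assms(1,2)] zz_eq_zigzag[OF assms(1,3)]
  have "X \<in> Obj C" "Z \<in> Obj C" using zz zigzag_objs by fast+
  then have nil: "zigzag C S X [] X" "zigzag C S Z [] Z" by (auto intro: zigzag.intros)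
  have "zz_eq C S X Z (p @ q) (p' @ q)"
    using zze_context[OF nil(1) assms(2), of q Z] zz by simp
  moreover have "zz_eq C S X Z (p' @ q) (p' @ q')"
    using zze_context[of C S X p' Y Z q q' "[]" Z] assms(3) zz nil by simp
  ultimately show ?thesis by (rule zze_trans)
qed

text \<open>A class could be empty, since \<open>zze_refl\<close> is available for zigzags alone.
  The hypothesis puts \<open>p\<close> into its own class, and equal classes then share
  \<open>p\<close>.\<close>

lemma zz_class_eq_iff:
  assumes "zigzag C S X p Y"
  shows "zz_class C S X Y p = zz_class C S X Y q \<longleftrightarrow> zz_eq C S X Y p q"
  unfolding zz_class_def using zze_refl[OF assms] by (blast intro: zze_sym zze_trans)

section \<open>Objects that see the arrows of \<open>S\<close> as isomorphisms, and their Hom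
  functors on zigzags\<close>

definition local_object :: "('o, 'm, 'z) cat_scheme \<Rightarrow> ('o \<times> 'm \<times> 'o) set \<Rightarrow> 'o \<Rightarrow> bool" where
  "local_object C S J \<longleftrightarrow> J \<in> Obj C \<and>
     (\<forall>X s Y. X \<in> Obj C \<and> Y \<in> Obj C \<and> s \<in> Hom C X Y \<and> (X, s, Y) \<in> S \<longrightarrow>
        (\<forall>f\<in>Hom C X J. \<exists>!g. g \<in> Hom C Y J \<and> Comp C X Y J g s = f))"

definition colocal_object :: "('o, 'm, 'z) cat_scheme \<Rightarrow> ('o \<times> 'm \<times> 'o) set \<Rightarrow> 'o \<Rightarrow> bool" where
  "colocal_object C S P \<longleftrightarrow> P \<in> Obj C \<and>
     (\<forall>X s Y. X \<in> Obj C \<and> Y \<in> Obj C \<and> s \<in> Hom C X Y \<and> (X, s, Y) \<in> S \<longrightarrow>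
        (\<forall>f\<in>Hom C P Y. \<exists>!g. g \<in> Hom C P X \<and> Comp C P X Y s g = f))"

text \<open>Hom(-, J) applied to a zigzag. As it is contravariant, the recursion reaches the end of
  the list before it acts. A \<open>Bwd\<close> step divides by \<open>s\<close>; the description is
  meaningful when \<open>J\<close> is local and the list is a zigzag.\<close>

fun pull :: "('o, 'm, 'z) cat_scheme \<Rightarrow> 'o \<Rightarrow> ('o, 'm) step list \<Rightarrow> 'm \<Rightarrow> 'm" where
  "pull C J [] g = g"
| "pull C J (Fwd X f Y # p) g = Comp C X Y J (pull C J p g) f"
| "pull C J (Bwd X s Y # p) g = (THE h. h \<in> Hom C Y J \<and> Comp C X Y J h s = pull C J p g)"

fun push :: "('o, 'm, 'z) cat_scheme \<Rightarrow> 'o \<Rightarrow> ('o, 'm) step list \<Rightarrow> 'm \<Rightarrow> 'm" where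
  "push C P [] g = g"
| "push C P (Fwd X f Y # p) g = push C P p (Comp C P X Y f g)"
| "push C P (Bwd X s Y # p) g = push C P p (THE h. h \<in> Hom C P X \<and> Comp C P X Y s h = g)"

lemma local_object_the:
  assumes "local_object C S J" "X \<in> Obj C" "Y \<in> Obj C" "s \<in> Hom C X Y" "(X, s, Y) \<in> S" "f \<in> Hom C X J"
  shows "(THE h. h \<in> Hom C Y J \<and> Comp C X Y J h s = f) \<in> Hom C Y J"
    and "Comp C X Y J (THE h. h \<in> Hom C Y J \<and> Comp C X Y J h s = f) s = f"
    and "g \<in> Hom C Y J \<Longrightarrow> Comp C X Y J g s = f \<Longrightarrow> (THE h. h \<in> Hom C Y J \<and> Comp C X Y J h s = f) = g"
proof -
  have ex: "\<exists>!h. h \<in> Hom C Y J \<and> Comp C X Y J h s = f"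
    using assms unfolding local_object_def by blast
  from theI'[OF ex]
  show "(THE h. h \<in> Hom C Y J \<and> Comp C X Y J h s = f) \<in> Hom C Y J"
    "Comp C X Y J (THE h. h \<in> Hom C Y J \<and> Comp C X Y J h s = f) s = f" by auto
  show "g \<in> Hom C Y J \<Longrightarrow> Comp C X Y J g s = f \<Longrightarrow> (THE h. h \<in> Hom C Y J \<and> Comp C X Y J h s = f) = g"
    using the1_equality[OF ex] by blast
qed

lemma colocal_object_the:
  assumes "colocal_object C S P" "X \<in> Obj C" "Y \<in> Obj C" "s \<in> Hom C X Y" "(X, s, Y) \<in> S" "f \<in> Hom C P Y"
  shows "(THE h. h \<in> Hom C P X \<and> Comp C P X Y s h = f) \<in> Hom C P X"
    and "Comp C P X Y s (THE h. h \<in> Hom C P X \<and> Comp C P X Y s h = f) = f"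
    and "g \<in> Hom C P X \<Longrightarrow> Comp C P X Y s g = f \<Longrightarrow> (THE h. h \<in> Hom C P X \<and> Comp C P X Y s h = f) = g"
proof -
  have ex: "\<exists>!h. h \<in> Hom C P X \<and> Comp C P X Y s h = f"
    using assms unfolding colocal_object_def by blast
  from theI'[OF ex]
  show "(THE h. h \<in> Hom C P X \<and> Comp C P X Y s h = f) \<in> Hom C P X"
    "Comp C P X Y s (THE h. h \<in> Hom C P X \<and> Comp C P X Y s h = f) = f" by auto
  show "g \<in> Hom C P X \<Longrightarrow> Comp C P X Y s g = f \<Longrightarrow> (THE h. h \<in> Hom C P X \<and> Comp C P X Y s h = f) = g"
    using the1_equality[OF ex] by blast
qed

lemma pull_append: "pull C J (p @ q) g = pull C J p (pull C J q g)"
  by (induction p) (auto simp: pull.simps split: step.splits elim: step.exhaust | (rename_tac a p, case_tac a))+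

lemma push_append: "push C P (p @ q) g = push C P q (push C P p g)"
  by (induction p arbitrary: g) (auto | (rename_tac a p g, case_tac a))+

text \<open>Removes a backward step in front of a morphism that factors through \<open>s\<close>.
  With a local target every morphism factors in this way, so backward steps can always be
  removed.\<close>

lemma zz_eq_Bwd_Fwd:
  assumes "category C" "X \<in> Obj C" "Y \<in> Obj C" "Z \<in> Obj C" "s \<in> Hom C X Y" "(X, s, Y) \<in> S"
    "f \<in> Hom C Y Z"
  shows "zz_eq C S Y Z [Bwd X s Y, Fwd X (Comp C X Y Z f s) Z] [Fwd Y f Z]"
proof -
  have 1: "zz_eq C S X Z [Fwd X (Comp C X Y Z f s) Z] [Fwd X s Y, Fwd Y f Z]"
    using assms by (intro zze_sym[OF zze_comp])
  have 2: "zz_eq C S Y Z ([Bwd X s Y] @ [Fwd X (Comp C X Y Z f s) Z]) ([Bwd X s Y] @ [Fwd X s Y, Fwd Y f Z])"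
    using assms zz_eq_append[OF assms(1) zze_refl[OF zigzag_Bwd] 1] by auto
  have 3: "zz_eq C S Y Z ([Bwd X s Y, Fwd X s Y] @ [Fwd Y f Z]) ([] @ [Fwd Y f Z])"
    using assms zz_eq_append[OF assms(1) zze_inv2 zze_refl[OF zigzag_Fwd]] by blast
  show ?thesis using zze_trans[of C S Y Z] 2 3 by simp
qed

lemma zz_eq_Fwd_Bwd:
  assumes "category C" "X \<in> Obj C" "Y \<in> Obj C" "Z \<in> Obj C" "s \<in> Hom C X Y" "(X, s, Y) \<in> S"
    "f \<in> Hom C Z X"
  shows "zz_eq C S Z X [Fwd Z (Comp C Z X Y s f) Y, Bwd X s Y] [Fwd Z f X]"
proof -
  have 1: "zz_eq C S Z Y [Fwd Z (Comp C Z X Y s f) Y] [Fwd Z f X, Fwd X s Y]"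
    using assms by (intro zze_sym[OF zze_comp])
  have 2: "zz_eq C S Z X ([Fwd Z (Comp C Z X Y s f) Y] @ [Bwd X s Y]) ([Fwd Z f X, Fwd X s Y] @ [Bwd X s Y])"
    using assms zz_eq_append[OF assms(1) 1 zze_refl[OF zigzag_Bwd]] by auto
  have 3: "zz_eq C S Z X ([Fwd Z f X] @ [Fwd X s Y, Bwd X s Y]) ([Fwd Z f X] @ [])"
    using assms zz_eq_append[OF assms(1) zze_refl[OF zigzag_Fwd] zze_inv1] by blast
  show ?thesis using zze_trans[of C S Z X] 2 3 by simp
qed

lemma pull_in_Hom:
  assumes "category C" "local_object C S J" "zigzag C S X p Z" "g \<in> Hom C Z J"
  shows "pull C J p g \<in> Hom C X J"
  using assms(3,4)
proof (induction rule: zigzag.induct)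
  case (zz_fwd X Y f p Z)
  then show ?case using assms(1,2) by (auto intro!: category_Comp simp: local_object_def)
next
  case (zz_bwd X Y s p Z)
  then show ?case using assms(2) by (auto intro: local_object_the)
qed auto

lemma push_in_Hom:
  assumes "category C" "colocal_object C S P" "zigzag C S X p Z" "g \<in> Hom C P X"
  shows "push C P p g \<in> Hom C P Z"
  using assms(3,4)
proof (induction arbitrary: g rule: zigzag.induct)
  case (zz_fwd X Y f p Z)
  then show ?case using assms(1,2) by (auto intro!: zz_fwd.IH category_Comp simp: colocal_object_def)
next
  case (zz_bwd X Y s p Z)
  then show ?case using assms(2) by (auto intro!: zz_bwd.IH intro: colocal_object_the)
qed auto

text \<open>Hom(-, J) descends to the localization because it is a functor inverting
  \<open>S\<close>; the work lies in the generating relations.\<close>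

lemma pull_zz_eq:
  assumes C: "category C" and J: "local_object C S J" and "zz_eq C S X Z p q" "g \<in> Hom C Z J"
  shows "pull C J p g = pull C J q g"
  using assms(3,4)
proof (induction arbitrary: g rule: zz_eq.induct)
  case (zze_context W a X Y p q b Z)
  then show ?case by (simp add: pull_append pull_in_Hom[OF C J])
next
  case (zze_id X)
  then show ?case using C J by (simp add: category_Id_right local_object_def)
next
  case (zze_comp X Y Z f g)
  then show ?case using C J by (simp add: category_assoc local_object_def)
next
  case (zze_inv1 X Y s)
  then show ?case using local_object_the[OF J, of X Y s] by simp
next
  \<comment> \<open>The previous case uses existence of the quotient by \<open>s\<close>; here
    uniqueness counts, as \<open>g\<close> itself solves the equation in the description.\<close>
  case (zze_inv2 X Y s)
  have "Comp C X Y J g s \<in> Hom C X J"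
    using C J zze_inv2 by (auto intro!: category_Comp simp: local_object_def)
  then show ?case using local_object_the(3)[OF J, of X Y s] zze_inv2 by simp
qed auto

lemma push_zz_eq:
  assumes C: "category C" and P: "colocal_object C S P" and "zz_eq C S X Z p q" "g \<in> Hom C P X"
  shows "push C P p g = push C P q g"
  using assms(3,4)
proof (induction arbitrary: g rule: zz_eq.induct)
  case (zze_context W a X Y p q b Z)
  then show ?case by (simp add: push_append push_in_Hom[OF C P])
next
  case (zze_id X)
  then show ?case using C P by (simp add: category_Id_left colocal_object_def)
next
  case (zze_comp X Y Z f g)
  then show ?case using C P by (simp add: category_assoc colocal_object_def)
next
  case (zze_inv1 X Y s)
  have "Comp C P X Y s g \<in> Hom C P Y"
    using C P zze_inv1 by (auto intro!: category_Comp simp: colocal_object_def)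
  then show ?case using colocal_object_the(3)[OF P, of X Y s] zze_inv1 by simp
next
  case (zze_inv2 X Y s)
  then show ?case using colocal_object_the[OF P, of X Y s] by simp
qed auto

text \<open>The steps of the zigzag are absorbed one after another, from the right, into the arrow
  ending in \<open>J\<close>: a forward step by composing, a backward step by dividing by
  \<open>s\<close>, which locality allows.\<close>

lemma zz_eq_pull:
  assumes C: "category C" and J: "local_object C S J" and "zigzag C S X p Z" "g \<in> Hom C Z J"
  shows "zz_eq C S X J (p @ [Fwd Z g J]) [Fwd X (pull C J p g) J]"
  using assms(3,4)
proof (induction rule: zigzag.induct)
  case (zz_nil X)
  then show ?case using J by (auto intro!: zze_refl zigzag_Fwd simp: local_object_def)
next
  case (zz_fwd X Y f p Z)
  have J': "J \<in> Obj C" using J by (simp add: local_object_def)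
  have "zz_eq C S X J ([Fwd X f Y] @ (p @ [Fwd Z g J])) ([Fwd X f Y] @ [Fwd Y (pull C J p g) J])"
    using zz_fwd zz_eq_append[OF C zze_refl[OF zigzag_Fwd] zz_fwd.IH] by blast
  moreover have "zz_eq C S X J [Fwd X f Y, Fwd Y (pull C J p g) J] [Fwd X (pull C J (Fwd X f Y # p) g) J]"
    using zz_fwd J' pull_in_Hom[OF C J] by (auto intro: zze_comp)
  ultimately show ?case using zze_trans by fastforce
next
  case (zz_bwd X Y s p Z)
  have J': "J \<in> Obj C" using J by (simp add: local_object_def)
  define h where "h = pull C J (Bwd X s Y # p) g"
  have pl: "pull C J p g \<in> Hom C X J" using zz_bwd pull_in_Hom[OF C J] by auto
  note h = local_object_the[OF J zz_bwd(1-4) pl]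
  have "zz_eq C S Y J ([Bwd X s Y] @ (p @ [Fwd Z g J])) ([Bwd X s Y] @ [Fwd X (pull C J p g) J])"
    using zz_bwd zz_eq_append[OF C zze_refl[OF zigzag_Bwd] zz_bwd.IH] by blast
  moreover have "zz_eq C S Y J [Bwd X s Y, Fwd X (pull C J p g) J] [Fwd Y h J]"
    using zz_eq_Bwd_Fwd[OF C zz_bwd(1,2) J' zz_bwd(3,4), of h] h(1,2) by (simp add: h_def)
  ultimately show ?case unfolding h_def using zze_trans by fastforce
qed

lemma zz_eq_push:
  assumes C: "category C" and P: "colocal_object C S P" and "zigzag C S X p Z" "g \<in> Hom C P X"
  shows "zz_eq C S P Z (Fwd P g X # p) [Fwd P (push C P p g) Z]"
  using assms(3,4)
proof (induction arbitrary: g rule: zigzag.induct)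
  case (zz_nil X)
  then show ?case using P by (auto intro!: zze_refl zigzag_Fwd simp: colocal_object_def)
next
  case (zz_fwd X Y f p Z)
  have P': "P \<in> Obj C" using P by (simp add: colocal_object_def)
  have fg: "Comp C P X Y f g \<in> Hom C P Y" using zz_fwd C P' by (auto intro: category_Comp)
  have "zz_eq C S P Z ([Fwd P g X, Fwd X f Y] @ p) ([Fwd P (Comp C P X Y f g) Y] @ p)"
    using zz_fwd P' zz_eq_append[OF C zze_comp zze_refl] by blast
  from zze_trans[OF this[simplified] zz_fwd.IH[OF fg]] show ?case by simp
next
  case (zz_bwd X Y s p Z)
  have P': "P \<in> Obj C" using P by (simp add: colocal_object_def)
  define h where "h = (THE h. h \<in> Hom C P X \<and> Comp C P X Y s h = g)"
  note h = colocal_object_the[OF P zz_bwd(1-4) zz_bwd.prems, folded h_def]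
  have "zz_eq C S P Z ([Fwd P g Y, Bwd X s Y] @ p) ([Fwd P h X] @ p)"
    using zz_eq_Fwd_Bwd[OF C zz_bwd(1,2) P' zz_bwd(3,4) h(1)] h(2) zz_bwd
    by (intro zz_eq_append C zze_refl) auto
  from zze_trans[OF this[simplified] zz_bwd.IH[OF h(1)]] show ?case by (simp add: h_def)
qed

lemma local_object_faithful:
  assumes C: "category C" and J: "local_object C S J" and "X \<in> Obj C" "f \<in> Hom C X J" "g \<in> Hom C X J"
    and "zz_eq C S X J [Fwd X f J] [Fwd X g J]"
  shows "f = g"
proof -
  have "J \<in> Obj C" using J by (simp add: local_object_def)
  then show ?thesis
    using pull_zz_eq[OF C J assms(6) category_Id[OF C]] assms by (simp add: category_Id_left)
qed

lemma colocal_object_faithful: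
  assumes C: "category C" and P: "colocal_object C S P" and "X \<in> Obj C" "f \<in> Hom C P X" "g \<in> Hom C P X"
    and "zz_eq C S P X [Fwd P f X] [Fwd P g X]"
  shows "f = g"
proof -
  have "P \<in> Obj C" using P by (simp add: colocal_object_def)
  then show ?thesis
    using push_zz_eq[OF C P assms(6) category_Id[OF C]] assms by (simp add: category_Id_right)
qed

lemma local_object_full:
  assumes C: "category C" and J: "local_object C S J" and "zigzag C S X p J"
  shows "\<exists>f\<in>Hom C X J. zz_eq C S X J p [Fwd X f J]"
proof
  have J': "J \<in> Obj C" using J by (simp add: local_object_def)
  note id = category_Id[OF C J']
  show "pull C J p (Id C J) \<in> Hom C X J" using pull_in_Hom[OF C J assms(3) id] .
  have "zz_eq C S X J (p @ [Fwd J (Id C J) J]) (p @ [])"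
    using zz_eq_append[OF C zze_refl[OF assms(3)] zze_id[OF J']] .
  with zz_eq_pull[OF C J assms(3) id] show "zz_eq C S X J p [Fwd X (pull C J p (Id C J)) J]"
    by (metis append_Nil2 zze_sym zze_trans)
qed

lemma colocal_object_full:
  assumes C: "category C" and P: "colocal_object C S P" and "zigzag C S P p X"
  shows "\<exists>f\<in>Hom C P X. zz_eq C S P X p [Fwd P f X]"
proof
  have P': "P \<in> Obj C" using P by (simp add: colocal_object_def)
  note id = category_Id[OF C P']
  show "push C P p (Id C P) \<in> Hom C P X" using push_in_Hom[OF C P assms(3) id] .
  have "zz_eq C S P X ([Fwd P (Id C P) P] @ p) ([] @ p)"
    using zz_eq_append[OF C zze_id[OF P'] zze_refl[OF assms(3)]] .
  with zz_eq_push[OF C P assms(3) id] show "zz_eq C S P X p [Fwd P (push C P p (Id C P)) X]"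
    by (metis append_Cons append_Nil zze_sym zze_trans)
qed

section \<open>Verdier quotients\<close>

text \<open>What lets the localization carry the additional structure: \<open>cone_in_Sh\<close>
  makes the shift act on zigzags, and \<open>cone_in_Id\<close> supplies trivial denominators for
  sums.\<close>

locale verdier =
  fixes T :: "('o, 'm) tricat" and A :: "'o set"
  assumes cat: "category T"
    and Tri_is_triangle: "t \<in> Tri T \<Longrightarrow> is_triangle T t"
    and Sh_Obj: "X \<in> Obj T \<Longrightarrow> Sh T X \<in> Obj T"
    and ShM_Hom: "X \<in> Obj T \<Longrightarrow> Y \<in> Obj T \<Longrightarrow> f \<in> Hom T X Y \<Longrightarrow> ShM T X Y f \<in> Hom T (Sh T X) (Sh T Y)"
    and ShM_Id: "X \<in> Obj T \<Longrightarrow> ShM T X X (Id T X) = Id T (Sh T X)"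
    and ShM_Comp: "X \<in> Obj T \<Longrightarrow> Y \<in> Obj T \<Longrightarrow> Z \<in> Obj T \<Longrightarrow> f \<in> Hom T X Y \<Longrightarrow> g \<in> Hom T Y Z \<Longrightarrow>
      ShM T X Z (Comp T X Y Z g f) = Comp T (Sh T X) (Sh T Y) (Sh T Z) (ShM T Y Z g) (ShM T X Y f)"
    and cone_in_Id: "X \<in> Obj T \<Longrightarrow> (X, Id T X, X) \<in> cone_in T A"
    and cone_in_Sh: "(X, s, Y) \<in> cone_in T A \<Longrightarrow> (Sh T X, ShM T X Y s, Sh T Y) \<in> cone_in T A"
begin

abbreviation "S \<equiv> cone_in T A"
abbreviation "D \<equiv> verdier_quotient T A"
abbreviation "Q \<equiv> quotient_functor T A"
abbreviation "cl \<equiv> zz_class T S"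

lemma D_simps:
  "Obj D = Obj T"
  "Hom D X Y = {cl X Y p |p. zigzag T S X p Y}"
  "Comp D X Y Z \<psi> \<phi> = {r. \<exists>p\<in>\<phi>. \<exists>q\<in>\<psi>. zz_eq T S X Z (p @ q) r}"
  "Id D X = cl X X []"
  "Sh D = Sh T"
  "ShM D X Y \<phi> = {r. \<exists>p\<in>\<phi>. zz_eq T S (Sh T X) (Sh T Y) (map (shift_step T) p) r}"
  by (simp_all add: verdier_quotient_def Let_def with_triangles_def)

lemma Q_simps: "FO Q X = X" "FM Q X Y f = cl X Y [Fwd X f Y]"
  by (simp_all add: quotient_functor_def)

lemma cone_in_Hom: "(X, s, Y) \<in> S \<Longrightarrow> X \<in> Obj T \<and> Y \<in> Obj T \<and> s \<in> Hom T X Y"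
  by (auto simp: cone_in_def dest!: Tri_is_triangle)

lemma cl_eqI: "zz_eq T S X Y p q \<Longrightarrow> cl X Y p = cl X Y q"
  using zz_eq_zigzag[OF cat] zz_class_eq_iff by metis

lemma D_Comp:
  assumes "zigzag T S X p Y" "zigzag T S Y q Z"
  shows "Comp D X Y Z (cl Y Z q) (cl X Y p) = cl X Z (p @ q)"
proof -
  have "r \<in> cl X Z (p @ q)" if "r \<in> Comp D X Y Z (cl Y Z q) (cl X Y p)" for r
  proof -
    from that obtain p' q' where
      "zz_eq T S X Y p p'" "zz_eq T S Y Z q q'" "zz_eq T S X Z (p' @ q') r"
      by (auto simp: D_simps zz_class_def)
    from zze_trans[OF zz_eq_append[OF cat this(1,2)] this(3)] show ?thesis by (simp add: zz_class_def)
  qed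
  moreover have "cl X Z (p @ q) \<subseteq> Comp D X Y Z (cl Y Z q) (cl X Y p)"
    unfolding D_simps zz_class_def using zze_refl[OF assms(1)] zze_refl[OF assms(2)] by blast
  ultimately show ?thesis by blast
qed

lemma D_Hom: "zigzag T S X p Y \<Longrightarrow> cl X Y p \<in> Hom D X Y"
  by (auto simp: D_simps)

lemma category_D: "category D"
proof -
  have nil: "zigzag T S X [] X" if "X \<in> Obj T" for X using that by (rule zz_nil)
  show ?thesis
    unfolding category_def
  proof (intro conjI ballI)
    fix X assume "X \<in> Obj D"
    then show "Id D X \<in> Hom D X X" using D_Hom[OF nil] by (simp add: D_simps(1,4))
  next
    fix X Y Z f g
    assume "f \<in> Hom D X Y" "g \<in> Hom D Y Z"
    then show "Comp D X Y Z g f \<in> Hom D X Z"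
      by (clarsimp simp: D_simps(2) D_Comp) (blast intro: zigzag_append)
  next
    fix X Y f
    assume o: "X \<in> Obj D" "Y \<in> Obj D" "f \<in> Hom D X Y"
    then obtain p where p: "f = cl X Y p" "zigzag T S X p Y" by (auto simp: D_simps(2))
    then show "Comp D X X Y f (Id D X) = f" "Comp D X Y Y (Id D Y) f = f"
      using o D_Comp[OF nil p(2)] D_Comp[OF p(2) nil] by (simp_all add: D_simps(1,4))
  next
    fix W X Y Z f g h
    assume "f \<in> Hom D W X" "g \<in> Hom D X Y" "h \<in> Hom D Y Z"
    then show "Comp D W Y Z h (Comp D W X Y g f) = Comp D W X Z (Comp D X Y Z h g) f"
      by (clarsimp simp: D_simps(2) D_Comp zigzag_append)
  qed
qed

lemma zigzag_Fwd_S: "X \<in> Obj T \<Longrightarrow> Y \<in> Obj T \<Longrightarrow> f \<in> Hom T X Y \<Longrightarrow> zigzag T S X [Fwd X f Y] Y"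
  by (rule zigzag_Fwd)

lemma Q_Comp:
  assumes "X \<in> Obj T" "Y \<in> Obj T" "Z \<in> Obj T" "f \<in> Hom T X Y" "g \<in> Hom T Y Z"
  shows "FM Q X Z (Comp T X Y Z g f) = Comp D X Y Z (FM Q Y Z g) (FM Q X Y f)"
  using assms cl_eqI[OF zze_comp[of X T Y Z f g S]] by (simp add: Q_simps D_Comp zigzag_Fwd_S)

lemma Q_Id: "X \<in> Obj T \<Longrightarrow> FM Q X X (Id T X) = Id D X"
  by (simp add: Q_simps D_simps cl_eqI zze_id)

lemma Q_Hom: "X \<in> Obj T \<Longrightarrow> Y \<in> Obj T \<Longrightarrow> f \<in> Hom T X Y \<Longrightarrow> FM Q X Y f \<in> Hom D X Y"
  by (simp add: Q_simps D_Hom zigzag_Fwd_S)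

lemma Q_cat_iso: "cat_iso T X Y f \<Longrightarrow> cat_iso D X Y (FM Q X Y f)"
  unfolding cat_iso_def D_simps(1) using Q_Comp Q_Id Q_Hom by metis

lemma zigzag_shift: "zigzag T S X p Y \<Longrightarrow> zigzag T S (Sh T X) (map (shift_step T) p) (Sh T Y)"
  by (induction rule: zigzag.induct)
     (auto intro!: zigzag.intros simp: Sh_Obj ShM_Hom cone_in_Sh)

lemma zz_eq_shift:
  "zz_eq T S X Y p q \<Longrightarrow> zz_eq T S (Sh T X) (Sh T Y) (map (shift_step T) p) (map (shift_step T) q)"
proof (induction rule: zz_eq.induct)
  case (zze_context W a X Y p q b Z)
  then show ?case using zz_eq.zze_context[OF zigzag_shift zze_context.IH zigzag_shift] by simp
next
  case (zze_trans X Y p q r)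
  show ?case using zz_eq.zze_trans[OF zze_trans.IH] by simp
next
  case (zze_comp X Y Z f g)
  then show ?case by (simp add: ShM_Comp zz_eq.zze_comp Sh_Obj ShM_Hom)
next
  case (zze_id X)
  then show ?case by (simp add: ShM_Id zz_eq.zze_id Sh_Obj)
next
  case (zze_refl X p Y)
  then show ?case using zz_eq.zze_refl[OF zigzag_shift] by simp
next
  case (zze_sym X Y p q)
  show ?case using zz_eq.zze_sym[OF zze_sym.IH] by simp
next
  case (zze_inv1 X Y s)
  then show ?case by (simp add: zz_eq.zze_inv1 Sh_Obj ShM_Hom cone_in_Sh)
next
  case (zze_inv2 X Y s)
  then show ?case by (simp add: zz_eq.zze_inv2 Sh_Obj ShM_Hom cone_in_Sh)
qed

lemma D_ShM:
  assumes "zigzag T S X p Y"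
  shows "ShM D X Y (cl X Y p) = cl (Sh T X) (Sh T Y) (map (shift_step T) p)"
proof -
  have "r \<in> cl (Sh T X) (Sh T Y) (map (shift_step T) p)" if "r \<in> ShM D X Y (cl X Y p)" for r
  proof -
    from that obtain p' where "zz_eq T S X Y p p'" "zz_eq T S (Sh T X) (Sh T Y) (map (shift_step T) p') r"
      by (auto simp: D_simps zz_class_def)
    from zze_trans[OF zz_eq_shift[OF this(1)] this(2)] show ?thesis by (simp add: zz_class_def)
  qed
  moreover have "cl (Sh T X) (Sh T Y) (map (shift_step T) p) \<subseteq> ShM D X Y (cl X Y p)"
    unfolding D_simps zz_class_def using zze_refl[OF assms] by blast
  ultimately show ?thesis by blast
qed

lemma Q_ShM:
  "X \<in> Obj T \<Longrightarrow> Y \<in> Obj T \<Longrightarrow> f \<in> Hom T X Y \<Longrightarrow>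
    ShM D X Y (FM Q X Y f) = FM Q (Sh T X) (Sh T Y) (ShM T X Y f)"
  by (simp add: Q_simps D_ShM zigzag_Fwd_S)

lemma D_TriI:
  assumes "(X, Y, Z, f, g, h) \<in> Tri T"
  shows "(X, Y, Z, FM Q X Y f, FM Q Y Z g, FM Q Z (Sh T X) h) \<in> Tri D"
proof -
  let ?t = "(X, Y, Z, FM Q X Y f, FM Q Y Z g, FM Q Z (Sh T X) h)"
  have tr: "X \<in> Obj T" "Y \<in> Obj T" "Z \<in> Obj T" "f \<in> Hom T X Y" "g \<in> Hom T Y Z" "h \<in> Hom T Z (Sh T X)"
    using Tri_is_triangle[OF assms] by auto
  \<comment> \<open>Inside \<open>with_triangles\<close> the comparison of triangles takes place in
    the record whose \<open>Tri\<close> is still empty; \<open>D0\<close> is that record.\<close>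
  define D0 where "D0 = D\<lparr>Tri := {}\<rparr>"
  have D0: "Obj D0 = Obj D" "Hom D0 = Hom D" "Comp D0 = Comp D" "Id D0 = Id D" "Sh D0 = Sh D" "ShM D0 = ShM D"
    by (simp_all add: D0_def)
  have DT: "Tri D = {t. is_triangle D0 t \<and>
    (\<exists>t'\<in>{(X, Y, Z, FM Q X Y f, FM Q Y Z g, FM Q Z (Sh T X) h) |X Y Z f g h. (X, Y, Z, f, g, h) \<in> Tri T}.
       triangle_iso D0 t t')}"
    by (simp add: D0_def verdier_quotient_def Let_def with_triangles_def)
  have isod: "cat_iso D X X (Id D X)" if "X \<in> Obj T" for X
    using Q_cat_iso[of X X "Id T X"] Q_Id that category_Id[OF cat] category_Id_left[OF cat]
    by (auto simp: cat_iso_def)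
  then have iso0: "cat_iso D0 X X (Id D X)" if "X \<in> Obj T" for X
    using that by (simp add: cat_iso_def D0)
  have "is_triangle D0 ?t" using tr Q_Hom Sh_Obj by (simp add: D0 D_simps(1,5))
  moreover have "triangle_iso D0 ?t ?t"
    unfolding triangle_iso.simps
    using tr Q_Hom Sh_Obj category_Id_left[OF category_D] category_Id_right[OF category_D]
      Q_ShM[OF tr(1,1) category_Id[OF cat tr(1)]] Q_Id ShM_Id
    by (intro exI[of _ "Id D X"] exI[of _ "Id D Y"] exI[of _ "Id D Z"] conjI iso0)
       (auto simp: D0 D_simps(1,5))
  ultimately show ?thesis unfolding DT using assms by blast
qed

text \<open>The shifts of \<open>T0\<close> and \<open>T\<close> agree up to the comparison
  \<open>\<eta>\<close> of the inclusion, and the composite takes the image of \<open>\<eta>\<close>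
  in the quotient as its own comparison. Additivity enters as the hypothesis \<open>add\<close>,
  because its proof depends on whether the objects of \<open>T0\<close> are local or
  colocal.\<close>

theorem triangulated_functor_Q_inclusion:
  fixes T0 :: "('o, 'm) tricat"
  assumes incl: "triangulated_functor T0 T inclusion_functor"
    and Sh0: "\<And>X. X \<in> Obj T0 \<Longrightarrow> Sh T0 X \<in> Obj T0"
    and ShM0: "\<And>X Y f. X \<in> Obj T0 \<Longrightarrow> Y \<in> Obj T0 \<Longrightarrow> f \<in> Hom T0 X Y \<Longrightarrow>
      ShM T0 X Y f \<in> Hom T0 (Sh T0 X) (Sh T0 Y)"
    and Tri0: "\<And>t. t \<in> Tri T0 \<Longrightarrow> is_triangle T0 t"
    and add: "\<And>X Y f g. X \<in> Obj T0 \<Longrightarrow> Y \<in> Obj T0 \<Longrightarrow> f \<in> Hom T X Y \<Longrightarrow> g \<in> Hom T X Y \<Longrightarrow>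
      FM Q X Y (Add T X Y f g) = Add D X Y (FM Q X Y f) (FM Q X Y g)"
  shows "triangulated_functor T0 D (functor_comp Q inclusion_functor)"
proof -
  let ?F = "functor_comp Q inclusion_functor :: ('o, 'm, 'o, ('o, 'm) step list set) functor_data"
  have F: "FO ?F X = X" "FM ?F X Y f = FM Q X Y f" for X Y f
    by (simp_all add: functor_comp_def inclusion_functor_def Q_simps(1))
  have I: "FO inclusion_functor X = X" "FM inclusion_functor X Y f = f" for X Y :: 'o and f :: 'm
    by (simp_all add: inclusion_functor_def)
  from incl obtain \<eta> where fn: "is_functor T0 T inclusion_functor"
    and ad: "\<And>X Y f g. X \<in> Obj T0 \<Longrightarrow> Y \<in> Obj T0 \<Longrightarrow> f \<in> Hom T0 X Y \<Longrightarrow> g \<in> Hom T0 X Y \<Longrightarrow>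
      Add T0 X Y f g = Add T X Y f g"
    and iso: "\<And>X. X \<in> Obj T0 \<Longrightarrow> cat_iso T (Sh T0 X) (Sh T X) (\<eta> X)"
    and nat: "\<And>X Y f. X \<in> Obj T0 \<Longrightarrow> Y \<in> Obj T0 \<Longrightarrow> f \<in> Hom T0 X Y \<Longrightarrow>
      Comp T (Sh T0 X) (Sh T0 Y) (Sh T Y) (\<eta> Y) (ShM T0 X Y f) =
      Comp T (Sh T0 X) (Sh T X) (Sh T Y) (ShM T X Y f) (\<eta> X)"
    and tri: "\<And>X Y Z f g h. (X, Y, Z, f, g, h) \<in> Tri T0 \<Longrightarrow>
      (X, Y, Z, f, g, Comp T Z (Sh T0 X) (Sh T X) (\<eta> X) h) \<in> Tri T"
    unfolding triangulated_functor_def I by (elim conjE exE) (rule that; blast)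
  have sub: "X \<in> Obj T" if "X \<in> Obj T0" for X
    using fn that by (auto simp: is_functor_def I)
  have Hsub: "f \<in> Hom T X Y" if "X \<in> Obj T0" "Y \<in> Obj T0" "f \<in> Hom T0 X Y" for X Y f
    using fn that by (auto simp: is_functor_def I)
  have eta: "\<eta> X \<in> Hom T (Sh T0 X) (Sh T X)" if "X \<in> Obj T0" for X
    using iso[OF that] by (simp add: cat_iso_def)
  have Idsub: "Id T0 X = Id T X" if "X \<in> Obj T0" for X
    using fn that by (auto simp: is_functor_def I)
  have Csub: "Comp T0 X Y Z g f = Comp T X Y Z g f"
    if "X \<in> Obj T0" "Y \<in> Obj T0" "Z \<in> Obj T0" "f \<in> Hom T0 X Y" "g \<in> Hom T0 Y Z" for X Y Z f g
    using fn that by (auto simp: is_functor_def I)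
  have "category T0" using fn by (simp add: is_functor_def)
  then have "is_functor T0 D ?F"
    unfolding is_functor_def F
    by (simp add: category_D D_simps(1) sub Idsub Q_Id Q_Hom Hsub Csub Q_Comp)
  moreover have "FM ?F X Y (Add T0 X Y f g) = Add D (FO ?F X) (FO ?F Y) (FM ?F X Y f) (FM ?F X Y g)"
    if "X \<in> Obj T0" "Y \<in> Obj T0" "f \<in> Hom T0 X Y" "g \<in> Hom T0 X Y" for X Y f g
    using that add ad Hsub by (simp add: F)
  moreover have "cat_iso D (FO ?F (Sh T0 X)) (Sh D (FO ?F X)) (FM Q (Sh T0 X) (Sh T X) (\<eta> X))"
    if "X \<in> Obj T0" for X
    using Q_cat_iso[OF iso[OF that]] by (simp add: F D_simps(5))
  moreover have "Comp D (FO ?F (Sh T0 X)) (FO ?F (Sh T0 Y)) (Sh D (FO ?F Y))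
            (FM Q (Sh T0 Y) (Sh T Y) (\<eta> Y)) (FM ?F (Sh T0 X) (Sh T0 Y) (ShM T0 X Y f)) =
          Comp D (FO ?F (Sh T0 X)) (Sh D (FO ?F X)) (Sh D (FO ?F Y))
            (ShM D (FO ?F X) (FO ?F Y) (FM ?F X Y f)) (FM Q (Sh T0 X) (Sh T X) (\<eta> X))"
    if XYf: "X \<in> Obj T0" "Y \<in> Obj T0" "f \<in> Hom T0 X Y" for X Y f
  proof -
    note [simp] = Sh0 sub Sh_Obj ShM_Hom Hsub eta ShM0 XYf
    show ?thesis
      unfolding F D_simps(5) by (simp add: Q_Comp[symmetric] nat Q_ShM)
  qed
  moreover have "(FO ?F X, FO ?F Y, FO ?F Z, FM ?F X Y f, FM ?F Y Z g,
           Comp D (FO ?F Z) (FO ?F (Sh T0 X)) (Sh D (FO ?F X)) (FM Q (Sh T0 X) (Sh T X) (\<eta> X))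
             (FM ?F Z (Sh T0 X) h)) \<in> Tri D"
    if t: "(X, Y, Z, f, g, h) \<in> Tri T0" for X Y Z f g h
  proof -
    have "X \<in> Obj T0" "Z \<in> Obj T0" "h \<in> Hom T0 Z (Sh T0 X)"
      using Tri0[OF t] by auto
    then show ?thesis
      using D_TriI[OF tri[OF t]] Sh0 sub Sh_Obj Hsub eta by (simp add: F D_simps(5) Q_Comp)
  qed
  ultimately show ?thesis unfolding triangulated_functor_def by (intro conjI exI[of _ "\<lambda>X. FM Q (Sh T0 X) (Sh T X) (\<eta> X)"]) blast+
qed

section \<open>Addition in the quotient\<close>

lemma D_Add:
  "Add D X Y \<phi> \<psi> = (THE \<theta>. \<exists>W s f g. W \<in> Obj T \<and> s \<in> Hom T W X \<and> (W, s, X) \<in> S \<and>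
     f \<in> Hom T W Y \<and> g \<in> Hom T W Y \<and>
     \<phi> = cl X Y [Bwd W s X, Fwd W f Y] \<and> \<psi> = cl X Y [Bwd W s X, Fwd W g Y] \<and>
     \<theta> = cl X Y [Bwd W s X, Fwd W (Add T W Y f g) Y])"
  by (simp add: verdier_quotient_def Let_def with_triangles_def)

text \<open>
  If \<open>Q\<close> is faithful enough, fractions \<open>f' s\<inverse>\<close> equal to a morphism \<open>f\<close> of \<open>T\<close> arise from \<open>f\<close> alone, so that
  addition by common denominators needs no calculus of fractions.
\<close>

lemma Q_Add:
  assumes XY: "X \<in> Obj T" "Y \<in> Obj T" and fg: "f \<in> Hom T X Y" "g \<in> Hom T X Y"
    and closed: "\<And>f g. f \<in> Hom T X Y \<Longrightarrow> g \<in> Hom T X Y \<Longrightarrow> Add T X Y f g \<in> Hom T X Y"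
    and frac: "\<And>W s f' g' f g. (W, s, X) \<in> S \<Longrightarrow> f' \<in> Hom T W Y \<Longrightarrow> g' \<in> Hom T W Y \<Longrightarrow>
      f \<in> Hom T X Y \<Longrightarrow> g \<in> Hom T X Y \<Longrightarrow>
      zz_eq T S X Y [Bwd W s X, Fwd W f' Y] [Fwd X f Y] \<Longrightarrow>
      zz_eq T S X Y [Bwd W s X, Fwd W g' Y] [Fwd X g Y] \<Longrightarrow>
      zz_eq T S X Y [Bwd W s X, Fwd W (Add T W Y f' g') Y] [Fwd X (Add T X Y f g) Y]"
  shows "FM Q X Y (Add T X Y f g) = Add D X Y (FM Q X Y f) (FM Q X Y g)"
proof -
  have id: "Id T X \<in> Hom T X X" using category_Id[OF cat XY(1)] .
  \<comment> \<open>Every morphism of \<open>T\<close> is a fraction with denominator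
    \<open>id\<close>, which gives \<open>f\<close> and \<open>g\<close> a common
    denominator.\<close>
  have split: "cl X Y [Fwd X h Y] = cl X Y [Bwd X (Id T X) X, Fwd X h Y]" if "h \<in> Hom T X Y" for h
    using zz_eq_Bwd_Fwd[OF cat XY(1,1,2) id cone_in_Id[OF XY(1)] that] that XY
    by (intro cl_eqI) (simp add: category_Id_right[OF cat] zze_sym)
  show ?thesis
    unfolding D_Add Q_simps
  proof (rule the_equality[symmetric])
    show "\<exists>W s f' g'. W \<in> Obj T \<and> s \<in> Hom T W X \<and> (W, s, X) \<in> S \<and>
     f' \<in> Hom T W Y \<and> g' \<in> Hom T W Y \<and>
     cl X Y [Fwd X f Y] = cl X Y [Bwd W s X, Fwd W f' Y] \<and> cl X Y [Fwd X g Y] = cl X Y [Bwd W s X, Fwd W g' Y] \<and>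
     cl X Y [Fwd X (Add T X Y f g) Y] = cl X Y [Bwd W s X, Fwd W (Add T W Y f' g') Y]"
      by (rule exI[of _ X], rule exI[of _ "Id T X"], rule exI[of _ f], rule exI[of _ g])
         (simp only: XY id cone_in_Id fg closed split simp_thms)
  next
    fix \<theta>
    assume "\<exists>W s f' g'. W \<in> Obj T \<and> s \<in> Hom T W X \<and> (W, s, X) \<in> S \<and>
     f' \<in> Hom T W Y \<and> g' \<in> Hom T W Y \<and>
     cl X Y [Fwd X f Y] = cl X Y [Bwd W s X, Fwd W f' Y] \<and> cl X Y [Fwd X g Y] = cl X Y [Bwd W s X, Fwd W g' Y] \<and>
     \<theta> = cl X Y [Bwd W s X, Fwd W (Add T W Y f' g') Y]"
    then obtain W s f' g' where W: "W \<in> Obj T" "s \<in> Hom T W X" "(W, s, X) \<in> S"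
      and f'g': "f' \<in> Hom T W Y" "g' \<in> Hom T W Y"
      and e: "cl X Y [Fwd X f Y] = cl X Y [Bwd W s X, Fwd W f' Y]"
        "cl X Y [Fwd X g Y] = cl X Y [Bwd W s X, Fwd W g' Y]"
      and \<theta>: "\<theta> = cl X Y [Bwd W s X, Fwd W (Add T W Y f' g') Y]" by blast
    have "zz_eq T S X Y [Bwd W s X, Fwd W f' Y] [Fwd X f Y]"
      "zz_eq T S X Y [Bwd W s X, Fwd W g' Y] [Fwd X g Y]"
      using e zz_class_eq_iff[OF zigzag_Fwd_S] XY fg by (auto intro: zze_sym)
    from cl_eqI[OF frac[OF W(3) f'g' fg this]] show "\<theta> = cl X Y [Fwd X (Add T X Y f g) Y]"
      by (simp add: \<theta>)
  qed
qed

text \<open>If the fraction \<open>f' s^-1\<close> equals \<open>f\<close>, then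
  \<open>f' = f s\<close>, as Hom(-, Y) shows when evaluated at \<open>id\<close> of
  \<open>Y\<close>. Hence every common denominator yields the sum \<open>(f s + g s) s^-1\<close>,
  which distributivity reduces to \<open>f + g\<close>.\<close>

lemma Q_Add_local:
  assumes XY: "X \<in> Obj T" "local_object T S Y" and fg: "f \<in> Hom T X Y" "g \<in> Hom T X Y"
    and closed: "\<And>X f g. X \<in> Obj T \<Longrightarrow> f \<in> Hom T X Y \<Longrightarrow> g \<in> Hom T X Y \<Longrightarrow> Add T X Y f g \<in> Hom T X Y"
    and distrib: "\<And>W s f g. W \<in> Obj T \<Longrightarrow> s \<in> Hom T W X \<Longrightarrow> f \<in> Hom T X Y \<Longrightarrow> g \<in> Hom T X Y \<Longrightarrow>
      Comp T W X Y (Add T X Y f g) s = Add T W Y (Comp T W X Y f s) (Comp T W X Y g s)"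
  shows "FM Q X Y (Add T X Y f g) = Add D X Y (FM Q X Y f) (FM Q X Y g)"
proof -
  have Y: "Y \<in> Obj T" using XY by (simp add: local_object_def)
  show ?thesis
  proof (rule Q_Add[OF XY(1) Y fg closed])
    fix W s f' g' f g
    assume s: "(W, s, X) \<in> S" and f'g': "f' \<in> Hom T W Y" "g' \<in> Hom T W Y"
      and fg: "f \<in> Hom T X Y" "g \<in> Hom T X Y"
      and e: "zz_eq T S X Y [Bwd W s X, Fwd W f' Y] [Fwd X f Y]"
        "zz_eq T S X Y [Bwd W s X, Fwd W g' Y] [Fwd X g Y]"
    note W = cone_in_Hom[OF s]
    have eq: "f' = Comp T W X Y f s" if "f' \<in> Hom T W Y" "f \<in> Hom T X Y"
      "zz_eq T S X Y [Bwd W s X, Fwd W f' Y] [Fwd X f Y]" for f' f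
    proof -
      have Id: "Id T Y \<in> Hom T Y Y" using category_Id[OF cat Y] .
      have "pull T Y [Bwd W s X, Fwd W f' Y] (Id T Y) = pull T Y [Fwd X f Y] (Id T Y)"
        using pull_zz_eq[OF cat XY(2) that(3) Id] .
      then show ?thesis
        using local_object_the(2)[OF XY(2), of W X s f'] that W s XY(1) Y
        by (simp add: category_Id_left[OF cat])
    qed
    show "zz_eq T S X Y [Bwd W s X, Fwd W (Add T W Y f' g') Y] [Fwd X (Add T X Y f g) Y]"
      using zz_eq_Bwd_Fwd[OF cat _ XY(1) Y _ s closed[OF XY(1) fg]] W
      by (simp add: eq[OF f'g'(1) fg(1) e(1)] eq[OF f'g'(2) fg(2) e(2)] distrib fg)
  qed (use XY in auto)
qed

text \<open>Colocality lifts \<open>id\<close> of \<open>X\<close> through the denominator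
  \<open>s\<close> to a section \<open>t\<close>, which becomes the inverse of \<open>s\<close> in
  the quotient. So the fraction \<open>h s^-1\<close> is the image of \<open>h t\<close>, and
  \<open>f = f' t\<close> follows by faithfulness.\<close>

lemma Q_Add_colocal:
  assumes XY: "colocal_object T S X" "Y \<in> Obj T" and fg: "f \<in> Hom T X Y" "g \<in> Hom T X Y"
    and closed: "\<And>X f g. X \<in> Obj T \<Longrightarrow> f \<in> Hom T X Y \<Longrightarrow> g \<in> Hom T X Y \<Longrightarrow> Add T X Y f g \<in> Hom T X Y"
    and distrib: "\<And>W s f g. W \<in> Obj T \<Longrightarrow> s \<in> Hom T X W \<Longrightarrow> f \<in> Hom T W Y \<Longrightarrow> g \<in> Hom T W Y \<Longrightarrow>
      Comp T X W Y (Add T W Y f g) s = Add T X Y (Comp T X W Y f s) (Comp T X W Y g s)"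
  shows "FM Q X Y (Add T X Y f g) = Add D X Y (FM Q X Y f) (FM Q X Y g)"
proof -
  have X: "X \<in> Obj T" using XY by (simp add: colocal_object_def)
  show ?thesis
  proof (rule Q_Add[OF X XY(2) fg closed])
    fix W s f' g' f g
    assume s: "(W, s, X) \<in> S" and f'g': "f' \<in> Hom T W Y" "g' \<in> Hom T W Y"
      and fg: "f \<in> Hom T X Y" "g \<in> Hom T X Y"
      and e: "zz_eq T S X Y [Bwd W s X, Fwd W f' Y] [Fwd X f Y]"
        "zz_eq T S X Y [Bwd W s X, Fwd W g' Y] [Fwd X g Y]"
    note W = cone_in_Hom[OF s]
    have Id: "Id T X \<in> Hom T X X" using category_Id[OF cat X] .
    obtain t where t: "t \<in> Hom T X W" "Comp T X W X s t = Id T X"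
      using XY(1) W s Id unfolding colocal_object_def by blast
    have "zz_eq T S X W ([Fwd X (Id T X) X] @ [Bwd W s X]) ([] @ [Bwd W s X])"
      using zz_eq_append[OF cat zze_id[OF X] zze_refl[OF zigzag_Bwd]] W s by blast
    then have "zz_eq T S X W [Bwd W s X] [Fwd X t W]"
      using zz_eq_Fwd_Bwd[OF cat _ X X _ s t(1)] W t(2) by (auto intro: zze_trans zze_sym)
    from zz_eq_append[OF cat this zze_refl[OF zigzag_Fwd_S]]
    have "zz_eq T S X Y [Bwd W s X, Fwd W h Y] [Fwd X t W, Fwd W h Y]" if "h \<in> Hom T W Y" for h
      using that W XY(2) by simp
    then have ht: "zz_eq T S X Y [Bwd W s X, Fwd W h Y] [Fwd X (Comp T X W Y h t) Y]" if "h \<in> Hom T W Y" for h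
      using zze_trans[OF _ zze_comp[OF X _ XY(2) t(1) that]] W that by blast
    have eq: "f = Comp T X W Y f' t" if "f' \<in> Hom T W Y" "f \<in> Hom T X Y"
      "zz_eq T S X Y [Bwd W s X, Fwd W f' Y] [Fwd X f Y]" for f' f
      using colocal_object_faithful[OF cat XY(1) XY(2) that(2) category_Comp[OF cat X _ XY(2) t(1) that(1)]
          zze_trans[OF zze_sym[OF that(3)] ht[OF that(1)]]] W by blast
    show "zz_eq T S X Y [Bwd W s X, Fwd W (Add T W Y f' g') Y] [Fwd X (Add T X Y f g) Y]"
      using ht[OF closed[OF _ f'g']] W t f'g'
      by (simp add: eq[OF f'g'(1) fg(1) e(1)] eq[OF f'g'(2) fg(2) e(2)] distrib)
  qed (use X closed in auto)
qed

section \<open>Full faithfulness of the quotient functor on local and colocal objects\<close>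

lemma bij_betw_Q_local:
  assumes "X \<in> Obj T" "local_object T S Y"
  shows "bij_betw (FM Q X Y) (Hom T X Y) (Hom D X Y)"
proof -
  have Y: "Y \<in> Obj T" using assms by (simp add: local_object_def)
  show ?thesis
    unfolding bij_betw_def inj_on_def
  proof (intro conjI ballI impI)
    show "f = g" if "f \<in> Hom T X Y" "g \<in> Hom T X Y" "FM Q X Y f = FM Q X Y g" for f g
      using local_object_faithful[OF cat assms(2,1) that(1,2)] that zz_class_eq_iff[OF zigzag_Fwd_S] assms(1) Y
      by (simp add: Q_simps)
    show "FM Q X Y ` Hom T X Y = Hom D X Y"
      using local_object_full[OF cat assms(2)] cl_eqI Q_Hom[OF assms(1) Y]
      by (fastforce simp: Q_simps D_simps)
  qed
qed

lemma bij_betw_Q_colocal: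
  assumes "colocal_object T S X" "Y \<in> Obj T"
  shows "bij_betw (FM Q X Y) (Hom T X Y) (Hom D X Y)"
proof -
  have X: "X \<in> Obj T" using assms by (simp add: colocal_object_def)
  show ?thesis
    unfolding bij_betw_def inj_on_def
  proof (intro conjI ballI impI)
    show "f = g" if "f \<in> Hom T X Y" "g \<in> Hom T X Y" "FM Q X Y f = FM Q X Y g" for f g
      using colocal_object_faithful[OF cat assms that(1,2)] that zz_class_eq_iff[OF zigzag_Fwd_S] assms(2) X
      by (simp add: Q_simps)
    show "FM Q X Y ` Hom T X Y = Hom D X Y"
      using colocal_object_full[OF cat assms(1)] cl_eqI Q_Hom[OF X assms(2)]
      by (fastforce simp: Q_simps D_simps)
  qed
qed

end

section \<open>Calculus in a DG-category\<close>

locale dgcat =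
  fixes E :: "('o, 'g::ab_group_add, 'm::ab_group_add) dg"
  assumes dg: "dg_category E"
begin

abbreviation comp :: "'m \<Rightarrow> 'm \<Rightarrow> 'm" (infixr "\<cdot>" 85) where "g \<cdot> f \<equiv> dcomp E g f"
abbreviation "e \<equiv> gone E"
abbreviation "sg \<equiv> dsign E"
abbreviation "d \<equiv> dd E"

text \<open>A typing judgement that carries the membership of both objects, so that the rules of the
  calculus can be chained with \<open>OF\<close> and leave at most an equation of degrees.\<close>

definition arr :: "'o \<Rightarrow> 'o \<Rightarrow> 'g \<Rightarrow> 'm \<Rightarrow> bool" where
  "arr X Y n f \<longleftrightarrow> X \<in> dobj E \<and> Y \<in> dobj E \<and> f \<in> dhom E X Y n"

definition clo :: "'o \<Rightarrow> 'o \<Rightarrow> 'g \<Rightarrow> 'm \<Rightarrow> bool" where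
  "clo X Y n f \<longleftrightarrow> arr X Y n f \<and> d X Y n f = 0"

definition bdry :: "'o \<Rightarrow> 'o \<Rightarrow> 'g \<Rightarrow> 'm \<Rightarrow> bool" where
  "bdry X Y n f \<longleftrightarrow> (\<exists>h. arr X Y (n - e) h \<and> f = d X Y (n - e) h)"

lemma dgD:
  shows "grading_data (gsig E) (gone E)"
    and "\<forall>X\<in>dobj E. \<forall>Y\<in>dobj E. \<forall>n. subgroup_set (dhom E X Y n)"
    and "\<forall>X\<in>dobj E. did E X \<in> dhom E X X 0"
    and "\<forall>X\<in>dobj E. \<forall>Y\<in>dobj E. \<forall>n. \<forall>f\<in>dhom E X Y n.
        dcomp E f (did E X) = f \<and> dcomp E (did E Y) f = f"
    and "\<forall>X\<in>dobj E. \<forall>Y\<in>dobj E. \<forall>Z\<in>dobj E. \<forall>m n. \<forall>f\<in>dhom E X Y n. \<forall>g\<in>dhom E Y Z m.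
        dcomp E g f \<in> dhom E X Z (m + n) \<and>
        (\<forall>f'\<in>dhom E X Y n. dcomp E g (f + f') = dcomp E g f + dcomp E g f') \<and>
        (\<forall>g'\<in>dhom E Y Z m. dcomp E (g + g') f = dcomp E g f + dcomp E g' f)"
    and "\<forall>W\<in>dobj E. \<forall>X\<in>dobj E. \<forall>Y\<in>dobj E. \<forall>Z\<in>dobj E. \<forall>l m n.
        \<forall>f\<in>dhom E W X n. \<forall>g\<in>dhom E X Y m. \<forall>h\<in>dhom E Y Z l.
        dcomp E h (dcomp E g f) = dcomp E (dcomp E h g) f"
    and "\<forall>X\<in>dobj E. \<forall>Y\<in>dobj E. \<forall>n. \<forall>f\<in>dhom E X Y n.
        dd E X Y n f \<in> dhom E X Y (n + gone E) \<and>
        (\<forall>f'\<in>dhom E X Y n. dd E X Y n (f + f') = dd E X Y n f + dd E X Y n f') \<and>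
        dd E X Y (n + gone E) (dd E X Y n f) = 0"
    and "\<forall>X\<in>dobj E. \<forall>Y\<in>dobj E. \<forall>Z\<in>dobj E. \<forall>m n. \<forall>f\<in>dhom E X Y n. \<forall>g\<in>dhom E Y Z m.
        dd E X Z (m + n) (dcomp E g f) =
        dcomp E (dd E Y Z m g) f + dsign E m (dcomp E g (dd E X Y n f))"
  using dg unfolding dg_category_def by - (elim conjE, assumption)+

lemma arr_objD: "arr X Y n f \<Longrightarrow> X \<in> dobj E" "arr X Y n f \<Longrightarrow> Y \<in> dobj E"
  by (simp_all add: arr_def)

lemma arr_0: "X \<in> dobj E \<Longrightarrow> Y \<in> dobj E \<Longrightarrow> arr X Y n 0"
  using dgD(2) by (simp add: arr_def subgroup_set_def)

lemma arr_diff: "arr X Y n f \<Longrightarrow> arr X Y n g \<Longrightarrow> arr X Y n (f - g)"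
  using dgD(2) by (simp add: arr_def subgroup_set_def)

lemma arr_uminus: "arr X Y n f \<Longrightarrow> arr X Y n (- f)"
  using arr_diff[OF arr_0, of X Y n f] by (simp add: arr_def)

lemma arr_add: "arr X Y n f \<Longrightarrow> arr X Y n g \<Longrightarrow> arr X Y n (f + g)"
  using arr_diff[OF _ arr_uminus, of X Y n f g] by simp

lemma arr_sg: "arr X Y n f \<Longrightarrow> arr X Y n (sg k f)"
  by (simp add: dsign_def arr_uminus)

lemma arr_id: "X \<in> dobj E \<Longrightarrow> arr X X 0 (did E X)"
  using dgD(3) by (simp add: arr_def)

lemma arr_comp: "arr X Y n f \<Longrightarrow> arr Y Z m g \<Longrightarrow> k = m + n \<Longrightarrow> arr X Z k (g \<cdot> f)"
  using dgD(5) unfolding arr_def by blast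

lemma arr_d: "arr X Y n f \<Longrightarrow> k = n + e \<Longrightarrow> arr X Y k (d X Y n f)"
  using dgD(7) by (simp add: arr_def)

lemma id_right: "arr X Y n f \<Longrightarrow> f \<cdot> did E X = f"
  and id_left: "arr X Y n f \<Longrightarrow> did E Y \<cdot> f = f"
  using dgD(4) unfolding arr_def by blast+

lemma assoc: "arr W X n f \<Longrightarrow> arr X Y m g \<Longrightarrow> arr Y Z l h \<Longrightarrow> (h \<cdot> g) \<cdot> f = h \<cdot> g \<cdot> f"
  using dgD(6) unfolding arr_def by metis

lemma comp_add_right: "arr Y Z m g \<Longrightarrow> arr X Y n f \<Longrightarrow> arr X Y n f' \<Longrightarrow> g \<cdot> (f + f') = g \<cdot> f + g \<cdot> f'"
  and comp_add_left: "arr Y Z m g \<Longrightarrow> arr Y Z m g' \<Longrightarrow> arr X Y n f \<Longrightarrow> (g + g') \<cdot> f = g \<cdot> f + g' \<cdot> f"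
  using dgD(5) unfolding arr_def by blast+

lemma comp_0_right: "arr Y Z m g \<Longrightarrow> X \<in> dobj E \<Longrightarrow> g \<cdot> 0 = 0"
  using comp_add_right[of Y Z m g X 0 0 0] arr_0[of X Y 0] by (simp add: arr_def)

lemma comp_0_left: "arr X Y n f \<Longrightarrow> Z \<in> dobj E \<Longrightarrow> 0 \<cdot> f = 0"
  using comp_add_left[of Y Z 0 0 0 X n f] arr_0[of Y Z 0] by (simp add: arr_def)

lemma comp_minus_right: "arr Y Z m g \<Longrightarrow> arr X Y n f \<Longrightarrow> g \<cdot> (- f) = - (g \<cdot> f)"
  using comp_add_right[of Y Z m g X n f "- f"] comp_0_right[of Y Z m g X] arr_uminus[of X Y n f]
  by (simp add: arr_def add_eq_0_iff)

lemma comp_minus_left: "arr Y Z m g \<Longrightarrow> arr X Y n f \<Longrightarrow> (- g) \<cdot> f = - (g \<cdot> f)"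
  using comp_add_left[of Y Z m g "- g" X n f] comp_0_left[of X Y n f Z] arr_uminus[of Y Z m g]
  by (simp add: arr_def add_eq_0_iff)

lemma comp_diff_right: "arr Y Z m g \<Longrightarrow> arr X Y n f \<Longrightarrow> arr X Y n f' \<Longrightarrow> g \<cdot> (f - f') = g \<cdot> f - g \<cdot> f'"
  using comp_add_right[of Y Z m g X n f "- f'"] comp_minus_right[of Y Z m g X n f'] arr_uminus[of X Y n f']
  by simp

lemma comp_diff_left: "arr Y Z m g \<Longrightarrow> arr Y Z m g' \<Longrightarrow> arr X Y n f \<Longrightarrow> (g - g') \<cdot> f = g \<cdot> f - g' \<cdot> f"
  using comp_add_left[of Y Z m g "- g'" X n f] comp_minus_left[of Y Z m g' X n f] arr_uminus[of Y Z m g']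
  by simp

lemma comp_sg_left: "arr Y Z m g \<Longrightarrow> arr X Y n f \<Longrightarrow> sg k g \<cdot> f = sg k (g \<cdot> f)"
  by (simp add: dsign_def comp_minus_left)

lemma d_add: "arr X Y n f \<Longrightarrow> arr X Y n g \<Longrightarrow> d X Y n (f + g) = d X Y n f + d X Y n g"
  using dgD(7) by (simp add: arr_def)

lemma d_0: "X \<in> dobj E \<Longrightarrow> Y \<in> dobj E \<Longrightarrow> d X Y n 0 = 0"
  using d_add[of X Y n 0 0] arr_0[of X Y n] by simp

lemma d_minus: "arr X Y n f \<Longrightarrow> d X Y n (- f) = - d X Y n f"
  using d_add[of X Y n f "- f"] d_0[of X Y n] arr_uminus[of X Y n f] by (simp add: arr_def add_eq_0_iff)

lemma d_diff: "arr X Y n f \<Longrightarrow> arr X Y n g \<Longrightarrow> d X Y n (f - g) = d X Y n f - d X Y n g"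
  using d_add[of X Y n f "- g"] d_minus[of X Y n g] arr_uminus[of X Y n g] by simp

lemma d_sg: "arr X Y n f \<Longrightarrow> d X Y n (sg k f) = sg k (d X Y n f)"
  by (simp add: dsign_def d_minus)

lemma d_d: "arr X Y n f \<Longrightarrow> k = n + e \<Longrightarrow> d X Y k (d X Y n f) = 0"
  using dgD(7) by (simp add: arr_def)

lemma leib: "arr X Y n f \<Longrightarrow> arr Y Z m g \<Longrightarrow> k = m + n \<Longrightarrow>
    d X Z k (g \<cdot> f) = d Y Z m g \<cdot> f + sg m (g \<cdot> d X Y n f)"
  using dgD(8) by (simp add: arr_def)

lemma gsig_add: "gsig E e (m + n) = gsig E e m + gsig E e n"
  using dgD(1) unfolding grading_data_def by metis

lemma gsig_0: "gsig E e 0 = 0"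
  using gsig_add[of 0 0] by simp

lemma gsig_e: "gsig E e e = 1"
  using dgD(1) by (simp add: grading_data_def)

lemma gsig_minus: "gsig E e (- n) = gsig E e n"
  using gsig_add[of n "- n"] gsig_0 by (cases "gsig E e n"; cases "gsig E e (- n)") simp_all

lemma sg_0 [simp]: "sg 0 x = x"
  by (simp add: dsign_def gsig_0)

lemma sg_e [simp]: "sg e x = - x" "sg (- e) x = - x"
  by (simp_all add: dsign_def gsig_e gsig_minus)

lemma sg_minus [simp]: "sg (- n) x = sg n x"
  by (simp add: dsign_def gsig_minus)

lemma sg_add: "sg (m + n) x = sg m (sg n x)"
  by (cases "gsig E e m"; cases "gsig E e n") (simp_all add: dsign_def gsig_add)

lemma sg_diff: "sg (m - n) x = sg m (sg n x)"
  using sg_add[of m "- n"] by simp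

lemma sg_sg [simp]: "sg n (sg n x) = x"
  by (simp add: dsign_def)

lemma sg_zero [simp]: "sg n 0 = 0"
  by (simp add: dsign_def)

lemma sg_uminus: "sg n (- x) = - sg n x"
  by (simp add: dsign_def)

lemma d_id: assumes "X \<in> dobj E" shows "d X X 0 (did E X) = 0"
proof -
  have "d X X 0 (did E X) = d X X 0 (did E X) + d X X 0 (did E X)"
    using leib[OF arr_id arr_id, OF assms assms] arr_d[OF arr_id[OF assms], of e] arr_id[OF assms]
    by (simp add: id_left id_right)
  then show ?thesis by simp
qed

lemma clo_arr: "clo X Y n f \<Longrightarrow> arr X Y n f"
  by (simp add: clo_def)

lemma clo_objD: "clo X Y n f \<Longrightarrow> X \<in> dobj E" "clo X Y n f \<Longrightarrow> Y \<in> dobj E"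
  by (simp_all add: clo_def arr_def)

lemma clo_id: "X \<in> dobj E \<Longrightarrow> clo X X 0 (did E X)"
  by (simp add: clo_def arr_id d_id)

lemma clo_0: "X \<in> dobj E \<Longrightarrow> Y \<in> dobj E \<Longrightarrow> clo X Y n 0"
  by (simp add: clo_def arr_0 d_0)

lemma clo_add: "clo X Y n f \<Longrightarrow> clo X Y n g \<Longrightarrow> clo X Y n (f + g)"
  by (simp add: clo_def arr_add d_add)

lemma clo_diff: "clo X Y n f \<Longrightarrow> clo X Y n g \<Longrightarrow> clo X Y n (f - g)"
  by (simp add: clo_def arr_diff d_diff)

lemma clo_uminus: "clo X Y n f \<Longrightarrow> clo X Y n (- f)"
  by (simp add: clo_def arr_uminus d_minus)

lemma clo_sg: "clo X Y n f \<Longrightarrow> clo X Y n (sg k f)"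
  by (simp add: dsign_def clo_uminus)

lemma clo_comp: "clo X Y n f \<Longrightarrow> clo Y Z m g \<Longrightarrow> k = m + n \<Longrightarrow> clo X Z k (g \<cdot> f)"
  unfolding clo_def using arr_comp[of X Y n f Z m g k] leib[of X Y n f Z m g k] comp_0_left[of X Y n f Z]
    comp_0_right[of Y Z m g X] by (auto simp: arr_objD)

lemma clo_d_arr: "arr X Y n f \<Longrightarrow> k = n + e \<Longrightarrow> clo X Y k (d X Y n f)"
  by (simp add: clo_def arr_d d_d)

lemma d_comp_clo_left: "clo Y Z m g \<Longrightarrow> arr X Y n f \<Longrightarrow> k = m + n \<Longrightarrow> d X Z k (g \<cdot> f) = sg m (g \<cdot> d X Y n f)"
  unfolding clo_def using leib[of X Y n f Z m g k] comp_0_left[of X Y n f Z] by (auto simp: arr_objD)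

lemma d_comp_clo_right: "clo X Y n f \<Longrightarrow> arr Y Z m g \<Longrightarrow> k = m + n \<Longrightarrow> d X Z k (g \<cdot> f) = d Y Z m g \<cdot> f"
  unfolding clo_def using leib[of X Y n f Z m g k] comp_0_right[of Y Z m g X] by (auto simp: arr_objD)

lemma bdry_clo: "bdry X Y n f \<Longrightarrow> clo X Y n f"
  unfolding bdry_def by (auto intro: clo_d_arr)

lemma bdryI: "arr X Y m h \<Longrightarrow> m = n - e \<Longrightarrow> bdry X Y n (d X Y m h)"
  unfolding bdry_def by auto

lemma bdry_0: "X \<in> dobj E \<Longrightarrow> Y \<in> dobj E \<Longrightarrow> bdry X Y n 0"
  using bdryI[OF arr_0] d_0 by metis

lemma bdry_diff: "bdry X Y n f \<Longrightarrow> bdry X Y n g \<Longrightarrow> bdry X Y n (f - g)"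
  unfolding bdry_def using arr_diff d_diff by metis

lemma bdry_uminus: "bdry X Y n f \<Longrightarrow> bdry X Y n (- f)"
  unfolding bdry_def using arr_uminus d_minus by metis

lemma bdry_add: "bdry X Y n f \<Longrightarrow> bdry X Y n g \<Longrightarrow> bdry X Y n (f + g)"
  unfolding bdry_def using arr_add d_add by metis

lemma bdry_sg: "bdry X Y n f \<Longrightarrow> bdry X Y n (sg k f)"
  by (simp add: dsign_def bdry_uminus)

lemma bdry_comp_left: assumes "bdry X Y n f" "clo Y Z m g" "k = m + n" shows "bdry X Z k (g \<cdot> f)"
proof -
  from assms(1) obtain h where h: "arr X Y (n - e) h" "f = d X Y (n - e) h" unfolding bdry_def by blast
  \<comment> \<open>\<open>g h\<close> is a primitive of \<open>g f\<close> up to the Koszul sign of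
    \<open>g\<close>; applying the same sign once more at the end undoes it.\<close>
  have "d X Z (k - e) (g \<cdot> h) = sg m (g \<cdot> f)"
    using d_comp_clo_left[OF assms(2) h(1)] h(2) assms(3) by (simp add: algebra_simps)
  moreover have "arr X Z (k - e) (g \<cdot> h)"
    using arr_comp[OF h(1) clo_arr[OF assms(2)]] assms(3) by (simp add: algebra_simps)
  ultimately have "bdry X Z k (sg m (g \<cdot> f))" unfolding bdry_def by metis
  then show ?thesis using bdry_sg[of X Z k "sg m (g \<cdot> f)" m] by simp
qed

lemma bdry_comp_right: assumes "bdry Y Z m g" "clo X Y n f" "k = m + n" shows "bdry X Z k (g \<cdot> f)"
proof -
  from assms(1) obtain h where h: "arr Y Z (m - e) h" "g = d Y Z (m - e) h" unfolding bdry_def by blast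
  have "d X Z (k - e) (h \<cdot> f) = g \<cdot> f"
    using d_comp_clo_right[OF assms(2) h(1)] h(2) assms(3) by (simp add: algebra_simps)
  moreover have "arr X Z (k - e) (h \<cdot> f)"
    using arr_comp[OF clo_arr[OF assms(2)] h(1)] assms(3) by (simp add: algebra_simps)
  ultimately show ?thesis unfolding bdry_def by metis
qed

lemma dclosed_iff: "X \<in> dobj E \<Longrightarrow> Y \<in> dobj E \<Longrightarrow> f \<in> dclosed E X Y n \<longleftrightarrow> clo X Y n f"
  by (simp add: dclosed_def clo_def arr_def)

section \<open>The homotopy category\<close>

abbreviation "hc \<equiv> hclass E"

lemma hclass_iff: "X \<in> dobj E \<Longrightarrow> Y \<in> dobj E \<Longrightarrow> f' \<in> hc X Y f \<longleftrightarrow> bdry X Y 0 (f' - f)"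
  by (auto simp: hclass_def bdry_def arr_def) (metis add.commute diff_add_cancel)

lemma hclass_self: "X \<in> dobj E \<Longrightarrow> Y \<in> dobj E \<Longrightarrow> f \<in> hc X Y f"
  by (simp add: hclass_iff bdry_0)

lemma hclass_eq_iff:
  assumes "X \<in> dobj E" "Y \<in> dobj E"
  shows "hc X Y f = hc X Y f' \<longleftrightarrow> bdry X Y 0 (f - f')"
proof
  assume "hc X Y f = hc X Y f'"
  then show "bdry X Y 0 (f - f')" using hclass_self[OF assms, of f] by (simp add: hclass_iff assms)
next
  assume b: "bdry X Y 0 (f - f')"
  have "bdry X Y 0 (g - f) \<longleftrightarrow> bdry X Y 0 (g - f')" for g
    using bdry_add[OF _ b, of "g - f"] bdry_diff[OF _ b, of "g - f'"] by (auto simp: algebra_simps)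
  then show "hc X Y f = hc X Y f'" by (auto simp: hclass_iff assms)
qed

lemma H0_simps:
  "Obj (H0 E) = dobj E"
  "Hom (H0 E) X Y = hc X Y ` dclosed E X Y 0"
  "Comp (H0 E) X Y Z G F = (\<Union>g\<in>G. \<Union>f\<in>F. hc X Z (dcomp E g f))"
  "Id (H0 E) X = hc X X (did E X)"
  "Add (H0 E) X Y F G = {f + g |f g. f \<in> F \<and> g \<in> G}"
  "Sh (H0 E) = shift_obj E e"
  "ShM (H0 E) X Y F = (\<Union>f\<in>F. hc (shift_obj E e X) (shift_obj E e Y) (shift_mor E e X Y f))"
  by (simp_all add: H0_def with_triangles_def)

lemma H0_HomI: "clo X Y 0 f \<Longrightarrow> hc X Y f \<in> Hom (H0 E) X Y"
  by (simp add: H0_simps dclosed_iff clo_objD)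

lemma H0_HomE:
  assumes "F \<in> Hom (H0 E) X Y" "X \<in> dobj E" "Y \<in> dobj E"
  obtains f where "clo X Y 0 f" "F = hc X Y f"
  using assms by (auto simp: H0_simps dclosed_iff)

lemma H0_Comp:
  assumes f: "clo X Y 0 f" and g: "clo Y Z 0 g"
  shows "Comp (H0 E) X Y Z (hc Y Z g) (hc X Y f) = hc X Z (g \<cdot> f)"
proof -
  note o = clo_objD[OF f] clo_objD[OF g]
  have "hc X Z (g' \<cdot> f') = hc X Z (g \<cdot> f)" if "g' \<in> hc Y Z g" "f' \<in> hc X Y f" for g' f'
  proof -
    have b: "bdry Y Z 0 (g' - g)" "bdry X Y 0 (f' - f)" using that o by (simp_all add: hclass_iff)
    have f': "clo X Y 0 f'" using clo_add[OF bdry_clo[OF b(2)] f] by simp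
    have g': "clo Y Z 0 g'" using clo_add[OF bdry_clo[OF b(1)] g] by simp
    \<comment> \<open>The difference \<open>g' f' - g f\<close> as a sum of two composites, each of
      a boundary with a closed morphism.\<close>
    have "bdry X Z 0 ((g' - g) \<cdot> f' + g \<cdot> (f' - f))"
      by (rule bdry_add[OF bdry_comp_right[OF b(1) f'] bdry_comp_left[OF b(2) g]]) simp_all
    then show ?thesis
      using comp_diff_left[OF clo_arr clo_arr clo_arr, OF g' g f'] comp_diff_right[OF clo_arr clo_arr clo_arr, OF g f' f]
      by (simp add: hclass_eq_iff o)
  qed
  then have "Comp (H0 E) X Y Z (hc Y Z g) (hc X Y f) = (\<Union>g'\<in>hc Y Z g. \<Union>f'\<in>hc X Y f. hc X Z (g \<cdot> f))"
    unfolding H0_simps by (intro SUP_cong refl)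
  \<comment> \<open>Both classes are nonempty, so the union of copies of one set is that
    set.\<close>
  then show ?thesis using hclass_self[OF o(1,2), of f] hclass_self[OF o(3,4), of g] by auto
qed

lemma category_H0: "category (H0 E)"
  unfolding category_def H0_simps(1,4)
proof (intro conjI ballI)
  fix X assume "X \<in> dobj E"
  then show "hc X X (did E X) \<in> Hom (H0 E) X X" by (intro H0_HomI clo_id)
next
  fix X Y Z F G
  assume o: "X \<in> dobj E" "Y \<in> dobj E" "Z \<in> dobj E" and "F \<in> Hom (H0 E) X Y" "G \<in> Hom (H0 E) Y Z"
  then obtain f g where f: "clo X Y 0 f" "F = hc X Y f" and g: "clo Y Z 0 g" "G = hc Y Z g"
    by (metis H0_HomE)
  show "Comp (H0 E) X Y Z G F \<in> Hom (H0 E) X Z"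
    unfolding f(2) g(2) H0_Comp[OF f(1) g(1)] by (rule H0_HomI, rule clo_comp[OF f(1) g(1)]) simp
next
  fix X Y F
  assume o: "X \<in> dobj E" "Y \<in> dobj E" and "F \<in> Hom (H0 E) X Y"
  then obtain f where f: "clo X Y 0 f" "F = hc X Y f" by (metis H0_HomE)
  show "Comp (H0 E) X X Y F (hc X X (did E X)) = F" "Comp (H0 E) X Y Y (hc Y Y (did E Y)) F = F"
    using f o by (simp_all add: H0_Comp clo_id id_left[OF clo_arr] id_right[OF clo_arr])
next
  fix W X Y Z F G H
  assume o: "W \<in> dobj E" "X \<in> dobj E" "Y \<in> dobj E" "Z \<in> dobj E"
    and "F \<in> Hom (H0 E) W X" "G \<in> Hom (H0 E) X Y" "H \<in> Hom (H0 E) Y Z"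
  then obtain f g h where f: "clo W X 0 f" "F = hc W X f" and g: "clo X Y 0 g" "G = hc X Y g"
    and h: "clo Y Z 0 h" "H = hc Y Z h" by (metis H0_HomE)
  have "clo W Y 0 (g \<cdot> f)" "clo X Z 0 (h \<cdot> g)" by (rule clo_comp[OF f(1) g(1)] clo_comp[OF g(1) h(1)]; simp)+
  then show "Comp (H0 E) W Y Z H (Comp (H0 E) W X Y G F) = Comp (H0 E) W X Z (Comp (H0 E) X Y Z H G) F"
    using f g h by (simp add: H0_Comp assoc[OF clo_arr clo_arr clo_arr])
qed

lemma H0_Add:
  assumes "X \<in> dobj E" "Y \<in> dobj E"
  shows "Add (H0 E) X Y (hc X Y f) (hc X Y g) = hc X Y (f + g)"
proof -
  have "u + v \<in> hc X Y (f + g)" if "u \<in> hc X Y f" "v \<in> hc X Y g" for u v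
    using bdry_add[of X Y 0 "u - f" "v - g"] that assms by (simp add: hclass_iff algebra_simps)
  moreover have "w - g \<in> hc X Y f" if "w \<in> hc X Y (f + g)" for w
    using that assms by (simp add: hclass_iff algebra_simps)
  ultimately show ?thesis
    unfolding H0_simps using hclass_self[OF assms, of g] by (auto, metis diff_add_cancel)
qed

lemma H0_Tri_is_triangle: "t \<in> Tri (H0 E) \<Longrightarrow> is_triangle (H0 E) t"
  by (cases t) (auto simp: H0_def with_triangles_def)

end

locale dgcat_shifts = dgcat E for E :: "('o, 'g::ab_group_add, 'm::ab_group_add) dg" +
  assumes shifts: "has_shifts E"
begin

abbreviation "sh \<equiv> shift_obj E"
abbreviation "ts \<equiv> to_shift E"
abbreviation "fs \<equiv> from_shift E"

text \<open>\<open>shift_obj\<close>, \<open>to_shift\<close> and \<open>from_shift\<close> are the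
  components of one and the same choice, hence compatible.\<close>

lemma is_shift_chosen:
  assumes "X \<in> dobj E" "i \<in> {e, - e}"
  shows "is_shift E i X (sh i X, ts i X, fs i X)"
proof -
  obtain t where "is_shift E i X t" using shifts assms unfolding has_shifts_def by blast
  from someI[of "is_shift E i X", OF this] show ?thesis
    by (simp add: shift_obj_def to_shift_def from_shift_def)
qed

lemma is_shift_iff: "X \<in> dobj E \<Longrightarrow> is_shift E i X (Y, u, v) \<longleftrightarrow>
    clo X Y (- i) u \<and> clo Y X i v \<and> v \<cdot> u = did E X \<and> u \<cdot> v = did E Y"
  unfolding is_shift_def by (auto simp: dclosed_iff clo_objD)

lemma shift:
  assumes "X \<in> dobj E" "i \<in> {e, - e}"
  shows shift_obj_in: "sh i X \<in> dobj E"
    and clo_ts: "clo X (sh i X) (- i) (ts i X)"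
    and clo_fs: "clo (sh i X) X i (fs i X)"
    and fs_ts: "fs i X \<cdot> ts i X = did E X"
    and ts_fs: "ts i X \<cdot> fs i X = did E (sh i X)"
  using is_shift_chosen[OF assms] assms(1) by (auto simp: is_shift_iff clo_objD)

lemma arr_ts: "X \<in> dobj E \<Longrightarrow> i \<in> {e, - e} \<Longrightarrow> arr X (sh i X) (- i) (ts i X)"
  and arr_fs: "X \<in> dobj E \<Longrightarrow> i \<in> {e, - e} \<Longrightarrow> arr (sh i X) X i (fs i X)"
  by (rule clo_arr[OF clo_ts] clo_arr[OF clo_fs]; assumption)+

lemma shift_mor_simp: "shift_mor E i X Y f = ts i Y \<cdot> f \<cdot> fs i X"
  by (simp add: shift_mor_def)

lemma clo_shift_mor:
  assumes "clo X Y 0 f" "i \<in> {e, - e}"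
  shows "clo (sh i X) (sh i Y) 0 (shift_mor E i X Y f)"
  unfolding shift_mor_simp
  by (rule clo_comp[OF clo_comp[OF clo_fs assms(1)] clo_ts]) (use assms clo_objD[OF assms(1)] in auto)

lemma arr_shift_mor:
  assumes "arr X Y 0 f" "i \<in> {e, - e}"
  shows "arr (sh i X) (sh i Y) 0 (shift_mor E i X Y f)"
  unfolding shift_mor_simp
  by (rule arr_comp[OF arr_comp[OF arr_fs assms(1)] arr_ts]) (use assms arr_objD[OF assms(1)] in auto)

lemma shift_mor_ts:
  assumes "arr X Y 0 f" "i \<in> {e, - e}"
  shows "shift_mor E i X Y f \<cdot> ts i X = ts i Y \<cdot> f"
proof -
  note o = arr_objD[OF assms(1)]
  note a = arr_ts[OF o(1) assms(2)] arr_fs[OF o(1) assms(2)] assms(1) arr_ts[OF o(2) assms(2)]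
  have "(ts i Y \<cdot> f \<cdot> fs i X) \<cdot> ts i X = ts i Y \<cdot> (f \<cdot> fs i X) \<cdot> ts i X"
    by (rule assoc[OF a(1) arr_comp[OF a(2) a(3)] a(4)]) simp
  also have "(f \<cdot> fs i X) \<cdot> ts i X = f"
    using assoc[OF a(1-3)] fs_ts[OF o(1) assms(2)] id_right[OF a(3)] by simp
  finally show ?thesis by (simp add: shift_mor_simp)
qed

lemma fs_shift_mor:
  assumes "arr X Y 0 f" "i \<in> {e, - e}"
  shows "fs i Y \<cdot> shift_mor E i X Y f = f \<cdot> fs i X"
proof -
  note o = arr_objD[OF assms(1)]
  note a = arr_fs[OF o(1) assms(2)] assms(1) arr_ts[OF o(2) assms(2)] arr_fs[OF o(2) assms(2)]
  have af: "arr (sh i X) Y i (f \<cdot> fs i X)" by (rule arr_comp[OF a(1,2)]) simp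
  show ?thesis
    using assoc[OF af a(3,4)] fs_ts[OF o(2) assms(2)] id_left[OF af] by (simp add: shift_mor_simp)
qed

lemma H0_ShM:
  assumes f: "clo X Y 0 f"
  shows "ShM (H0 E) X Y (hc X Y f) = hc (sh e X) (sh e Y) (shift_mor E e X Y f)"
proof -
  note o = clo_objD[OF f]
  have i: "e \<in> {e, - e}" by simp
  note so = shift_obj_in[OF o(1) i] shift_obj_in[OF o(2) i]
  have "hc (sh e X) (sh e Y) (shift_mor E e X Y f') = hc (sh e X) (sh e Y) (shift_mor E e X Y f)"
    if "f' \<in> hc X Y f" for f'
  proof -
    have b: "bdry X Y 0 (f' - f)" using that o by (simp add: hclass_iff)
    have f': "clo X Y 0 f'" using clo_add[OF bdry_clo[OF b] f] by simp
    have "bdry (sh e X) (sh e Y) 0 (ts e Y \<cdot> (f' - f) \<cdot> fs e X)"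
      by (rule bdry_comp_left[OF bdry_comp_right[OF b clo_fs[OF o(1) i]] clo_ts[OF o(2) i]]) simp_all
    moreover have "ts e Y \<cdot> (f' - f) \<cdot> fs e X = shift_mor E e X Y f' - shift_mor E e X Y f"
      using comp_diff_left[OF clo_arr[OF f'] clo_arr[OF f] arr_fs[OF o(1) i]]
        comp_diff_right[OF arr_ts[OF o(2) i] arr_comp[OF arr_fs[OF o(1) i] clo_arr[OF f'] refl]
          arr_comp[OF arr_fs[OF o(1) i] clo_arr[OF f] refl]] by (simp add: shift_mor_simp)
    ultimately show ?thesis by (simp add: hclass_eq_iff so)
  qed
  then have "ShM (H0 E) X Y (hc X Y f) = (\<Union>f'\<in>hc X Y f. hc (sh e X) (sh e Y) (shift_mor E e X Y f))"
    unfolding H0_simps by (intro SUP_cong refl)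
  then show ?thesis using hclass_self[OF o, of f] by auto
qed

lemma shift_mor_id: "X \<in> dobj E \<Longrightarrow> i \<in> {e, - e} \<Longrightarrow> shift_mor E i X X (did E X) = did E (sh i X)"
  using id_left[OF arr_fs, of X i] ts_fs[of X i] by (simp add: shift_mor_simp)

lemma shift_mor_comp:
  assumes f: "arr X Y 0 f" and g: "arr Y Z 0 g" and i: "i \<in> {e, - e}"
  shows "shift_mor E i X Z (g \<cdot> f) = shift_mor E i Y Z g \<cdot> shift_mor E i X Y f"
proof -
  note o = arr_objD[OF f] arr_objD[OF g]
  note a = arr_fs[OF o(1) i] f g arr_ts[OF o(4) i] arr_fs[OF o(2) i] arr_shift_mor[OF f i]
  have "shift_mor E i Y Z g \<cdot> shift_mor E i X Y f = ts i Z \<cdot> (g \<cdot> fs i Y) \<cdot> shift_mor E i X Y f"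
    unfolding shift_mor_simp[of i Y Z]
    by (rule assoc[OF a(6) arr_comp[OF a(5,3) refl] a(4)])
  also have "(g \<cdot> fs i Y) \<cdot> shift_mor E i X Y f = g \<cdot> f \<cdot> fs i X"
    using assoc[OF a(6,5,3)] fs_shift_mor[OF f i] by simp
  also have "\<dots> = (g \<cdot> f) \<cdot> fs i X" using assoc[OF a(1-3)] by simp
  finally show ?thesis by (simp add: shift_mor_simp)
qed

end

section \<open>Cones\<close>

context dgcat
begin

text \<open>\<open>is_cone\<close> describes morphisms into the cone. Here the cone appears as the
  graded direct sum of \<open>Y\<close> and \<open>X[1]\<close>, with the differentials of its
  projections and injections; these equations are purely algebraic and control morphisms out of
  \<open>C\<close> just as well.\<close>

definition cone_data :: "'o \<Rightarrow> 'o \<Rightarrow> 'm \<Rightarrow> 'o \<Rightarrow> 'm \<Rightarrow> 'm \<Rightarrow> 'm \<Rightarrow> 'm \<Rightarrow> bool" where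
  "cone_data X Y f C p q i j \<longleftrightarrow> clo X Y 0 f \<and> arr C Y 0 p \<and> clo C X e q \<and> clo Y C 0 i \<and> arr X C (- e) j \<and>
     p \<cdot> i = did E Y \<and> q \<cdot> j = did E X \<and> p \<cdot> j = 0 \<and> q \<cdot> i = 0 \<and> i \<cdot> p + j \<cdot> q = did E C \<and>
     d C Y 0 p = - (f \<cdot> q) \<and> d X C (- e) j = i \<cdot> f"

lemma cone_dataD:
  assumes "cone_data X Y f C p q i j"
  shows "clo X Y 0 f" "arr C Y 0 p" "clo C X e q" "clo Y C 0 i" "arr X C (- e) j"
    "p \<cdot> i = did E Y" "q \<cdot> j = did E X" "p \<cdot> j = 0" "q \<cdot> i = 0" "i \<cdot> p + j \<cdot> q = did E C"
    "d C Y 0 p = - (f \<cdot> q)" "d X C (- e) j = i \<cdot> f"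
    "arr X Y 0 f" "arr C X e q" "arr Y C 0 i" "X \<in> dobj E" "Y \<in> dobj E" "C \<in> dobj E"
  using assms by (simp_all add: cone_data_def clo_def arr_def)

lemma is_coneD:
  assumes "is_cone E X Y f (C, p, q)" "X \<in> dobj E" "Y \<in> dobj E"
  shows "C \<in> dobj E" "arr C Y 0 p" "clo C X e q" "d C Y 0 p = - (f \<cdot> q)"
    "\<And>Z n y x. arr Z Y n y \<Longrightarrow> arr Z X (n + e) x \<Longrightarrow> \<exists>!c. arr Z C n c \<and> p \<cdot> c = y \<and> q \<cdot> c = x"
  using assms by (simp_all add: is_cone_def clo_def arr_def)

lemma is_cone_ext:
  assumes "is_cone E X Y f (C, p, q)" "X \<in> dobj E" "Y \<in> dobj E"
    and "arr Z C n c" "arr Z C n c'" "p \<cdot> c = p \<cdot> c'" "q \<cdot> c = q \<cdot> c'"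
  shows "c = c'"
proof -
  note D = is_coneD[OF assms(1-3)]
  have "arr Z Y n (p \<cdot> c)" "arr Z X (n + e) (q \<cdot> c)"
    using arr_comp[OF assms(4) D(2)] arr_comp[OF assms(4) clo_arr[OF D(3)]] by (simp_all add: add.commute)
  from D(5)[OF this] show ?thesis using assms(4-7) by metis
qed

text \<open>Each equation between morphisms into \<open>C\<close> is tested after \<open>p\<close>
  and after \<open>q\<close>, by \<open>is_cone_ext\<close>. The differentials of \<open>i\<close>
  and \<open>j\<close> come from applying \<open>d\<close> to the composites \<open>p i\<close>,
  \<open>q i\<close>, \<open>p j\<close> and \<open>q j\<close>.\<close>

lemma is_cone_cone_data:
  assumes C: "is_cone E X Y f (C, p, q)" and f: "clo X Y 0 f"
  shows "cone_data X Y f C p q (cone_in_cod E Y (C, p, q)) (cone_in_dom E X (C, p, q))"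
proof -
  note o = clo_objD[OF f]
  note D = is_coneD[OF C o] and ext = is_cone_ext[OF C o]
  note q = clo_arr[OF D(3)]
  define i where "i = cone_in_cod E Y (C, p, q)"
  define j where "j = cone_in_dom E X (C, p, q)"
  have i': "i = (THE c. arr Y C 0 c \<and> p \<cdot> c = did E Y \<and> q \<cdot> c = 0)"
    by (simp add: i_def cone_in_cod_def arr_def o D(1))
  have j': "j = (THE c. arr X C (- e) c \<and> p \<cdot> c = 0 \<and> q \<cdot> c = did E X)"
    by (simp add: j_def cone_in_dom_def arr_def o D(1))
  have i: "arr Y C 0 i" "p \<cdot> i = did E Y" "q \<cdot> i = 0"
    using theI'[OF D(5)[of Y 0 "did E Y" 0]] o by (simp_all add: i' arr_id arr_0)
  have j: "arr X C (- e) j" "p \<cdot> j = 0" "q \<cdot> j = did E X"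
    using theI'[OF D(5)[of X "- e" 0 "did E X"]] o by (simp_all add: j' arr_id arr_0)
  have ip: "arr C C 0 (i \<cdot> p)" and jq: "arr C C 0 (j \<cdot> q)"
    by (rule arr_comp[OF D(2) i(1)] arr_comp[OF q j(1)]; simp)+
  have "i \<cdot> p + j \<cdot> q = did E C"
  proof (rule ext[OF arr_add[OF ip jq] arr_id[OF D(1)]])
    have "p \<cdot> i \<cdot> p = p" "p \<cdot> j \<cdot> q = 0" "q \<cdot> i \<cdot> p = 0" "q \<cdot> j \<cdot> q = q"
      using assoc[OF D(2) i(1) D(2)] assoc[OF q j(1) D(2)] assoc[OF D(2) i(1) q] assoc[OF q j(1) q]
        i j id_left[OF D(2)] id_left[OF q] comp_0_left[OF q o(2)] comp_0_left[OF D(2) o(1)] by simp_all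
    then show "p \<cdot> (i \<cdot> p + j \<cdot> q) = p \<cdot> did E C" "q \<cdot> (i \<cdot> p + j \<cdot> q) = q \<cdot> did E C"
      using comp_add_right[OF D(2) ip jq] comp_add_right[OF q ip jq] id_right[OF D(2)] id_right[OF q] by simp_all
  qed
  moreover have "d Y C 0 i = 0"
  proof (rule ext[OF arr_d[OF i(1) refl] arr_0[OF o(2) D(1)]])
    have "d Y Y 0 (p \<cdot> i) = (- (f \<cdot> q)) \<cdot> i + p \<cdot> d Y C 0 i"
      using leib[OF i(1) D(2)] D(4) by simp
    moreover have "(- (f \<cdot> q)) \<cdot> i = 0"
      using comp_minus_left[OF arr_comp[OF q clo_arr[OF f] refl] i(1)] assoc[OF i(1) q clo_arr[OF f]] i(3)
        comp_0_right[OF clo_arr[OF f] o(2)] by simp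
    ultimately show "p \<cdot> d Y C 0 i = p \<cdot> 0" using i(2) d_id[OF o(2)] comp_0_right[OF D(2) o(2)] by simp
    have "d Y X e (q \<cdot> i) = - (q \<cdot> d Y C 0 i)"
      using d_comp_clo_left[OF D(3) i(1), of e] by simp
    then show "q \<cdot> d Y C 0 i = q \<cdot> 0" using i(3) d_0[OF o(2,1)] comp_0_right[OF q o(2)] by simp
  qed
  moreover have "d X C (- e) j = i \<cdot> f"
  proof (rule ext[of X 0])
    show "arr X C 0 (d X C (- e) j)" by (rule arr_d[OF j(1)]) simp
    show "arr X C 0 (i \<cdot> f)" by (rule arr_comp[OF clo_arr[OF f] i(1)]) simp
    have "d X Y (- e) (p \<cdot> j) = (- (f \<cdot> q)) \<cdot> j + p \<cdot> d X C (- e) j"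
      using leib[OF j(1) D(2), of "- e"] D(4) by simp
    moreover have "(- (f \<cdot> q)) \<cdot> j = - f"
      using comp_minus_left[OF arr_comp[OF q clo_arr[OF f] refl] j(1)] assoc[OF j(1) q clo_arr[OF f]] j(3)
        id_right[OF clo_arr[OF f]] by simp
    moreover have "p \<cdot> i \<cdot> f = f"
      using assoc[OF clo_arr[OF f] i(1) D(2)] i(2) id_left[OF clo_arr[OF f]] by simp
    ultimately show "p \<cdot> d X C (- e) j = p \<cdot> i \<cdot> f" using j(2) d_0[OF o(1,2)] by simp
    have "d X X 0 (q \<cdot> j) = - (q \<cdot> d X C (- e) j)"
      using d_comp_clo_left[OF D(3) j(1), of 0] by simp
    moreover have "q \<cdot> i \<cdot> f = 0"
      using assoc[OF clo_arr[OF f] i(1) q] i(3) comp_0_left[OF clo_arr[OF f] o(1)] by simp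
    ultimately show "q \<cdot> d X C (- e) j = q \<cdot> i \<cdot> f" using j(3) d_id[OF o(1)] by simp
  qed
  ultimately show ?thesis
    unfolding cone_data_def i_def[symmetric] j_def[symmetric] using f D i j by (simp add: clo_def)
qed

lemma cone_data_expand_left:
  assumes B: "cone_data X Y f C p q i j" and c: "arr Z C n c"
  shows "c = i \<cdot> p \<cdot> c + j \<cdot> q \<cdot> c"
proof -
  note b = cone_dataD[OF B]
  have "arr C C 0 (i \<cdot> p)" "arr C C 0 (j \<cdot> q)"
    by (rule arr_comp[OF b(2,15)] arr_comp[OF b(14,5)]; simp)+
  from comp_add_left[OF this c] show ?thesis
    using b(10) id_left[OF c] assoc[OF c b(2,15)] assoc[OF c b(14,5)] by simp
qed

lemma cone_data_expand_right:
  assumes B: "cone_data X Y f C p q i j" and c: "arr C Z n c"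
  shows "c = (c \<cdot> i) \<cdot> p + (c \<cdot> j) \<cdot> q"
proof -
  note b = cone_dataD[OF B]
  have "arr C C 0 (i \<cdot> p)" "arr C C 0 (j \<cdot> q)"
    by (rule arr_comp[OF b(2,15)] arr_comp[OF b(14,5)]; simp)+
  from comp_add_right[OF c this] show ?thesis
    using b(10) id_right[OF c] assoc[OF b(2,15) c] assoc[OF b(14,5) c] by simp
qed

lemma cone_data_is_cone:
  assumes B: "cone_data X Y f C p q i j"
  shows "is_cone E X Y f (C, p, q)"
proof -
  note b = cone_dataD[OF B]
  have "\<exists>!c. arr Z C n c \<and> p \<cdot> c = y \<and> q \<cdot> c = x" if y: "arr Z Y n y" and x: "arr Z X (n + e) x" for Z n y x
  proof
    have iy: "arr Z C n (i \<cdot> y)" by (rule arr_comp[OF y b(15)]) simp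
    have jx: "arr Z C n (j \<cdot> x)" by (rule arr_comp[OF x b(5)]) simp
    have "p \<cdot> i \<cdot> y = y" "p \<cdot> j \<cdot> x = 0" "q \<cdot> i \<cdot> y = 0" "q \<cdot> j \<cdot> x = x"
      using assoc[OF y b(15,2)] assoc[OF y b(15,14)] assoc[OF x b(5,2)] assoc[OF x b(5,14)] b(6-9)
        id_left[OF y] id_left[OF x] comp_0_left[OF x b(17)] comp_0_left[OF y b(16)] by simp_all
    then show "arr Z C n (i \<cdot> y + j \<cdot> x) \<and> p \<cdot> (i \<cdot> y + j \<cdot> x) = y \<and> q \<cdot> (i \<cdot> y + j \<cdot> x) = x"
      using comp_add_right[OF b(2) iy jx] comp_add_right[OF b(14) iy jx] arr_add[OF iy jx] by simp
    show "c = i \<cdot> y + j \<cdot> x" if "arr Z C n c \<and> p \<cdot> c = y \<and> q \<cdot> c = x" for c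
      using cone_data_expand_left[OF B, of Z n c] that by simp
  qed
  then show ?thesis
    using b unfolding is_cone_def by (simp add: clo_def arr_def)
qed

section \<open>Acyclicity of Hom complexes\<close>

text \<open>Only the degrees \<open>n \<cdot> \<one>\<close> with \<open>n\<close> an integer are within reach of the shifts \<open>[1]\<close>, \<open>[-1]\<close>.\<close>

inductive int_degree :: "'g \<Rightarrow> bool" where
  int_degree_0: "int_degree 0"
| int_degree_plus: "int_degree n \<Longrightarrow> int_degree (n + e)"
| int_degree_minus: "int_degree n \<Longrightarrow> int_degree (n - e)"

definition acyclic_hom :: "'o \<Rightarrow> 'o \<Rightarrow> bool" where
  "acyclic_hom X J \<longleftrightarrow> (\<forall>n f. int_degree n \<longrightarrow> clo X J n f \<longrightarrow> bdry X J n f)"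

lemma acyclic_homD: "acyclic_hom X J \<Longrightarrow> int_degree n \<Longrightarrow> clo X J n f \<Longrightarrow> bdry X J n f"
  by (simp add: acyclic_hom_def)

lemma acyclic_homE:
  assumes "acyclic_hom X J" "int_degree n" "clo X J n f"
  obtains h where "arr X J (n - e) h" "d X J (n - e) h = f"
  using acyclic_homD[OF assms] unfolding bdry_def by metis

text \<open>A segment of the long exact sequence of Hom(-, J). A cocycle on \<open>C\<close>
  restricts to a boundary on \<open>Y\<close>; corrected by \<open>d(u p)\<close>, it vanishes on
  \<open>Y\<close> and is therefore pulled back along \<open>q\<close> from a cocycle on
  \<open>X\<close>, again a boundary.\<close>

lemma cone_data_acyclic_left:
  assumes B: "cone_data X Y f C p q i j" and "acyclic_hom X J" "acyclic_hom Y J"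
  shows "acyclic_hom C J"
  unfolding acyclic_hom_def
proof (intro allI impI)
  fix n w assume n: "int_degree n" and w: "clo C J n w"
  note b = cone_dataD[OF B]
  have J: "J \<in> dobj E" using clo_objD[OF w] by simp
  have "clo Y J n (w \<cdot> i)" by (rule clo_comp[OF b(4) w]) simp
  then obtain u where u: "arr Y J (n - e) u" "d Y J (n - e) u = w \<cdot> i" by (rule acyclic_homE[OF assms(3) n])
  have up: "arr C J (n - e) (u \<cdot> p)" by (rule arr_comp[OF b(2) u(1)]) simp
  define w' where "w' = w - d C J (n - e) (u \<cdot> p)"
  have dup: "clo C J n (d C J (n - e) (u \<cdot> p))" by (rule clo_d_arr[OF up]) simp
  have w': "clo C J n w'" unfolding w'_def by (rule clo_diff[OF w dup])
  have "d C J (n - e) (u \<cdot> p) \<cdot> i = d Y J (n - e) ((u \<cdot> p) \<cdot> i)"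
    by (rule d_comp_clo_right[OF b(4) up, symmetric]) simp
  also have "(u \<cdot> p) \<cdot> i = u" using assoc[OF b(15) b(2) u(1)] b(6) id_right[OF u(1)] by simp
  finally have w'i: "w' \<cdot> i = 0"
    using comp_diff_left[OF clo_arr[OF w] clo_arr[OF dup] b(15)] u(2) by (simp add: w'_def)
  have w'j: "arr X J (n - e) (w' \<cdot> j)" by (rule arr_comp[OF b(5) clo_arr[OF w']]) simp
  have "d X J (n - e) (w' \<cdot> j) = sg n (w' \<cdot> d X C (- e) j)" by (rule d_comp_clo_left[OF w' b(5)]) simp
  also have "w' \<cdot> d X C (- e) j = 0"
    using assoc[OF b(13,15) clo_arr[OF w']] w'i b(12) comp_0_left[OF b(13) J] by simp
  finally have "clo X J (n - e) (w' \<cdot> j)" using w'j by (simp add: clo_def)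
  from bdry_comp_right[OF acyclic_homD[OF assms(2) int_degree_minus[OF n] this] b(3)]
  have "bdry C J n ((w' \<cdot> j) \<cdot> q)" by simp
  also have "(w' \<cdot> j) \<cdot> q = w'"
    using cone_data_expand_right[OF B clo_arr[OF w']] w'i comp_0_left[OF b(2) J] by simp
  finally have "bdry C J n w'" .
  from bdry_add[OF this bdryI[OF up refl]] show "bdry C J n w" by (simp add: w'_def)
qed

text \<open>The connecting map sends \<open>h\<close> to the cocycle \<open>h q\<close> on
  \<open>C\<close>. A primitive \<open>w\<close> of it restricts to a cocycle \<open>w i\<close> on
  \<open>Y\<close>, and the Leibniz rule for \<open>w j\<close> shows that \<open>(w i) f\<close> is
  \<open>h\<close> up to a sign and a boundary.\<close>

lemma cone_data_surj_left:
  assumes B: "cone_data X Y f C p q i j" and "acyclic_hom C J" "int_degree n" and h: "clo X J n h"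
  obtains g where "clo Y J n g" "bdry X J n (g \<cdot> f - h)"
proof -
  note b = cone_dataD[OF B]
  have J: "J \<in> dobj E" using clo_objD[OF h] by simp
  have "clo C J (n + e) (h \<cdot> q)" by (rule clo_comp[OF b(3) h]) simp
  then obtain w where w: "arr C J n w" "d C J n w = h \<cdot> q"
    using acyclic_homE[OF assms(2) int_degree_plus[OF assms(3)]] by (metis add_diff_cancel)
  have wi: "arr Y J n (w \<cdot> i)" by (rule arr_comp[OF b(15) w(1)]) simp
  have "d Y J n (w \<cdot> i) = d C J n w \<cdot> i" by (rule d_comp_clo_right[OF b(4) w(1)]) simp
  also have "\<dots> = 0" using w(2) assoc[OF b(15,14) clo_arr[OF h]] b(9) comp_0_right[OF clo_arr[OF h] b(17)] by simp
  finally have cwi: "clo Y J n (w \<cdot> i)" using wi by (simp add: clo_def)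
  have wj: "arr X J (n - e) (w \<cdot> j)" by (rule arr_comp[OF b(5) w(1)]) simp
  have "d X J (n - e) (w \<cdot> j) = d C J n w \<cdot> j + sg n (w \<cdot> d X C (- e) j)" by (rule leib[OF b(5) w(1)]) simp
  also have "d C J n w \<cdot> j = h" using w(2) assoc[OF b(5,14) clo_arr[OF h]] b(7) id_right[OF clo_arr[OF h]] by simp
  also have "w \<cdot> d X C (- e) j = (w \<cdot> i) \<cdot> f" using assoc[OF b(13,15) w(1)] b(12) by simp
  finally have "bdry X J n (h + sg n ((w \<cdot> i) \<cdot> f))" using bdryI[OF wj refl] by simp
  moreover have "- sg n ((w \<cdot> i) \<cdot> f) - h = - (h + sg n ((w \<cdot> i) \<cdot> f))" by simp
  ultimately have bd: "bdry X J n (- sg n ((w \<cdot> i) \<cdot> f) - h)" using bdry_uminus by metis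
  show ?thesis
  proof (rule that[of "- sg n (w \<cdot> i)"])
    show "clo Y J n (- sg n (w \<cdot> i))" by (rule clo_uminus[OF clo_sg[OF cwi]])
    show "bdry X J n ((- sg n (w \<cdot> i)) \<cdot> f - h)"
      using bd comp_minus_left[OF arr_sg[OF wi] b(13)] comp_sg_left[OF wi b(13)] by simp
  qed
qed

text \<open>A primitive \<open>h\<close> of \<open>g f\<close> is what is missing to extend
  \<open>g\<close> from \<open>Y\<close> to a cocycle on \<open>C\<close>; the sign in front of
  \<open>h q\<close> makes the two differentials cancel. The extension is a boundary, hence so is
  its restriction \<open>g\<close>.\<close>

lemma cone_data_inj_left:
  assumes B: "cone_data X Y f C p q i j" and "acyclic_hom C J" "int_degree n" and g: "clo Y J n g" and gf: "bdry X J n (g \<cdot> f)"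
  shows "bdry Y J n g"
proof -
  note b = cone_dataD[OF B]
  note ga = clo_arr[OF g]
  have J: "J \<in> dobj E" using clo_objD[OF g] by simp
  obtain h where h: "arr X J (n - e) h" "g \<cdot> f = d X J (n - e) h" using gf unfolding bdry_def by blast
  have gp: "arr C J n (g \<cdot> p)" by (rule arr_comp[OF b(2) ga]) simp
  have hq: "arr C J n (h \<cdot> q)" by (rule arr_comp[OF b(14) h(1)]) simp
  define w where "w = g \<cdot> p + sg n (h \<cdot> q)"
  have wa: "arr C J n w" unfolding w_def by (rule arr_add[OF gp arr_sg[OF hq]])
  have "d C J n (g \<cdot> p) = sg n (g \<cdot> d C Y 0 p)" by (rule d_comp_clo_left[OF g b(2)]) simp
  also have "g \<cdot> d C Y 0 p = - ((g \<cdot> f) \<cdot> q)"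
    using b(11) comp_minus_right[OF ga arr_comp[OF b(14,13) refl]] assoc[OF b(14,13) ga] by simp
  finally have 1: "d C J n (g \<cdot> p) = - sg n ((g \<cdot> f) \<cdot> q)" by (simp add: sg_uminus)
  have 2: "d C J n (h \<cdot> q) = (g \<cdot> f) \<cdot> q"
    unfolding h(2) by (rule d_comp_clo_right[OF b(3) h(1)]) simp
  have w: "clo C J n w"
    using wa d_add[OF gp arr_sg[OF hq]] d_sg[OF hq] 1 2 by (simp add: clo_def w_def)
  have "(g \<cdot> p) \<cdot> i = g" using assoc[OF b(15,2) ga] b(6) id_right[OF ga] by simp
  moreover have "sg n (h \<cdot> q) \<cdot> i = 0"
    using comp_sg_left[OF hq b(15)] assoc[OF b(15,14) h(1)] b(9) comp_0_right[OF h(1) b(17)] by simp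
  ultimately have "w \<cdot> i = g" using comp_add_left[OF gp arr_sg[OF hq] b(15)] by (simp add: w_def)
  with bdry_comp_right[OF acyclic_homD[OF assms(2,3) w] b(4)] show ?thesis by simp
qed

text \<open>Dual to \<open>cone_data_acyclic_left\<close>: the component of a cocycle in
  \<open>X\<close> is the differential of some \<open>u\<close>, and adding \<open>d(j u)\<close>
  removes it, leaving a cocycle that comes from \<open>Y\<close> through \<open>i\<close>.\<close>

lemma cone_data_acyclic_right:
  assumes B: "cone_data X Y f C p q i j" and "acyclic_hom P X" "acyclic_hom P Y"
  shows "acyclic_hom P C"
  unfolding acyclic_hom_def
proof (intro allI impI)
  fix n w assume n: "int_degree n" and w: "clo P C n w"
  note b = cone_dataD[OF B]
  have P: "P \<in> dobj E" using clo_objD[OF w] by simp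
  have "clo P X (n + e) (q \<cdot> w)" by (rule clo_comp[OF w b(3)]) (rule add.commute)
  then obtain u where u: "arr P X n u" "d P X n u = q \<cdot> w"
    using acyclic_homE[OF assms(2) int_degree_plus[OF n]] by (metis add_diff_cancel)
  have ju: "arr P C (n - e) (j \<cdot> u)" by (rule arr_comp[OF u(1) b(5)]) simp
  define w' where "w' = w + d P C (n - e) (j \<cdot> u)"
  have dju: "clo P C n (d P C (n - e) (j \<cdot> u))" by (rule clo_d_arr[OF ju]) simp
  have w': "clo P C n w'" unfolding w'_def by (rule clo_add[OF w dju])
  have ifu: "arr P C n ((i \<cdot> f) \<cdot> u)" by (rule arr_comp[OF u(1) arr_comp[OF b(13,15) refl]]) simp
  have qw: "arr P X (n + e) (q \<cdot> w)" using \<open>clo P X (n + e) (q \<cdot> w)\<close> by (rule clo_arr)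
  have jqw: "arr P C n (j \<cdot> q \<cdot> w)" by (rule arr_comp[OF qw b(5)]) simp
  have "d P C (n - e) (j \<cdot> u) = (i \<cdot> f) \<cdot> u - j \<cdot> q \<cdot> w"
    using leib[OF u(1) b(5), of "n - e"] u(2) b(12) by simp
  moreover have "q \<cdot> (i \<cdot> f) \<cdot> u = 0"
    using assoc[OF u(1) b(13,15)] assoc[OF arr_comp[OF u(1) b(13) refl] b(15,14)] b(9)
      comp_0_left[OF arr_comp[OF u(1) b(13) refl] b(16)] by simp
  moreover have "q \<cdot> j \<cdot> q \<cdot> w = q \<cdot> w"
    using assoc[OF qw b(5,14)] b(7) id_left[OF qw] by simp
  ultimately have "q \<cdot> w' = 0"
    using comp_add_right[OF b(14) clo_arr[OF w] clo_arr[OF dju]] comp_diff_right[OF b(14) ifu jqw]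
    by (simp add: w'_def)
  then have ex: "i \<cdot> p \<cdot> w' = w'"
    using cone_data_expand_left[OF B clo_arr[OF w']] comp_0_right[OF b(5) P] by simp
  have pw': "arr P Y n (p \<cdot> w')" by (rule arr_comp[OF clo_arr[OF w'] b(2)]) simp
  have "d P Y n (p \<cdot> w') = d C Y 0 p \<cdot> w'" by (rule d_comp_clo_right[OF w' b(2)]) simp
  also have "\<dots> = 0"
    using b(11) comp_minus_left[OF arr_comp[OF b(14,13) refl] clo_arr[OF w']]
      assoc[OF clo_arr[OF w'] b(14,13)] \<open>q \<cdot> w' = 0\<close> comp_0_right[OF b(13) P] by simp
  finally have "clo P Y n (p \<cdot> w')" using pw' by (simp add: clo_def)
  from bdry_comp_left[OF acyclic_homD[OF assms(3) n this] b(4)] ex have "bdry P C n w'" by simp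
  from bdry_diff[OF this bdryI[OF ju refl]] show "bdry P C n w" by (simp add: w'_def)
qed

text \<open>A primitive \<open>w\<close> of \<open>i h\<close> has a closed component
  \<open>q w\<close>, and the Leibniz rule for \<open>p w\<close> says that \<open>f q w\<close>
  differs from \<open>h\<close> by a boundary.\<close>

lemma cone_data_surj_right:
  assumes B: "cone_data X Y f C p q i j" and "acyclic_hom P C" "int_degree n" and h: "clo P Y n h"
  obtains g where "clo P X n g" "bdry P Y n (f \<cdot> g - h)"
proof -
  note b = cone_dataD[OF B]
  have P: "P \<in> dobj E" using clo_objD[OF h] by simp
  have "clo P C n (i \<cdot> h)" by (rule clo_comp[OF h b(4)]) simp
  then obtain w where w: "arr P C (n - e) w" "d P C (n - e) w = i \<cdot> h" by (rule acyclic_homE[OF assms(2,3)])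
  have qw: "arr P X n (q \<cdot> w)" by (rule arr_comp[OF w(1) b(14)]) simp
  have "d P X n (q \<cdot> w) = - (q \<cdot> d P C (n - e) w)" using d_comp_clo_left[OF b(3) w(1), of n] by simp
  also have "\<dots> = 0" using w(2) assoc[OF clo_arr[OF h] b(15,14)] b(9) comp_0_left[OF clo_arr[OF h] b(16)] by simp
  finally have cqw: "clo P X n (q \<cdot> w)" using qw by (simp add: clo_def)
  have pw: "arr P Y (n - e) (p \<cdot> w)" by (rule arr_comp[OF w(1) b(2)]) simp
  have "d P Y (n - e) (p \<cdot> w) = d C Y 0 p \<cdot> w + p \<cdot> d P C (n - e) w"
    using leib[OF w(1) b(2), of "n - e"] by simp
  also have "d C Y 0 p \<cdot> w = - (f \<cdot> q \<cdot> w)"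
    using b(11) comp_minus_left[OF arr_comp[OF b(14,13) refl] w(1)] assoc[OF w(1) b(14,13)] by simp
  also have "p \<cdot> d P C (n - e) w = h" using w(2) assoc[OF clo_arr[OF h] b(15,2)] b(6) id_left[OF clo_arr[OF h]] by simp
  finally have "bdry P Y n (- (f \<cdot> q \<cdot> w) + h)" using bdryI[OF pw refl] by simp
  from bdry_uminus[OF this] show ?thesis using that[OF cqw] by simp
qed

text \<open>With \<open>f g = d h\<close>, the morphisms \<open>j g\<close> and \<open>i h\<close>
  have equal differentials; their difference is a cocycle in \<open>C\<close> whose component in
  \<open>X\<close> is \<open>g\<close>.\<close>

lemma cone_data_inj_right:
  assumes B: "cone_data X Y f C p q i j" and "acyclic_hom P C" "int_degree n" and g: "clo P X n g" and fg: "bdry P Y n (f \<cdot> g)"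
  shows "bdry P X n g"
proof -
  note b = cone_dataD[OF B]
  note ga = clo_arr[OF g]
  obtain h where h: "arr P Y (n - e) h" "f \<cdot> g = d P Y (n - e) h" using fg unfolding bdry_def by blast
  have jg: "arr P C (n - e) (j \<cdot> g)" by (rule arr_comp[OF ga b(5)]) simp
  have ih: "arr P C (n - e) (i \<cdot> h)" by (rule arr_comp[OF h(1) b(15)]) simp
  have "d P C (n - e) (j \<cdot> g) = d X C (- e) j \<cdot> g" by (rule d_comp_clo_right[OF g b(5)]) simp
  also have "\<dots> = i \<cdot> f \<cdot> g" using b(12) assoc[OF ga b(13,15)] by simp
  also have "\<dots> = d P C (n - e) (i \<cdot> h)" using d_comp_clo_left[OF b(4) h(1), of "n - e"] h(2) by simp
  finally have "clo P C (n - e) (j \<cdot> g - i \<cdot> h)"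
    using arr_diff[OF jg ih] d_diff[OF jg ih] by (simp add: clo_def)
  from bdry_comp_left[OF acyclic_homD[OF assms(2) int_degree_minus[OF assms(3)] this] b(3)]
  have "bdry P X n (q \<cdot> (j \<cdot> g - i \<cdot> h))" by simp
  moreover have "q \<cdot> j \<cdot> g = g" "q \<cdot> i \<cdot> h = 0"
    using assoc[OF ga b(5,14)] assoc[OF h(1) b(15,14)] b(7,9) id_left[OF ga] comp_0_left[OF h(1) b(16)] by simp_all
  ultimately show ?thesis using comp_diff_right[OF b(14) jg ih] by simp
qed

section \<open>Invariance of acyclicity under homotopy equivalences and shifts\<close>

lemma H0_cat_isoE:
  assumes "cat_iso (H0 E) X Y F"
  obtains f g where "clo X Y 0 f" "clo Y X 0 g" "bdry X X 0 (g \<cdot> f - did E X)" "bdry Y Y 0 (f \<cdot> g - did E Y)"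
    "F = hc X Y f"
proof -
  from assms have o: "X \<in> dobj E" "Y \<in> dobj E" by (simp_all add: cat_iso_def H0_simps)
  from assms o obtain f g where f: "clo X Y 0 f" "F = hc X Y f" and g: "clo Y X 0 g"
    and e: "Comp (H0 E) X Y X (hc Y X g) F = Id (H0 E) X" "Comp (H0 E) Y X Y F (hc Y X g) = Id (H0 E) Y"
    by (auto simp: cat_iso_def elim!: H0_HomE)
  show ?thesis
    using that[OF f(1) g _ _ f(2)] e o unfolding f(2) H0_Comp[OF f(1) g] H0_Comp[OF g f(1)]
    by (simp add: H0_simps hclass_eq_iff)
qed

lemma acyclic_hom_iso_left:
  assumes "cat_iso (H0 E) X Y F" "acyclic_hom X J"
  shows "acyclic_hom Y J"
  unfolding acyclic_hom_def
proof (intro allI impI)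
  fix n w assume n: "int_degree n" and w: "clo Y J n w"
  from assms(1) obtain f g where f: "clo X Y 0 f" and g: "clo Y X 0 g"
    and b: "bdry Y Y 0 (f \<cdot> g - did E Y)" by (rule H0_cat_isoE)
  note o = clo_objD[OF f]
  have wf: "clo X J n (w \<cdot> f)" by (rule clo_comp[OF f w]) simp
  have fg: "arr Y Y 0 (f \<cdot> g)" by (rule arr_comp[OF clo_arr[OF g] clo_arr[OF f]]) simp
  have "bdry Y J n ((w \<cdot> f) \<cdot> g)" by (rule bdry_comp_right[OF acyclic_homD[OF assms(2) n wf] g]) simp
  moreover have "bdry Y J n (w \<cdot> (f \<cdot> g - did E Y))" by (rule bdry_comp_left[OF b w]) simp
  ultimately show "bdry Y J n w"
    using bdry_diff assoc[OF clo_arr[OF g] clo_arr[OF f] clo_arr[OF w]]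
      comp_diff_right[OF clo_arr[OF w] fg arr_id[OF o(2)]] id_right[OF clo_arr[OF w]] by fastforce
qed

lemma acyclic_hom_iso_right:
  assumes "cat_iso (H0 E) X Y F" "acyclic_hom P X"
  shows "acyclic_hom P Y"
  unfolding acyclic_hom_def
proof (intro allI impI)
  fix n w assume n: "int_degree n" and w: "clo P Y n w"
  from assms(1) obtain f g where f: "clo X Y 0 f" and g: "clo Y X 0 g"
    and b: "bdry Y Y 0 (f \<cdot> g - did E Y)" by (rule H0_cat_isoE)
  note o = clo_objD[OF f]
  have gw: "clo P X n (g \<cdot> w)" by (rule clo_comp[OF w g]) simp
  have fg: "arr Y Y 0 (f \<cdot> g)" by (rule arr_comp[OF clo_arr[OF g] clo_arr[OF f]]) simp
  have "bdry P Y n (f \<cdot> g \<cdot> w)" by (rule bdry_comp_left[OF acyclic_homD[OF assms(2) n gw] f]) simp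
  moreover have "bdry P Y n ((f \<cdot> g - did E Y) \<cdot> w)" by (rule bdry_comp_right[OF b w]) simp
  ultimately show "bdry P Y n w"
    using bdry_diff assoc[OF clo_arr[OF w] clo_arr[OF g] clo_arr[OF f]]
      comp_diff_left[OF fg arr_id[OF o(2)] clo_arr[OF w]] id_left[OF clo_arr[OF w]] by fastforce
qed

lemma int_degree_plus_unit: "int_degree n \<Longrightarrow> i \<in> {e, - e} \<Longrightarrow> int_degree (n + i)"
  and int_degree_minus_unit: "int_degree n \<Longrightarrow> i \<in> {e, - e} \<Longrightarrow> int_degree (n - i)"
  using int_degree_plus[of n] int_degree_minus[of n] by auto

text \<open>\<open>X\<close> is a retract of \<open>Y\<close> up to a shift by \<open>i\<close>, and
  boundaries restrict along \<open>u\<close>. Applied to a shift and to the inverse shift, this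
  gives both implications between \<open>X\<close> and \<open>X[1]\<close>.\<close>

lemma acyclic_hom_transport_left:
  assumes "clo X Y (- i) u" "clo Y X i v" "v \<cdot> u = did E X" "i \<in> {e, - e}" "acyclic_hom Y J"
  shows "acyclic_hom X J"
  unfolding acyclic_hom_def
proof (intro allI impI)
  fix n w assume n: "int_degree n" and w: "clo X J n w"
  have "clo Y J (n + i) (w \<cdot> v)" by (rule clo_comp[OF assms(2) w]) simp
  from bdry_comp_right[OF acyclic_homD[OF assms(5) int_degree_plus_unit[OF n assms(4)] this] assms(1)]
  have "bdry X J n ((w \<cdot> v) \<cdot> u)" by simp
  then show "bdry X J n w"
    using assoc[OF clo_arr clo_arr clo_arr, OF assms(1,2) w] assms(3) id_right[OF clo_arr[OF w]] by simp
qed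

lemma acyclic_hom_transport_right:
  assumes "clo X Y (- i) u" "clo Y X i v" "v \<cdot> u = did E X" "i \<in> {e, - e}" "acyclic_hom P Y"
  shows "acyclic_hom P X"
  unfolding acyclic_hom_def
proof (intro allI impI)
  fix n w assume n: "int_degree n" and w: "clo P X n w"
  have "clo P Y (n - i) (u \<cdot> w)" by (rule clo_comp[OF w assms(1)]) simp
  from bdry_comp_left[OF acyclic_homD[OF assms(5) int_degree_minus_unit[OF n assms(4)] this] assms(2)]
  have "bdry P X n (v \<cdot> u \<cdot> w)" by simp
  then show "bdry P X n w"
    using assoc[OF clo_arr clo_arr clo_arr, OF w assms(1,2)] assms(3) id_left[OF clo_arr[OF w]] by simp
qed

lemma acyclic_hom_zero_left:
  assumes "N \<in> dobj E" "did E N = 0" shows "acyclic_hom N J"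
  unfolding acyclic_hom_def
proof (intro allI impI)
  fix n w assume w: "clo N J n w"
  have "w = 0" using id_right[OF clo_arr[OF w]] assms(2) comp_0_right[OF clo_arr[OF w] assms(1)] by simp
  then show "bdry N J n w" using clo_objD[OF w] bdry_0 by simp
qed

lemma acyclic_hom_zero_right:
  assumes "N \<in> dobj E" "did E N = 0" shows "acyclic_hom P N"
  unfolding acyclic_hom_def
proof (intro allI impI)
  fix n w assume w: "clo P N n w"
  have "w = 0" using id_left[OF clo_arr[OF w]] assms(2) comp_0_left[OF clo_arr[OF w] assms(1)] by simp
  then show "bdry P N n w" using clo_objD[OF w] bdry_0 by simp
qed

end

section \<open>Triangles of the homotopy category\<close>

lemma triangle_iso_Tri_update: "triangle_iso (T\<lparr>Tri := S\<rparr>) t t' = triangle_iso T t t'"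
  by (cases t; cases t') (simp add: cat_iso_def)

lemma is_triangle_Tri_update: "is_triangle (T\<lparr>Tri := S\<rparr>) t = is_triangle T t"
  by (cases t) simp

text \<open>\<open>with_triangles\<close> compares triangles in the structure before the update;
  since isomorphism of triangles ignores \<open>Tri\<close>, the comparison can be read in the
  resulting structure.\<close>

lemma Tri_with_triangles:
  "t \<in> Tri (with_triangles T Std) \<longleftrightarrow>
    is_triangle (with_triangles T Std) t \<and> (\<exists>t'\<in>Std. triangle_iso (with_triangles T Std) t t')"
  unfolding with_triangles_def by (simp add: triangle_iso_Tri_update is_triangle_Tri_update)

lemma cat_iso_inverse: "cat_iso C X Y f \<Longrightarrow> \<exists>g. cat_iso C Y X g"
  unfolding cat_iso_def by blast

lemma cat_iso_Id: "category C \<Longrightarrow> X \<in> Obj C \<Longrightarrow> cat_iso C X X (Id C X)"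
  unfolding cat_iso_def by (auto intro!: bexI[of _ "Id C X"] simp: category_Id category_Id_left)

context dgcat_shifts
begin

definition std :: "'o \<Rightarrow> 'o \<Rightarrow> 'm \<Rightarrow> 'o \<Rightarrow> 'm \<Rightarrow> 'm \<Rightarrow> ('o, 'm set) triangle" where
  "std X Y f C p q = (X, Y, C, hc X Y f, hc Y C (cone_in_cod E Y (C, p, q)), hc C (sh e X) (ts e X \<cdot> q))"

lemma H0_Tri_iff:
  "t \<in> Tri (H0 E) \<longleftrightarrow> is_triangle (H0 E) t \<and> (\<exists>X Y f C p q. clo X Y 0 f \<and> is_cone E X Y f (C, p, q) \<and>
     triangle_iso (H0 E) t (std X Y f C p q))"
proof -
  have "(\<exists>t'\<in>{(X, Y, C, hclass E X Y f, hclass E Y C (cone_in_cod E Y (C, p, q)),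
       hclass E C (shift_obj E (gone E) X) (dcomp E (to_shift E (gone E) X) q)) |X Y C f p q.
        X \<in> dobj E \<and> Y \<in> dobj E \<and> f \<in> dclosed E X Y 0 \<and> is_cone E X Y f (C, p, q)}. triangle_iso (H0 E) t t')
    \<longleftrightarrow> (\<exists>X Y f C p q. clo X Y 0 f \<and> is_cone E X Y f (C, p, q) \<and> triangle_iso (H0 E) t (std X Y f C p q))"
    by (auto simp: std_def dclosed_iff) (metis clo_objD dclosed_iff)+
  then show ?thesis unfolding H0_def Tri_with_triangles by simp
qed

lemma is_triangle_std:
  assumes "clo X Y 0 f" "is_cone E X Y f (C, p, q)"
  shows "is_triangle (H0 E) (std X Y f C p q)"
proof -
  note b = cone_dataD[OF is_cone_cone_data[OF assms(2,1)]]
  have "clo C (sh e X) 0 (ts e X \<cdot> q)" by (rule clo_comp[OF b(3) clo_ts]) (simp_all add: b(16))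
  then show ?thesis
    using b by (auto simp: std_def H0_simps(1,6) intro!: H0_HomI)
qed

lemma std_in_Tri:
  assumes "clo X Y 0 f" "is_cone E X Y f (C, p, q)"
  shows "std X Y f C p q \<in> Tri (H0 E)"
proof -
  note t = is_triangle_std[OF assms]
  have "triangle_iso (H0 E) (std X Y f C p q) (std X Y f C p q)"
  proof -
    from t have o: "X \<in> dobj E" "Y \<in> dobj E" "C \<in> dobj E" "sh e X \<in> dobj E"
      by (auto simp: std_def H0_simps(1,6) shift_obj_in)
    note c = category_H0
    have ShId: "ShM (H0 E) X X (Id (H0 E) X) = Id (H0 E) (sh e X)"
      using H0_ShM[OF clo_id[OF o(1)]] shift_mor_id[OF o(1), of e] by (simp add: H0_simps(4))
    show ?thesis
      using t o unfolding std_def triangle_iso.simps is_triangle.simps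
      by (intro exI[of _ "Id (H0 E) X"] exI[of _ "Id (H0 E) Y"] exI[of _ "Id (H0 E) C"])
        (simp add: cat_iso_Id[OF c] category_Id_left[OF c] category_Id_right[OF c] ShId H0_simps(1,6))
  qed
  with t assms show ?thesis unfolding H0_Tri_iff by blast
qed

text \<open>Of the isomorphism with a standard triangle the first square is kept: it relates
  \<open>F\<close> to the morphism whose cone is \<open>C\<close>.\<close>

lemma H0_Tri_E:
  assumes "(X, Y, Z, F, G, H) \<in> Tri (H0 E)"
  obtains X' Y' f C p q i j a b c where "cone_data X' Y' f C p q i j" "cat_iso (H0 E) X X' a" "cat_iso (H0 E) Y Y' b"
    "cat_iso (H0 E) Z C c" "Comp (H0 E) X Y Y' b F = Comp (H0 E) X X' Y' (hc X' Y' f) a"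
    "F \<in> Hom (H0 E) X Y"
proof -
  from assms obtain X' Y' f C p q where f: "clo X' Y' 0 f" and C: "is_cone E X' Y' f (C, p, q)"
    and t: "triangle_iso (H0 E) (X, Y, Z, F, G, H) (std X' Y' f C p q)" and F: "F \<in> Hom (H0 E) X Y"
    unfolding H0_Tri_iff by auto
  from t obtain a b c where "cat_iso (H0 E) X X' a" "cat_iso (H0 E) Y Y' b" "cat_iso (H0 E) Z C c"
    "Comp (H0 E) X Y Y' b F = Comp (H0 E) X X' Y' (hc X' Y' f) a"
    unfolding std_def triangle_iso.simps by blast
  from that[OF is_cone_cone_data[OF C f] this F] show ?thesis .
qed

text \<open>Distinguished triangles are isomorphic to standard ones, so for a property invariant
  under isomorphism the two-out-of-three condition can be tested on actual cones.\<close>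

lemma triangulated_subcategory_Collect:
  assumes iso: "\<And>X Y F. cat_iso (H0 E) X Y F \<Longrightarrow> P X \<Longrightarrow> P Y"
    and sh: "\<And>X. X \<in> dobj E \<Longrightarrow> P X \<longleftrightarrow> P (sh e X)"
    and cone_data: "\<And>X Y f C p q i j. cone_data X Y f C p q i j \<Longrightarrow>
      (P X \<and> P Y \<longrightarrow> P C) \<and> (P Y \<and> P C \<longrightarrow> P X) \<and> (P X \<and> P C \<longrightarrow> P Y)"
    and N: "N \<in> dobj E" "P N"
  shows "triangulated_subcategory (H0 E) {X \<in> dobj E. P X}"
proof -
  have o: "Y \<in> dobj E" if "cat_iso (H0 E) X Y F" for X Y F
    using that by (simp add: cat_iso_def H0_simps(1))
  have iso': "P X \<longleftrightarrow> P Y" if "cat_iso (H0 E) X Y F" for X Y F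
    using iso cat_iso_inverse that by metis
  have tri: "(P X \<and> P Y \<longrightarrow> P Z) \<and> (P Y \<and> P Z \<longrightarrow> P X) \<and> (P X \<and> P Z \<longrightarrow> P Y) \<and>
    X \<in> dobj E \<and> Y \<in> dobj E \<and> Z \<in> dobj E"
    if t: "(X, Y, Z, F, G, H) \<in> Tri (H0 E)" for X Y Z F G H
  proof -
    from t obtain X' Y' f C p q i j a b c where "cone_data X' Y' f C p q i j" "cat_iso (H0 E) X X' a"
      "cat_iso (H0 E) Y Y' b" "cat_iso (H0 E) Z C c" by (rule H0_Tri_E)
    then have "(P X' \<and> P Y' \<longrightarrow> P C) \<and> (P Y' \<and> P C \<longrightarrow> P X') \<and> (P X' \<and> P C \<longrightarrow> P Y')"
      "P X \<longleftrightarrow> P X'" "P Y \<longleftrightarrow> P Y'" "P Z \<longleftrightarrow> P C"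
      using cone_data iso' by blast+
    moreover have "X \<in> dobj E" "Y \<in> dobj E" "Z \<in> dobj E"
      using H0_Tri_is_triangle[OF t] by (simp_all add: H0_simps(1))
    ultimately show ?thesis by blast
  qed
  show ?thesis
    unfolding triangulated_subcategory_def H0_simps(1,6)
  proof (intro conjI ballI allI impI)
    show "{X \<in> dobj E. P X} \<noteq> {}" using N by blast
    show "Y \<in> {X \<in> dobj E. P X}" if "cat_iso (H0 E) X Y F \<and> X \<in> {X \<in> dobj E. P X}" for X Y F
      using that iso[of X Y F] o[of X Y F] by simp
    show "X \<in> {X \<in> dobj E. P X} \<longleftrightarrow> sh e X \<in> {X \<in> dobj E. P X}" if "X \<in> dobj E" for X
    proof -
      have "sh e X \<in> dobj E" by (rule shift_obj_in[OF that]) simp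
      with that show ?thesis by (simp add: sh[symmetric])
    qed
    fix X Y Z F G H assume t: "(X, Y, Z, F, G, H) \<in> Tri (H0 E)"
    show "Z \<in> {X \<in> dobj E. P X}" if "X \<in> {X \<in> dobj E. P X} \<and> Y \<in> {X \<in> dobj E. P X}"
      using that tri[OF t] by blast
    show "X \<in> {X \<in> dobj E. P X}" if "Y \<in> {X \<in> dobj E. P X} \<and> Z \<in> {X \<in> dobj E. P X}"
      using that tri[OF t] by blast
    show "Y \<in> {X \<in> dobj E. P X}" if "X \<in> {X \<in> dobj E. P X} \<and> Z \<in> {X \<in> dobj E. P X}"
      using that tri[OF t] by blast
  qed blast
qed

text \<open>Conjugation by the structure morphisms of the shift anticommutes with \<open>d\<close>,
  so the shifted projections satisfy the cone equations once the sign of \<open>q\<close> is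
  changed.\<close>

lemma shifted_cone:
  assumes f: "clo X Y 0 f" and C: "is_cone E X Y f (C, p, q)"
  shows "is_cone E (sh e X) (sh e Y) (shift_mor E e X Y f)
    (sh e C, ts e Y \<cdot> p \<cdot> fs e C, - (ts e X \<cdot> q \<cdot> fs e C))"
proof -
  have i: "e \<in> {e, - e}" by simp
  note b = cone_dataD[OF is_cone_cone_data[OF C f]]
  note o = b(16-18)
  note so = shift_obj_in[OF o(1) i] shift_obj_in[OF o(2) i] shift_obj_in[OF o(3) i]
  note u = clo_ts[OF o(1) i] clo_ts[OF o(2) i] clo_ts[OF o(3) i]
  note v = clo_fs[OF o(1) i] clo_fs[OF o(2) i] clo_fs[OF o(3) i]
  note ua = u[THEN clo_arr] and va = v[THEN clo_arr]
  have pv: "arr (sh e C) Y e (p \<cdot> fs e C)" by (rule arr_comp[OF va(3) b(2)]) simp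
  have p': "arr (sh e C) (sh e Y) 0 (ts e Y \<cdot> p \<cdot> fs e C)" by (rule arr_comp[OF pv ua(2)]) simp
  have qv: "clo (sh e C) X (e + e) (q \<cdot> fs e C)" by (rule clo_comp[OF v(3) b(3)]) simp
  have q0: "clo (sh e C) (sh e X) e (ts e X \<cdot> q \<cdot> fs e C)" by (rule clo_comp[OF qv u(1)]) simp
  have sf: "arr (sh e X) (sh e Y) 0 (shift_mor E e X Y f)" by (rule arr_shift_mor[OF b(13) i])
  have "d (sh e C) (sh e Y) 0 (ts e Y \<cdot> p \<cdot> fs e C) = - (ts e Y \<cdot> d (sh e C) Y e (p \<cdot> fs e C))"
    using d_comp_clo_left[OF u(2) pv, of 0] by simp
  also have "d (sh e C) Y e (p \<cdot> fs e C) = d C Y 0 p \<cdot> fs e C"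
    by (rule d_comp_clo_right[OF v(3) b(2)]) simp
  also have "\<dots> = - (f \<cdot> q \<cdot> fs e C)"
    using b(11) comp_minus_left[OF arr_comp[OF b(14,13) refl] va(3)] assoc[OF va(3) b(14,13)] by simp
  also have "- (ts e Y \<cdot> (- (f \<cdot> q \<cdot> fs e C))) = ts e Y \<cdot> f \<cdot> q \<cdot> fs e C"
    using comp_minus_right[OF ua(2) arr_comp[OF clo_arr[OF qv] b(13) refl]] by simp
  also have "\<dots> = (ts e Y \<cdot> f) \<cdot> q \<cdot> fs e C" using assoc[OF clo_arr[OF qv] b(13) ua(2)] by simp
  also have "\<dots> = shift_mor E e X Y f \<cdot> ts e X \<cdot> q \<cdot> fs e C"
    using shift_mor_ts[OF b(13) i] assoc[OF clo_arr[OF qv] ua(1) sf] by simp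
  finally have dp: "d (sh e C) (sh e Y) 0 (ts e Y \<cdot> p \<cdot> fs e C) =
      - (shift_mor E e X Y f \<cdot> (- (ts e X \<cdot> q \<cdot> fs e C)))"
    using comp_minus_right[OF sf clo_arr[OF q0]] by simp
  have "\<exists>!c. arr Z (sh e C) n c \<and> (ts e Y \<cdot> p \<cdot> fs e C) \<cdot> c = y \<and> (- (ts e X \<cdot> q \<cdot> fs e C)) \<cdot> c = x"
    if y: "arr Z (sh e Y) n y" and x: "arr Z (sh e X) (n + e) x" for Z n y x
  proof -
    have pc: "(ts e Y \<cdot> p \<cdot> fs e C) \<cdot> c = ts e Y \<cdot> p \<cdot> fs e C \<cdot> c"
      and qc: "(- (ts e X \<cdot> q \<cdot> fs e C)) \<cdot> c = - (ts e X \<cdot> q \<cdot> fs e C \<cdot> c)"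
      if c: "arr Z (sh e C) n c" for c
      using assoc[OF c pv ua(2)] assoc[OF c va(3) b(2)] assoc[OF c clo_arr[OF qv] ua(1)] assoc[OF c va(3) b(14)]
        comp_minus_left[OF clo_arr[OF q0] c] by simp_all
    have vy: "arr Z Y (n + e) (fs e Y \<cdot> y)" by (rule arr_comp[OF y va(2)]) (rule add.commute)
    have vx: "arr Z X (n + e + e) (fs e X \<cdot> x)" by (rule arr_comp[OF x va(1)]) (rule add.commute)
    \<comment> \<open>Multiplied by the inverse shift morphisms, the equations for the unknown
      \<open>c\<close> become cone equations of \<open>C\<close> for \<open>fs e C \<cdot> c\<close>
      in degree \<open>n + e\<close>; \<open>c0\<close> is their solution.\<close>
    obtain c0 where c0: "arr Z C (n + e) c0" "p \<cdot> c0 = fs e Y \<cdot> y" "q \<cdot> c0 = - (fs e X \<cdot> x)"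
      using is_coneD(5)[OF C o(1,2) vy arr_uminus[OF vx]] by auto
    have uv: "ts e Y \<cdot> fs e Y \<cdot> y = y" "ts e X \<cdot> fs e X \<cdot> x = x"
      using assoc[OF y va(2) ua(2)] assoc[OF x va(1) ua(1)] ts_fs[OF o(2) i] ts_fs[OF o(1) i] id_left[OF x] id_left[OF y]
      by simp_all
    show ?thesis
    proof
      have uc: "arr Z (sh e C) n (ts e C \<cdot> c0)" by (rule arr_comp[OF c0(1) ua(3)]) simp
      have vuc: "fs e C \<cdot> ts e C \<cdot> c0 = c0"
        using assoc[OF c0(1) ua(3) va(3)] fs_ts[OF o(3) i] id_left[OF c0(1)] by simp
      show "arr Z (sh e C) n (ts e C \<cdot> c0) \<and> (ts e Y \<cdot> p \<cdot> fs e C) \<cdot> ts e C \<cdot> c0 = y \<and>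
          (- (ts e X \<cdot> q \<cdot> fs e C)) \<cdot> ts e C \<cdot> c0 = x"
        using uc by (simp add: pc[OF uc] qc[OF uc] vuc c0 uv comp_minus_right[OF ua(1) vx])
    next
      fix c assume "arr Z (sh e C) n c \<and> (ts e Y \<cdot> p \<cdot> fs e C) \<cdot> c = y \<and> (- (ts e X \<cdot> q \<cdot> fs e C)) \<cdot> c = x"
      then have c: "arr Z (sh e C) n c" and cy: "ts e Y \<cdot> p \<cdot> fs e C \<cdot> c = y"
        and cx: "- (ts e X \<cdot> q \<cdot> fs e C \<cdot> c) = x" using pc[of c] qc[of c] by auto
      have vc: "arr Z C (n + e) (fs e C \<cdot> c)" by (rule arr_comp[OF c va(3)]) (rule add.commute)
      have pvc: "arr Z Y (n + e) (p \<cdot> fs e C \<cdot> c)" by (rule arr_comp[OF vc b(2)]) simp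
      have qvc: "arr Z X (n + e + e) (q \<cdot> fs e C \<cdot> c)" by (rule arr_comp[OF vc b(14)]) (rule add.commute)
      have 1: "p \<cdot> fs e C \<cdot> c = p \<cdot> c0"
        using assoc[OF pvc ua(2) va(2)] fs_ts[OF o(2) i] id_left[OF pvc] cy c0(2) by simp
      have "fs e X \<cdot> x = - (fs e X \<cdot> ts e X \<cdot> q \<cdot> fs e C \<cdot> c)"
        using cx comp_minus_right[OF va(1) arr_comp[OF qvc ua(1) refl]] by simp
      then have 2: "q \<cdot> fs e C \<cdot> c = q \<cdot> c0"
        using assoc[OF qvc ua(1) va(1)] fs_ts[OF o(1) i] id_left[OF qvc] c0(3) by simp
      have "fs e C \<cdot> c = c0" by (rule is_cone_ext[OF C o(1,2) vc c0(1) 1 2])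
      then show "c = ts e C \<cdot> c0" using assoc[OF c va(3) ua(3)] ts_fs[OF o(3) i] id_left[OF c] by simp
    qed
  qed
  then show ?thesis
    using p' clo_uminus[OF q0] dp so unfolding is_cone_def by (simp add: arr_def clo_def)
qed

lemma H0_Sh_Obj: "X \<in> Obj (H0 E) \<Longrightarrow> Sh (H0 E) X \<in> Obj (H0 E)"
  by (simp add: H0_simps shift_obj_in)

lemma H0_ShM_Hom:
  assumes "X \<in> Obj (H0 E)" "Y \<in> Obj (H0 E)" "F \<in> Hom (H0 E) X Y"
  shows "ShM (H0 E) X Y F \<in> Hom (H0 E) (Sh (H0 E) X) (Sh (H0 E) Y)"
proof -
  obtain f where f: "clo X Y 0 f" "F = hc X Y f" using H0_HomE[OF assms(3)] assms by (auto simp: H0_simps(1))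
  then show ?thesis using H0_ShM[OF f(1)] H0_HomI[OF clo_shift_mor[OF f(1), of e]] by (simp add: H0_simps(6))
qed

lemma H0_ShM_Id: "X \<in> Obj (H0 E) \<Longrightarrow> ShM (H0 E) X X (Id (H0 E) X) = Id (H0 E) (Sh (H0 E) X)"
  using H0_ShM[OF clo_id, of X] shift_mor_id[of X e] by (simp add: H0_simps(1,4,6))

lemma H0_ShM_Comp:
  assumes o: "X \<in> Obj (H0 E)" "Y \<in> Obj (H0 E)" "Z \<in> Obj (H0 E)" and F: "F \<in> Hom (H0 E) X Y" and G: "G \<in> Hom (H0 E) Y Z"
  shows "ShM (H0 E) X Z (Comp (H0 E) X Y Z G F) = Comp (H0 E) (Sh (H0 E) X) (Sh (H0 E) Y) (Sh (H0 E) Z)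
      (ShM (H0 E) Y Z G) (ShM (H0 E) X Y F)"
proof -
  have i: "e \<in> {e, - e}" by simp
  obtain f where f: "clo X Y 0 f" "F = hc X Y f" using H0_HomE[OF F] o by (auto simp: H0_simps(1))
  obtain g where g: "clo Y Z 0 g" "G = hc Y Z g" using H0_HomE[OF G] o by (auto simp: H0_simps(1))
  have gf: "clo X Z 0 (g \<cdot> f)" by (rule clo_comp[OF f(1) g(1)]) simp
  show ?thesis
    unfolding f(2) g(2) H0_Comp[OF f(1) g(1)] H0_ShM[OF f(1)] H0_ShM[OF g(1)] H0_ShM[OF gf] H0_simps(6)
      H0_Comp[OF clo_shift_mor[OF f(1) i] clo_shift_mor[OF g(1) i]]
      shift_mor_comp[OF clo_arr[OF f(1)] clo_arr[OF g(1)] i] ..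
qed

lemma H0_ShM_iso:
  "cat_iso (H0 E) X Y F \<Longrightarrow> cat_iso (H0 E) (Sh (H0 E) X) (Sh (H0 E) Y) (ShM (H0 E) X Y F)"
  unfolding cat_iso_def by (metis H0_Sh_Obj H0_ShM_Hom H0_ShM_Comp H0_ShM_Id)

text \<open>The point is that the shift of an arrow with cone in \<open>A\<close> is again such an
  arrow. The arrow is replaced by an isomorphic morphism \<open>f\<close> of standard form, and
  \<open>shifted_cone\<close> gives a cone of its shift; the third vertex is thus the shift of
  \<open>C\<close> rather than of \<open>Z\<close>.\<close>

lemma verdier_H0:
  assumes iso: "\<And>X Y F. cat_iso (H0 E) X Y F \<Longrightarrow> X \<in> A \<Longrightarrow> Y \<in> A"
    and sh: "\<And>X. X \<in> A \<Longrightarrow> X \<in> dobj E \<Longrightarrow> sh e X \<in> A"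
    and id: "\<And>X C p q. X \<in> dobj E \<Longrightarrow> is_cone E X X (did E X) (C, p, q) \<Longrightarrow> C \<in> A"
    and cones: "has_cones E"
  shows "verdier (H0 E) A"
proof
  show "category (H0 E)" by (rule category_H0)
  show "(X, Id (H0 E) X, X) \<in> cone_in (H0 E) A" if "X \<in> Obj (H0 E)" for X
  proof -
    have X: "X \<in> dobj E" using that by (simp add: H0_simps(1))
    then obtain C p q where C: "is_cone E X X (did E X) (C, p, q)"
      using cones clo_id[OF X] unfolding has_cones_def by (metis dclosed_iff prod_cases3)
    show ?thesis
      using std_in_Tri[OF clo_id[OF X] C] id[OF X C] unfolding cone_in_def std_def H0_simps(4) by blast
  qed
  show "(Sh (H0 E) X, ShM (H0 E) X Y F, Sh (H0 E) Y) \<in> cone_in (H0 E) A"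
    if XFY: "(X, F, Y) \<in> cone_in (H0 E) A" for X F Y
  proof -
    let ?T = "H0 E"
    let ?S = "Sh (H0 E)"
    from XFY obtain Z G H where t: "(X, Y, Z, F, G, H) \<in> Tri ?T" and Z: "Z \<in> A" unfolding cone_in_def by blast
    from t obtain X' Y' f C p q i j a b c where B: "cone_data X' Y' f C p q i j" and a: "cat_iso ?T X X' a"
      and b: "cat_iso ?T Y Y' b" and c: "cat_iso ?T Z C c"
      and sq: "Comp ?T X Y Y' b F = Comp ?T X X' Y' (hc X' Y' f) a" and F: "F \<in> Hom ?T X Y" by (rule H0_Tri_E)
    note f = cone_dataD(1)[OF B]
    have o: "X \<in> Obj ?T" "Y \<in> Obj ?T" "X' \<in> Obj ?T" "Y' \<in> Obj ?T" "C \<in> Obj ?T"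
      and aH: "a \<in> Hom ?T X X'" and bH: "b \<in> Hom ?T Y Y'"
      using a b c by (simp_all add: cat_iso_def)
    have C: "?S C \<in> A" using sh iso[OF c Z] o(5) by (simp add: H0_simps(1,6))
    note f' = clo_shift_mor[OF f, of e, simplified] and C' = shifted_cone[OF f cone_data_is_cone[OF B]]
    let ?X = "?S X" and ?Y = "?S Y" and ?C = "?S C" and ?X' = "?S X'" and ?Y' = "?S Y'"
    let ?a = "ShM ?T X X' a" and ?b = "ShM ?T Y Y' b" and ?f = "ShM ?T X' Y' (hc X' Y' f)"
    obtain G0 H0' where std: "std ?X' ?Y' (shift_mor E e X' Y' f) ?C
        (ts e Y' \<cdot> p \<cdot> fs e C) (- (ts e X' \<cdot> q \<cdot> fs e C)) = (?X', ?Y', ?C, ?f, G0, H0')"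
      unfolding std_def H0_ShM[OF f] H0_simps(6) by blast
    have oS: "?X \<in> Obj ?T" "?Y \<in> Obj ?T" "?C \<in> Obj ?T" "?X' \<in> Obj ?T" "?Y' \<in> Obj ?T"
      "?S ?X \<in> Obj ?T" "?S ?X' \<in> Obj ?T" by (intro H0_Sh_Obj o)+
    have G0: "G0 \<in> Hom ?T ?Y' ?C" and H0': "H0' \<in> Hom ?T ?C (?S ?X')"
      using is_triangle_std[OF f'[folded H0_simps(6)] C'[folded H0_simps(6)]] std by simp_all
    note aS = H0_ShM_iso[OF a] and bS = H0_ShM_iso[OF b]
    \<comment> \<open>\<open>k\<close> inverts the double shift of \<open>a\<close>. It carries the
      last morphism of the standard triangle on the shifted objects back to one that ends in the
      double shift of \<open>X\<close>.\<close>
    obtain k where k: "k \<in> Hom ?T (?S ?X') (?S ?X)"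
      "Comp ?T (?S ?X') (?S ?X) (?S ?X') (ShM ?T ?X ?X' ?a) k = Id ?T (?S ?X')"
      and aa: "ShM ?T ?X ?X' ?a \<in> Hom ?T (?S ?X) (?S ?X')"
      using H0_ShM_iso[OF aS] unfolding cat_iso_def by blast
    define G' where "G' = Comp ?T ?Y ?Y' ?C G0 ?b"
    define H' where "H' = Comp ?T ?C (?S ?X') (?S ?X) k H0'"
    note c = category_H0
    have bH': "?b \<in> Hom ?T ?Y ?Y'" using bS by (simp add: cat_iso_def)
    have G': "G' \<in> Hom ?T ?Y ?C" unfolding G'_def by (rule category_Comp[OF c oS(2,5,3) bH' G0])
    have H': "H' \<in> Hom ?T ?C (?S ?X)" unfolding H'_def by (rule category_Comp[OF c oS(3,7,6) H0' k(1)])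
    have FH: "ShM ?T X Y F \<in> Hom ?T ?X ?Y" by (rule H0_ShM_Hom[OF o(1,2) F])
    have "triangle_iso ?T (?X, ?Y, ?C, ShM ?T X Y F, G', H') (?X', ?Y', ?C, ?f, G0, H0')"
      unfolding triangle_iso.simps
    proof (rule exI[of _ ?a], rule exI[of _ ?b], rule exI[of _ "Id ?T ?C"], intro conjI)
      show "cat_iso ?T ?X ?X' ?a" "cat_iso ?T ?Y ?Y' ?b" by (rule aS bS)+
      show "cat_iso ?T ?C ?C (Id ?T ?C)" by (rule cat_iso_Id[OF c oS(3)])
      show "Comp ?T ?X ?Y ?Y' ?b (ShM ?T X Y F) = Comp ?T ?X ?X' ?Y' ?f ?a"
        using H0_ShM_Comp[OF o(1,2,4) F bH] H0_ShM_Comp[OF o(1,3,4) aH H0_HomI[OF f]] sq by simp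
      show "Comp ?T ?Y ?C ?C (Id ?T ?C) G' = Comp ?T ?Y ?Y' ?C G0 ?b"
        using category_Id_left[OF c oS(2,3) G'] by (simp add: G'_def)
      show "Comp ?T ?C (?S ?X) (?S ?X') (ShM ?T ?X ?X' ?a) H' = Comp ?T ?C ?C (?S ?X') H0' (Id ?T ?C)"
        unfolding H'_def
        using category_assoc[OF c oS(3,7,6,7) H0' k(1) aa] k(2) category_Id_left[OF c oS(3,7) H0']
          category_Id_right[OF c oS(3,7) H0'] by simp
    qed
    moreover have "is_triangle ?T (?X, ?Y, ?C, ShM ?T X Y F, G', H')" using oS FH G' H' by simp
    ultimately have "(?X, ?Y, ?C, ShM ?T X Y F, G', H') \<in> Tri ?T"
      using f' C' std unfolding H0_Tri_iff H0_simps(6) by metis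
    then show ?thesis unfolding cone_in_def using C by blast
  qed
qed (fact H0_Tri_is_triangle H0_Sh_Obj H0_ShM_Hom H0_ShM_Id H0_ShM_Comp)+

end

text \<open>Reduces locality from arbitrary distinguished triangles to standard ones: the square
  makes \<open>F\<close> and \<open>F'\<close> isomorphic arrows, and bijectivity of precomposition
  passes between such arrows.\<close>

lemma precomp_transport:
  assumes C: "category C" and a: "cat_iso C X X' a" and b: "cat_iso C Y Y' b"
    and F: "F \<in> Hom C X Y" and F': "F' \<in> Hom C X' Y'" and J: "J \<in> Obj C"
    and sq: "Comp C X Y Y' b F = Comp C X X' Y' F' a"
    and bij: "\<And>h. h \<in> Hom C X' J \<Longrightarrow> \<exists>!g. g \<in> Hom C Y' J \<and> Comp C X' Y' J g F' = h"
    and h: "h \<in> Hom C X J"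
  shows "\<exists>!g. g \<in> Hom C Y J \<and> Comp C X Y J g F = h"
proof -
  from a obtain a' where o: "X \<in> Obj C" "X' \<in> Obj C" and aH: "a \<in> Hom C X X'" "a' \<in> Hom C X' X"
    and aa: "Comp C X X' X a' a = Id C X" "Comp C X' X X' a a' = Id C X'" unfolding cat_iso_def by blast
  from b obtain b' where o': "Y \<in> Obj C" "Y' \<in> Obj C" and bH: "b \<in> Hom C Y Y'" "b' \<in> Hom C Y' Y"
    and bb: "Comp C Y Y' Y b' b = Id C Y" "Comp C Y' Y Y' b b' = Id C Y'" unfolding cat_iso_def by blast
  note as = category_assoc[OF C] and cm = category_Comp[OF C]
  have ha: "Comp C X' X J h a' \<in> Hom C X' J" by (rule cm[OF o(2,1) J aH(2) h])
  from bij[OF this] obtain g' where g': "g' \<in> Hom C Y' J" "Comp C X' Y' J g' F' = Comp C X' X J h a'" by blast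
  show ?thesis
  proof
    have "Comp C X Y J (Comp C Y Y' J g' b) F = Comp C X Y' J g' (Comp C X Y Y' b F)"
      by (rule as[OF o(1) o' J F bH(1) g'(1), symmetric])
    also have "\<dots> = Comp C X X' J (Comp C X' Y' J g' F') a"
      unfolding sq by (rule as[OF o o'(2) J aH(1) F' g'(1)])
    also have "\<dots> = h"
      unfolding g'(2) using as[OF o o(1) J aH h] aa(1) category_Id_right[OF C o(1) J h] by simp
    finally show "Comp C Y Y' J g' b \<in> Hom C Y J \<and> Comp C X Y J (Comp C Y Y' J g' b) F = h"
      using cm[OF o' J bH(1) g'(1)] by simp
  next
    fix g assume g: "g \<in> Hom C Y J \<and> Comp C X Y J g F = h"
    have gb: "Comp C Y' Y J g b' \<in> Hom C Y' J" by (rule cm[OF o'(2,1) J bH(2)]) (use g in simp)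
    have gbb: "Comp C Y Y' J (Comp C Y' Y J g b') b = g"
      using as[OF o' o'(1) J bH, of g] g bb(1) category_Id_right[OF C o'(1) J] by simp
    have "Comp C X' Y' J (Comp C Y' Y J g b') F' = Comp C X' X J (Comp C X Y' J (Comp C Y' Y J g b') (Comp C X X' Y' F' a)) a'"
      using as[OF o(2,1) o'(2) J aH(2) cm[OF o o'(2) aH(1) F'] gb] as[OF o(2,1,2) o'(2) aH(2,1) F'] aa(2)
        category_Id_right[OF C o(2) o'(2) F'] by simp
    also have "Comp C X Y' J (Comp C Y' Y J g b') (Comp C X X' Y' F' a) = h"
      unfolding sq[symmetric] using as[OF o(1) o' J F bH(1) gb] gbb g by simp
    finally have "Comp C Y' Y J g b' = g'" using bij[OF ha] g' gb by blast
    then show "g = Comp C Y Y' J g' b" using gbb by simp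
  qed
qed

lemma postcomp_transport:
  assumes C: "category C" and a: "cat_iso C X X' a" and b: "cat_iso C Y Y' b"
    and F: "F \<in> Hom C X Y" and F': "F' \<in> Hom C X' Y'" and P: "P \<in> Obj C"
    and sq: "Comp C X Y Y' b F = Comp C X X' Y' F' a"
    and bij: "\<And>h. h \<in> Hom C P Y' \<Longrightarrow> \<exists>!g. g \<in> Hom C P X' \<and> Comp C P X' Y' F' g = h"
    and h: "h \<in> Hom C P Y"
  shows "\<exists>!g. g \<in> Hom C P X \<and> Comp C P X Y F g = h"
proof -
  from a obtain a' where o: "X \<in> Obj C" "X' \<in> Obj C" and aH: "a \<in> Hom C X X'" "a' \<in> Hom C X' X"
    and aa: "Comp C X X' X a' a = Id C X" "Comp C X' X X' a a' = Id C X'" unfolding cat_iso_def by blast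
  from b obtain b' where o': "Y \<in> Obj C" "Y' \<in> Obj C" and bH: "b \<in> Hom C Y Y'" "b' \<in> Hom C Y' Y"
    and bb: "Comp C Y Y' Y b' b = Id C Y" "Comp C Y' Y Y' b b' = Id C Y'" unfolding cat_iso_def by blast
  note as = category_assoc[OF C] and cm = category_Comp[OF C]
  have bh: "Comp C P Y Y' b h \<in> Hom C P Y'" by (rule cm[OF P o' h bH(1)])
  from bij[OF this] obtain g' where g': "g' \<in> Hom C P X'" "Comp C P X' Y' F' g' = Comp C P Y Y' b h" by blast
  have bk: "Comp C P Y' Y b' (Comp C P Y Y' b k) = k" if "k \<in> Hom C P Y" for k
    using as[OF P o' o'(1) that bH] bb(1) category_Id_left[OF C P o'(1) that] by simp
  have binj: "k = k'" if "k \<in> Hom C P Y" "k' \<in> Hom C P Y" "Comp C P Y Y' b k = Comp C P Y Y' b k'" for k k'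
    using bk[OF that(1)] bk[OF that(2)] that(3) by metis
  have bF: "Comp C P Y Y' b (Comp C P X Y F g) = Comp C P X' Y' F' (Comp C P X X' a g)" if "g \<in> Hom C P X" for g
    using as[OF P o(1) o' that F bH(1)] as[OF P o o'(2) that aH(1) F'] sq by simp
  show ?thesis
  proof
    have ag: "Comp C P X' X a' g' \<in> Hom C P X" by (rule cm[OF P o(2,1) g'(1) aH(2)])
    have "Comp C P X X' a (Comp C P X' X a' g') = g'"
      using as[OF P o(2,1,2) g'(1) aH(2,1)] aa(2) category_Id_left[OF C P o(2) g'(1)] by simp
    then have "Comp C P X Y F (Comp C P X' X a' g') = h"
      using binj[OF cm[OF P o(1) o'(1) ag F] h] bF[OF ag] g'(2) by simp
    with ag show "Comp C P X' X a' g' \<in> Hom C P X \<and> Comp C P X Y F (Comp C P X' X a' g') = h" by simp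
  next
    fix g assume g: "g \<in> Hom C P X \<and> Comp C P X Y F g = h"
    then have "Comp C P X' Y' F' (Comp C P X X' a g) = Comp C P Y Y' b h" using bF by force
    then have "Comp C P X X' a g = g'" using bij[OF bh] g' cm[OF P o _ aH(1)] g by blast
    then show "g = Comp C P X' X a' g'"
      using as[OF P o o(1) _ aH, of g] aa(1) category_Id_left[OF C P o(1)] g by simp
  qed
qed

context dgcat_shifts
begin

text \<open>The long exact sequence of Hom(-, J) for a cone whose Hom complex into \<open>J\<close>
  is acyclic: \<open>cone_data_surj_left\<close> gives existence and
  \<open>cone_data_inj_left\<close> uniqueness of the factorization.\<close>

lemma local_object_H0:
  assumes iso: "\<And>X Y F. cat_iso (H0 E) X Y F \<Longrightarrow> X \<in> A \<Longrightarrow> Y \<in> A"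
    and J: "J \<in> dobj E" "\<And>X. X \<in> A \<Longrightarrow> acyclic_hom X J"
  shows "local_object (H0 E) (cone_in (H0 E) A) J"
  unfolding local_object_def
proof (intro conjI allI impI ballI)
  show JO: "J \<in> Obj (H0 E)" using J(1) by (simp add: H0_simps(1))
  fix X F Y h
  assume XFY: "X \<in> Obj (H0 E) \<and> Y \<in> Obj (H0 E) \<and> F \<in> Hom (H0 E) X Y \<and> (X, F, Y) \<in> cone_in (H0 E) A"
    and h: "h \<in> Hom (H0 E) X J"
  then obtain Z G H where t: "(X, Y, Z, F, G, H) \<in> Tri (H0 E)" and Z: "Z \<in> A" unfolding cone_in_def by blast
  from t obtain X' Y' f C p q i j a b c where B: "cone_data X' Y' f C p q i j" and a: "cat_iso (H0 E) X X' a"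
    and b: "cat_iso (H0 E) Y Y' b" and c: "cat_iso (H0 E) Z C c"
    and sq: "Comp (H0 E) X Y Y' b F = Comp (H0 E) X X' Y' (hc X' Y' f) a" and F: "F \<in> Hom (H0 E) X Y" by (rule H0_Tri_E)
  have C: "acyclic_hom C J" by (rule J(2)[OF iso[OF c Z]])
  note f = cone_dataD(1)[OF B]
  note o = cone_dataD(16,17)[OF B]
  show "\<exists>!g. g \<in> Hom (H0 E) Y J \<and> Comp (H0 E) X Y J g F = h"
  proof (rule precomp_transport[OF category_H0 a b F H0_HomI[OF f] JO sq _ h])
    fix k assume "k \<in> Hom (H0 E) X' J"
    then obtain k0 where k: "clo X' J 0 k0" "k = hc X' J k0" using H0_HomE o J(1) by metis
    obtain g where g: "clo Y' J 0 g" "bdry X' J 0 (g \<cdot> f - k0)" by (rule cone_data_surj_left[OF B C int_degree_0 k(1)])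
    show "\<exists>!g. g \<in> Hom (H0 E) Y' J \<and> Comp (H0 E) X' Y' J g (hc X' Y' f) = k"
    proof
      show "hc Y' J g \<in> Hom (H0 E) Y' J \<and> Comp (H0 E) X' Y' J (hc Y' J g) (hc X' Y' f) = k"
        using H0_HomI[OF g(1)] H0_Comp[OF f g(1)] g(2) k(2) by (simp add: hclass_eq_iff o J(1))
      fix K assume K: "K \<in> Hom (H0 E) Y' J \<and> Comp (H0 E) X' Y' J K (hc X' Y' f) = k"
      then obtain g' where g': "clo Y' J 0 g'" "K = hc Y' J g'" using H0_HomE o J(1) by metis
      have "bdry X' J 0 (g' \<cdot> f - k0)"
        using K H0_Comp[OF f g'(1)] by (simp add: g'(2) k(2) hclass_eq_iff o J(1))
      from bdry_diff[OF this g(2)] have "bdry X' J 0 ((g' - g) \<cdot> f)"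
        using comp_diff_left[OF clo_arr clo_arr clo_arr, OF g'(1) g(1) f] by simp
      from cone_data_inj_left[OF B C int_degree_0 clo_diff[OF g'(1) g(1)] this]
      show "K = hc Y' J g" by (simp add: g'(2) hclass_eq_iff o J(1))
    qed
  qed
qed

lemma colocal_object_H0:
  assumes iso: "\<And>X Y F. cat_iso (H0 E) X Y F \<Longrightarrow> X \<in> A \<Longrightarrow> Y \<in> A"
    and P: "P \<in> dobj E" "\<And>X. X \<in> A \<Longrightarrow> acyclic_hom P X"
  shows "colocal_object (H0 E) (cone_in (H0 E) A) P"
  unfolding colocal_object_def
proof (intro conjI allI impI ballI)
  show PO: "P \<in> Obj (H0 E)" using P(1) by (simp add: H0_simps(1))
  fix X F Y h
  assume XFY: "X \<in> Obj (H0 E) \<and> Y \<in> Obj (H0 E) \<and> F \<in> Hom (H0 E) X Y \<and> (X, F, Y) \<in> cone_in (H0 E) A"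
    and h: "h \<in> Hom (H0 E) P Y"
  then obtain Z G H where t: "(X, Y, Z, F, G, H) \<in> Tri (H0 E)" and Z: "Z \<in> A" unfolding cone_in_def by blast
  from t obtain X' Y' f C p q i j a b c where B: "cone_data X' Y' f C p q i j" and a: "cat_iso (H0 E) X X' a"
    and b: "cat_iso (H0 E) Y Y' b" and c: "cat_iso (H0 E) Z C c"
    and sq: "Comp (H0 E) X Y Y' b F = Comp (H0 E) X X' Y' (hc X' Y' f) a" and F: "F \<in> Hom (H0 E) X Y" by (rule H0_Tri_E)
  have C: "acyclic_hom P C" by (rule P(2)[OF iso[OF c Z]])
  note f = cone_dataD(1)[OF B]
  note o = cone_dataD(16,17)[OF B]
  show "\<exists>!g. g \<in> Hom (H0 E) P X \<and> Comp (H0 E) P X Y F g = h"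
  proof (rule postcomp_transport[OF category_H0 a b F H0_HomI[OF f] PO sq _ h])
    fix k assume "k \<in> Hom (H0 E) P Y'"
    then obtain k0 where k: "clo P Y' 0 k0" "k = hc P Y' k0" using H0_HomE o P(1) by metis
    obtain g where g: "clo P X' 0 g" "bdry P Y' 0 (f \<cdot> g - k0)" by (rule cone_data_surj_right[OF B C int_degree_0 k(1)])
    show "\<exists>!g. g \<in> Hom (H0 E) P X' \<and> Comp (H0 E) P X' Y' (hc X' Y' f) g = k"
    proof
      show "hc P X' g \<in> Hom (H0 E) P X' \<and> Comp (H0 E) P X' Y' (hc X' Y' f) (hc P X' g) = k"
        using H0_HomI[OF g(1)] H0_Comp[OF g(1) f] g(2) k(2) by (simp add: hclass_eq_iff o P(1))
      fix K assume K: "K \<in> Hom (H0 E) P X' \<and> Comp (H0 E) P X' Y' (hc X' Y' f) K = k"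
      then obtain g' where g': "clo P X' 0 g'" "K = hc P X' g'" using H0_HomE o P(1) by metis
      have "bdry P Y' 0 (f \<cdot> g' - k0)"
        using K H0_Comp[OF g'(1) f] by (simp add: g'(2) k(2) hclass_eq_iff o P(1))
      from bdry_diff[OF this g(2)] have "bdry P Y' 0 (f \<cdot> (g' - g))"
        using comp_diff_right[OF clo_arr clo_arr clo_arr, OF f g'(1) g(1)] by simp
      from cone_data_inj_right[OF B C int_degree_0 clo_diff[OF g'(1) g(1)] this]
      show "K = hc P X' g" by (simp add: g'(2) hclass_eq_iff o P(1))
    qed
  qed
qed

end

section \<open>Full DG-subcategories closed under shifts and cones\<close>

context dgcat
begin

lemma cat_iso_H0I:
  assumes "clo X Y 0 f" "clo Y X 0 g" "bdry X X 0 (g \<cdot> f - did E X)" "bdry Y Y 0 (f \<cdot> g - did E Y)"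
  shows "cat_iso (H0 E) X Y (hc X Y f)"
  unfolding cat_iso_def
proof (intro conjI bexI[of _ "hc Y X g"])
  note o = clo_objD[OF assms(1)]
  show "X \<in> Obj (H0 E)" "Y \<in> Obj (H0 E)" using o by (simp_all add: H0_simps(1))
  show "hc X Y f \<in> Hom (H0 E) X Y" "hc Y X g \<in> Hom (H0 E) Y X" by (rule H0_HomI; fact)+
  show "Comp (H0 E) X Y X (hc Y X g) (hc X Y f) = Id (H0 E) X" "Comp (H0 E) Y X Y (hc X Y f) (hc Y X g) = Id (H0 E) Y"
    using assms o by (simp_all add: H0_Comp H0_simps(4) hclass_eq_iff)
qed

text \<open>\<open>j p\<close> is a contracting homotopy. Cones of identities are therefore zero
  objects of the homotopy category, and \<open>contractible_iso\<close> makes all of them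
  isomorphic.\<close>

lemma cone_data_id_contractible:
  assumes B: "cone_data X X (did E X) C p q i j"
  shows "bdry C C 0 (did E C)"
proof -
  note b = cone_dataD[OF B]
  have jp: "arr C C (- e) (j \<cdot> p)" by (rule arr_comp[OF b(2,5)]) simp
  have "d C C (- e) (j \<cdot> p) = d X C (- e) j \<cdot> p - j \<cdot> d C X 0 p" using leib[OF b(2,5), of "- e"] by simp
  also have "d X C (- e) j = i" using b(12) id_right[OF b(15)] by simp
  also have "j \<cdot> d C X 0 p = - (j \<cdot> q)" using b(11) id_left[OF b(14)] comp_minus_right[OF b(5,14)] by simp
  finally have "d C C (- e) (j \<cdot> p) = did E C" using b(10) by simp
  then show ?thesis using bdryI[OF jp, of 0] by simp
qed

lemma contractible_iso:
  assumes "bdry C C 0 (did E C)" "bdry D D 0 (did E D)"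
  shows "\<exists>F. cat_iso (H0 E) C D F"
proof -
  have o: "C \<in> dobj E" "D \<in> dobj E" using assms[THEN bdry_clo, THEN clo_objD(1)] .
  have "cat_iso (H0 E) C D (hc C D 0)"
    by (rule cat_iso_H0I[of _ _ _ 0])
       (use o assms bdry_uminus in \<open>simp_all add: clo_0 comp_0_left[OF arr_0]\<close>)
  then show ?thesis ..
qed

end

lemma full_dg_subcategory_simps [simp]:
  "gsig (full_dg_subcategory E B) = gsig E" "gone (full_dg_subcategory E B) = gone E"
  "dobj (full_dg_subcategory E B) = dobj E \<inter> B" "dhom (full_dg_subcategory E B) = dhom E"
  "dcomp (full_dg_subcategory E B) = dcomp E" "did (full_dg_subcategory E B) = did E"
  "dd (full_dg_subcategory E B) = dd E"
  by (simp_all add: full_dg_subcategory_def)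

lemma full_dg_subcategory_derived [simp]:
  "dsign (full_dg_subcategory E B) = dsign E"
  "dclosed (full_dg_subcategory E B) = dclosed E"
  "hclass (full_dg_subcategory E B) = hclass E"
  "cone_in_cod (full_dg_subcategory E B) = cone_in_cod E"
  by (simp_all add: fun_eq_iff dsign_def dclosed_def hclass_def cone_in_cod_def)

lemma dg_category_full:
  assumes "dg_category E" shows "dg_category (full_dg_subcategory E B)"
proof -
  interpret dgcat E by unfold_locales fact
  \<comment> \<open>Restriction of bounded quantifiers, one rule per number of objects, so that the
    axioms of a DG-category pass to fewer objects as they stand.\<close>
  have sub1: "\<forall>X\<in>A. P X \<Longrightarrow> \<forall>X\<in>A \<inter> B. P X"
    and sub2: "\<forall>X\<in>A. \<forall>Y\<in>A. P2 X Y \<Longrightarrow> \<forall>X\<in>A \<inter> B. \<forall>Y\<in>A \<inter> B. P2 X Y"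
    and sub3: "\<forall>X\<in>A. \<forall>Y\<in>A. \<forall>Z\<in>A. P3 X Y Z \<Longrightarrow> \<forall>X\<in>A \<inter> B. \<forall>Y\<in>A \<inter> B. \<forall>Z\<in>A \<inter> B. P3 X Y Z"
    and sub4: "\<forall>W\<in>A. \<forall>X\<in>A. \<forall>Y\<in>A. \<forall>Z\<in>A. P4 W X Y Z \<Longrightarrow>
      \<forall>W\<in>A \<inter> B. \<forall>X\<in>A \<inter> B. \<forall>Y\<in>A \<inter> B. \<forall>Z\<in>A \<inter> B. P4 W X Y Z"
    for A :: "'a set" and P P2 P3 P4
    by simp_all
  show ?thesis
    unfolding dg_category_def full_dg_subcategory_simps full_dg_subcategory_derived
    by (intro conjI dgD(1) sub2[OF dgD(2)] sub1[OF dgD(3)] sub2[OF dgD(4)] sub3[OF dgD(5)] sub4[OF dgD(6)]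
        sub2[OF dgD(7)] sub3[OF dgD(8)])
qed

text \<open>Closure is stated for arbitrary shifts and cones, so it applies to whichever
  representative has been chosen.\<close>

locale closed_full = dgcat_shifts E for E :: "('o, 'g::ab_group_add, 'm::ab_group_add) dg" +
  fixes B :: "'o set"
  assumes cones: "has_cones E"
    and B_shift: "X \<in> dobj E \<Longrightarrow> X \<in> B \<Longrightarrow> n \<in> {e, - e} \<Longrightarrow> is_shift E n X (Y, u, v) \<Longrightarrow> Y \<in> B"
    and B_cone: "cone_data X Y f C p q i j \<Longrightarrow> X \<in> B \<Longrightarrow> Y \<in> B \<Longrightarrow> C \<in> B"
begin

abbreviation "EB \<equiv> full_dg_subcategory E B"

sublocale F: dgcat_shifts EB
proof
  show "dg_category EB" using dg by (rule dg_category_full)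
  show "has_shifts EB"
    unfolding has_shifts_def
  proof (intro ballI)
    fix X i assume X: "X \<in> dobj EB" and "i \<in> {gone EB, - gone EB}"
    then have X': "X \<in> dobj E" "X \<in> B" and i: "i \<in> {e, - e}" by auto
    obtain Y u v where s: "is_shift E i X (Y, u, v)" using is_shift_chosen[OF X'(1) i] by blast
    then have "is_shift EB i X (Y, u, v)" using B_shift[OF X' i s] by (simp add: is_shift_def)
    then show "\<exists>t. is_shift EB i X t" by blast
  qed
qed

lemma F_clo: "F.clo X Y n f \<longleftrightarrow> clo X Y n f \<and> X \<in> B \<and> Y \<in> B"
  and F_arr: "F.arr X Y n f \<longleftrightarrow> arr X Y n f \<and> X \<in> B \<and> Y \<in> B"
  by (auto simp: F.clo_def clo_def F.arr_def arr_def)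

text \<open>The universal property in \<open>EB\<close> is tested by objects of \<open>B\<close>
  alone. A cone \<open>C0\<close> formed in \<open>E\<close> belongs to \<open>B\<close> too, so
  both cones compare inside \<open>EB\<close>, and the comparison isomorphism transfers the
  universal property to all test objects of \<open>E\<close>.\<close>

lemma F_is_cone:
  assumes f: "clo X Y 0 f" and XY: "X \<in> B" "Y \<in> B" and C: "is_cone EB X Y f (C, p, q)"
  shows "is_cone E X Y f (C, p, q)"
proof -
  note o = clo_objD[OF f]
  obtain C0 p0 q0 where C0: "is_cone E X Y f (C0, p0, q0)"
    using cones f o unfolding has_cones_def by (metis dclosed_iff prod_cases3)
  have C0B: "C0 \<in> B" using B_cone[OF is_cone_cone_data[OF C0 f]] XY .
  note D0 = is_coneD[OF C0 o]
  have oF: "X \<in> dobj EB" "Y \<in> dobj EB" using o XY by auto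
  note D = F.is_coneD[OF C oF, unfolded F_arr F_clo full_dg_subcategory_simps]
  have pa: "arr C Y 0 p" and qa: "arr C X e q" using D(2,3) clo_arr by auto
  have q0a: "arr C0 X e q0" using D0(3) clo_arr by auto
  have CE: "C \<in> dobj E" "C \<in> B" using D(1) by auto
  obtain c where c: "arr C0 C 0 c" "p \<cdot> c = p0" "q \<cdot> c = q0"
    using D(5)[of C0 0 p0 q0] D0(2) q0a C0B XY by auto
  obtain c' where c': "arr C C0 0 c'" "p0 \<cdot> c' = p" "q0 \<cdot> c' = q"
    using D0(5)[of C 0 p q] pa qa by auto
  have cc: "arr C C 0 (c \<cdot> c')" by (rule arr_comp[OF c'(1) c(1)]) simp
  have "c \<cdot> c' = did E C"
  proof (rule F.is_cone_ext[OF C oF, of C 0, unfolded F_arr full_dg_subcategory_simps])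
    show "p \<cdot> c \<cdot> c' = p \<cdot> did E C" "q \<cdot> c \<cdot> c' = q \<cdot> did E C"
      using assoc[OF c'(1) c(1) pa] assoc[OF c'(1) c(1) qa] c c' id_right[OF pa] id_right[OF qa] by simp_all
  qed (use cc CE arr_id in auto)
  have "\<exists>!k. arr Z C n k \<and> p \<cdot> k = y \<and> q \<cdot> k = x" if y: "arr Z Y n y" and x: "arr Z X (n + e) x" for Z n y x
  proof -
    obtain k0 where k0: "arr Z C0 n k0" "p0 \<cdot> k0 = y" "q0 \<cdot> k0 = x" using D0(5)[OF y x] by auto
    show ?thesis
    proof
      show "arr Z C n (c \<cdot> k0) \<and> p \<cdot> c \<cdot> k0 = y \<and> q \<cdot> c \<cdot> k0 = x"
        using arr_comp[OF k0(1) c(1)] assoc[OF k0(1) c(1) pa] assoc[OF k0(1) c(1) qa] c k0 by simp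
    next
      fix k assume k: "arr Z C n k \<and> p \<cdot> k = y \<and> q \<cdot> k = x"
      then have ka: "arr Z C n k" by simp
      have c'k: "arr Z C0 n (c' \<cdot> k)" by (rule arr_comp[OF ka c'(1)]) simp
      have "c' \<cdot> k = k0"
        by (rule is_cone_ext[OF C0 o c'k k0(1)])
           (use assoc[OF ka c'(1) D0(2)] assoc[OF ka c'(1) q0a] c' k k0 in simp_all)
      then show "k = c \<cdot> k0"
        using assoc[OF ka c'(1) c(1)] \<open>c \<cdot> c' = did E C\<close> id_left[OF ka] by simp
    qed
  qed
  then show ?thesis
    using pa D(3,4) CE unfolding is_cone_def by (simp add: clo_def arr_def)
qed

lemma triangulated_functor_inclusion: "triangulated_functor (H0 EB) (H0 E) inclusion_functor"
proof -
  have I: "FO inclusion_functor X = X" "FM inclusion_functor X Y f = f" for X Y :: 'o and f :: "'m set"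
    by (simp_all add: inclusion_functor_def)
  have CompB: "Comp (H0 EB) = Comp (H0 E)" by (simp add: fun_eq_iff H0_simps F.H0_simps)
  have HomB: "Hom (H0 EB) = Hom (H0 E)" by (simp add: fun_eq_iff H0_simps F.H0_simps)
  have ObjB: "X \<in> Obj (H0 EB) \<longleftrightarrow> X \<in> dobj E \<and> X \<in> B" for X by (simp add: F.H0_simps)
  have isoB: "cat_iso (H0 E) X Y a" if "cat_iso (H0 EB) X Y a" for X Y a
    using that unfolding cat_iso_def by (simp add: CompB HomB F.H0_simps(1,4) H0_simps(1,4))
  have i: "e \<in> {e, - e}" and iB: "e \<in> {gone EB, - gone EB}" by simp_all
  have XB: "X \<in> dobj EB" if "X \<in> dobj E" "X \<in> B" for X using that by simp
  \<comment> \<open>\<open>E\<close> and \<open>EB\<close> choose \<open>X[1]\<close> independently;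
    this is the canonical isomorphism between the two choices.\<close>
  define \<eta> where "\<eta> X = ts e X \<cdot> F.fs e X" for X
  have FS: "F.sh e X \<in> dobj E" "F.sh e X \<in> B" "clo X (F.sh e X) (- e) (F.ts e X)" "clo (F.sh e X) X e (F.fs e X)"
    "F.fs e X \<cdot> F.ts e X = did E X" "F.ts e X \<cdot> F.fs e X = did E (F.sh e X)" if "X \<in> dobj E" "X \<in> B" for X
    using F.shift[OF XB[OF that] iB] by (simp_all add: F_clo)
  note ES = shift[OF _ i]
  have \<eta>: "clo (F.sh e X) (sh e X) 0 (\<eta> X)" if "X \<in> dobj E" "X \<in> B" for X
    unfolding \<eta>_def by (rule clo_comp[OF FS(4)[OF that] ES(2)[OF that(1)]]) simp
  have iso: "cat_iso (H0 E) (F.sh e X) (sh e X) (hc (F.sh e X) (sh e X) (\<eta> X))" if X: "X \<in> dobj E" "X \<in> B" for X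
  proof (rule cat_iso_H0I[OF \<eta>[OF X]])
    note a = FS(3,4)[OF X, THEN clo_arr] ES(2,3)[OF X(1), THEN clo_arr]
    show "clo (sh e X) (F.sh e X) 0 (F.ts e X \<cdot> fs e X)" by (rule clo_comp[OF ES(3)[OF X(1)] FS(3)[OF X]]) simp
    have 1: "(F.ts e X \<cdot> fs e X) \<cdot> ts e X \<cdot> F.fs e X = did E (F.sh e X)"
      using assoc[OF arr_comp[OF a(2,3) refl] a(4,1)] assoc[OF a(2,3,4)] ES(4)[OF X(1)] id_left[OF a(2)] FS(6)[OF X] by simp
    have 2: "(ts e X \<cdot> F.fs e X) \<cdot> F.ts e X \<cdot> fs e X = did E (sh e X)"
      using assoc[OF arr_comp[OF a(4,1) refl] a(2,3)] assoc[OF a(4,1,2)] FS(5)[OF X] id_left[OF a(4)] ES(5)[OF X(1)] by simp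
    show "bdry (F.sh e X) (F.sh e X) 0 ((F.ts e X \<cdot> fs e X) \<cdot> \<eta> X - did E (F.sh e X))"
      "bdry (sh e X) (sh e X) 0 (\<eta> X \<cdot> F.ts e X \<cdot> fs e X - did E (sh e X))"
      unfolding \<eta>_def 1 2 using FS(1)[OF X] ES(1)[OF X(1)] by (simp_all add: bdry_0)
  qed
  have nat: "Comp (H0 E) (F.sh e X) (F.sh e Y) (sh e Y) (hc (F.sh e Y) (sh e Y) (\<eta> Y)) (ShM (H0 EB) X Y F) =
      Comp (H0 E) (F.sh e X) (sh e X) (sh e Y) (ShM (H0 E) X Y F) (hc (F.sh e X) (sh e X) (\<eta> X))"
    if X: "X \<in> dobj E" "X \<in> B" and Y: "Y \<in> dobj E" "Y \<in> B" and F: "F \<in> Hom (H0 E) X Y" for X Y F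
  proof -
    obtain f where f: "clo X Y 0 f" "F = hc X Y f" using H0_HomE[OF F X(1) Y(1)] .
    have Ff: "F.clo X Y 0 f" using f X Y by (simp add: F_clo)
    note fa = clo_arr[OF f(1)]
    have Fsm: "clo (F.sh e X) (F.sh e Y) 0 (shift_mor EB e X Y f)" using F.clo_shift_mor[OF Ff iB] by (simp add: F_clo)
    note sm = clo_shift_mor[OF f(1) i]
    note aX = FS(4)[OF X, THEN clo_arr] ES(2)[OF X(1), THEN clo_arr]
      and aY = FS(4)[OF Y, THEN clo_arr] ES(2)[OF Y(1), THEN clo_arr]
    have "\<eta> Y \<cdot> shift_mor EB e X Y f = ts e Y \<cdot> F.fs e Y \<cdot> shift_mor EB e X Y f"
      unfolding \<eta>_def by (rule assoc[OF clo_arr[OF Fsm] aY])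
    also have "F.fs e Y \<cdot> shift_mor EB e X Y f = f \<cdot> F.fs e X"
      using F.fs_shift_mor[OF F.clo_arr[OF Ff] iB] by simp
    also have "ts e Y \<cdot> f \<cdot> F.fs e X = (shift_mor E e X Y f \<cdot> ts e X) \<cdot> F.fs e X"
      using shift_mor_ts[OF fa i] assoc[OF aX(1) fa aY(2)] by simp
    also have "\<dots> = shift_mor E e X Y f \<cdot> \<eta> X"
      unfolding \<eta>_def by (rule assoc[OF aX clo_arr[OF sm]])
    finally show ?thesis
      using F.H0_ShM[OF Ff] by (simp add: f(2) H0_ShM[OF f(1)] H0_Comp[OF Fsm \<eta>[OF Y]] H0_Comp[OF \<eta>[OF X] sm])
  qed
  have tri: "(X, Y, Z, F, G, Comp (H0 E) Z (F.sh e X) (sh e X) (hc (F.sh e X) (sh e X) (\<eta> X)) H) \<in> Tri (H0 E)"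
    if t: "(X, Y, Z, F, G, H) \<in> Tri (H0 EB)" for X Y Z F G H
  proof -
    from t obtain X' Y' f C p q where f: "F.clo X' Y' 0 f" and C: "is_cone EB X' Y' f (C, p, q)"
      and ti: "triangle_iso (H0 EB) (X, Y, Z, F, G, H) (F.std X' Y' f C p q)" unfolding F.H0_Tri_iff by auto
    have f': "clo X' Y' 0 f" and X'B: "X' \<in> B" "Y' \<in> B" using f by (simp_all add: F_clo)
    note C' = F_is_cone[OF f' X'B C]
    note b = cone_dataD[OF is_cone_cone_data[OF C' f']]
    from F.H0_Tri_is_triangle[OF t] have X: "X \<in> dobj E" "X \<in> B" and Y: "Y \<in> dobj E" and Z: "Z \<in> dobj E"
      and FGH: "F \<in> Hom (H0 E) X Y" "G \<in> Hom (H0 E) Y Z" "H \<in> Hom (H0 E) Z (F.sh e X)"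
      by (simp_all add: ObjB HomB F.H0_simps(6))
    let ?\<eta> = "\<lambda>X. hc (F.sh e X) (sh e X) (\<eta> X)"
    have \<eta>H: "?\<eta> X \<in> Hom (H0 E) (F.sh e X) (sh e X)" using H0_HomI[OF \<eta>[OF X]] .
    have \<eta>H': "?\<eta> X' \<in> Hom (H0 E) (F.sh e X') (sh e X')" using H0_HomI[OF \<eta>[OF b(16) X'B(1)]] .
    from ti obtain a b' c where a: "cat_iso (H0 EB) X X' a" and b': "cat_iso (H0 EB) Y Y' b'" and c: "cat_iso (H0 EB) Z C c"
      and sq: "Comp (H0 E) X Y Y' b' F = Comp (H0 E) X X' Y' (hc X' Y' f) a"
      "Comp (H0 E) Y Z C c G = Comp (H0 E) Y Y' C (hc Y' C (cone_in_cod E Y' (C, p, q))) b'"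
      "Comp (H0 E) Z (F.sh e X) (F.sh e X') (ShM (H0 EB) X X' a) H =
        Comp (H0 E) Z C (F.sh e X') (hc C (F.sh e X') (F.ts e X' \<cdot> q)) c"
      by (auto simp: F.std_def CompB F.H0_simps(6))
    have aH: "a \<in> Hom (H0 E) X X'" and cH: "c \<in> Hom (H0 E) Z C" using a c by (simp_all add: cat_iso_def HomB)
    have o: "X \<in> Obj (H0 E)" "Z \<in> Obj (H0 E)" "C \<in> Obj (H0 E)" "F.sh e X \<in> Obj (H0 E)" "F.sh e X' \<in> Obj (H0 E)"
      "sh e X \<in> Obj (H0 E)" "sh e X' \<in> Obj (H0 E)" "X' \<in> Obj (H0 E)"
      using X Z b(16,18) FS(1)[OF X] FS(1)[OF b(16) X'B(1)] ES(1)[OF X(1)] ES(1)[OF b(16)] by (simp_all add: H0_simps(1))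
    note cat = category_H0 and as = category_assoc[OF category_H0]
    have SaB: "ShM (H0 EB) X X' a \<in> Hom (H0 E) (F.sh e X) (F.sh e X')"
      using F.H0_ShM_Hom[of X X' a] X b(16) X'B aH by (simp add: ObjB HomB F.H0_simps(6))
    have Sa: "ShM (H0 E) X X' a \<in> Hom (H0 E) (sh e X) (sh e X')"
      using H0_ShM_Hom[of X X' a] o aH by (simp add: H0_simps(6))
    have Ft: "clo C (F.sh e X') 0 (F.ts e X' \<cdot> q)" by (rule clo_comp[OF b(3) FS(3)[OF b(16) X'B(1)]]) simp
    \<comment> \<open>The last morphisms of the standard triangles of \<open>EB\<close> and of
      \<open>E\<close> differ exactly by \<open>\<eta>\<close>.\<close>
    have "\<eta> X' \<cdot> F.ts e X' \<cdot> q = ts e X' \<cdot> q"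
    proof -
      note aa = FS(3,4)[OF b(16) X'B(1), THEN clo_arr] ES(2)[OF b(16), THEN clo_arr]
      show ?thesis
        unfolding \<eta>_def using assoc[OF clo_arr[OF Ft] aa(2,3)] assoc[OF b(14) aa(1,2)] FS(5)[OF b(16) X'B(1)] id_left[OF b(14)]
        by simp
    qed
    then have ht: "Comp (H0 E) C (F.sh e X') (sh e X') (?\<eta> X') (hc C (F.sh e X') (F.ts e X' \<cdot> q)) = hc C (sh e X') (ts e X' \<cdot> q)"
      using H0_Comp[OF Ft \<eta>[OF b(16) X'B(1)]] by simp
    have "Comp (H0 E) Z (sh e X) (sh e X') (ShM (H0 E) X X' a) (Comp (H0 E) Z (F.sh e X) (sh e X) (?\<eta> X) H) =
      Comp (H0 E) Z (F.sh e X) (sh e X') (Comp (H0 E) (F.sh e X) (sh e X) (sh e X') (ShM (H0 E) X X' a) (?\<eta> X)) H"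
      by (rule as[OF o(2,4,6,7) FGH(3) \<eta>H Sa])
    also have "\<dots> = Comp (H0 E) Z (F.sh e X) (sh e X') (Comp (H0 E) (F.sh e X) (F.sh e X') (sh e X') (?\<eta> X') (ShM (H0 EB) X X' a)) H"
      using nat[OF X b(16) X'B(1) aH] by simp
    also have "\<dots> = Comp (H0 E) Z (F.sh e X') (sh e X') (?\<eta> X') (Comp (H0 E) Z C (F.sh e X') (hc C (F.sh e X') (F.ts e X' \<cdot> q)) c)"
      unfolding sq(3)[symmetric] by (rule as[OF o(2,4,5,7) FGH(3) SaB \<eta>H', symmetric])
    also have "\<dots> = Comp (H0 E) Z C (sh e X') (hc C (sh e X') (ts e X' \<cdot> q)) c"
      unfolding ht[symmetric] by (rule as[OF o(2,3,5,7) cH H0_HomI[OF Ft] \<eta>H'])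
    finally have "triangle_iso (H0 E) (X, Y, Z, F, G, Comp (H0 E) Z (F.sh e X) (sh e X) (?\<eta> X) H) (std X' Y' f C p q)"
      unfolding std_def triangle_iso.simps H0_simps(6) using isoB[OF a] isoB[OF b'] isoB[OF c] sq(1,2) by blast
    moreover have "is_triangle (H0 E) (X, Y, Z, F, G, Comp (H0 E) Z (F.sh e X) (sh e X) (?\<eta> X) H)"
      using X Y Z FGH category_Comp[OF cat o(2,4,6) FGH(3) \<eta>H] by (simp add: H0_simps(1,6))
    ultimately show ?thesis unfolding H0_Tri_iff using f' C' by blast
  qed
  have "is_functor (H0 EB) (H0 E) inclusion_functor"
    unfolding is_functor_def I
    using category_H0 F.category_H0 by (simp add: CompB HomB F.H0_simps(1,4) H0_simps(1,4))
  then show ?thesis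
    unfolding triangulated_functor_def I
    using iso nat tri
    by (intro conjI exI[of _ "\<lambda>X. hc (F.sh e X) (sh e X) (\<eta> X)"])
       (simp_all add: ObjB HomB H0_simps(6) F.H0_simps(6) H0_simps(5) F.H0_simps(5))
qed

end

section \<open>Totalizations of short exact sequences\<close>

context dgcat
begin

text \<open>
  A chase through the total complex of the three-term exact sequence of Hom complexes: \<open>l'\<close> and \<open>z\<close>
  below successively kill the components of a cocycle.
\<close>

lemma totalization_acyclic_left:
  assumes B: "cone_data K L f C p q i j" and B': "cone_data C M (g \<cdot> p) T p' q' i' j'" and g: "clo L M 0 g"
    and ext: "\<And>n k. int_degree n \<Longrightarrow> arr K J n k \<Longrightarrow> \<exists>l. arr L J n l \<and> l \<cdot> f = k"
    and cok: "\<And>n l. int_degree n \<Longrightarrow> arr L J n l \<Longrightarrow> l \<cdot> f = 0 \<Longrightarrow> \<exists>m. arr M J n m \<and> m \<cdot> g = l"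
    and inj: "\<And>n m. int_degree n \<Longrightarrow> arr M J n m \<Longrightarrow> m \<cdot> g = 0 \<Longrightarrow> m = 0"
  shows "acyclic_hom T J"
  unfolding acyclic_hom_def
proof (intro allI impI)
  fix n w assume n: "int_degree n" and w: "clo T J n w"
  note b = cone_dataD[OF B] and b' = cone_dataD[OF B'] and ga = clo_arr[OF g] and wa = clo_arr[OF w]
  have J: "J \<in> dobj E" using clo_objD[OF w] by simp
  have n1: "int_degree (n - e)" and n2: "int_degree (n - e - e)" using n int_degree_minus by blast+
  \<comment> \<open>Components of \<open>w\<close> for the graded decomposition of \<open>T\<close>
    into \<open>M\<close>, \<open>L[1]\<close> and \<open>K[2]\<close>; \<open>c\<close> joins the
    last two, and the degrees drop accordingly.\<close>
  define m where "m = w \<cdot> i'"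
  define c where "c = w \<cdot> j'"
  define l where "l = c \<cdot> i"
  define k where "k = c \<cdot> j"
  have m: "clo M J n m" unfolding m_def by (rule clo_comp[OF b'(4) w]) simp
  have c: "arr C J (n - e) c" unfolding c_def by (rule arr_comp[OF b'(5) wa]) simp
  have l: "arr L J (n - e) l" unfolding l_def by (rule arr_comp[OF b(15) c]) simp
  have k: "arr K J (n - e - e) k" unfolding k_def by (rule arr_comp[OF b(5) c]) simp
  note ma = clo_arr[OF m]
  have mg: "arr L J n (m \<cdot> g)" by (rule arr_comp[OF ga ma]) simp
  have "d C J (n - e) c = sg n (w \<cdot> d C T (- e) j')" unfolding c_def by (rule d_comp_clo_left[OF w b'(5)]) simp
  also have "w \<cdot> d C T (- e) j' = (m \<cdot> g) \<cdot> p"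
    using b'(12) assoc[OF b'(13,15) wa] assoc[OF b(2) ga ma] by (simp add: m_def)
  finally have dc: "d C J (n - e) c = sg n ((m \<cdot> g) \<cdot> p)" .
  have mgp: "arr C J n ((m \<cdot> g) \<cdot> p)" by (rule arr_comp[OF b(2) mg]) simp
  have "d L J (n - e) l = d C J (n - e) c \<cdot> i" unfolding l_def by (rule d_comp_clo_right[OF b(4) c]) simp
  also have "\<dots> = sg n (m \<cdot> g)"
    unfolding dc using comp_sg_left[OF mgp b(15)] assoc[OF b(15,2) mg] b(6) id_right[OF mg] by simp
  finally have dl: "d L J (n - e) l = sg n (m \<cdot> g)" .
  have "d K J (n - e - e) k = d C J (n - e) c \<cdot> j + sg (n - e) (c \<cdot> d K C (- e) j)"
    unfolding k_def by (rule leib[OF b(5) c]) simp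
  also have "d C J (n - e) c \<cdot> j = 0"
    unfolding dc using comp_sg_left[OF mgp b(5)] assoc[OF b(5,2) mg] b(8) comp_0_right[OF mg b(16)] by simp
  also have "c \<cdot> d K C (- e) j = l \<cdot> f" using b(12) assoc[OF b(13,15) c] by (simp add: l_def)
  finally have dk: "d K J (n - e - e) k = - sg n (l \<cdot> f)" by (simp add: sg_diff sg_uminus)
  \<comment> \<open>The extension property is spent on \<open>k\<close>: the differential of the
    extension \<open>l'\<close> corrects \<open>l\<close> so that it vanishes on \<open>K\<close>
    and hence factors through \<open>g\<close>.\<close>
  obtain l' where l': "arr L J (n - e - e) l'" "l' \<cdot> f = k" using ext[OF n2 k] by blast
  have dl': "arr L J (n - e) (d L J (n - e - e) l')" by (rule arr_d[OF l'(1)]) simp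
  have "d L J (n - e - e) l' \<cdot> f = d K J (n - e - e) k"
    unfolding l'(2)[symmetric] by (rule d_comp_clo_right[OF b(1) l'(1), symmetric]) simp
  then have "(l + sg n (d L J (n - e - e) l')) \<cdot> f = 0"
    using comp_add_left[OF l arr_sg[OF dl'] b(13)] comp_sg_left[OF dl' b(13)] dk by (simp add: sg_uminus)
  from cok[OF n1 arr_add[OF l arr_sg[OF dl']] this]
  obtain z where z: "arr M J (n - e) z" "z \<cdot> g = l + sg n (d L J (n - e - e) l')" by blast
  have dz: "arr M J n (d M J (n - e) z)" by (rule arr_d[OF z(1)]) simp
  have "d M J (n - e) z \<cdot> g = d L J (n - e) (z \<cdot> g)" by (rule d_comp_clo_right[OF g z(1), symmetric]) simp
  also have "\<dots> = sg n (m \<cdot> g)"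
    unfolding z(2) using d_add[OF l arr_sg[OF dl']] d_sg[OF dl'] d_d[OF l'(1)] dl by simp
  finally have "(m - sg n (d M J (n - e) z)) \<cdot> g = 0"
    using comp_diff_left[OF ma arr_sg[OF dz] ga] comp_sg_left[OF dz ga] by simp
  \<comment> \<open>Nothing is left to be solved for \<open>m\<close>: since graded morphisms are
    determined by their composites with \<open>g\<close>, the \<open>z\<close> found for
    \<open>l\<close> also provides a primitive of \<open>m\<close>.\<close>
  from inj[OF n arr_diff[OF ma arr_sg[OF dz]] this] have mz: "m = sg n (d M J (n - e) z)" by simp
  have zp: "arr T J (n - e) (z \<cdot> p')" by (rule arr_comp[OF b'(2) z(1)]) simp
  have lp: "arr C J (n - e - e) (l' \<cdot> p)" by (rule arr_comp[OF b(2) l'(1)]) simp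
  have lpq: "arr T J (n - e) ((l' \<cdot> p) \<cdot> q')" by (rule arr_comp[OF b'(14) lp]) simp
  have kq: "arr C J (n - e) (k \<cdot> q)" by (rule arr_comp[OF b(14) k]) simp
  have dlp: "arr C J (n - e) (d L J (n - e - e) l' \<cdot> p)" by (rule arr_comp[OF b(2) dl']) simp
  have zgp: "arr C J (n - e) ((z \<cdot> g) \<cdot> p)"
    by (rule arr_comp[OF b(2) arr_comp[OF ga z(1) refl]]) simp
  have "d T J (n - e) (z \<cdot> p') = d M J (n - e) z \<cdot> p' + sg (n - e) (z \<cdot> d T M 0 p')"
    by (rule leib[OF b'(2) z(1)]) simp
  also have "z \<cdot> d T M 0 p' = - (((z \<cdot> g) \<cdot> p) \<cdot> q')"
    using b'(11) comp_minus_right[OF z(1) arr_comp[OF b'(14,13) refl]] assoc[OF b'(14,13) z(1)] assoc[OF b(2) ga z(1)] by simp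
  finally have 1: "d T J (n - e) (z \<cdot> p') = d M J (n - e) z \<cdot> p' + sg n (((z \<cdot> g) \<cdot> p) \<cdot> q')"
    by (simp add: sg_diff sg_uminus)
  have "d C J (n - e - e) (l' \<cdot> p) = d L J (n - e - e) l' \<cdot> p + sg (n - e - e) (l' \<cdot> d C L 0 p)"
    by (rule leib[OF b(2) l'(1)]) simp
  also have "l' \<cdot> d C L 0 p = - (k \<cdot> q)"
    using b(11) comp_minus_right[OF l'(1) arr_comp[OF b(14,13) refl]] assoc[OF b(14,13) l'(1)] l'(2) by simp
  finally have "d C J (n - e - e) (l' \<cdot> p) = d L J (n - e - e) l' \<cdot> p - sg n (k \<cdot> q)"
    by (simp add: sg_diff sg_uminus)
  moreover have "d T J (n - e) ((l' \<cdot> p) \<cdot> q') = d C J (n - e - e) (l' \<cdot> p) \<cdot> q'"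
    by (rule d_comp_clo_right[OF b'(3) lp]) simp
  ultimately have 2: "d T J (n - e) ((l' \<cdot> p) \<cdot> q') = (d L J (n - e - e) l' \<cdot> p) \<cdot> q' - sg n ((k \<cdot> q) \<cdot> q')"
    using comp_diff_left[OF dlp arr_sg[OF kq] b'(14)] comp_sg_left[OF kq b'(14)] by simp
  have 3: "(z \<cdot> g) \<cdot> p = l \<cdot> p + sg n (d L J (n - e - e) l' \<cdot> p)"
    unfolding z(2) using comp_add_left[OF l arr_sg[OF dl'] b(2)] comp_sg_left[OF dl' b(2)] by simp
  have lpa: "arr C J (n - e) (l \<cdot> p)" by (rule arr_comp[OF b(2) l]) simp
  have 4: "((z \<cdot> g) \<cdot> p) \<cdot> q' = (l \<cdot> p) \<cdot> q' + sg n ((d L J (n - e - e) l' \<cdot> p) \<cdot> q')"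
    unfolding 3 using comp_add_left[OF lpa arr_sg[OF dlp] b'(14)] comp_sg_left[OF dlp b'(14)] by simp
  have "c = l \<cdot> p + k \<cdot> q" using cone_data_expand_right[OF B c] by (simp add: l_def k_def)
  then have "c \<cdot> q' = (l \<cdot> p) \<cdot> q' + (k \<cdot> q) \<cdot> q'" using comp_add_left[OF lpa kq b'(14)] by simp
  then have "w = m \<cdot> p' + ((l \<cdot> p) \<cdot> q' + (k \<cdot> q) \<cdot> q')"
    using cone_data_expand_right[OF B' wa] by (simp add: m_def c_def)
  moreover have "m \<cdot> p' = sg n (d M J (n - e) z \<cdot> p')" unfolding mz by (rule comp_sg_left[OF dz b'(2)])
  \<comment> \<open>\<open>z\<close> and \<open>l'\<close> placed on their summands of
    \<open>T\<close>; the terms in \<open>d l'\<close> that come from both of them cancel.\<close>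
  moreover define u where "u = sg n (z \<cdot> p') - sg n ((l' \<cdot> p) \<cdot> q')"
  ultimately have "d T J (n - e) u = w"
    using d_diff[OF arr_sg[OF zp] arr_sg[OF lpq]] d_sg[OF zp] d_sg[OF lpq] 1 2 4
    by (simp add: dsign_def split: if_splits)
  moreover have "arr T J (n - e) u" unfolding u_def by (rule arr_diff[OF arr_sg[OF zp] arr_sg[OF lpq]])
  ultimately show "bdry T J n w" unfolding bdry_def by metis
qed

text \<open>The dual chase starts at \<open>M\<close>, where lifting applies: \<open>l'\<close>
  lifts \<open>m\<close>, then \<open>z\<close> lifts the corrected \<open>l\<close> to
  \<open>K\<close>, and injectivity of composition with \<open>f\<close> identifies
  \<open>k\<close>.\<close>

lemma totalization_acyclic_right:
  assumes B: "cone_data K L f C p q i j" and B': "cone_data C M (g \<cdot> p) T p' q' i' j'" and g: "clo L M 0 g"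
    and lift: "\<And>n m. int_degree n \<Longrightarrow> arr P M n m \<Longrightarrow> \<exists>l. arr P L n l \<and> g \<cdot> l = m"
    and ker: "\<And>n l. int_degree n \<Longrightarrow> arr P L n l \<Longrightarrow> g \<cdot> l = 0 \<Longrightarrow> \<exists>k. arr P K n k \<and> f \<cdot> k = l"
    and inj: "\<And>n k. int_degree n \<Longrightarrow> arr P K n k \<Longrightarrow> f \<cdot> k = 0 \<Longrightarrow> k = 0"
  shows "acyclic_hom P T"
  unfolding acyclic_hom_def
proof (intro allI impI)
  fix n w assume n: "int_degree n" and w: "clo P T n w"
  note b = cone_dataD[OF B] and b' = cone_dataD[OF B'] and ga = clo_arr[OF g] and wa = clo_arr[OF w]
  have P: "P \<in> dobj E" using clo_objD[OF w] by simp
  have n1: "int_degree (n + e)" and n2: "int_degree (n + e + e)" using n int_degree_plus by blast+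
  define m where "m = p' \<cdot> w"
  define c where "c = q' \<cdot> w"
  define l where "l = p \<cdot> c"
  define k where "k = q \<cdot> c"
  have m: "arr P M n m" unfolding m_def by (rule arr_comp[OF wa b'(2)]) simp
  have c: "clo P C (n + e) c" unfolding c_def by (rule clo_comp[OF w b'(3)]) (rule add.commute)
  note ca = clo_arr[OF c]
  have l: "arr P L (n + e) l" unfolding l_def by (rule arr_comp[OF ca b(2)]) simp
  have k: "clo P K (n + e + e) k" unfolding k_def by (rule clo_comp[OF c b(3)]) (rule add.commute)
  note ka = clo_arr[OF k]
  have "d P L (n + e) l = d C L 0 p \<cdot> c" unfolding l_def by (rule d_comp_clo_right[OF c b(2)]) simp
  also have "\<dots> = - (f \<cdot> k)"
    using b(11) comp_minus_left[OF arr_comp[OF b(14,13) refl] ca] assoc[OF ca b(14,13)] by (simp add: k_def)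
  finally have dl: "d P L (n + e) l = - (f \<cdot> k)" .
  have "d P M n m = d T M 0 p' \<cdot> w" unfolding m_def by (rule d_comp_clo_right[OF w b'(2)]) simp
  also have "\<dots> = - (g \<cdot> l)"
    using b'(11) comp_minus_left[OF arr_comp[OF b'(14,13) refl] wa] assoc[OF wa b'(14,13)] assoc[OF ca b(2) ga]
    by (simp add: c_def l_def)
  finally have dm: "d P M n m = - (g \<cdot> l)" .
  obtain l' where l': "arr P L n l'" "g \<cdot> l' = m" using lift[OF n m] by blast
  have dl': "arr P L (n + e) (d P L n l')" by (rule arr_d[OF l'(1)]) simp
  have "g \<cdot> d P L n l' = d P M n m" using d_comp_clo_left[OF g l'(1), of n] l'(2) by simp
  then have "g \<cdot> (d P L n l' + l) = 0" using comp_add_right[OF ga dl' l] dm by simp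
  from ker[OF n1 arr_add[OF dl' l] this] obtain z where z: "arr P K (n + e) z" "f \<cdot> z = d P L n l' + l" by blast
  have dz: "arr P K (n + e + e) (d P K (n + e) z)" by (rule arr_d[OF z(1)]) simp
  have "f \<cdot> d P K (n + e) z = d P L (n + e) (f \<cdot> z)" using d_comp_clo_left[OF b(1) z(1), of "n + e"] by simp
  also have "\<dots> = - (f \<cdot> k)" unfolding z(2) using d_add[OF dl' l] d_d[OF l'(1)] dl by simp
  finally have "f \<cdot> (d P K (n + e) z + k) = 0" using comp_add_right[OF b(13) dz ka] by simp
  from inj[OF n2 arr_add[OF dz ka] this] have kz: "k = - d P K (n + e) z" by (simp add: eq_neg_iff_add_eq_0 add.commute)
  have il: "arr P C n (i \<cdot> l')" by (rule arr_comp[OF l'(1) b(15)]) simp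
  have jz: "arr P C n (j \<cdot> z)" by (rule arr_comp[OF z(1) b(5)]) simp
  \<comment> \<open>A primitive of \<open>w\<close> can be sought as \<open>j' v\<close> with
    \<open>v\<close> in \<open>C\<close>; this requires \<open>g p v = m\<close> and
    \<open>d v = - c\<close>.\<close>
  define v where "v = i \<cdot> l' - j \<cdot> z"
  have v: "arr P C n v" unfolding v_def by (rule arr_diff[OF il jz])
  have "d P C n (i \<cdot> l') = i \<cdot> d P L n l'" using d_comp_clo_left[OF b(4) l'(1), of n] by simp
  moreover have "d P C n (j \<cdot> z) = (i \<cdot> f) \<cdot> z - j \<cdot> d P K (n + e) z"
    using leib[OF z(1) b(5), of n] b(12) by simp
  moreover have "(i \<cdot> f) \<cdot> z = i \<cdot> d P L n l' + i \<cdot> l"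
    using assoc[OF z(1) b(13,15)] z(2) comp_add_right[OF b(15) dl' l] by simp
  moreover have "j \<cdot> k = - (j \<cdot> d P K (n + e) z)" unfolding kz by (rule comp_minus_right[OF b(5) dz])
  moreover have "c = i \<cdot> l + j \<cdot> k" using cone_data_expand_left[OF B ca] by (simp add: l_def k_def)
  ultimately have dv: "d P C n v = - c" using d_diff[OF il jz] by (simp add: v_def)
  have pv: "p \<cdot> v = l'"
  proof -
    have "p \<cdot> i \<cdot> l' = l'" "p \<cdot> j \<cdot> z = 0"
      using assoc[OF l'(1) b(15,2)] assoc[OF z(1) b(5,2)] b(6,8) id_left[OF l'(1)] comp_0_left[OF z(1) b(17)] by simp_all
    then show ?thesis using comp_diff_right[OF b(2) il jz] by (simp add: v_def)
  qed
  have jv: "arr P T (n - e) (j' \<cdot> v)" by (rule arr_comp[OF v b'(5)]) simp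
  have "d P T (n - e) (j' \<cdot> v) = d C T (- e) j' \<cdot> v - j' \<cdot> d P C n v"
    using leib[OF v b'(5), of "n - e"] by simp
  also have "d C T (- e) j' \<cdot> v = i' \<cdot> m"
    using b'(12) assoc[OF v b'(13,15)] assoc[OF v b(2) ga] pv l'(2) by simp
  also have "j' \<cdot> d P C n v = - (j' \<cdot> c)" unfolding dv by (rule comp_minus_right[OF b'(5) ca])
  finally have "d P T (n - e) (j' \<cdot> v) = w" using cone_data_expand_left[OF B' wa] by (simp add: m_def c_def)
  then show "bdry P T n w" unfolding bdry_def using jv by metis
qed

end

section \<open>Graded injective and graded projective objects\<close>

locale exact_dg =
  fixes E :: "('o, 'g::ab_group_add, 'm::ab_group_add) dg"
    and S :: "('o, 'm) ses set" and SN :: "('o \<times> 'm, 'm) ses set"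
  assumes exact: "exact_dg_category E S SN"
begin

sublocale dgcat_shifts E
  using exact by unfold_locales (simp_all add: exact_dg_category_def)

abbreviation "N \<equiv> natural_dg E"

lemma exactD:
  "has_cones E" "additive_category (Z0 E)" "exact_structure (Z0 E) S" "exact_structure (Z0 N) SN"
  "\<And>i. i \<in> {e, - e} \<Longrightarrow> shift_preserves_ses E i S"
  "\<forall>X\<in>dobj E. \<forall>Y\<in>dobj E. \<forall>Z\<in>dobj E. \<forall>f\<in>dclosed E X Y 0. \<forall>g\<in>dclosed E Y Z 0.
        (X, f, Y, g, Z) \<in> S \<longleftrightarrow>
        (phi_obj E X, phi_mor E X Y f, phi_obj E Y, phi_mor E Y Z g, phi_obj E Z) \<in> SN"
  "\<forall>M\<in>dobj N. \<forall>N'\<in>dobj N. \<forall>P\<in>dobj N. \<forall>f\<in>dclosed N M N' 0. \<forall>g\<in>dclosed N N' P 0.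
        (M, f, N', g, P) \<in> SN \<longleftrightarrow> (fst M, f, fst N', g, fst P) \<in> S"
  using exact unfolding exact_dg_category_def by - (elim conjE, (assumption | blast))+

lemma Z0_simps: "Obj (Z0 F) = dobj F" "Hom (Z0 F) X Y = dclosed F X Y 0" "Comp (Z0 F) X Y Z g f = dcomp F g f"
  "Id (Z0 F) = did F"
  by (simp_all add: Z0_def)

lemma S_D:
  assumes "(A, i, B, p, D) \<in> S"
  shows "clo A B 0 i" "clo B D 0 p" "is_kernel (Z0 E) A i B p D" "is_cokernel (Z0 E) A i B p D"
proof -
  have "A \<in> dobj E \<and> B \<in> dobj E \<and> D \<in> dobj E \<and> i \<in> dclosed E A B 0 \<and> p \<in> dclosed E B D 0 \<and>
        is_kernel (Z0 E) A i B p D \<and> is_cokernel (Z0 E) A i B p D"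
    using exactD(3)[unfolded exact_structure_def, THEN conjunct2, THEN conjunct1, rule_format, OF assms]
    by (simp add: Z0_simps)
  then show "clo A B 0 i" "clo B D 0 p" "is_kernel (Z0 E) A i B p D" "is_cokernel (Z0 E) A i B p D"
    by (auto simp: dclosed_iff)
qed

lemma SN_D:
  assumes "(M, i, N', p, P) \<in> SN"
  shows "M \<in> dobj N" "N' \<in> dobj N" "P \<in> dobj N" "i \<in> dclosed N M N' 0" "p \<in> dclosed N N' P 0"
    "(fst M, i, fst N', p, fst P) \<in> S"
proof -
  have *: "M \<in> dobj N \<and> N' \<in> dobj N \<and> P \<in> dobj N \<and> i \<in> dclosed N M N' 0 \<and> p \<in> dclosed N N' P 0"
    using exactD(4)[unfolded exact_structure_def, THEN conjunct2, THEN conjunct1, rule_format, OF assms]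
    by (simp add: Z0_simps)
  then show "M \<in> dobj N" "N' \<in> dobj N" "P \<in> dobj N" "i \<in> dclosed N M N' 0" "p \<in> dclosed N N' P 0"
    by blast+
  show "(fst M, i, fst N', p, fst P) \<in> S"
    using exactD(7) * assms by blast
qed

lemma S_shift:
  assumes "(A, i, B, p, D) \<in> S" "n \<in> {e, - e}"
  shows "(sh n A, shift_mor E n A B i, sh n B, shift_mor E n B D p, sh n D) \<in> S"
  using exactD(5)[OF assms(2)] assms(1) unfolding shift_preserves_ses_def by blast

lemma N_comp: "dcomp N = dcomp E"
  by (simp add: natural_dg_def)

lemma N_obj_iff: "(X, s) \<in> dobj N \<longleftrightarrow> arr X X (- e) s \<and> d X X (- e) s = did E X \<and> s \<cdot> s = 0"
  by (auto simp: natural_dg_def arr_def)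

lemma N_hom_iff:
  assumes "X \<in> dobj E" "Y \<in> dobj E"
  shows "f \<in> dclosed N (X, s) (Y, t) 0 \<longleftrightarrow> clo X Y 0 f \<and> t \<cdot> f = f \<cdot> s"
  using assms by (simp add: natural_dg_def dclosed_def[of "natural_dg E"] dclosed_def dclosed_iff clo_def arr_def)

text \<open>
  \<open>cone(id\<^bsub>A[-1]\<^esub>)\<close> is \<open>A[-1] \<oplus> A\<close> as a graded object. In terms of \<open>A\<close>, its projections are \<open>ph A\<close>, of
  degree \<open>-1\<close>, and \<open>rh A\<close>, of degree \<open>0\<close>; its injections are \<open>ka A\<close>, of degree \<open>1\<close>, and \<open>io A\<close>, of degree \<open>0\<close>.
\<close>

definition "pc A = fst (phi_cone E A)"
definition "ph A = fs (- e) A \<cdot> fst (snd (phi_cone E A))"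
definition "rh A = fs (- e) A \<cdot> snd (snd (phi_cone E A))"
definition "io A = cone_in_dom E (sh (- e) A) (phi_cone E A) \<cdot> ts (- e) A"
definition "ka A = cone_in_cod E (sh (- e) A) (phi_cone E A) \<cdot> ts (- e) A"

lemma phi_cone_is_cone:
  assumes "A \<in> dobj E"
  shows "is_cone E (sh (- e) A) (sh (- e) A) (did E (sh (- e) A)) (phi_cone E A)"
proof -
  have B: "sh (- e) A \<in> dobj E" by (rule shift_obj_in[OF assms]) simp
  then obtain t where "is_cone E (sh (- e) A) (sh (- e) A) (did E (sh (- e) A)) t"
    using exactD(1) clo_id[OF B] unfolding has_cones_def by (metis dclosed_iff)
  then show ?thesis unfolding phi_cone_def Let_def by (rule someI)
qed

lemma phi_cone_data:
  assumes "A \<in> dobj E"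
  shows "cone_data (sh (- e) A) (sh (- e) A) (did E (sh (- e) A)) (pc A) (fst (snd (phi_cone E A))) (snd (snd (phi_cone E A)))
    (cone_in_cod E (sh (- e) A) (phi_cone E A)) (cone_in_dom E (sh (- e) A) (phi_cone E A))"
proof -
  have B: "sh (- e) A \<in> dobj E" by (rule shift_obj_in[OF assms]) simp
  obtain C p q where t: "phi_cone E A = (C, p, q)" using prod_cases3 by blast
  from is_cone_cone_data[OF phi_cone_is_cone[OF assms, unfolded t] clo_id[OF B]]
  show ?thesis by (simp add: t pc_def)
qed

text \<open>The cone identities for \<open>id\<close> on \<open>A[-1]\<close>, rewritten in terms of
  \<open>A\<close> by the structure morphisms of the shift. Because \<open>d io = ka\<close> and
  \<open>d ph = rh\<close>, the graded morphisms \<open>io\<close> and \<open>ph\<close> determine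
  the other two.\<close>

lemma phi_data:
  assumes A: "A \<in> dobj E"
  shows "pc A \<in> dobj E" "arr (pc A) A (- e) (ph A)" "clo (pc A) A 0 (rh A)" "arr A (pc A) 0 (io A)" "clo A (pc A) e (ka A)"
    and "ph A \<cdot> ka A = did E A" "rh A \<cdot> io A = did E A" "ph A \<cdot> io A = 0" "rh A \<cdot> ka A = 0"
    and "ka A \<cdot> ph A + io A \<cdot> rh A = did E (pc A)"
    and "d A (pc A) 0 (io A) = ka A" "d (pc A) A (- e) (ph A) = rh A"
proof -
  have i: "- e \<in> {e, - e}" by simp
  note b = cone_dataD[OF phi_cone_data[OF A]]
  note u = clo_ts[OF A i, simplified] and v = clo_fs[OF A i]
  note ua = clo_arr[OF u] and va = clo_arr[OF v]
  let ?p = "fst (snd (phi_cone E A))" and ?q = "snd (snd (phi_cone E A))"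
  let ?i = "cone_in_cod E (sh (- e) A) (phi_cone E A)" and ?j = "cone_in_dom E (sh (- e) A) (phi_cone E A)"
  show "pc A \<in> dobj E" by (rule b(18))
  show ph: "arr (pc A) A (- e) (ph A)" unfolding ph_def by (rule arr_comp[OF b(2) va]) simp
  show rh: "clo (pc A) A 0 (rh A)" unfolding rh_def by (rule clo_comp[OF b(3) v]) simp
  show io: "arr A (pc A) 0 (io A)" unfolding io_def by (rule arr_comp[OF ua b(5)]) simp
  show ka: "clo A (pc A) e (ka A)" unfolding ka_def by (rule clo_comp[OF u b(4)]) simp
  have vxu: "(fs (- e) A \<cdot> x) \<cdot> y \<cdot> ts (- e) A = fs (- e) A \<cdot> (x \<cdot> y) \<cdot> ts (- e) A"
    if "arr (pc A) (sh (- e) A) n x" "arr (sh (- e) A) (pc A) m y" for x y n m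
    using assoc[OF arr_comp[OF ua that(2) refl] that(1) va] assoc[OF ua that(2,1)] by simp
  note vu = fs_ts[OF A i] and z = id_left[OF ua] comp_0_left[OF ua b(16)] comp_0_right[OF va A]
  show "ph A \<cdot> ka A = did E A" "rh A \<cdot> io A = did E A" "ph A \<cdot> io A = 0" "rh A \<cdot> ka A = 0"
    using vxu[OF b(2,15)] vxu[OF b(14,5)] vxu[OF b(2,5)] vxu[OF b(14,15)] b(6-9) vu z
    by (simp_all add: ph_def rh_def io_def ka_def)
  have xuv: "(x \<cdot> ts (- e) A) \<cdot> fs (- e) A \<cdot> y = x \<cdot> y"
    if "arr (sh (- e) A) (pc A) m x" "arr (pc A) (sh (- e) A) n y" for x y n m
    using assoc[OF arr_comp[OF that(2) va refl] ua that(1)] assoc[OF that(2) va ua] ts_fs[OF A i] id_left[OF that(2)] by simp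
  show "ka A \<cdot> ph A + io A \<cdot> rh A = did E (pc A)"
    using xuv[OF b(15,2)] xuv[OF b(5,14)] b(10) by (simp add: ph_def rh_def io_def ka_def)
  have "d A (pc A) 0 (io A) = d (sh (- e) A) (pc A) (- e) ?j \<cdot> ts (- e) A"
    unfolding io_def by (rule d_comp_clo_right[OF u b(5)]) simp
  then show "d A (pc A) 0 (io A) = ka A" using b(12) id_right[OF b(15)] by (simp add: ka_def)
  have "d (pc A) A (- e) (ph A) = - (fs (- e) A \<cdot> d (pc A) (sh (- e) A) 0 ?p)"
    unfolding ph_def using d_comp_clo_left[OF v b(2), of "- e"] by simp
  then show "d (pc A) A (- e) (ph A) = rh A"
    using b(11) id_left[OF b(14)] comp_minus_right[OF va b(14)] by (simp add: rh_def)
qed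

lemma phi_obj_eq: "A \<in> dobj E \<Longrightarrow> phi_obj E A = (pc A, io A \<cdot> ph A)"
  by (simp add: phi_obj_def Let_def pc_def io_def ph_def case_prod_beta)

text \<open>The shift morphisms inside \<open>shift_mor\<close> are absorbed into the four structure
  morphisms, so that \<open>f\<close> itself acts on both summands.\<close>

lemma phi_mor_eq:
  assumes f: "clo A A' 0 f"
  shows "phi_mor E A A' f = ka A' \<cdot> f \<cdot> ph A + io A' \<cdot> f \<cdot> rh A"
proof -
  have i: "- e \<in> {e, - e}" by simp
  note o = clo_objD[OF f] and fa = clo_arr[OF f]
  note b = cone_dataD[OF phi_cone_data[OF o(1)]] and b' = cone_dataD[OF phi_cone_data[OF o(2)]]
  note va = clo_fs[OF o(1) i, THEN clo_arr] and ua = clo_ts[OF o(2) i, THEN clo_arr]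
  have *: "y \<cdot> shift_mor E (- e) A A' f \<cdot> x = (y \<cdot> ts (- e) A') \<cdot> f \<cdot> fs (- e) A \<cdot> x"
    if x: "arr (pc A) (sh (- e) A) n x" and y: "arr (sh (- e) A') (pc A') m y" for x y n m
  proof -
    have vx: "arr (pc A) A (- e + n) (fs (- e) A \<cdot> x)" by (rule arr_comp[OF x va refl])
    have "shift_mor E (- e) A A' f \<cdot> x = ts (- e) A' \<cdot> f \<cdot> fs (- e) A \<cdot> x"
      unfolding shift_mor_simp using assoc[OF x arr_comp[OF va fa refl] ua] assoc[OF x va fa] by simp
    then show ?thesis using assoc[OF arr_comp[OF vx fa refl] ua y] by simp
  qed
  show ?thesis
    using *[OF b(2) b'(15)] *[OF b(14) b'(5)]
    by (simp add: phi_mor_def Let_def case_prod_beta io_def ph_def rh_def ka_def)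
qed

lemma phi_mor_rules:
  assumes f: "clo A A' 0 f"
  shows "clo (pc A) (pc A') 0 (phi_mor E A A' f)"
    and "phi_mor E A A' f \<cdot> io A = io A' \<cdot> f" "phi_mor E A A' f \<cdot> ka A = ka A' \<cdot> f"
    and "ph A' \<cdot> phi_mor E A A' f = f \<cdot> ph A" "rh A' \<cdot> phi_mor E A A' f = f \<cdot> rh A"
proof -
  note o = clo_objD[OF f] and fa = clo_arr[OF f]
  note P = phi_data[OF o(1)] and P' = phi_data[OF o(2)]
  note rh = clo_arr[OF P(3)] and ka = clo_arr[OF P(5)] and rh' = clo_arr[OF P'(3)] and ka' = clo_arr[OF P'(5)]
  have fp: "arr (pc A) A' (- e) (f \<cdot> ph A)" by (rule arr_comp[OF P(2) fa]) simp
  have fr: "clo (pc A) A' 0 (f \<cdot> rh A)" by (rule clo_comp[OF P(3) f]) simp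
  note fra = clo_arr[OF fr]
  have kfp: "arr (pc A) (pc A') 0 (ka A' \<cdot> f \<cdot> ph A)" by (rule arr_comp[OF fp ka']) simp
  have ifr: "arr (pc A) (pc A') 0 (io A' \<cdot> f \<cdot> rh A)" by (rule arr_comp[OF fra P'(4)]) simp
  have "d (pc A) (pc A') 0 (ka A' \<cdot> f \<cdot> ph A) = - (ka A' \<cdot> f \<cdot> rh A)"
    using d_comp_clo_left[OF P'(5) fp, of 0] d_comp_clo_left[OF f P(2), of "- e"] P(12) by simp
  moreover have "d (pc A) (pc A') 0 (io A' \<cdot> f \<cdot> rh A) = ka A' \<cdot> f \<cdot> rh A"
    using d_comp_clo_right[OF fr P'(4), of 0] P'(11) by simp
  ultimately show "clo (pc A) (pc A') 0 (phi_mor E A A' f)"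
    unfolding phi_mor_eq[OF f] clo_def using arr_add[OF kfp ifr] d_add[OF kfp ifr] by simp
  have r: "(y \<cdot> f \<cdot> x) \<cdot> z = y \<cdot> f \<cdot> x \<cdot> z"
    if "arr (pc A) A n x" "arr A' (pc A') m y" "arr A (pc A) k z" for x y z n m k
    using assoc[OF that(3) arr_comp[OF that(1) fa refl] that(2)] assoc[OF that(3,1) fa] by simp
  have l: "z \<cdot> y \<cdot> f \<cdot> x = (z \<cdot> y) \<cdot> f \<cdot> x"
    if "arr (pc A) A n x" "arr A' (pc A') m y" "arr (pc A') A' k z" for x y z n m k
    using assoc[OF arr_comp[OF that(1) fa refl] that(2,3)] by simp
  note fz = comp_0_right[OF fa o(1)] id_right[OF fa]
  show "phi_mor E A A' f \<cdot> io A = io A' \<cdot> f" "phi_mor E A A' f \<cdot> ka A = ka A' \<cdot> f"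
    unfolding phi_mor_eq[OF f]
    using comp_add_left[OF kfp ifr P(4)] comp_add_left[OF kfp ifr ka] r[OF P(2) ka' P(4)] r[OF rh P'(4) P(4)]
      r[OF P(2) ka' ka] r[OF rh P'(4) ka] P(6-9) fz comp_0_right[OF ka' o(1)] comp_0_right[OF P'(4) o(1)] by simp_all
  show "ph A' \<cdot> phi_mor E A A' f = f \<cdot> ph A" "rh A' \<cdot> phi_mor E A A' f = f \<cdot> rh A"
    unfolding phi_mor_eq[OF f]
    using comp_add_right[OF P'(2) kfp ifr] comp_add_right[OF rh' kfp ifr] l[OF P(2) ka' P'(2)] l[OF rh P'(4) P'(2)]
      l[OF P(2) ka' rh'] l[OF rh P'(4) rh'] P'(6-9) id_left[OF fp] id_left[OF fra]
      comp_0_left[OF fp o(2)] comp_0_left[OF fra o(2)] by simp_all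
qed

lemma phi_obj_N: assumes A: "A \<in> dobj E" shows "phi_obj E A \<in> dobj N"
  unfolding phi_obj_eq[OF A] N_obj_iff
proof (intro conjI)
  note P = phi_data[OF A]
  show ip: "arr (pc A) (pc A) (- e) (io A \<cdot> ph A)" by (rule arr_comp[OF P(2,4)]) simp
  show "d (pc A) (pc A) (- e) (io A \<cdot> ph A) = did E (pc A)"
    using leib[OF P(2,4), of "- e"] P(10-12) by simp
  show "(io A \<cdot> ph A) \<cdot> io A \<cdot> ph A = 0"
    using assoc[OF ip P(2,4)] assoc[OF P(2,4,2)] P(8) comp_0_left[OF P(2) A] comp_0_right[OF P(4,1)] by simp
qed

text \<open>The passage from \<open>S\<close> to \<open>SN\<close> and back. Exactness of the second
  sequence concerns closed morphisms to and from the cones, and these encode graded morphisms to and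
  from \<open>A\<close>, \<open>B\<close> and \<open>D\<close>.\<close>

lemma phi_ses:
  assumes "(A, i, B, p, D) \<in> S"
  shows "(phi_obj E A, phi_mor E A B i, phi_obj E B, phi_mor E B D p, phi_obj E D) \<in> SN"
    and "(pc A, phi_mor E A B i, pc B, phi_mor E B D p, pc D) \<in> S"
proof -
  note c = S_D(1,2)[OF assms]
  note o = clo_objD[OF c(1)] clo_objD(2)[OF c(2)]
  show *: "(phi_obj E A, phi_mor E A B i, phi_obj E B, phi_mor E B D p, phi_obj E D) \<in> SN"
    using exactD(6) assms c o by (simp add: dclosed_iff)
  from SN_D(6)[OF this] show "(pc A, phi_mor E A B i, pc B, phi_mor E B D p, pc D) \<in> S"
    by (simp add: phi_obj_eq o)
qed

text \<open>
  Closed morphisms between \<open>cone(id\<^bsub>A[-1]\<^esub>)\<close> and \<open>X\<close> are arbitrary graded morphisms between \<open>A\<close> and \<open>X\<close>: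
  \<open>y\<close> is recovered from \<open>d(y ph)\<close>, resp. \<open>d(io y)\<close>, by composing with \<open>io\<close>, resp. \<open>ph\<close>.
\<close>

lemma phi_out:
  assumes A: "A \<in> dobj E" and y: "arr A X 0 y"
  shows "clo (pc A) X 0 (d (pc A) X (- e) (y \<cdot> ph A))" "d (pc A) X (- e) (y \<cdot> ph A) = d A X 0 y \<cdot> ph A + y \<cdot> rh A"
    "d (pc A) X (- e) (y \<cdot> ph A) \<cdot> io A = y"
proof -
  note P = phi_data[OF A]
  note o = arr_objD[OF y]
  have yp: "arr (pc A) X (- e) (y \<cdot> ph A)" by (rule arr_comp[OF P(2) y]) simp
  show "clo (pc A) X 0 (d (pc A) X (- e) (y \<cdot> ph A))" by (rule clo_d_arr[OF yp]) simp
  show *: "d (pc A) X (- e) (y \<cdot> ph A) = d A X 0 y \<cdot> ph A + y \<cdot> rh A"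
    using leib[OF P(2) y, of "- e"] P(12) by simp
  have dy: "arr A X e (d A X 0 y)" by (rule arr_d[OF y]) simp
  have 1: "arr (pc A) X 0 (d A X 0 y \<cdot> ph A)" by (rule arr_comp[OF P(2) dy]) simp
  have 2: "arr (pc A) X 0 (y \<cdot> rh A)" by (rule arr_comp[OF clo_arr[OF P(3)] y]) simp
  show "d (pc A) X (- e) (y \<cdot> ph A) \<cdot> io A = y"
    unfolding * using comp_add_left[OF 1 2 P(4)] assoc[OF P(4,2) dy] assoc[OF P(4) clo_arr[OF P(3)] y] P(7,8)
      id_right[OF y] comp_0_right[OF dy A] by simp
qed

lemma phi_in:
  assumes A: "A \<in> dobj E" and y: "arr X A n y"
  shows "clo X (pc A) (n + e) (d X (pc A) n (io A \<cdot> y))" "d X (pc A) n (io A \<cdot> y) = ka A \<cdot> y + io A \<cdot> d X A n y"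
    "ph A \<cdot> d X (pc A) n (io A \<cdot> y) = y"
proof -
  note P = phi_data[OF A]
  note o = arr_objD[OF y]
  have yp: "arr X (pc A) n (io A \<cdot> y)" by (rule arr_comp[OF y P(4)]) simp
  show "clo X (pc A) (n + e) (d X (pc A) n (io A \<cdot> y))" by (rule clo_d_arr[OF yp]) simp
  show *: "d X (pc A) n (io A \<cdot> y) = ka A \<cdot> y + io A \<cdot> d X A n y"
    using leib[OF y P(4), of n] P(11) by simp
  have dy: "arr X A (n + e) (d X A n y)" by (rule arr_d[OF y]) simp
  have 1: "arr X (pc A) (n + e) (ka A \<cdot> y)" by (rule arr_comp[OF y clo_arr[OF P(5)]]) (rule add.commute)
  have 2: "arr X (pc A) (n + e) (io A \<cdot> d X A n y)" by (rule arr_comp[OF dy P(4)]) simp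
  show "ph A \<cdot> d X (pc A) n (io A \<cdot> y) = y"
    unfolding * using comp_add_right[OF P(2) 1 2] assoc[OF y clo_arr[OF P(5)] P(2)] assoc[OF dy P(4,2)] P(6,8)
      id_left[OF y] comp_0_left[OF dy A] by simp
qed

text \<open>The adjunctions between \<open>\<Phi>\<close> and the forgetful functors \<open>(X, s) \<mapsto> X\<close> and \<open>(X, s) \<mapsto> X[1]\<close>.\<close>

lemma to_phi:
  assumes Xs: "(X, s) \<in> dobj N" and a: "clo X A 0 a"
  defines "\<phi> \<equiv> io A \<cdot> a + ka A \<cdot> a \<cdot> s"
  shows "\<phi> \<in> dclosed N (X, s) (phi_obj E A) 0" "rh A \<cdot> \<phi> = a"
proof -
  note o = clo_objD[OF a] and aa = clo_arr[OF a]
  note P = phi_data[OF o(2)] and rh = phi_data(3)[OF o(2), THEN clo_arr] and ka = phi_data(5)[OF o(2), THEN clo_arr]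
  from Xs have s: "arr X X (- e) s" "d X X (- e) s = did E X" "s \<cdot> s = 0" by (simp_all add: N_obj_iff)
  have as: "arr X A (- e) (a \<cdot> s)" by (rule arr_comp[OF s(1) aa]) simp
  have ia: "arr X (pc A) 0 (io A \<cdot> a)" by (rule arr_comp[OF aa P(4)]) simp
  have kas: "arr X (pc A) 0 (ka A \<cdot> a \<cdot> s)" by (rule arr_comp[OF as ka]) simp
  have \<phi>: "arr X (pc A) 0 \<phi>" unfolding \<phi>_def by (rule arr_add[OF ia kas])
  have "d X (pc A) 0 (io A \<cdot> a) = ka A \<cdot> a" using d_comp_clo_right[OF a P(4), of 0] P(11) by simp
  moreover have "d X (pc A) 0 (ka A \<cdot> a \<cdot> s) = - (ka A \<cdot> a)"
    using d_comp_clo_left[OF P(5) as, of 0] d_comp_clo_left[OF a s(1), of "- e"] s(2) id_right[OF aa] by simp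
  ultimately have clo: "clo X (pc A) 0 \<phi>" using \<phi> d_add[OF ia kas] by (simp add: clo_def \<phi>_def)
  have ph: "ph A \<cdot> \<phi> = a \<cdot> s"
    unfolding \<phi>_def using comp_add_right[OF P(2) ia kas] assoc[OF aa P(4,2)] assoc[OF as ka P(2)] P(6,8)
      comp_0_left[OF aa o(2)] id_left[OF as] by simp
  have "(io A \<cdot> ph A) \<cdot> \<phi> = io A \<cdot> a \<cdot> s" using assoc[OF \<phi> P(2,4)] ph by simp
  moreover have "\<phi> \<cdot> s = io A \<cdot> a \<cdot> s"
  proof -
    have "(ka A \<cdot> a \<cdot> s) \<cdot> s = 0"
      using assoc[OF s(1) as ka] assoc[OF s(1,1) aa] s(3) comp_0_right[OF aa o(1)] comp_0_right[OF ka o(1)] by simp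
    then show ?thesis unfolding \<phi>_def using comp_add_left[OF ia kas s(1)] assoc[OF s(1) aa P(4)] by simp
  qed
  ultimately show "\<phi> \<in> dclosed N (X, s) (phi_obj E A) 0"
    unfolding phi_obj_eq[OF o(2)] using clo by (simp add: N_hom_iff[OF o(1) P(1)])
  show "rh A \<cdot> \<phi> = a"
    unfolding \<phi>_def using comp_add_right[OF rh ia kas] assoc[OF aa P(4) rh] assoc[OF as ka rh] P(7,9)
      comp_0_left[OF as o(2)] id_left[OF aa] by simp
qed

text \<open>Compatibility with the contracting homotopies forces
  \<open>ph A \<cdot> \<chi> = (rh A \<cdot> \<chi>) \<cdot> s\<close>, so the component along
  \<open>rh\<close> determines both components.\<close>

lemma to_phi_unique:
  assumes Xs: "(X, s) \<in> dobj N" and A: "A \<in> dobj E"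
    and \<phi>: "\<phi> \<in> dclosed N (X, s) (phi_obj E A) 0" and \<psi>: "\<psi> \<in> dclosed N (X, s) (phi_obj E A) 0"
    and eq: "rh A \<cdot> \<phi> = rh A \<cdot> \<psi>"
  shows "\<phi> = \<psi>"
proof -
  note P = phi_data[OF A] and rh = phi_data(3)[OF A, THEN clo_arr] and ka = phi_data(5)[OF A, THEN clo_arr]
  from Xs have s: "arr X X (- e) s" by (simp add: N_obj_iff)
  have kp: "arr (pc A) (pc A) 0 (ka A \<cdot> ph A)" by (rule arr_comp[OF P(2) ka]) simp
  have ir: "arr (pc A) (pc A) 0 (io A \<cdot> rh A)" by (rule arr_comp[OF rh P(4)]) simp
  have "\<chi> = ka A \<cdot> (rh A \<cdot> \<chi>) \<cdot> s + io A \<cdot> rh A \<cdot> \<chi>" if "\<chi> \<in> dclosed N (X, s) (phi_obj E A) 0" for \<chi>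
  proof -
    have \<chi>: "arr X (pc A) 0 \<chi>" and com: "(io A \<cdot> ph A) \<cdot> \<chi> = \<chi> \<cdot> s"
      using that arr_objD(1)[OF s] by (simp_all add: phi_obj_eq[OF A] N_hom_iff P(1) clo_arr)
    have pchi: "arr X A (- e) (ph A \<cdot> \<chi>)" by (rule arr_comp[OF \<chi> P(2)]) simp
    have "rh A \<cdot> io A \<cdot> ph A \<cdot> \<chi> = (rh A \<cdot> \<chi>) \<cdot> s"
      using com assoc[OF \<chi> P(2,4)] assoc[OF s \<chi> rh] by simp
    then have "ph A \<cdot> \<chi> = (rh A \<cdot> \<chi>) \<cdot> s" using assoc[OF pchi P(4) rh] P(7) id_left[OF pchi] by simp
    moreover have "\<chi> = ka A \<cdot> ph A \<cdot> \<chi> + io A \<cdot> rh A \<cdot> \<chi>"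
      using P(10) id_left[OF \<chi>] comp_add_left[OF kp ir \<chi>]
        assoc[OF \<chi> P(2) ka] assoc[OF \<chi> rh P(4)] by simp
    ultimately show ?thesis by simp
  qed
  then show ?thesis using \<phi> \<psi> eq by metis
qed

lemma from_phi:
  assumes Xs: "(X, s) \<in> dobj N" and A: "A \<in> dobj E" and a: "clo A X e a"
  defines "\<phi> \<equiv> a \<cdot> ph A + (s \<cdot> a) \<cdot> rh A"
  shows "\<phi> \<in> dclosed N (phi_obj E A) (X, s) 0" "\<phi> \<cdot> ka A = a"
proof -
  note o = clo_objD[OF a] and aa = clo_arr[OF a]
  note P = phi_data[OF A] and rh = phi_data(3)[OF A, THEN clo_arr] and ka = phi_data(5)[OF A, THEN clo_arr]
  from Xs have s: "arr X X (- e) s" "d X X (- e) s = did E X" "s \<cdot> s = 0" by (simp_all add: N_obj_iff)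
  have sa: "arr A X 0 (s \<cdot> a)" by (rule arr_comp[OF aa s(1)]) simp
  have ap: "arr (pc A) X 0 (a \<cdot> ph A)" by (rule arr_comp[OF P(2) aa]) simp
  have sar: "arr (pc A) X 0 ((s \<cdot> a) \<cdot> rh A)" by (rule arr_comp[OF rh sa]) simp
  have \<phi>: "arr (pc A) X 0 \<phi>" unfolding \<phi>_def by (rule arr_add[OF ap sar])
  have "d (pc A) X 0 (a \<cdot> ph A) = - (a \<cdot> rh A)" using d_comp_clo_left[OF a P(2), of 0] P(12) by simp
  moreover have "d (pc A) X 0 ((s \<cdot> a) \<cdot> rh A) = a \<cdot> rh A"
    using d_comp_clo_right[OF P(3) sa, of 0] d_comp_clo_right[OF a s(1), of 0] s(2) id_left[OF aa] by simp
  ultimately have clo: "clo (pc A) X 0 \<phi>" using \<phi> d_add[OF ap sar] by (simp add: clo_def \<phi>_def)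
  have io: "\<phi> \<cdot> io A = s \<cdot> a"
    unfolding \<phi>_def using comp_add_left[OF ap sar P(4)] assoc[OF P(4,2) aa] assoc[OF P(4) rh sa] P(7,8)
      comp_0_right[OF aa A] id_right[OF sa] by simp
  have "\<phi> \<cdot> io A \<cdot> ph A = s \<cdot> a \<cdot> ph A" using assoc[OF P(2,4) \<phi>] io assoc[OF P(2) aa s(1)] by simp
  moreover have "s \<cdot> \<phi> = s \<cdot> a \<cdot> ph A"
  proof -
    have "s \<cdot> (s \<cdot> a) \<cdot> rh A = 0"
      using assoc[OF rh sa s(1)] assoc[OF aa s(1,1)] s(3) comp_0_left[OF aa o(2)] comp_0_left[OF rh o(2)] by simp
    then show ?thesis unfolding \<phi>_def using comp_add_right[OF s(1) ap sar] by simp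
  qed
  ultimately show "\<phi> \<in> dclosed N (phi_obj E A) (X, s) 0"
    unfolding phi_obj_eq[OF A] using clo by (simp add: N_hom_iff[OF P(1) o(2)])
  show "\<phi> \<cdot> ka A = a"
    unfolding \<phi>_def using comp_add_left[OF ap sar ka] assoc[OF ka P(2) aa] assoc[OF ka rh sa] P(6,9)
      comp_0_right[OF sa A] id_right[OF aa] by simp
qed

text \<open>Here compatibility with the homotopies forces
  \<open>\<chi> \<cdot> io A = s \<cdot> \<chi> \<cdot> ka A\<close>, so the restriction along
  \<open>ka\<close> determines both restrictions.\<close>

lemma from_phi_unique:
  assumes Xs: "(X, s) \<in> dobj N" and A: "A \<in> dobj E"
    and \<phi>: "\<phi> \<in> dclosed N (phi_obj E A) (X, s) 0" and \<psi>: "\<psi> \<in> dclosed N (phi_obj E A) (X, s) 0"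
    and eq: "\<phi> \<cdot> ka A = \<psi> \<cdot> ka A"
  shows "\<phi> = \<psi>"
proof -
  note P = phi_data[OF A] and rh = phi_data(3)[OF A, THEN clo_arr] and ka = phi_data(5)[OF A, THEN clo_arr]
  from Xs have s: "arr X X (- e) s" by (simp add: N_obj_iff)
  have kp: "arr (pc A) (pc A) 0 (ka A \<cdot> ph A)" by (rule arr_comp[OF P(2) ka]) simp
  have ir: "arr (pc A) (pc A) 0 (io A \<cdot> rh A)" by (rule arr_comp[OF rh P(4)]) simp
  have "\<chi> = (\<chi> \<cdot> ka A) \<cdot> ph A + (s \<cdot> \<chi> \<cdot> ka A) \<cdot> rh A" if "\<chi> \<in> dclosed N (phi_obj E A) (X, s) 0" for \<chi>
  proof -
    have \<chi>: "arr (pc A) X 0 \<chi>" and com: "s \<cdot> \<chi> = \<chi> \<cdot> io A \<cdot> ph A"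
      using that arr_objD(1)[OF s] by (simp_all add: phi_obj_eq[OF A] N_hom_iff P(1) clo_arr)
    have ip: "arr (pc A) (pc A) (- e) (io A \<cdot> ph A)" by (rule arr_comp[OF P(2,4)]) simp
    have "s \<cdot> \<chi> \<cdot> ka A = (\<chi> \<cdot> io A \<cdot> ph A) \<cdot> ka A" using com assoc[OF ka \<chi> s] by simp
    also have "\<dots> = \<chi> \<cdot> io A"
      using assoc[OF ka ip \<chi>] assoc[OF ka P(2,4)] P(6) id_right[OF P(4)] by simp
    finally have "\<chi> \<cdot> io A = s \<cdot> \<chi> \<cdot> ka A" by simp
    moreover have "\<chi> = (\<chi> \<cdot> ka A) \<cdot> ph A + (\<chi> \<cdot> io A) \<cdot> rh A"
      using P(10) id_right[OF \<chi>] comp_add_right[OF \<chi> kp ir]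
        assoc[OF P(2) ka \<chi>] assoc[OF rh P(4) \<chi>] by simp
    ultimately show ?thesis by simp
  qed
  then show ?thesis using \<phi> \<psi> eq by metis
qed

section \<open>Graded injectivity and projectivity as extension and lifting of graded
  morphisms\<close>

definition extends_to :: "'o \<Rightarrow> 'g \<Rightarrow> bool" where
  "extends_to J n \<longleftrightarrow> (\<forall>A i B f. inflation S A i B \<longrightarrow> arr A J n f \<longrightarrow> (\<exists>g. arr B J n g \<and> g \<cdot> i = f))"

definition lifts_from :: "'o \<Rightarrow> 'g \<Rightarrow> bool" where
  "lifts_from P n \<longleftrightarrow> (\<forall>B p D f. deflation S B p D \<longrightarrow> arr P D n f \<longrightarrow> (\<exists>g. arr P B n g \<and> p \<cdot> g = f))"

lemma int_degree_induct_units [consumes 1, case_names zero step]: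
  assumes "int_degree n" "P 0" "\<And>n k. int_degree n \<Longrightarrow> P n \<Longrightarrow> k \<in> {e, - e} \<Longrightarrow> P (n + k)"
  shows "P n"
  using assms(1)
proof (induction rule: int_degree.induct)
  case (int_degree_plus n)
  then show ?case using assms(3)[of n e] by simp
next
  case (int_degree_minus n)
  then show ?case using assms(3)[of n "- e"] by simp
qed (fact assms(2))

lemma units_minus: "k \<in> {e, - e} \<Longrightarrow> - k \<in> {e, - e}"
  by auto

text \<open>The short exact sequence is shifted instead of \<open>J\<close>: \<open>S\<close> is
  stable under shifts by assumption, whereas stability of graded injectivity,
  \<open>extends_to_shift\<close>, is itself deduced from this lemma.\<close>

lemma extends_to_int_degree:
  assumes "extends_to J 0" "int_degree n"
  shows "extends_to J n"
  using assms(2,1)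
proof (rule int_degree_induct_units)
  fix n k assume IH: "extends_to J n" and k: "k \<in> {e, - e}"
  note mk = units_minus[OF k]
  show "extends_to J (n + k)"
    unfolding extends_to_def
  proof (intro allI impI)
    fix A i B f assume i: "inflation S A i B" and f: "arr A J (n + k) f"
    from i obtain p D where s: "(A, i, B, p, D) \<in> S" unfolding inflation_def by blast
    note ic = S_D(1)[OF s] and o = clo_objD[OF S_D(1)[OF s]]
    note ia = clo_arr[OF ic]
    note uA = arr_ts[OF o(1) mk, simplified] and vA = arr_fs[OF o(1) mk] and uB = arr_ts[OF o(2) mk, simplified]
    have "inflation S (sh (- k) A) (shift_mor E (- k) A B i) (sh (- k) B)"
      using S_shift[OF s mk] unfolding inflation_def by blast
    moreover have "arr (sh (- k) A) J n (f \<cdot> fs (- k) A)" by (rule arr_comp[OF vA f]) simp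
    ultimately obtain g where g: "arr (sh (- k) B) J n g" "g \<cdot> shift_mor E (- k) A B i = f \<cdot> fs (- k) A"
      using IH unfolding extends_to_def by blast
    have "(g \<cdot> ts (- k) B) \<cdot> i = g \<cdot> shift_mor E (- k) A B i \<cdot> ts (- k) A"
      using assoc[OF ia uB g(1)] shift_mor_ts[OF ia mk] by simp
    also have "\<dots> = (f \<cdot> fs (- k) A) \<cdot> ts (- k) A"
      using assoc[OF uA clo_arr[OF clo_shift_mor[OF ic mk]] g(1)] g(2) by simp
    also have "\<dots> = f" using assoc[OF uA vA f] fs_ts[OF o(1) mk] id_right[OF f] by simp
    finally have "(g \<cdot> ts (- k) B) \<cdot> i = f" .
    moreover have "arr B J (n + k) (g \<cdot> ts (- k) B)" by (rule arr_comp[OF uB g(1)]) simp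
    ultimately show "\<exists>g. arr B J (n + k) g \<and> g \<cdot> i = f" by blast
  qed
qed

lemma lifts_from_int_degree:
  assumes "lifts_from P 0" "int_degree n"
  shows "lifts_from P n"
  using assms(2,1)
proof (rule int_degree_induct_units)
  fix n k assume IH: "lifts_from P n" and k: "k \<in> {e, - e}"
  show "lifts_from P (n + k)"
    unfolding lifts_from_def
  proof (intro allI impI)
    fix B p D f assume p: "deflation S B p D" and f: "arr P D (n + k) f"
    from p obtain i A where s: "(A, i, B, p, D) \<in> S" unfolding deflation_def by blast
    note pcl = S_D(2)[OF s] and o = clo_objD[OF S_D(2)[OF s]]
    note pa = clo_arr[OF pcl]
    note uD = arr_ts[OF o(2) k] and vD = arr_fs[OF o(2) k] and vB = arr_fs[OF o(1) k]
    have "deflation S (sh k B) (shift_mor E k B D p) (sh k D)"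
      using S_shift[OF s k] unfolding deflation_def by blast
    moreover have "arr P (sh k D) n (ts k D \<cdot> f)" by (rule arr_comp[OF f uD]) simp
    ultimately obtain g where g: "arr P (sh k B) n g" "shift_mor E k B D p \<cdot> g = ts k D \<cdot> f"
      using IH unfolding lifts_from_def by blast
    have "p \<cdot> fs k B \<cdot> g = fs k D \<cdot> shift_mor E k B D p \<cdot> g"
      using assoc[OF g(1) vB pa] fs_shift_mor[OF pa k] assoc[OF g(1) clo_arr[OF clo_shift_mor[OF pcl k]] vD] by simp
    also have "\<dots> = f" unfolding g(2) using assoc[OF f uD vD] fs_ts[OF o(2) k] id_left[OF f] by simp
    finally have "p \<cdot> fs k B \<cdot> g = f" .
    moreover have "arr P B (n + k) (fs k B \<cdot> g)" by (rule arr_comp[OF g(1) vB]) (rule add.commute)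
    ultimately show "\<exists>g. arr P B (n + k) g \<and> p \<cdot> g = f" by blast
  qed
qed

text \<open>In \<open>E\<^sup>\<natural>\<close> all objects have contracting homotopies, so that closed morphisms are boundaries \<open>d(f' s)\<close>
  and extend as soon as \<open>f' s\<close> does.\<close>

theorem graded_injective_iff:
  assumes J: "J \<in> dobj E"
  shows "injective_object (Z0 N) SN (phi_obj E J) \<longleftrightarrow> extends_to J 0"
proof
  assume inj: "injective_object (Z0 N) SN (phi_obj E J)"
  show "extends_to J 0"
    unfolding extends_to_def
  proof (intro allI impI)
    fix A i B f assume i: "inflation S A i B" and f: "arr A J 0 f"
    from i obtain p D where s: "(A, i, B, p, D) \<in> S" unfolding inflation_def by blast
    note ic = S_D(1)[OF s] and o = clo_objD[OF S_D(1)[OF s]]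
    note PA = phi_data[OF o(1)] and PB = phi_data[OF o(2)] and PJ = phi_data[OF J]
    note M = phi_mor_rules[OF ic]
    define a where "a = d (pc A) J (- e) (f \<cdot> ph A)"
    note a = phi_out[OF o(1) f, folded a_def]
    have N: "(pc A, io A \<cdot> ph A) \<in> dobj N" using phi_obj_N[OF o(1)] phi_obj_eq[OF o(1)] by simp
    \<comment> \<open>The graded \<open>f\<close> has become the closed \<open>a\<close> on
      \<open>pc A\<close>, and adjunction turns \<open>a\<close> into a morphism from
      \<open>phi_obj E A\<close> to \<open>phi_obj E J\<close>, to which injectivity
      applies.\<close>
    define \<phi> where "\<phi> = io J \<cdot> a + ka J \<cdot> a \<cdot> io A \<cdot> ph A"
    note \<phi> = to_phi[OF N a(1), folded \<phi>_def phi_obj_eq[OF o(1)]]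
    have "inflation SN (phi_obj E A) (phi_mor E A B i) (phi_obj E B)"
      using phi_ses(1)[OF s] unfolding inflation_def by blast
    then obtain \<psi> where \<psi>: "\<psi> \<in> dclosed N (phi_obj E B) (phi_obj E J) 0" "\<psi> \<cdot> phi_mor E A B i = \<phi>"
      using inj \<phi>(1) unfolding injective_object_def Z0_simps N_comp by blast
    have \<psi>a: "arr (pc B) (pc J) 0 \<psi>"
      using \<psi>(1) by (simp add: phi_obj_eq o J N_hom_iff PB(1) PJ(1) clo_arr)
    note Ma = clo_arr[OF M(1)] and rJ = clo_arr[OF PJ(3)] and ia = clo_arr[OF ic]
    have rpsi: "arr (pc B) J 0 (rh J \<cdot> \<psi>)" by (rule arr_comp[OF \<psi>a rJ]) simp
    have "((rh J \<cdot> \<psi>) \<cdot> io B) \<cdot> i = (rh J \<cdot> \<psi>) \<cdot> phi_mor E A B i \<cdot> io A"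
      using assoc[OF ia PB(4) rpsi] M(2) by simp
    also have "\<dots> = (rh J \<cdot> \<phi>) \<cdot> io A"
      using assoc[OF PA(4) Ma rpsi] assoc[OF Ma \<psi>a rJ] \<psi>(2) by simp
    also have "\<dots> = f" unfolding \<phi>(2) by (rule a(3))
    finally have "((rh J \<cdot> \<psi>) \<cdot> io B) \<cdot> i = f" .
    moreover have "arr B J 0 ((rh J \<cdot> \<psi>) \<cdot> io B)" by (rule arr_comp[OF PB(4) rpsi]) simp
    ultimately show "\<exists>g. arr B J 0 g \<and> g \<cdot> i = f" by blast
  qed
next
  assume ext: "extends_to J 0"
  \<comment> \<open>The contracting homotopy has degree \<open>- e\<close>, so the morphism to be
    extended below has that degree.\<close>
  have "int_degree (- e)" using int_degree_minus[OF int_degree_0] by simp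
  note ext' = extends_to_int_degree[OF ext this]
  show "injective_object (Z0 N) SN (phi_obj E J)"
    unfolding injective_object_def Z0_simps
  proof (intro conjI allI impI ballI)
    show "phi_obj E J \<in> dobj N" by (rule phi_obj_N[OF J])
    fix M i M' \<phi>
    assume i: "inflation SN M i M'" and \<phi>: "\<phi> \<in> dclosed N M (phi_obj E J) 0"
    obtain X s Y t where M: "M = (X, s)" "M' = (Y, t)" by (metis surj_pair)
    from i obtain p P where ses: "((X, s), i, (Y, t), p, P) \<in> SN" unfolding inflation_def M by blast
    note SNd = SN_D[OF ses]
    have s: "arr X X (- e) s" "d X X (- e) s = did E X" using SNd(1) by (simp_all add: N_obj_iff)
    have t: "arr Y Y (- e) t" using SNd(2) by (simp add: N_obj_iff)
    note o = arr_objD(1)[OF s(1)] arr_objD(1)[OF t]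
    note PJ = phi_data[OF J]
    have i': "clo X Y 0 i" "t \<cdot> i = i \<cdot> s" using SNd(4) by (simp_all add: N_hom_iff o)
    have \<phi>': "clo X (pc J) 0 \<phi>" using \<phi> by (simp add: M phi_obj_eq J N_hom_iff o PJ(1))
    define f where "f = rh J \<cdot> \<phi>"
    have f: "clo X J 0 f" unfolding f_def by (rule clo_comp[OF \<phi>' PJ(3)]) simp
    have "inflation S X i Y" using SNd(6) unfolding inflation_def by auto
    moreover have "arr X J (- e) (f \<cdot> s)" by (rule arr_comp[OF s(1) clo_arr[OF f]]) simp
    ultimately obtain h where h: "arr Y J (- e) h" "h \<cdot> i = f \<cdot> s" using ext' unfolding extends_to_def by blast
    define g where "g = d Y J (- e) h"
    have g: "clo Y J 0 g" unfolding g_def by (rule clo_d_arr[OF h(1)]) simp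
    have "g \<cdot> i = d X J (- e) (h \<cdot> i)" unfolding g_def by (rule d_comp_clo_right[OF i'(1) h(1), symmetric]) simp
    also have "\<dots> = f" unfolding h(2) using d_comp_clo_left[OF f s(1), of "- e"] s(2) id_right[OF clo_arr[OF f]] by simp
    finally have gi: "g \<cdot> i = f" .
    define \<psi> where "\<psi> = io J \<cdot> g + ka J \<cdot> g \<cdot> t"
    note \<psi> = to_phi[OF SNd(2) g, folded \<psi>_def]
    have \<psi>c: "clo Y (pc J) 0 \<psi>" "(io J \<cdot> ph J) \<cdot> \<psi> = \<psi> \<cdot> t"
      using \<psi>(1) by (simp_all add: phi_obj_eq J N_hom_iff o PJ(1))
    have ip: "arr (pc J) (pc J) (- e) (io J \<cdot> ph J)" by (rule arr_comp[OF PJ(2,4)]) simp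
    note ia = clo_arr[OF i'(1)] and \<psi>a = clo_arr[OF \<psi>c(1)]
    have "clo X (pc J) 0 (\<psi> \<cdot> i)" by (rule clo_comp[OF i'(1) \<psi>c(1)]) simp
    moreover have "(io J \<cdot> ph J) \<cdot> \<psi> \<cdot> i = (\<psi> \<cdot> i) \<cdot> s"
      using assoc[OF ia \<psi>a ip] \<psi>c(2) assoc[OF ia t \<psi>a] i'(2) assoc[OF s(1) ia \<psi>a] by simp
    ultimately have "\<psi> \<cdot> i \<in> dclosed N (X, s) (phi_obj E J) 0" by (simp add: phi_obj_eq J N_hom_iff o PJ(1))
    moreover have "rh J \<cdot> \<psi> \<cdot> i = rh J \<cdot> \<phi>" using assoc[OF ia \<psi>a clo_arr[OF PJ(3)]] \<psi>(2) gi f_def by simp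
    ultimately have "\<psi> \<cdot> i = \<phi>" using to_phi_unique[OF SNd(1) J] \<phi> M by simp
    then show "\<exists>g\<in>dclosed N M' (phi_obj E J) 0. dcomp N g i = \<phi>"
      using \<psi>(1) M unfolding N_comp by blast
  qed
qed

text \<open>The dual uses the other adjunction, under which morphisms from
  \<open>phi_obj E P\<close> to \<open>(Y, t)\<close> are closed morphisms \<open>f\<close> from
  \<open>P\<close> to \<open>Y\<close> of degree 1. As \<open>t\<close> lowers the degree to 0,
  lifting is applied to \<open>t f\<close> in degree 0, and the differential of the lift lifts
  \<open>f\<close>.\<close>

theorem graded_projective_iff:
  assumes P: "P \<in> dobj E"
  shows "projective_object (Z0 N) SN (phi_obj E P) \<longleftrightarrow> lifts_from P 0"
proof
  assume proj: "projective_object (Z0 N) SN (phi_obj E P)"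
  show "lifts_from P 0"
    unfolding lifts_from_def
  proof (intro allI impI)
    fix B p D f assume p: "deflation S B p D" and f: "arr P D 0 f"
    from p obtain i A where s: "(A, i, B, p, D) \<in> S" unfolding deflation_def by blast
    note pcl = S_D(2)[OF s] and o = clo_objD[OF S_D(2)[OF s]]
    note PB = phi_data[OF o(1)] and PD = phi_data[OF o(2)] and PP = phi_data[OF P]
    note M = phi_mor_rules[OF pcl]
    define a where "a = d P (pc D) 0 (io D \<cdot> f)"
    note a = phi_in[OF o(2) f, folded a_def, simplified]
    have N: "(pc D, io D \<cdot> ph D) \<in> dobj N" using phi_obj_N[OF o(2)] phi_obj_eq[OF o(2)] by simp
    define \<phi> where "\<phi> = a \<cdot> ph P + ((io D \<cdot> ph D) \<cdot> a) \<cdot> rh P"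
    note \<phi> = from_phi[OF N P a(1), folded \<phi>_def phi_obj_eq[OF o(2)]]
    have "deflation SN (phi_obj E B) (phi_mor E B D p) (phi_obj E D)"
      using phi_ses(1)[OF s] unfolding deflation_def by blast
    then obtain \<psi> where \<psi>: "\<psi> \<in> dclosed N (phi_obj E P) (phi_obj E B) 0" "phi_mor E B D p \<cdot> \<psi> = \<phi>"
      using proj \<phi>(1) unfolding projective_object_def Z0_simps N_comp by blast
    have \<psi>a: "arr (pc P) (pc B) 0 \<psi>"
      using \<psi>(1) by (simp add: phi_obj_eq o P N_hom_iff PB(1) PP(1) clo_arr)
    note Ma = clo_arr[OF M(1)] and kP = clo_arr[OF PP(5)] and pa = clo_arr[OF pcl]
    have psik: "arr P (pc B) e (\<psi> \<cdot> ka P)" by (rule arr_comp[OF kP \<psi>a]) simp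
    have "p \<cdot> ph B \<cdot> \<psi> \<cdot> ka P = ph D \<cdot> phi_mor E B D p \<cdot> \<psi> \<cdot> ka P"
      using assoc[OF psik PB(2) pa] M(4) assoc[OF psik Ma PD(2)] by simp
    also have "\<dots> = ph D \<cdot> \<phi> \<cdot> ka P"
      using assoc[OF kP \<psi>a Ma] \<psi>(2) by simp
    also have "\<dots> = f" unfolding \<phi>(2) by (rule a(3))
    finally have "p \<cdot> ph B \<cdot> \<psi> \<cdot> ka P = f" .
    moreover have "arr P B 0 (ph B \<cdot> \<psi> \<cdot> ka P)" by (rule arr_comp[OF psik PB(2)]) simp
    ultimately show "\<exists>g. arr P B 0 g \<and> p \<cdot> g = f" by blast
  qed
next
  assume lift: "lifts_from P 0"
  show "projective_object (Z0 N) SN (phi_obj E P)"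
    unfolding projective_object_def Z0_simps
  proof (intro conjI allI impI ballI)
    show "phi_obj E P \<in> dobj N" by (rule phi_obj_N[OF P])
    fix M p M' \<phi>
    assume p: "deflation SN M p M'" and \<phi>: "\<phi> \<in> dclosed N (phi_obj E P) M' 0"
    obtain X s Y t where M: "M = (X, s)" "M' = (Y, t)" by (metis surj_pair)
    from p obtain i K where ses: "(K, i, (X, s), p, (Y, t)) \<in> SN" unfolding deflation_def M by blast
    note SNd = SN_D[OF ses]
    have s: "arr X X (- e) s" using SNd(2) by (simp add: N_obj_iff)
    have t: "arr Y Y (- e) t" "d Y Y (- e) t = did E Y" using SNd(3) by (simp_all add: N_obj_iff)
    note o = arr_objD(1)[OF s] arr_objD(1)[OF t(1)]
    note PP = phi_data[OF P]
    have p': "clo X Y 0 p" "t \<cdot> p = p \<cdot> s" using SNd(5) by (simp_all add: N_hom_iff o)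
    have \<phi>': "clo (pc P) Y 0 \<phi>" using \<phi> by (simp add: M phi_obj_eq P N_hom_iff o PP(1))
    define f where "f = \<phi> \<cdot> ka P"
    have f: "clo P Y e f" unfolding f_def by (rule clo_comp[OF PP(5) \<phi>']) simp
    have "deflation S X p Y" using SNd(6) unfolding deflation_def by auto
    moreover have "arr P Y 0 (t \<cdot> f)" by (rule arr_comp[OF clo_arr[OF f] t(1)]) simp
    ultimately obtain h where h: "arr P X 0 h" "p \<cdot> h = t \<cdot> f" using lift unfolding lifts_from_def by blast
    define g where "g = d P X 0 h"
    have g: "clo P X e g" unfolding g_def by (rule clo_d_arr[OF h(1)]) simp
    have "p \<cdot> g = d P Y 0 (p \<cdot> h)" unfolding g_def using d_comp_clo_left[OF p'(1) h(1), of 0] by simp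
    also have "\<dots> = f" unfolding h(2) using d_comp_clo_right[OF f t(1), of 0] t(2) id_left[OF clo_arr[OF f]] by simp
    finally have pg: "p \<cdot> g = f" .
    define \<psi> where "\<psi> = g \<cdot> ph P + (s \<cdot> g) \<cdot> rh P"
    note \<psi> = from_phi[OF SNd(2) P g, folded \<psi>_def]
    have \<psi>c: "clo (pc P) X 0 \<psi>" "s \<cdot> \<psi> = \<psi> \<cdot> io P \<cdot> ph P"
      using \<psi>(1) by (simp_all add: phi_obj_eq P N_hom_iff o PP(1))
    have ip: "arr (pc P) (pc P) (- e) (io P \<cdot> ph P)" by (rule arr_comp[OF PP(2,4)]) simp
    note pa = clo_arr[OF p'(1)] and \<psi>a = clo_arr[OF \<psi>c(1)]
    have "clo (pc P) Y 0 (p \<cdot> \<psi>)" by (rule clo_comp[OF \<psi>c(1) p'(1)]) simp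
    moreover have "t \<cdot> p \<cdot> \<psi> = (p \<cdot> \<psi>) \<cdot> io P \<cdot> ph P"
      using assoc[OF \<psi>a pa t(1)] p'(2) assoc[OF \<psi>a s pa] \<psi>c(2) assoc[OF ip \<psi>a pa] by simp
    ultimately have "p \<cdot> \<psi> \<in> dclosed N (phi_obj E P) (Y, t) 0" by (simp add: phi_obj_eq P N_hom_iff o PP(1))
    moreover have "(p \<cdot> \<psi>) \<cdot> ka P = \<phi> \<cdot> ka P" using assoc[OF clo_arr[OF PP(5)] \<psi>a pa] \<psi>(2) pg f_def by simp
    ultimately have "p \<cdot> \<psi> = \<phi>" using from_phi_unique[OF SNd(3) P] \<phi> M by simp
    then show "\<exists>g\<in>dclosed N (phi_obj E P) M 0. dcomp N p g = \<phi>"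
      using \<psi>(1) M unfolding N_comp by blast
  qed
qed

text \<open>By \<open>phi_ses\<close> the morphism between cones induced by \<open>p\<close> is a
  cokernel for closed morphisms, and \<open>phi_out\<close> translates this to graded morphisms of
  degree 0. The target \<open>X\<close> varies in the induction because the other degrees are
  obtained by shifting it.\<close>

lemma ses_cokernel_graded:
  assumes s: "(A, i, B, p, D) \<in> S" and n: "int_degree n"
  shows "X \<in> dobj E \<Longrightarrow> (\<forall>y. arr B X n y \<longrightarrow> y \<cdot> i = 0 \<longrightarrow> (\<exists>z. arr D X n z \<and> z \<cdot> p = y)) \<and>
    (\<forall>z. arr D X n z \<longrightarrow> z \<cdot> p = 0 \<longrightarrow> z = 0)"
  using n
proof (induction arbitrary: X rule: int_degree_induct_units)
  case (zero X)
  note 1 = zero.prems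
  note ic = S_D(1)[OF s] and pcl = S_D(2)[OF s]
  note o = clo_objD[OF ic] clo_objD(2)[OF pcl]
  note PA = phi_data[OF o(1)] and PB = phi_data[OF o(2)] and PD = phi_data[OF o(3)]
  note Mi = phi_mor_rules[OF ic] and Mp = phi_mor_rules[OF pcl]
  note ck = S_D(4)[OF phi_ses(2)[OF s], unfolded is_cokernel_def Z0_simps]
  note ia = clo_arr[OF ic] and pa = clo_arr[OF pcl]
  \<comment> \<open>If \<open>y\<close> kills \<open>f\<close>, then so does \<open>d y\<close>;
    hence the closed morphism that encodes \<open>y\<close> kills
    \<open>phi_mor E A' B' f\<close>.\<close>
  have comp_out: "d (pc B') X (- e) (y \<cdot> ph B') \<cdot> phi_mor E A' B' f = 0"
    if f: "clo A' B' 0 f" and y: "arr B' X 0 y" "y \<cdot> f = 0" for A' B' f y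
  proof -
    note o' = clo_objD[OF f]
    note P' = phi_data[OF o'(2)] and Q' = phi_data[OF o'(1)]
    note M = phi_mor_rules[OF f]
    note Ma = clo_arr[OF M(1)] and fa = clo_arr[OF f]
    have dy: "arr B' X e (d B' X 0 y)" by (rule arr_d[OF y(1)]) simp
    have 1: "arr (pc B') X 0 (d B' X 0 y \<cdot> ph B')" by (rule arr_comp[OF P'(2) dy]) simp
    have 2: "arr (pc B') X 0 (y \<cdot> rh B')" by (rule arr_comp[OF clo_arr[OF P'(3)] y(1)]) simp
    have "d B' X 0 y \<cdot> f = d A' X 0 (y \<cdot> f)" by (rule d_comp_clo_right[OF f y(1), symmetric]) simp
    then have "d B' X 0 y \<cdot> f = 0" using y(2) d_0[OF o'(1) \<open>X \<in> dobj E\<close>] by simp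
    then show ?thesis
      using phi_out(2)[OF o'(2) y(1)] comp_add_left[OF 1 2 Ma] assoc[OF Ma P'(2) dy] assoc[OF Ma clo_arr[OF P'(3)] y(1)]
        M(4,5) assoc[OF Q'(2) fa dy] assoc[OF clo_arr[OF Q'(3)] fa y(1)] y(2) comp_0_left[OF Q'(2) \<open>X \<in> dobj E\<close>]
        comp_0_left[OF clo_arr[OF Q'(3)] \<open>X \<in> dobj E\<close>] by simp
  qed
  show ?case
  proof (intro conjI allI impI)
    fix y assume y: "arr B X 0 y" "y \<cdot> i = 0"
    define a where "a = d (pc B) X (- e) (y \<cdot> ph B)"
    note a = phi_out[OF o(2) y(1), folded a_def]
    have "a \<cdot> phi_mor E A B i = 0" unfolding a_def by (rule comp_out[OF ic y])
    then obtain b where b: "clo (pc D) X 0 b" "b \<cdot> phi_mor E B D p = a"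
      using ck a(1) 1 PB(1) PD(1) by (metis dclosed_iff)
    note ba = clo_arr[OF b(1)]
    have "(b \<cdot> io D) \<cdot> p = y"
      using assoc[OF pa PD(4) ba] Mp(2) assoc[OF PB(4) clo_arr[OF Mp(1)] ba] b(2) a(3) by simp
    moreover have "arr D X 0 (b \<cdot> io D)" by (rule arr_comp[OF PD(4) ba]) simp
    ultimately show "\<exists>z. arr D X 0 z \<and> z \<cdot> p = y" by blast
  next
    fix z assume z: "arr D X 0 z" "z \<cdot> p = 0"
    define b where "b = d (pc D) X (- e) (z \<cdot> ph D)"
    note b = phi_out[OF o(3) z(1), folded b_def]
    have b0: "b \<cdot> phi_mor E B D p = 0" unfolding b_def by (rule comp_out[OF pcl z])
    have z0: "clo (pc D) X 0 0" "clo (pc B) X 0 0" using clo_0 PD(1) PB(1) 1 by simp_all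
    have 00: "0 \<cdot> phi_mor E B D p = 0" "0 \<cdot> phi_mor E A B i = 0"
      using comp_0_left[OF clo_arr[OF Mp(1)] 1(1)] comp_0_left[OF clo_arr[OF Mi(1)] 1(1)] by simp_all
    have "\<exists>!g. clo (pc D) X 0 g \<and> g \<cdot> phi_mor E B D p = 0"
      using ck z0 00 1 PB(1) PD(1) by (simp add: dclosed_iff)
    then have "b = 0" using b(1) b0 z0 00 by blast
    then show "z = 0" using b(3) comp_0_left[OF PD(4) 1(1)] by simp
  qed
next
  case (step n k X)
  note X = \<open>X \<in> dobj E\<close> and k = \<open>k \<in> {e, - e}\<close>
  note IH = step.IH[OF shift_obj_in[OF X k]]
  note u = arr_ts[OF X k] and v = arr_fs[OF X k]
  note ia = S_D(1)[OF s, THEN clo_arr] and pa = S_D(2)[OF s, THEN clo_arr]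
  note o = arr_objD[OF ia]
  have vu: "fs k X \<cdot> ts k X \<cdot> y = y" if "arr Y X m y" for Y m y
    using assoc[OF that u v] fs_ts[OF X k] id_left[OF that] by simp
  show ?case
  proof (intro conjI allI impI)
    fix y assume y: "arr B X (n + k) y" "y \<cdot> i = 0"
    have "arr B (sh k X) n (ts k X \<cdot> y)" by (rule arr_comp[OF y(1) u]) simp
    moreover have "(ts k X \<cdot> y) \<cdot> i = 0" using assoc[OF ia y(1) u] y(2) comp_0_right[OF u o(1)] by simp
    ultimately obtain z where z: "arr D (sh k X) n z" "z \<cdot> p = ts k X \<cdot> y" using IH by blast
    have "(fs k X \<cdot> z) \<cdot> p = y" using assoc[OF pa z(1) v] z(2) vu[OF y(1)] by simp
    moreover have "arr D X (n + k) (fs k X \<cdot> z)" by (rule arr_comp[OF z(1) v]) (rule add.commute)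
    ultimately show "\<exists>z. arr D X (n + k) z \<and> z \<cdot> p = y" by blast
  next
    fix z assume z: "arr D X (n + k) z" "z \<cdot> p = 0"
    have "arr D (sh k X) n (ts k X \<cdot> z)" by (rule arr_comp[OF z(1) u]) simp
    moreover have "(ts k X \<cdot> z) \<cdot> p = 0" using assoc[OF pa z(1) u] z(2) comp_0_right[OF u o(2)] by simp
    ultimately have "ts k X \<cdot> z = 0" using IH by blast
    then show "z = 0" using vu[OF z(1)] comp_0_right[OF v arr_objD(1)[OF z(1)]] by simp
  qed
qed

text \<open>Dual to the cokernel, with an offset: \<open>phi_in\<close> raises the degree by
  \<open>e\<close>, so closed morphisms of degree 0 into the cones encode graded morphisms of degree
  \<open>- e\<close>. The induction over degrees is therefore entered by one shift from
  \<open>- e\<close> to 0.\<close>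

lemma ses_kernel_graded:
  assumes s: "(A, i, B, p, D) \<in> S" and n: "int_degree n" and X: "X \<in> dobj E"
  shows "(\<forall>y. arr X B n y \<longrightarrow> p \<cdot> y = 0 \<longrightarrow> (\<exists>z. arr X A n z \<and> i \<cdot> z = y)) \<and>
    (\<forall>z. arr X A n z \<longrightarrow> i \<cdot> z = 0 \<longrightarrow> z = 0)"
proof -
  define Pr where "Pr n \<longleftrightarrow> (\<forall>X\<in>dobj E. (\<forall>y. arr X B n y \<longrightarrow> p \<cdot> y = 0 \<longrightarrow> (\<exists>z. arr X A n z \<and> i \<cdot> z = y)) \<and>
    (\<forall>z. arr X A n z \<longrightarrow> i \<cdot> z = 0 \<longrightarrow> z = 0))" for n
  note ic = S_D(1)[OF s] and pcl = S_D(2)[OF s]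
  note o = clo_objD[OF ic] clo_objD(2)[OF pcl]
  note ia = clo_arr[OF ic] and pa = clo_arr[OF pcl]
  have base: "Pr (- e)"
    unfolding Pr_def
  proof (rule ballI)
    fix X assume X: "X \<in> dobj E"
    note PA = phi_data[OF o(1)] and PB = phi_data[OF o(2)] and PD = phi_data[OF o(3)]
    note Mi = phi_mor_rules[OF ic] and Mp = phi_mor_rules[OF pcl]
    note ck = S_D(3)[OF phi_ses(2)[OF s], unfolded is_kernel_def Z0_simps]
    have comp_in: "phi_mor E A' B' f \<cdot> d X (pc A') (- e) (io A' \<cdot> y) = 0"
      if f: "clo A' B' 0 f" and y: "arr X A' (- e) y" "f \<cdot> y = 0" for A' B' f y
    proof -
      note o' = clo_objD[OF f]
      note Q' = phi_data[OF o'(1)] and P' = phi_data[OF o'(2)]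
      note M = phi_mor_rules[OF f]
      note Ma = clo_arr[OF M(1)] and fa = clo_arr[OF f]
      have dy: "arr X A' 0 (d X A' (- e) y)" by (rule arr_d[OF y(1)]) simp
      have 1: "arr X (pc A') 0 (ka A' \<cdot> y)" by (rule arr_comp[OF y(1) clo_arr[OF Q'(5)]]) simp
      have 2: "arr X (pc A') 0 (io A' \<cdot> d X A' (- e) y)" by (rule arr_comp[OF dy Q'(4)]) simp
      have "f \<cdot> d X A' (- e) y = d X B' (- e) (f \<cdot> y)" using d_comp_clo_left[OF f y(1), of "- e"] by simp
      then have "f \<cdot> d X A' (- e) y = 0" using y(2) d_0[OF X o'(2)] by simp
      then show ?thesis
        using phi_in(2)[OF o'(1) y(1)] comp_add_right[OF Ma 1 2] assoc[OF y(1) clo_arr[OF Q'(5)] Ma] assoc[OF dy Q'(4) Ma]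
          M(2,3) assoc[OF y(1) fa clo_arr[OF P'(5)]] assoc[OF dy fa P'(4)] y(2) comp_0_right[OF clo_arr[OF P'(5)] X]
          comp_0_right[OF P'(4) X] by simp
    qed
    show "(\<forall>y. arr X B (- e) y \<longrightarrow> p \<cdot> y = 0 \<longrightarrow> (\<exists>z. arr X A (- e) z \<and> i \<cdot> z = y)) \<and>
      (\<forall>z. arr X A (- e) z \<longrightarrow> i \<cdot> z = 0 \<longrightarrow> z = 0)"
    proof (intro conjI allI impI)
      fix y assume y: "arr X B (- e) y" "p \<cdot> y = 0"
      define a where "a = d X (pc B) (- e) (io B \<cdot> y)"
      note a = phi_in[OF o(2) y(1), folded a_def, simplified]
      have "phi_mor E B D p \<cdot> a = 0" unfolding a_def by (rule comp_in[OF pcl y])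
      then obtain b where b: "clo X (pc A) 0 b" "phi_mor E A B i \<cdot> b = a"
        using ck a(1) X PB(1) PA(1) by (metis dclosed_iff)
      note ba = clo_arr[OF b(1)]
      have "i \<cdot> ph A \<cdot> b = y"
        using assoc[OF ba PA(2) ia] Mi(4) assoc[OF ba clo_arr[OF Mi(1)] PB(2)] b(2) a(3) by simp
      moreover have "arr X A (- e) (ph A \<cdot> b)" by (rule arr_comp[OF ba PA(2)]) simp
      ultimately show "\<exists>z. arr X A (- e) z \<and> i \<cdot> z = y" by blast
    next
      fix z assume z: "arr X A (- e) z" "i \<cdot> z = 0"
      define b where "b = d X (pc A) (- e) (io A \<cdot> z)"
      note b = phi_in[OF o(1) z(1), folded b_def, simplified]
      have b0: "phi_mor E A B i \<cdot> b = 0" unfolding b_def by (rule comp_in[OF ic z])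
      have z0: "clo X (pc A) 0 0" "clo X (pc B) 0 0" using clo_0 PA(1) PB(1) X by simp_all
      have 00: "phi_mor E A B i \<cdot> 0 = 0" "phi_mor E B D p \<cdot> 0 = 0"
        using comp_0_right[OF clo_arr[OF Mi(1)] X] comp_0_right[OF clo_arr[OF Mp(1)] X] by simp_all
      have "\<exists>!g. clo X (pc A) 0 g \<and> phi_mor E A B i \<cdot> g = 0"
        using ck z0 00 X PB(1) PA(1) by (simp add: dclosed_iff)
      then have "b = 0" using b(1) b0 z0 00 by blast
      then show "z = 0" using b(3) comp_0_right[OF PA(2) X] by simp
    qed
  qed
  have step: "Pr (n + k)" if IH: "Pr n" and k: "k \<in> {e, - e}" for n k
    unfolding Pr_def
  proof (rule ballI)
    fix X assume X: "X \<in> dobj E"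
    note mk = units_minus[OF k]
    note IH' = bspec[OF IH[unfolded Pr_def] shift_obj_in[OF X mk]]
    note u = arr_ts[OF X mk, simplified] and v = arr_fs[OF X mk]
    have yvu: "(y \<cdot> fs (- k) X) \<cdot> ts (- k) X = y" if "arr X Y m y" for Y m y
      using assoc[OF u v that] fs_ts[OF X mk] id_right[OF that] by simp
    show "(\<forall>y. arr X B (n + k) y \<longrightarrow> p \<cdot> y = 0 \<longrightarrow> (\<exists>z. arr X A (n + k) z \<and> i \<cdot> z = y)) \<and>
      (\<forall>z. arr X A (n + k) z \<longrightarrow> i \<cdot> z = 0 \<longrightarrow> z = 0)"
    proof (intro conjI allI impI)
      fix y assume y: "arr X B (n + k) y" "p \<cdot> y = 0"
      have "arr (sh (- k) X) B n (y \<cdot> fs (- k) X)" by (rule arr_comp[OF v y(1)]) simp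
      moreover have "p \<cdot> y \<cdot> fs (- k) X = 0" using assoc[OF v y(1) pa] y(2) comp_0_left[OF v o(3)] by simp
      ultimately obtain z where z: "arr (sh (- k) X) A n z" "i \<cdot> z = y \<cdot> fs (- k) X" using IH' by blast
      have "i \<cdot> z \<cdot> ts (- k) X = y" using assoc[OF u z(1) ia] z(2) yvu[OF y(1)] by simp
      moreover have "arr X A (n + k) (z \<cdot> ts (- k) X)" by (rule arr_comp[OF u z(1)]) simp
      ultimately show "\<exists>z. arr X A (n + k) z \<and> i \<cdot> z = y" by blast
    next
      fix z assume z: "arr X A (n + k) z" "i \<cdot> z = 0"
      have "arr (sh (- k) X) A n (z \<cdot> fs (- k) X)" by (rule arr_comp[OF v z(1)]) simp
      moreover have "i \<cdot> z \<cdot> fs (- k) X = 0" using assoc[OF v z(1) ia] z(2) comp_0_left[OF v o(2)] by simp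
      ultimately have "z \<cdot> fs (- k) X = 0" using IH' by blast
      then show "z = 0" using yvu[OF z(1)] comp_0_left[OF u arr_objD(2)[OF z(1)]] by simp
    qed
  qed
  have "Pr 0" using step[OF base, of e] by simp
  with n have "Pr n" by (rule int_degree_induct_units) (rule step)
  then show ?thesis using X by (simp add: Pr_def)
qed

end

section \<open>Orthogonality and full faithfulness\<close>

context dgcat
begin

lemma H0_Add_Hom:
  assumes "X \<in> Obj (H0 E)" "Y \<in> Obj (H0 E)" "F \<in> Hom (H0 E) X Y" "G \<in> Hom (H0 E) X Y"
  shows "Add (H0 E) X Y F G \<in> Hom (H0 E) X Y"
proof -
  have o: "X \<in> dobj E" "Y \<in> dobj E" using assms by (simp_all add: H0_simps(1))
  obtain f g where f: "clo X Y 0 f" "F = hc X Y f" and g: "clo X Y 0 g" "G = hc X Y g"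
    using assms(3,4) o by (metis H0_HomE)
  then show ?thesis using H0_Add[OF o] H0_HomI[OF clo_add[OF f(1) g(1)]] by simp
qed

lemma H0_Add_Comp:
  assumes "W \<in> Obj (H0 E)" "X \<in> Obj (H0 E)" "Y \<in> Obj (H0 E)"
    "s \<in> Hom (H0 E) W X" "F \<in> Hom (H0 E) X Y" "G \<in> Hom (H0 E) X Y"
  shows "Comp (H0 E) W X Y (Add (H0 E) X Y F G) s = Add (H0 E) W Y (Comp (H0 E) W X Y F s) (Comp (H0 E) W X Y G s)"
proof -
  have o: "W \<in> dobj E" "X \<in> dobj E" "Y \<in> dobj E" using assms by (simp_all add: H0_simps(1))
  obtain f g t where f: "clo X Y 0 f" "F = hc X Y f" and g: "clo X Y 0 g" "G = hc X Y g" and t: "clo W X 0 t" "s = hc W X t"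
    using assms(4-6) o by (metis H0_HomE)
  then show ?thesis
    using H0_Add[OF o(2,3)] H0_Add[OF o(1,3)] H0_Comp clo_add[OF f(1) g(1)] comp_add_left[OF clo_arr clo_arr clo_arr, OF f(1) g(1) t(1)]
    by simp
qed

end

context closed_full
begin

text \<open>Either alternative in \<open>loc\<close> provides additivity and bijectivity on Hom
  sets, which lets the two halves of the theorem share this step.\<close>

lemma quotient_functor_conclusions:
  assumes V: "verdier (H0 E) A"
    and loc: "(\<forall>J\<in>dobj E \<inter> B. local_object (H0 E) (cone_in (H0 E) A) J) \<or>
      (\<forall>P\<in>dobj E \<inter> B. colocal_object (H0 E) (cone_in (H0 E) A) P)"
  defines "F \<equiv> functor_comp (quotient_functor (H0 E) A) inclusion_functor"
  shows "triangulated_functor (H0 EB) (verdier_quotient (H0 E) A) F \<and>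
    fully_faithful (H0 EB) (verdier_quotient (H0 E) A) F"
proof
  have sub: "X \<in> Obj (H0 E) \<and> X \<in> dobj E \<inter> B" if "X \<in> Obj (H0 EB)" for X
    using that by (simp add: F.H0_simps(1) H0_simps(1))
  show "triangulated_functor (H0 EB) (verdier_quotient (H0 E) A) F"
    unfolding F_def
  proof (rule verdier.triangulated_functor_Q_inclusion[OF V triangulated_functor_inclusion
      F.H0_Sh_Obj F.H0_ShM_Hom F.H0_Tri_is_triangle])
    fix X Y f g assume XY: "X \<in> Obj (H0 EB)" "Y \<in> Obj (H0 EB)" and fg: "f \<in> Hom (H0 E) X Y" "g \<in> Hom (H0 E) X Y"
    note s = sub[OF XY(1)] sub[OF XY(2)]
    show "FM (quotient_functor (H0 E) A) X Y (Add (H0 E) X Y f g) =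
      Add (verdier_quotient (H0 E) A) X Y (FM (quotient_functor (H0 E) A) X Y f) (FM (quotient_functor (H0 E) A) X Y g)"
      using loc
    proof
      assume "\<forall>J\<in>dobj E \<inter> B. local_object (H0 E) (cone_in (H0 E) A) J"
      then have J: "local_object (H0 E) (cone_in (H0 E) A) Y" using s by blast
      show ?thesis
        by (rule verdier.Q_Add_local[OF V _ J fg]) (use s H0_Add_Hom H0_Add_Comp in auto)
    next
      assume "\<forall>P\<in>dobj E \<inter> B. colocal_object (H0 E) (cone_in (H0 E) A) P"
      then have P: "colocal_object (H0 E) (cone_in (H0 E) A) X" using s by blast
      show ?thesis
        by (rule verdier.Q_Add_colocal[OF V P _ fg]) (use s H0_Add_Hom H0_Add_Comp in auto)
    qed
  qed
  show "fully_faithful (H0 EB) (verdier_quotient (H0 E) A) F"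
    unfolding fully_faithful_def
  proof (intro ballI)
    fix X Y assume XY: "X \<in> Obj (H0 EB)" "Y \<in> Obj (H0 EB)"
    note s = sub[OF XY(1)] sub[OF XY(2)]
    have "bij_betw (FM (quotient_functor (H0 E) A) X Y) (Hom (H0 E) X Y) (Hom (verdier_quotient (H0 E) A) X Y)"
      using loc verdier.bij_betw_Q_local[OF V] verdier.bij_betw_Q_colocal[OF V] s by blast
    then show "bij_betw (FM F X Y) (Hom (H0 EB) X Y) (Hom (verdier_quotient (H0 E) A) (FO F X) (FO F Y))"
      by (simp add: F_def functor_comp_def inclusion_functor_def verdier.Q_simps(1)[OF V] H0_simps(2) F.H0_simps(2))
  qed
qed

end

context exact_dg
begin

section \<open>Stability of graded injectivity and projectivity under shifts and cones\<close>

lemma extends_to_shift: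
  assumes J: "extends_to J 0" and k: "k \<in> {e, - e}"
    and u: "clo J Y (- k) u" and v: "clo Y J k v" and uv: "u \<cdot> v = did E Y"
  shows "extends_to Y 0"
  unfolding extends_to_def
proof (intro allI impI)
  fix A i B f assume i: "inflation S A i B" and f: "arr A Y 0 f"
  note va = clo_arr[OF v] and ua = clo_arr[OF u]
  have ia: "arr A B 0 i" using i S_D(1) clo_arr unfolding inflation_def by blast
  have "int_degree k" using int_degree_plus_unit[OF int_degree_0 k] by simp
  moreover have "arr A J k (v \<cdot> f)" by (rule arr_comp[OF f va]) simp
  ultimately obtain g where g: "arr B J k g" "g \<cdot> i = v \<cdot> f"
    using extends_to_int_degree[OF J] i unfolding extends_to_def by blast
  have "(u \<cdot> g) \<cdot> i = f" using assoc[OF ia g(1) ua] g(2) assoc[OF f va ua] uv id_left[OF f] by simp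
  moreover have "arr B Y 0 (u \<cdot> g)" by (rule arr_comp[OF g(1) ua]) simp
  ultimately show "\<exists>g. arr B Y 0 g \<and> g \<cdot> i = f" by blast
qed

lemma lifts_from_shift:
  assumes P: "lifts_from P 0" and k: "k \<in> {e, - e}"
    and u: "clo P Y (- k) u" and v: "clo Y P k v" and uv: "u \<cdot> v = did E Y"
  shows "lifts_from Y 0"
  unfolding lifts_from_def
proof (intro allI impI)
  fix B p D f assume p: "deflation S B p D" and f: "arr Y D 0 f"
  note va = clo_arr[OF v] and ua = clo_arr[OF u]
  have pa: "arr B D 0 p" using p S_D(2) clo_arr unfolding deflation_def by blast
  have "int_degree (- k)" using int_degree_minus_unit[OF int_degree_0 k] by simp
  moreover have "arr P D (- k) (f \<cdot> u)" by (rule arr_comp[OF ua f]) simp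
  ultimately obtain g where g: "arr P B (- k) g" "p \<cdot> g = f \<cdot> u"
    using lifts_from_int_degree[OF P] p unfolding lifts_from_def by blast
  have "p \<cdot> g \<cdot> v = f" using assoc[OF va g(1) pa] g(2) assoc[OF va ua f] uv id_right[OF f] by simp
  moreover have "arr Y B 0 (g \<cdot> v)" by (rule arr_comp[OF va g(1)]) simp
  ultimately show "\<exists>g. arr Y B 0 g \<and> p \<cdot> g = f" by blast
qed

text \<open>Graded extension disregards the differential, and as a graded object \<open>C\<close> is
  the sum of \<open>Y\<close> and \<open>X[1]\<close>, so the two components are extended
  separately.\<close>

lemma extends_to_cone:
  assumes C: "cone_data X Y f C p q j k" and X: "extends_to X 0" and Y: "extends_to Y 0"
  shows "extends_to C 0"
  unfolding extends_to_def
proof (intro allI impI)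
  fix A i B h assume i: "inflation S A i B" and h: "arr A C 0 h"
  note b = cone_dataD[OF C]
  have ia: "arr A B 0 i" using i S_D(1) clo_arr unfolding inflation_def by blast
  have "int_degree e" using int_degree_plus[OF int_degree_0] by simp
  moreover have "arr A X e (q \<cdot> h)" by (rule arr_comp[OF h b(14)]) simp
  ultimately obtain x where x: "arr B X e x" "x \<cdot> i = q \<cdot> h"
    using extends_to_int_degree[OF X] i unfolding extends_to_def by blast
  have "arr A Y 0 (p \<cdot> h)" by (rule arr_comp[OF h b(2)]) simp
  then obtain y where y: "arr B Y 0 y" "y \<cdot> i = p \<cdot> h" using Y i unfolding extends_to_def by blast
  have jy: "arr B C 0 (j \<cdot> y)" by (rule arr_comp[OF y(1) b(15)]) simp
  have kx: "arr B C 0 (k \<cdot> x)" by (rule arr_comp[OF x(1) b(5)]) simp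
  have "(j \<cdot> y + k \<cdot> x) \<cdot> i = h"
    using comp_add_left[OF jy kx ia] assoc[OF ia y(1) b(15)] assoc[OF ia x(1) b(5)] x(2) y(2) cone_data_expand_left[OF C h]
    by simp
  then show "\<exists>g. arr B C 0 g \<and> g \<cdot> i = h" using arr_add[OF jy kx] by blast
qed

lemma lifts_from_cone:
  assumes C: "cone_data X Y f C p q j k" and X: "lifts_from X 0" and Y: "lifts_from Y 0"
  shows "lifts_from C 0"
  unfolding lifts_from_def
proof (intro allI impI)
  fix B r D h assume r: "deflation S B r D" and h: "arr C D 0 h"
  note b = cone_dataD[OF C]
  have ra: "arr B D 0 r" using r S_D(2) clo_arr unfolding deflation_def by blast
  have "int_degree (- e)" using int_degree_minus[OF int_degree_0] by simp
  moreover have "arr X D (- e) (h \<cdot> k)" by (rule arr_comp[OF b(5) h]) simp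
  ultimately obtain x where x: "arr X B (- e) x" "r \<cdot> x = h \<cdot> k"
    using lifts_from_int_degree[OF X] r unfolding lifts_from_def by blast
  have "arr Y D 0 (h \<cdot> j)" by (rule arr_comp[OF b(15) h]) simp
  then obtain y where y: "arr Y B 0 y" "r \<cdot> y = h \<cdot> j" using Y r unfolding lifts_from_def by blast
  have yp: "arr C B 0 (y \<cdot> p)" by (rule arr_comp[OF b(2) y(1)]) simp
  have xq: "arr C B 0 (x \<cdot> q)" by (rule arr_comp[OF b(14) x(1)]) simp
  have "r \<cdot> (y \<cdot> p + x \<cdot> q) = h"
    using comp_add_right[OF ra yp xq] assoc[OF b(2) y(1) ra] assoc[OF b(14) x(1) ra] x(2) y(2) cone_data_expand_right[OF C h]
    by simp
  then show "\<exists>g. arr C B 0 g \<and> r \<cdot> g = h" using arr_add[OF yp xq] by blast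
qed

abbreviation "Inj \<equiv> {J. injective_object (Z0 N) SN (phi_obj E J)}"
abbreviation "Proj \<equiv> {P. projective_object (Z0 N) SN (phi_obj E P)}"

lemma Inj_iff: "J \<in> dobj E \<Longrightarrow> J \<in> Inj \<longleftrightarrow> extends_to J 0"
  by (simp add: graded_injective_iff)

lemma Proj_iff: "P \<in> dobj E \<Longrightarrow> P \<in> Proj \<longleftrightarrow> lifts_from P 0"
  by (simp add: graded_projective_iff)

lemma closed_full_Inj: "closed_full E Inj"
proof
  show "has_cones E" by (rule exactD(1))
  show "Y \<in> Inj" if X: "X \<in> dobj E" "X \<in> Inj" and n: "n \<in> {e, - e}" and s: "is_shift E n X (Y, u, v)" for X n Y u v
  proof -
    have s: "clo X Y (- n) u" "clo Y X n v" "u \<cdot> v = did E Y" using s X by (simp_all add: is_shift_iff)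
    from extends_to_shift[OF _ n this] X Inj_iff[OF X(1)] Inj_iff[OF clo_objD(2)[OF s(1)]] show ?thesis by blast
  qed
  show "C \<in> Inj" if B: "cone_data X Y f C p q i j" and XY: "X \<in> Inj" "Y \<in> Inj" for X Y f C p q i j
  proof -
    note b = cone_dataD(16-18)[OF B]
    from extends_to_cone[OF B] XY Inj_iff[OF b(1)] Inj_iff[OF b(2)] Inj_iff[OF b(3)] show ?thesis by blast
  qed
qed

lemma closed_full_Proj: "closed_full E Proj"
proof
  show "has_cones E" by (rule exactD(1))
  show "Y \<in> Proj" if X: "X \<in> dobj E" "X \<in> Proj" and n: "n \<in> {e, - e}" and s: "is_shift E n X (Y, u, v)" for X n Y u v
  proof -
    have s: "clo X Y (- n) u" "clo Y X n v" "u \<cdot> v = did E Y" using s X by (simp_all add: is_shift_iff)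
    from lifts_from_shift[OF _ n this] X Proj_iff[OF X(1)] Proj_iff[OF clo_objD(2)[OF s(1)]] show ?thesis by blast
  qed
  show "C \<in> Proj" if B: "cone_data X Y f C p q i j" and XY: "X \<in> Proj" "Y \<in> Proj" for X Y f C p q i j
  proof -
    note b = cone_dataD(16-18)[OF B]
    from lifts_from_cone[OF B] XY Proj_iff[OF b(1)] Proj_iff[OF b(2)] Proj_iff[OF b(3)] show ?thesis by blast
  qed
qed

text \<open>\<open>g f = 0\<close> together with the differential of \<open>p\<close> makes
  \<open>g p\<close> closed, so the outer cone too is the cone of a closed morphism.\<close>

lemma totalization_cone_data:
  assumes s: "(K, f, L, g, M) \<in> S" and T: "is_totalization E (K, f, L, g, M) T"
  obtains C p q i j p' q' i' j' where "cone_data K L f C p q i j" "cone_data C M (g \<cdot> p) T p' q' i' j'"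
proof -
  note f = S_D(1)[OF s] and g = S_D(2)[OF s]
  have gf: "g \<cdot> f = 0" using S_D(3)[OF s] by (simp add: is_kernel_def Z0_simps)
  from T obtain C p q p' q' where C: "is_cone E K L f (C, p, q)" and T': "is_cone E C M (g \<cdot> p) (T, p', q')"
    unfolding is_totalization_def by auto
  note B = is_cone_cone_data[OF C f]
  note b = cone_dataD[OF B]
  note ga = clo_arr[OF g]
  have gp: "arr C M 0 (g \<cdot> p)" by (rule arr_comp[OF b(2) ga]) simp
  have "d C M 0 (g \<cdot> p) = g \<cdot> d C L 0 p" using d_comp_clo_left[OF g b(2), of 0] by simp
  also have "\<dots> = 0"
    using b(11) comp_minus_right[OF ga arr_comp[OF b(14,13) refl]] assoc[OF b(14,13) ga] gf
      comp_0_left[OF b(14) clo_objD(2)[OF g]] by simp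
  finally have "clo C M 0 (g \<cdot> p)" using gp by (simp add: clo_def)
  from that[OF B is_cone_cone_data[OF T' this]] show ?thesis .
qed

lemma totalization_acyclic_injective:
  assumes s: "(K, f, L, g, M) \<in> S" and T: "is_totalization E (K, f, L, g, M) T" and J: "J \<in> dobj E" "J \<in> Inj"
  shows "acyclic_hom T J"
proof -
  obtain C p q i j p' q' i' j' where B: "cone_data K L f C p q i j" "cone_data C M (g \<cdot> p) T p' q' i' j'"
    by (rule totalization_cone_data[OF s T])
  have i: "inflation S K f L" using s unfolding inflation_def by blast
  have J': "extends_to J 0" using J Inj_iff by blast
  show ?thesis
  proof (rule totalization_acyclic_left[OF B S_D(2)[OF s]])
    show "\<exists>l. arr L J n l \<and> l \<cdot> f = k" if "int_degree n" "arr K J n k" for n k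
      using extends_to_int_degree[OF J' that(1)] i that(2) unfolding extends_to_def by blast
  qed (use ses_cokernel_graded[OF s _ J(1)] in blast)+
qed

lemma totalization_acyclic_projective:
  assumes s: "(K, f, L, g, M) \<in> S" and T: "is_totalization E (K, f, L, g, M) T" and P: "P \<in> dobj E" "P \<in> Proj"
  shows "acyclic_hom P T"
proof -
  obtain C p q i j p' q' i' j' where B: "cone_data K L f C p q i j" "cone_data C M (g \<cdot> p) T p' q' i' j'"
    by (rule totalization_cone_data[OF s T])
  have i: "deflation S L g M" using s unfolding deflation_def by blast
  have P': "lifts_from P 0" using P Proj_iff by blast
  show ?thesis
  proof (rule totalization_acyclic_right[OF B S_D(2)[OF s]])
    show "\<exists>l. arr P L n l \<and> g \<cdot> l = k" if "int_degree n" "arr P M n k" for n k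
      using lifts_from_int_degree[OF P' that(1)] i that(2) unfolding lifts_from_def by blast
  qed (use ses_kernel_graded[OF s _ P(1)] in blast)+
qed

text \<open>Coproducts in the homotopy category test morphisms of degree 0 only. Morphisms of degree
  \<open>n + k\<close> into \<open>J\<close> are morphisms of degree \<open>n\<close> into
  \<open>J[k]\<close>, again a graded-injective object; this is why the hypothesis ranges over all
  \<open>J\<close>.\<close>

lemma acyclic_hom_degree_0_left:
  assumes "\<And>J w. J \<in> dobj E \<Longrightarrow> J \<in> Inj \<Longrightarrow> clo X J 0 w \<Longrightarrow> bdry X J 0 w" and J: "J \<in> dobj E" "J \<in> Inj"
  shows "acyclic_hom X J"
proof -
  interpret I: closed_full E Inj by (rule closed_full_Inj)
  have "\<forall>J w. J \<in> dobj E \<longrightarrow> J \<in> Inj \<longrightarrow> clo X J n w \<longrightarrow> bdry X J n w" if "int_degree n" for n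
    using that
  proof (induction rule: int_degree_induct_units)
    case zero
    then show ?case using assms(1) by blast
  next
    case (step n k)
    note k = \<open>k \<in> {e, - e}\<close>
    show ?case
    proof (intro allI impI)
      fix J w assume J: "J \<in> dobj E" "J \<in> Inj" and w: "clo X J (n + k) w"
      have "sh k J \<in> Inj" by (rule I.B_shift[OF J k is_shift_chosen[OF J(1) k]])
      moreover have "clo X (sh k J) n (ts k J \<cdot> w)" by (rule clo_comp[OF w clo_ts[OF J(1) k]]) simp
      ultimately have "bdry X (sh k J) n (ts k J \<cdot> w)" using step.IH shift_obj_in[OF J(1) k] by blast
      from bdry_comp_left[OF this clo_fs[OF J(1) k], of "n + k"]
      show "bdry X J (n + k) w"
        using assoc[OF clo_arr[OF w] arr_ts[OF J(1) k] arr_fs[OF J(1) k]] fs_ts[OF J(1) k] id_left[OF clo_arr[OF w]]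
        by (simp add: add.commute)
    qed
  qed
  then show ?thesis using J unfolding acyclic_hom_def by blast
qed

text \<open>For products it is the source \<open>P\<close> that is shifted, and in the opposite
  direction.\<close>

lemma acyclic_hom_degree_0_right:
  assumes "\<And>P w. P \<in> dobj E \<Longrightarrow> P \<in> Proj \<Longrightarrow> clo P X 0 w \<Longrightarrow> bdry P X 0 w" and P: "P \<in> dobj E" "P \<in> Proj"
  shows "acyclic_hom P X"
proof -
  interpret I: closed_full E Proj by (rule closed_full_Proj)
  have "\<forall>P w. P \<in> dobj E \<longrightarrow> P \<in> Proj \<longrightarrow> clo P X n w \<longrightarrow> bdry P X n w" if "int_degree n" for n
    using that
  proof (induction rule: int_degree_induct_units)
    case zero
    then show ?case using assms(1) by blast
  next
    case (step n k)
    note k = units_minus[OF \<open>k \<in> {e, - e}\<close>]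
    show ?case
    proof (intro allI impI)
      fix P w assume P: "P \<in> dobj E" "P \<in> Proj" and w: "clo P X (n + k) w"
      have "sh (- k) P \<in> Proj" by (rule I.B_shift[OF P k is_shift_chosen[OF P(1) k]])
      moreover have "clo (sh (- k) P) X n (w \<cdot> fs (- k) P)" by (rule clo_comp[OF clo_fs[OF P(1) k] w]) simp
      ultimately have "bdry (sh (- k) P) X n (w \<cdot> fs (- k) P)" using step.IH shift_obj_in[OF P(1) k] by blast
      from bdry_comp_right[OF this clo_ts[OF P(1) k], of "n + k"]
      show "bdry P X (n + k) w"
        using assoc[OF arr_ts[OF P(1) k] arr_fs[OF P(1) k] clo_arr[OF w]] fs_ts[OF P(1) k] id_right[OF clo_arr[OF w]]
        by simp
    qed
  qed
  then show ?thesis using P unfolding acyclic_hom_def by blast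
qed

text \<open>An object with vanishing identity is acyclic on both sides; it witnesses that the
  orthogonals defined next are nonempty.\<close>

lemma zero_object: "\<exists>N0\<in>dobj E. did E N0 = 0"
proof -
  obtain N0 where N0: "N0 \<in> dobj E" "\<forall>X\<in>dobj E. dclosed E N0 X 0 = {0}"
    using exactD(2) unfolding additive_category_def Z0_simps by blast
  then show ?thesis using clo_id[OF N0(1)] by (auto simp: dclosed_iff[OF N0(1,1), symmetric])
qed

section \<open>Orthogonals of the graded-injective and graded-projective objects\<close>

definition "acyclic_inj = {X \<in> dobj E. \<forall>J\<in>dobj E \<inter> Inj. acyclic_hom X J}"
definition "acyclic_proj = {X \<in> dobj E. \<forall>P\<in>dobj E \<inter> Proj. acyclic_hom P X}"

lemma triangulated_acyclic_inj: "triangulated_subcategory (H0 E) acyclic_inj"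
proof -
  obtain N0 where N0: "N0 \<in> dobj E" "did E N0 = 0" using zero_object by blast
  have i: "e \<in> {e, - e}" by simp
  show ?thesis
    unfolding acyclic_inj_def
  proof (rule triangulated_subcategory_Collect[OF _ _ _ N0(1)])
    show "\<forall>J\<in>dobj E \<inter> Inj. acyclic_hom Y J" if "cat_iso (H0 E) X Y F" "\<forall>J\<in>dobj E \<inter> Inj. acyclic_hom X J" for X Y F
      using acyclic_hom_iso_left[OF that(1)] that(2) by blast
    show "(\<forall>J\<in>dobj E \<inter> Inj. acyclic_hom X J) \<longleftrightarrow> (\<forall>J\<in>dobj E \<inter> Inj. acyclic_hom (sh e X) J)" if X: "X \<in> dobj E" for X
    proof -
      have "acyclic_hom X J \<longleftrightarrow> acyclic_hom (sh e X) J" for J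
        using acyclic_hom_transport_left[OF clo_ts[OF X i] clo_fs[OF X i] fs_ts[OF X i] i]
          acyclic_hom_transport_left[of "sh e X" X "- e" "fs e X" "ts e X"] clo_ts[OF X i] clo_fs[OF X i] ts_fs[OF X i] by auto
      then show ?thesis by simp
    qed
    show "\<forall>J\<in>dobj E \<inter> Inj. acyclic_hom N0 J" using acyclic_hom_zero_left[OF N0] by blast
    fix X Y f C p q i j assume B: "cone_data X Y f C p q i j"
    have XC: "acyclic_hom X J" if YJ: "acyclic_hom Y J" and CJ: "acyclic_hom C J" for J
      unfolding acyclic_hom_def
    proof (intro allI impI)
      fix n w assume n: "int_degree n" and w: "clo X J n w"
      obtain g where g: "clo Y J n g" "bdry X J n (g \<cdot> f - w)" by (rule cone_data_surj_left[OF B CJ n w])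
      have "bdry X J n (g \<cdot> f)" by (rule bdry_comp_right[OF acyclic_homD[OF YJ n g(1)] cone_dataD(1)[OF B]]) simp
      from bdry_diff[OF this g(2)] show "bdry X J n w" by simp
    qed
    have YC: "acyclic_hom Y J" if "acyclic_hom X J" "acyclic_hom C J" for J
      unfolding acyclic_hom_def
    proof (intro allI impI)
      fix n w assume n: "int_degree n" and w: "clo Y J n w"
      have "clo X J n (w \<cdot> f)" by (rule clo_comp[OF cone_dataD(1)[OF B] w]) simp
      from cone_data_inj_left[OF B that(2) n w acyclic_homD[OF that(1) n this]] show "bdry Y J n w" .
    qed
    show "((\<forall>J\<in>dobj E \<inter> Inj. acyclic_hom X J) \<and> (\<forall>J\<in>dobj E \<inter> Inj. acyclic_hom Y J) \<longrightarrow> (\<forall>J\<in>dobj E \<inter> Inj. acyclic_hom C J)) \<and>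
      ((\<forall>J\<in>dobj E \<inter> Inj. acyclic_hom Y J) \<and> (\<forall>J\<in>dobj E \<inter> Inj. acyclic_hom C J) \<longrightarrow> (\<forall>J\<in>dobj E \<inter> Inj. acyclic_hom X J)) \<and>
      ((\<forall>J\<in>dobj E \<inter> Inj. acyclic_hom X J) \<and> (\<forall>J\<in>dobj E \<inter> Inj. acyclic_hom C J) \<longrightarrow> (\<forall>J\<in>dobj E \<inter> Inj. acyclic_hom Y J))"
      using cone_data_acyclic_left[OF B] XC YC by blast
  qed
qed

lemma triangulated_acyclic_proj: "triangulated_subcategory (H0 E) acyclic_proj"
proof -
  obtain N0 where N0: "N0 \<in> dobj E" "did E N0 = 0" using zero_object by blast
  have i: "e \<in> {e, - e}" by simp
  show ?thesis
    unfolding acyclic_proj_def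
  proof (rule triangulated_subcategory_Collect[OF _ _ _ N0(1)])
    show "\<forall>J\<in>dobj E \<inter> Proj. acyclic_hom J Y" if "cat_iso (H0 E) X Y F" "\<forall>J\<in>dobj E \<inter> Proj. acyclic_hom J X" for X Y F
      using acyclic_hom_iso_right[OF that(1)] that(2) by blast
    show "(\<forall>J\<in>dobj E \<inter> Proj. acyclic_hom J X) \<longleftrightarrow> (\<forall>J\<in>dobj E \<inter> Proj. acyclic_hom J (sh e X))" if X: "X \<in> dobj E" for X
    proof -
      have "acyclic_hom J X \<longleftrightarrow> acyclic_hom J (sh e X)" for J
        using acyclic_hom_transport_right[OF clo_ts[OF X i] clo_fs[OF X i] fs_ts[OF X i] i]
          acyclic_hom_transport_right[of "sh e X" X "- e" "fs e X" "ts e X"] clo_ts[OF X i] clo_fs[OF X i] ts_fs[OF X i] by auto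
      then show ?thesis by simp
    qed
    show "\<forall>J\<in>dobj E \<inter> Proj. acyclic_hom J N0" using acyclic_hom_zero_right[OF N0] by blast
    fix X Y f C p q i j assume B: "cone_data X Y f C p q i j"
    have XC: "acyclic_hom J X" if "acyclic_hom J Y" "acyclic_hom J C" for J
      unfolding acyclic_hom_def
    proof (intro allI impI)
      fix n w assume n: "int_degree n" and w: "clo J X n w"
      have "clo J Y n (f \<cdot> w)" by (rule clo_comp[OF w cone_dataD(1)[OF B]]) simp
      from cone_data_inj_right[OF B that(2) n w acyclic_homD[OF that(1) n this]] show "bdry J X n w" .
    qed
    have YC: "acyclic_hom J Y" if JX: "acyclic_hom J X" and JC: "acyclic_hom J C" for J
      unfolding acyclic_hom_def
    proof (intro allI impI)
      fix n w assume n: "int_degree n" and w: "clo J Y n w"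
      obtain g where g: "clo J X n g" "bdry J Y n (f \<cdot> g - w)" by (rule cone_data_surj_right[OF B JC n w])
      have "bdry J Y n (f \<cdot> g)" by (rule bdry_comp_left[OF acyclic_homD[OF JX n g(1)] cone_dataD(1)[OF B]]) simp
      from bdry_diff[OF this g(2)] show "bdry J Y n w" by simp
    qed
    show "((\<forall>J\<in>dobj E \<inter> Proj. acyclic_hom J X) \<and> (\<forall>J\<in>dobj E \<inter> Proj. acyclic_hom J Y) \<longrightarrow> (\<forall>J\<in>dobj E \<inter> Proj. acyclic_hom J C)) \<and>
      ((\<forall>J\<in>dobj E \<inter> Proj. acyclic_hom J Y) \<and> (\<forall>J\<in>dobj E \<inter> Proj. acyclic_hom J C) \<longrightarrow> (\<forall>J\<in>dobj E \<inter> Proj. acyclic_hom J X)) \<and>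
      ((\<forall>J\<in>dobj E \<inter> Proj. acyclic_hom J X) \<and> (\<forall>J\<in>dobj E \<inter> Proj. acyclic_hom J C) \<longrightarrow> (\<forall>J\<in>dobj E \<inter> Proj. acyclic_hom J Y))"
      using cone_data_acyclic_right[OF B] XC YC by blast
  qed
qed

text \<open>Uniqueness in the universal property: a class of morphisms into \<open>J\<close> and the
  zero class agree on every summand, as all closed morphisms of degree 0 from a summand to
  \<open>J\<close> are null-homotopic.\<close>

lemma acyclic_inj_coproduct:
  assumes X: "\<forall>\<alpha>\<in>I. X \<alpha> \<in> acyclic_inj" and W: "is_coproduct (H0 E) I X W j"
  shows "W \<in> acyclic_inj"
proof -
  from W have WO: "W \<in> dobj E" and j: "\<And>\<alpha>. \<alpha> \<in> I \<Longrightarrow> j \<alpha> \<in> Hom (H0 E) (X \<alpha>) W"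
    by (simp_all add: is_coproduct_def H0_simps(1))
  have "acyclic_hom W J" if J: "J \<in> dobj E" "J \<in> Inj" for J
  proof (rule acyclic_hom_degree_0_left[OF _ J])
    fix J w assume J: "J \<in> dobj E" "J \<in> Inj" and w: "clo W J 0 w"
    have c: "Comp (H0 E) (X \<alpha>) W J (hc W J v) (j \<alpha>) = hc (X \<alpha>) J 0" if \<alpha>: "\<alpha> \<in> I" and v: "clo W J 0 v" for \<alpha> v
    proof -
      have XO: "X \<alpha> \<in> dobj E" and ac: "acyclic_hom (X \<alpha>) J" using X \<alpha> J by (auto simp: acyclic_inj_def)
      obtain k where k: "clo (X \<alpha>) W 0 k" "j \<alpha> = hc (X \<alpha>) W k" by (rule H0_HomE[OF j[OF \<alpha>] XO WO])
      have "clo (X \<alpha>) J 0 (v \<cdot> k)" by (rule clo_comp[OF k(1) v]) simp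
      from acyclic_homD[OF ac int_degree_0 this] show ?thesis
        by (simp add: k(2) H0_Comp[OF k(1) v] hclass_eq_iff XO J)
    qed
    have "hc (X \<alpha>) J 0 \<in> Hom (H0 E) (X \<alpha>) J" if "\<alpha> \<in> I" for \<alpha>
      using H0_HomI[OF clo_0] X that J by (auto simp: acyclic_inj_def)
    then have "\<exists>!h. h \<in> Hom (H0 E) W J \<and> (\<forall>\<alpha>\<in>I. Comp (H0 E) (X \<alpha>) W J h (j \<alpha>) = hc (X \<alpha>) J 0)"
      using W[unfolded is_coproduct_def H0_simps(1), THEN conjunct2, THEN conjunct2, rule_format,
          of J "\<lambda>\<alpha>. hc (X \<alpha>) J 0"] J(1) by simp
    moreover have "hc W J v \<in> Hom (H0 E) W J \<and> (\<forall>\<alpha>\<in>I. Comp (H0 E) (X \<alpha>) W J (hc W J v) (j \<alpha>) = hc (X \<alpha>) J 0)"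
      if "clo W J 0 v" for v
      using c[OF _ that] H0_HomI[OF that] by simp
    ultimately have "hc W J w = hc W J 0" using w clo_0[OF WO J(1)] by (metis (no_types, lifting))
    then show "bdry W J 0 w" by (simp add: hclass_eq_iff WO J)
  qed
  then show ?thesis using WO by (simp add: acyclic_inj_def)
qed

lemma acyclic_proj_product:
  assumes X: "\<forall>\<alpha>\<in>I. X \<alpha> \<in> acyclic_proj" and W: "is_product (H0 E) I X W j"
  shows "W \<in> acyclic_proj"
proof -
  from W have WO: "W \<in> dobj E" and j: "\<And>\<alpha>. \<alpha> \<in> I \<Longrightarrow> j \<alpha> \<in> Hom (H0 E) W (X \<alpha>)"
    by (simp_all add: is_product_def H0_simps(1))
  have "acyclic_hom P W" if P: "P \<in> dobj E" "P \<in> Proj" for P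
  proof (rule acyclic_hom_degree_0_right[OF _ P])
    fix P w assume P: "P \<in> dobj E" "P \<in> Proj" and w: "clo P W 0 w"
    have c: "Comp (H0 E) P W (X \<alpha>) (j \<alpha>) (hc P W v) = hc P (X \<alpha>) 0" if \<alpha>: "\<alpha> \<in> I" and v: "clo P W 0 v" for \<alpha> v
    proof -
      have XO: "X \<alpha> \<in> dobj E" and ac: "acyclic_hom P (X \<alpha>)" using X \<alpha> P by (auto simp: acyclic_proj_def)
      obtain k where k: "clo W (X \<alpha>) 0 k" "j \<alpha> = hc W (X \<alpha>) k" by (rule H0_HomE[OF j[OF \<alpha>] WO XO])
      have "clo P (X \<alpha>) 0 (k \<cdot> v)" by (rule clo_comp[OF v k(1)]) simp
      from acyclic_homD[OF ac int_degree_0 this] show ?thesis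
        by (simp add: k(2) H0_Comp[OF v k(1)] hclass_eq_iff XO P)
    qed
    have "hc P (X \<alpha>) 0 \<in> Hom (H0 E) P (X \<alpha>)" if "\<alpha> \<in> I" for \<alpha>
      using H0_HomI[OF clo_0] X that P by (auto simp: acyclic_proj_def)
    then have "\<exists>!h. h \<in> Hom (H0 E) P W \<and> (\<forall>\<alpha>\<in>I. Comp (H0 E) P W (X \<alpha>) (j \<alpha>) h = hc P (X \<alpha>) 0)"
      using W[unfolded is_product_def H0_simps(1), THEN conjunct2, THEN conjunct2, rule_format,
          of P "\<lambda>\<alpha>. hc P (X \<alpha>) 0"] P(1) by simp
    moreover have "hc P W v \<in> Hom (H0 E) P W \<and> (\<forall>\<alpha>\<in>I. Comp (H0 E) P W (X \<alpha>) (j \<alpha>) (hc P W v) = hc P (X \<alpha>) 0)"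
      if "clo P W 0 v" for v
      using c[OF _ that] H0_HomI[OF that] by simp
    ultimately have "hc P W w = hc P W 0" using w clo_0[OF P(1) WO] by (metis (no_types, lifting))
    then show "bdry P W 0 w" by (simp add: hclass_eq_iff WO P)
  qed
  then show ?thesis using WO by (simp add: acyclic_proj_def)
qed

lemma Ac_co_subset: "Ac_co U E S \<subseteq> acyclic_inj"
  unfolding Ac_co_def
proof (rule Inter_lower, intro CollectI conjI ballI allI impI)
  show "triangulated_subcategory (H0 E) acyclic_inj" by (rule triangulated_acyclic_inj)
  fix s T assume s: "s \<in> S" and T: "is_totalization E s T"
  obtain K f L g M where s': "s = (K, f, L, g, M)" by (metis prod_cases5)
  have "T \<in> dobj E" using totalization_cone_data[OF s[unfolded s'] T[unfolded s']] cone_dataD(18) by metis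
  then show "T \<in> acyclic_inj"
    using totalization_acyclic_injective[OF s[unfolded s'] T[unfolded s']] by (auto simp: acyclic_inj_def)
qed (use acyclic_inj_coproduct in blast)

lemma Ac_ctr_subset: "Ac_ctr U E S \<subseteq> acyclic_proj"
  unfolding Ac_ctr_def
proof (rule Inter_lower, intro CollectI conjI ballI allI impI)
  show "triangulated_subcategory (H0 E) acyclic_proj" by (rule triangulated_acyclic_proj)
  fix s T assume s: "s \<in> S" and T: "is_totalization E s T"
  obtain K f L g M where s': "s = (K, f, L, g, M)" by (metis prod_cases5)
  have "T \<in> dobj E" using totalization_cone_data[OF s[unfolded s'] T[unfolded s']] cone_dataD(18) by metis
  then show "T \<in> acyclic_proj"
    using totalization_acyclic_projective[OF s[unfolded s'] T[unfolded s']] by (auto simp: acyclic_proj_def)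
qed (use acyclic_proj_product in blast)

lemma Inter_iso_closed:
  assumes "\<And>A. A \<in> \<F> \<Longrightarrow> triangulated_subcategory (H0 E) A" "cat_iso (H0 E) X Y F" "X \<in> \<Inter>\<F>"
  shows "Y \<in> \<Inter>\<F>"
  using assms unfolding triangulated_subcategory_def by blast

text \<open>Each member of the family is nonempty and so contains a cone of the identity of one of
  its objects. All contractible objects being isomorphic, it contains every cone of an identity, and
  therefore the intersection does.\<close>

lemma verdier_Inter:
  assumes tri: "\<And>A. A \<in> \<F> \<Longrightarrow> triangulated_subcategory (H0 E) A"
  shows "verdier (H0 E) (\<Inter>\<F>)"
proof (rule verdier_H0[OF _ _ _ exactD(1)])
  show "Y \<in> \<Inter>\<F>" if "cat_iso (H0 E) X Y F" "X \<in> \<Inter>\<F>" for X Y F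
    by (rule Inter_iso_closed[OF tri that])
  show "sh e X \<in> \<Inter>\<F>" if "X \<in> \<Inter>\<F>" "X \<in> dobj E" for X
    using that tri unfolding triangulated_subcategory_def H0_simps(1,6) by blast
  show "C \<in> \<Inter>\<F>" if X: "X \<in> dobj E" and C: "is_cone E X X (did E X) (C, p, q)" for X C p q
  proof
    fix A assume "A \<in> \<F>"
    note A = tri[OF this, unfolded triangulated_subcategory_def]
    then obtain Y where Y: "Y \<in> A" "Y \<in> dobj E" unfolding H0_simps(1) by blast
    obtain C' p' q' where C': "is_cone E Y Y (did E Y) (C', p', q')"
      using exactD(1) clo_id[OF Y(2)] Y(2) unfolding has_cones_def by (metis dclosed_iff prod_cases3)
    have "C' \<in> A" using std_in_Tri[OF clo_id[OF Y(2)] C'] A Y(1) unfolding std_def by blast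
    moreover obtain F where "cat_iso (H0 E) C' C F"
      using contractible_iso[OF cone_data_id_contractible[OF is_cone_cone_data[OF C' clo_id[OF Y(2)]]]
          cone_data_id_contractible[OF is_cone_cone_data[OF C clo_id[OF X]]]] by blast
    ultimately show "C \<in> A" using A by blast
  qed
qed

lemma Hom_trivial:
  assumes "acyclic_hom X Y" "X \<in> dobj E" "Y \<in> dobj E"
  shows "Hom (H0 E) X Y = {hc X Y 0}"
proof -
  have "hc X Y f = hc X Y 0" if "clo X Y 0 f" for f
    using acyclic_homD[OF assms(1) int_degree_0 that] by (simp add: hclass_eq_iff assms)
  then have "hc X Y ` dclosed E X Y 0 \<subseteq> {hc X Y 0}" by (simp add: image_subset_iff dclosed_iff[OF assms(2,3)])
  moreover have "hc X Y 0 \<in> hc X Y ` dclosed E X Y 0"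
    using clo_0[OF assms(2,3), of 0] by (intro imageI) (simp add: dclosed_iff[OF assms(2,3)])
  ultimately show ?thesis unfolding H0_simps(2) by blast
qed

lemma coderived_conclusions:
  "(\<forall>J\<in>Obj (H0 (E_inj E SN)). \<forall>X\<in>Ac_co U E S. Hom (H0 E) X J = {hclass E X J 0}) \<and>
   (let F = functor_comp (quotient_functor (H0 E) (Ac_co U E S)) inclusion_functor in
     triangulated_functor (H0 (E_inj E SN)) (D_co U E S) F \<and>
     fully_faithful (H0 (E_inj E SN)) (D_co U E S) F)"
proof -
  interpret I: closed_full E Inj by (rule closed_full_Inj)
  have orth: "acyclic_hom X J \<and> X \<in> dobj E" if "X \<in> Ac_co U E S" "J \<in> dobj E \<inter> Inj" for X J
    using Ac_co_subset that by (auto simp: acyclic_inj_def)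
  have V: "verdier (H0 E) (Ac_co U E S)" unfolding Ac_co_def by (rule verdier_Inter) blast
  have "local_object (H0 E) (cone_in (H0 E) (Ac_co U E S)) J" if "J \<in> dobj E \<inter> Inj" for J
  proof (rule local_object_H0)
    show "Y \<in> Ac_co U E S" if "cat_iso (H0 E) X Y F" "X \<in> Ac_co U E S" for X Y F
      using that(2) unfolding Ac_co_def by (rule Inter_iso_closed[OF _ that(1), rotated]) blast
  qed (use orth that in auto)
  then have "triangulated_functor (H0 I.EB) (D_co U E S) (functor_comp (quotient_functor (H0 E) (Ac_co U E S)) inclusion_functor) \<and>
     fully_faithful (H0 I.EB) (D_co U E S) (functor_comp (quotient_functor (H0 E) (Ac_co U E S)) inclusion_functor)"
    unfolding D_co_def using I.quotient_functor_conclusions[OF V] by blast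
  moreover have "\<forall>J\<in>Obj (H0 I.EB). \<forall>X\<in>Ac_co U E S. Hom (H0 E) X J = {hclass E X J 0}"
    using Hom_trivial orth by (simp add: I.F.H0_simps(1))
  ultimately show ?thesis unfolding E_inj_def Let_def by blast
qed

lemma contraderived_conclusions:
  "(\<forall>P\<in>Obj (H0 (E_proj E SN)). \<forall>Y\<in>Ac_ctr U E S. Hom (H0 E) P Y = {hclass E P Y 0}) \<and>
   (let F = functor_comp (quotient_functor (H0 E) (Ac_ctr U E S)) inclusion_functor in
     triangulated_functor (H0 (E_proj E SN)) (D_ctr U E S) F \<and>
     fully_faithful (H0 (E_proj E SN)) (D_ctr U E S) F)"
proof -
  interpret I: closed_full E Proj by (rule closed_full_Proj)
  have orth: "acyclic_hom P Y \<and> Y \<in> dobj E" if "Y \<in> Ac_ctr U E S" "P \<in> dobj E \<inter> Proj" for Y P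
    using Ac_ctr_subset that by (auto simp: acyclic_proj_def)
  have V: "verdier (H0 E) (Ac_ctr U E S)" unfolding Ac_ctr_def by (rule verdier_Inter) blast
  have "colocal_object (H0 E) (cone_in (H0 E) (Ac_ctr U E S)) P" if "P \<in> dobj E \<inter> Proj" for P
  proof (rule colocal_object_H0)
    show "Y \<in> Ac_ctr U E S" if "cat_iso (H0 E) X Y F" "X \<in> Ac_ctr U E S" for X Y F
      using that(2) unfolding Ac_ctr_def by (rule Inter_iso_closed[OF _ that(1), rotated]) blast
  qed (use orth that in auto)
  then have "triangulated_functor (H0 I.EB) (D_ctr U E S) (functor_comp (quotient_functor (H0 E) (Ac_ctr U E S)) inclusion_functor) \<and>
     fully_faithful (H0 I.EB) (D_ctr U E S) (functor_comp (quotient_functor (H0 E) (Ac_ctr U E S)) inclusion_functor)"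
    unfolding D_ctr_def using I.quotient_functor_conclusions[OF V] by blast
  moreover have "\<forall>P\<in>Obj (H0 I.EB). \<forall>Y\<in>Ac_ctr U E S. Hom (H0 E) P Y = {hclass E P Y 0}"
    using Hom_trivial orth by (simp add: I.F.H0_simps(1))
  ultimately show ?thesis unfolding E_proj_def Let_def by blast
qed

end

theorem theorem5p5:
  fixes E :: "('o, 'g::ab_group_add, 'm::ab_group_add) dg"
    and S :: "('o, 'm) ses set" and SN :: "('o \<times> 'm, 'm) ses set" and U :: "'i set set"
  assumes "exact_dg_category E S SN"
  shows
    "(has_exact_coproducts U E S \<longrightarrow>
        (\<forall>J\<in>Obj (H0 (E_inj E SN)). \<forall>X\<in>Ac_co U E S. Hom (H0 E) X J = {hclass E X J 0}) \<and>
        (let F = functor_comp (quotient_functor (H0 E) (Ac_co U E S)) inclusion_functor in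
           triangulated_functor (H0 (E_inj E SN)) (D_co U E S) F \<and>
           fully_faithful (H0 (E_inj E SN)) (D_co U E S) F)) \<and>
     (has_exact_products U E S \<longrightarrow>
        (\<forall>P\<in>Obj (H0 (E_proj E SN)). \<forall>Y\<in>Ac_ctr U E S. Hom (H0 E) P Y = {hclass E P Y 0}) \<and>
        (let F = functor_comp (quotient_functor (H0 E) (Ac_ctr U E S)) inclusion_functor in
           triangulated_functor (H0 (E_proj E SN)) (D_ctr U E S) F \<and>
           fully_faithful (H0 (E_proj E SN)) (D_ctr U E S) F))"
proof -
  interpret exact_dg E S SN using assms by unfold_locales
  show ?thesis
    by (rule conjI; rule impI; rule coderived_conclusions contraderived_conclusions)
qed

end
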